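(* Let $d \ge 2$, $\alpha > 0$, and $\lambda > 0$. Let $Q$ be a symmetric, translation-invariant, heavy-tailed transition kernel on $\mathbb{Z}^d$ with exponent $\alpha$, and let $Q_L$ be its standard projection onto $\mathbb{T}^d_L$. Consider the frog model on $\mathbb{T}^d_L$ with kernel $Q_L$, particle density $\lambda$, and a planted particle at the origin, and let $\mathcal{L}$ be its cover lifespan, $\tau_{\mathrm{cov}}$ its cover time, and $\ell^*=\ell^*(L)$ the smallest positive integer $\ell$ with $$\frac{\lambda \ell}{G_\ell(o,o)}\ge d\log L,\qquad G_\ell(o,o)=\sum_{n=0}^{\ell}Q^n(o,o).$$ Then for every $\epsilon>0$, $$\lim_{L \to \infty} \mathbb{P}_L^+\big((1-\epsilon)\ell^* \le \tau_{\mathrm{cov}} \le \mathcal{L} \le (1+\epsilon)\ell^*\big) = 1.$$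
   Context: **Kernels.** $|\cdot|$ is the $\ell_\infty$-norm. A transition kernel $Q$ on $\mathbb{Z}^d$ (nonnegative, rows summing to 1) is symmetric if $Q(x,y)=Q(y,x)$, translation-invariant if $Q(x,y)=Q(0,y-x)$, and heavy-tailed with exponent $\alpha$ if there is $K>0$ with $K^{-1}|x-y|^{-(d+\alpha)}\le Q(x,y)\le K|x-y|^{-(d+\alpha)}$ for all $x\neq y$. $\mathbb{T}^d_L=\mathbb{Z}^d/L\mathbb{Z}^d$, $\pi$ is the canonical projection, $o=0$ is the origin, $Q_L(u,v)=\sum_{x\in\pi^{-1}(v-u)}Q(o,x)$. $Q^n$ denotes the $n$-step kernel on $\mathbb{Z}^d$. **Frog model, cover lifespan, cover time.** Under $\mathbb{P}_L^+$, each vertex $v\in\mathbb{T}^d_L$ carries an independent Poisson($\lambda$) number of (ordinary) particles, and $o$ carries one additional particle (the planted particle). Every particle has an independent infinite discrete-time random walk trajectory with kernel $Q_L$ started at its initial vertex. For $\ell\in\mathbb{N}$, write $v\to_\ell u$ if some particle started at $v$ (including the planted one if $v=o$) visits $u$ within its first $\ell$ steps. The set of vertices eventually activated with lifespan $\ell$ is $\mathcal{A}^{\ell}(\infty)$, the set of $u$ for which there are $m\ge0$ and $o=v_0,\dots,v_m=u$ with $v_{i-1}\to_\ell v_i$ for all $i$ (equivalently, the set of vertices ever visited by active particles when initially only particles at $o$ are active, each active particle makes $\ell$ steps and is then removed, and inactive particles are activated when an active particle visits their vertex). The cover lifespan is $\mathcal{L}=\inf\{\ell\in\mathbb{N}:\mathcal{A}^{\ell}(\infty)=\mathbb{T}^d_L\}$.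 The cover time $\tau_{\mathrm{cov}}$, defined on the same probability space, is the smallest $k$ such that every vertex of $\mathbb{T}^d_L$ is visited within the first $k$ steps by at least one ordinary particle, when all ordinary particles start walking at time 0 and the planted particle is ignored. *)

theory Defs
  imports "HOL-Probability.Probability"
begin

text \<open>The lattice \<open>\<int>\<^sup>d\<close> is \<^typ>\<open>int ^ 'd\<close> with \<open>d = CARD('d)\<close>.\<close>

definition linf_norm :: "int ^ 'd \<Rightarrow> int" where
  "linf_norm x = Max (range (\<lambda>i. \<bar>x $ i\<bar>))"

definition transition_kernel :: "('v \<Rightarrow> 'v \<Rightarrow> real) \<Rightarrow> bool" where
  "transition_kernel Q \<longleftrightarrow> (\<forall>x y. 0 \<le> Q x y) \<and> (\<forall>x. (Q x has_sum 1) UNIV)"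

definition symmetric_kernel :: "('v \<Rightarrow> 'v \<Rightarrow> real) \<Rightarrow> bool" where
  "symmetric_kernel Q \<longleftrightarrow> (\<forall>x y. Q x y = Q y x)"

definition translation_invariant :: "(int ^ 'd \<Rightarrow> int ^ 'd \<Rightarrow> real) \<Rightarrow> bool" where
  "translation_invariant Q \<longleftrightarrow> (\<forall>x y. Q x y = Q 0 (y - x))"

definition heavy_tailed :: "real \<Rightarrow> (int ^ 'd \<Rightarrow> int ^ 'd \<Rightarrow> real) \<Rightarrow> bool" where
  "heavy_tailed \<alpha> Q \<longleftrightarrow>
     (\<exists>K>0. \<forall>x y. x \<noteq> y \<longrightarrow>
        inverse K * real_of_int (linf_norm (x - y)) powr - (real CARD('d) + \<alpha>) \<le> Q x y \<and>
        Q x y \<le> K * real_of_int (linf_norm (x - y)) powr - (real CARD('d) + \<alpha>))"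

primrec kernel_power :: "('v \<Rightarrow> 'v \<Rightarrow> real) \<Rightarrow> nat \<Rightarrow> 'v \<Rightarrow> 'v \<Rightarrow> real" where
  "kernel_power Q 0 = (\<lambda>x y. if x = y then 1 else 0)"
| "kernel_power Q (Suc n) = (\<lambda>x y. \<Sum>\<^sub>\<infinity>z. kernel_power Q n x z * Q z y)"

definition green :: "('v \<Rightarrow> 'v \<Rightarrow> real) \<Rightarrow> nat \<Rightarrow> 'v \<Rightarrow> 'v \<Rightarrow> real" where
  "green Q l x y = (\<Sum>n\<le>l. kernel_power Q n x y)"

text \<open>For \<open>L \<ge> 1\<close>, a vertex of \<open>\<int>\<^sup>d / L\<int>\<^sup>d\<close> is encoded by its representative with
  coordinates in \<open>{0..<L}\<close>; the canonical projection reduces coordinates modulo \<open>L\<close>, and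
  \<open>torus_proj L (v - u)\<close> is the difference of \<open>v\<close> and \<open>u\<close> in the quotient group.\<close>

definition torus :: "nat \<Rightarrow> (int ^ 'd) set" where
  "torus L = {v. \<forall>i. 0 \<le> v $ i \<and> v $ i < int L}"

definition torus_proj :: "nat \<Rightarrow> int ^ 'd \<Rightarrow> int ^ 'd" where
  "torus_proj L x = (\<chi> i. x $ i mod int L)"

definition torus_kernel ::
    "(int ^ 'd \<Rightarrow> int ^ 'd \<Rightarrow> real) \<Rightarrow> nat \<Rightarrow> int ^ 'd \<Rightarrow> int ^ 'd \<Rightarrow> real" where
  "torus_kernel Q L u v = (\<Sum>\<^sub>\<infinity>x\<in>{x. torus_proj L x = torus_proj L (v - u)}. Q 0 x)"

text \<open>\<open>Y\<close> is a random walk (Markov chain) on the countable set \<open>S\<close> with kernel \<open>K\<close>, started at \<open>v\<close>.\<close>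

definition random_walk ::
    "'a measure \<Rightarrow> 'v set \<Rightarrow> ('v \<Rightarrow> 'v \<Rightarrow> real) \<Rightarrow> 'v \<Rightarrow> ('a \<Rightarrow> nat \<Rightarrow> 'v) \<Rightarrow> bool" where
  "random_walk M S K v Y \<longleftrightarrow>
     Y \<in> M \<rightarrow>\<^sub>M PiM UNIV (\<lambda>_. count_space S) \<and>
     (\<forall>n x. (\<forall>i\<le>n. x i \<in> S) \<longrightarrow>
        measure M {\<omega> \<in> space M. \<forall>i\<le>n. Y \<omega> i = x i} =
          (if x 0 = v then \<Prod>i<n. K (x i) (x (Suc i)) else 0))"

text \<open>Every vertex \<open>v\<close> has infinitely many potential particles \<open>Ordinary v j\<close>; the ones that are
  actually present are those with \<open>j < N v\<close>, where \<open>N v\<close> is the Poisson number of particles at \<open>v\<close>.\<close>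

datatype 'v particle = Planted | Ordinary 'v nat

primrec start :: "(int ^ 'd) particle \<Rightarrow> int ^ 'd" where
  "start Planted = 0"
| "start (Ordinary v j) = v"

definition particles :: "nat \<Rightarrow> (int ^ 'd) particle set" where
  "particles L = {p. start p \<in> torus L}"

definition present :: "(int ^ 'd \<Rightarrow> nat) \<Rightarrow> (int ^ 'd) particle \<Rightarrow> bool" where
  "present n p \<longleftrightarrow> (case p of Planted \<Rightarrow> True | Ordinary v j \<Rightarrow> j < n v)"

text \<open>\<open>frog_model Q lam L M N X\<close>: on the probability space \<open>M\<close>, the particle counts \<open>N\<close> and the
  trajectories \<open>X\<close> realise the frog model on the torus. The
  joint law of all \<open>N v\<close> with \<open>v \<in> torus L\<close> and \<open>X p\<close> with \<open>p \<in> particles L\<close> is determined by this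
  predicate: all of them are independent.\<close>

definition frog_model ::
    "(int ^ 'd \<Rightarrow> int ^ 'd \<Rightarrow> real) \<Rightarrow> real \<Rightarrow> nat \<Rightarrow> 'a measure \<Rightarrow>
     (int ^ 'd \<Rightarrow> 'a \<Rightarrow> nat) \<Rightarrow> ((int ^ 'd) particle \<Rightarrow> 'a \<Rightarrow> nat \<Rightarrow> int ^ 'd) \<Rightarrow> bool" where
  "frog_model Q lam L M N X \<longleftrightarrow>
     prob_space M \<and>
     (\<forall>v\<in>torus L. distr M (count_space UNIV) (N v) = measure_pmf (poisson_pmf lam)) \<and>
     prob_space.indep_vars M (\<lambda>_. count_space UNIV) N (torus L) \<and>
     (\<forall>p\<in>particles L. random_walk M (torus L) (torus_kernel Q L) (start p) (X p)) \<and>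
     prob_space.indep_vars M (\<lambda>_. PiM UNIV (\<lambda>_. count_space (torus L))) X (particles L) \<and>
     prob_space.indep_set M
       (sets (vimage_algebra (space M) (\<lambda>\<omega>. \<lambda>v\<in>torus L. N v \<omega>)
          (PiM (torus L) (\<lambda>_. count_space UNIV))))
       (sets (vimage_algebra (space M) (\<lambda>\<omega>. \<lambda>p\<in>particles L. X p \<omega>)
          (PiM (particles L) (\<lambda>_. PiM UNIV (\<lambda>_. count_space (torus L))))))"

text \<open>The remaining notions are functions of a single realisation: \<open>n v\<close> is the number of ordinary
  particles at \<open>v\<close> and \<open>X p\<close> the trajectory of particle \<open>p\<close>.\<close>

definition reaches ::
    "nat \<Rightarrow> (int ^ 'd \<Rightarrow> nat) \<Rightarrow> ((int ^ 'd) particle \<Rightarrow> nat \<Rightarrow> int ^ 'd) \<Rightarrow> nat \<Rightarrow>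
     int ^ 'd \<Rightarrow> int ^ 'd \<Rightarrow> bool" where
  "reaches L n X l v u \<longleftrightarrow> (\<exists>p\<in>particles L. present n p \<and> start p = v \<and> (\<exists>k\<le>l. X p k = u))"

definition activated ::
    "nat \<Rightarrow> (int ^ 'd \<Rightarrow> nat) \<Rightarrow> ((int ^ 'd) particle \<Rightarrow> nat \<Rightarrow> int ^ 'd) \<Rightarrow> nat \<Rightarrow>
     (int ^ 'd) set" where
  "activated L n X l = {u. (reaches L n X l)\<^sup>*\<^sup>* 0 u}"

text \<open>Both times below are \<open>\<infinity>\<close> if no finite time works.\<close>

definition cover_lifespan ::
    "nat \<Rightarrow> (int ^ 'd \<Rightarrow> nat) \<Rightarrow> ((int ^ 'd) particle \<Rightarrow> nat \<Rightarrow> int ^ 'd) \<Rightarrow> enat" where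
  "cover_lifespan L n X = Inf (enat ` {l. activated L n X l = torus L})"

definition cover_time ::
    "nat \<Rightarrow> (int ^ 'd \<Rightarrow> nat) \<Rightarrow> ((int ^ 'd) particle \<Rightarrow> nat \<Rightarrow> int ^ 'd) \<Rightarrow> enat" where
  "cover_time L n X =
     Inf (enat ` {k. \<forall>u\<in>torus L. \<exists>v\<in>torus L. \<exists>j<n v. \<exists>i\<le>k. X (Ordinary v j) i = u})"

text \<open>The smallest element exists for the kernels of the theorem, since then
  \<open>kernel_power Q n 0 0\<close> tends to \<open>0\<close> and hence \<open>l / green Q l 0 0\<close> tends to infinity.\<close>

definition ell_star :: "(int ^ 'd \<Rightarrow> int ^ 'd \<Rightarrow> real) \<Rightarrow> real \<Rightarrow> nat \<Rightarrow> nat" where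
  "ell_star Q lam L =
     (LEAST l. 0 < l \<and> lam * real l / green Q l 0 0 \<ge> real CARD('d) * ln (real L))"

end

theory Submission
  imports Defs "HOL-Probability.Product_PMF" "HOL-Real_Asymp.Real_Asymp"
begin

text \<open>Only the void probabilities of the Poisson field of trajectories are used: no ordinary particle
  joins \<open>v\<close> to \<open>u\<close> within \<open>l\<close> steps for any pair \<open>(v, u)\<close> of a set \<open>\<rho>\<close> with probability \<open>exp (- lam * s)\<close>,
  where \<open>s\<close> is the sum over \<open>v\<close> of the probabilities of hitting \<open>{u. (v, u) \<in> \<rho>}\<close>. For a single \<open>u\<close> and
  all \<open>v\<close> the sum is asymptotically \<open>l\<close> divided by the Green function \<open>G l\<close>, so that \<open>l\<close> is critical when
  the expected number of vertices not visited is of order one. Below criticality a second moment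
  argument yields a vertex missed by all ordinary particles, and the few vertices met by the planted
  particle are visited by ordinary ones as well.

  Above criticality consider the backward cluster of \<open>u\<close>, the vertices from which ordinary particles
  lead to \<open>u\<close>. Union bounds over all vertices show that it has many elements in one box of the radius
  natural for \<open>l\<close>, because the expected number of first steps back slightly exceeds \<open>ln (L ^ d)\<close>; hence
  it also has many in each neighbouring box, and by iteration near the origin. There it is made
  dense by repeated doubling in boxes of a much smaller scale, where only polynomially many (in \<open>l\<close>)
  boxes matter, and the planted particle then hits it with high probability. The heat kernel
  input, almost regular decay of the return probabilities, comes from a Nash type argument.\<close>

section \<open>Boxes and scales\<close>

text \<open>The difficulty is to serve all L^d targets at once. A failure probability below L^-d
  requires a mean number of relevant particles above ln (L^d), which lies between multiples of l /
  ln l and l, while a union bound over n-element sets of vertices costs exp (C n ln l). Over the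
  whole torus clusters are therefore controlled only up to size l / (ln l)^3. Dense clusters come
  from the shorter time k = sqrt l, where failure is only stretched exponentially small in k; this
  suffices in a cube of radius polynomial in l. The planted particle misses a dense cluster with a
  probability merely small in l, so no union over u is possible. Instead, an inactive u makes its
  whole backward cluster near the origin inactive, and Markov's inequality bounds the number of such
  vertices there.

  All \<alpha> > 0 are treated alike: heat kernel bounds hold only up to constants, with any
  logarithm at \<alpha> = 2 carried by \<open>Psi\<close>. The sharp constant comes from the Green
  function alone, through its slow variation. Positive definiteness of the even-step probabilities
  takes the place of Fourier analysis.\<close>

definition nrm :: "int ^ 'd \<Rightarrow> nat" where
  "nrm x = nat (linf_norm x)"

lemma linf_norm_le_iff: "linf_norm x \<le> r \<longleftrightarrow> (\<forall>i. \<bar>x $ i\<bar> \<le> r)"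
  unfolding linf_norm_def by (subst Max_le_iff) auto

lemma linf_norm_nonneg: "0 \<le> linf_norm x"
proof -
  have "0 \<le> \<bar>x $ undefined\<bar>" by simp
  also have "\<dots> \<le> linf_norm x" using linf_norm_le_iff[of x "linf_norm x"] by blast
  finally show ?thesis .
qed

lemma linf_norm_eq_nrm: "linf_norm x = int (nrm x)"
  unfolding nrm_def using linf_norm_nonneg[of x] by simp

lemma nrm_le_iff: "nrm x \<le> r \<longleftrightarrow> (\<forall>i. \<bar>x $ i\<bar> \<le> int r)"
  using linf_norm_le_iff[of x "int r"] linf_norm_eq_nrm[of x] by simp

lemma abs_nth_le_nrm: "\<bar>x $ i\<bar> \<le> int (nrm x)"
  using nrm_le_iff[of x "nrm x"] by simp

lemma nrm_zero [simp]: "nrm 0 = 0"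
  using nrm_le_iff[of 0 0] by simp

lemma nrm_eq_0_iff [simp]: "nrm x = 0 \<longleftrightarrow> x = 0"
  using nrm_le_iff[of x 0] by (auto simp: vec_eq_iff)

lemma nrm_minus [simp]: "nrm (- x) = nrm x"
proof -
  have "nrm (- x) \<le> nrm x" for x :: "int ^ 'd"
    by (auto simp: nrm_le_iff[of "- x"] abs_nth_le_nrm)
  from this[of x] this[of "- x"] show ?thesis by simp
qed

lemma nrm_triangle: "nrm (x + y) \<le> nrm x + nrm y"
  unfolding nrm_le_iff using abs_nth_le_nrm[of x] abs_nth_le_nrm[of y]
  by (auto intro: order_trans[OF abs_triangle_ineq] add_mono)

lemma nrm_triangle_diff: "nrm (x - y) \<le> nrm x + nrm y"
  using nrm_triangle[of x "- y"] by simp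

lemma nrm_axis [simp]: "nrm (axis i a) = nat \<bar>a\<bar>"
  by (rule antisym) (use abs_nth_le_nrm[of "axis i a" i] in \<open>auto simp: nrm_le_iff axis_def\<close>)

lemma card_vec_Pi:
  fixes A :: "'d :: finite \<Rightarrow> int set"
  assumes "\<And>i. finite (A i)"
  shows "finite {x :: int ^ 'd. \<forall>i. x $ i \<in> A i}"
    and "card {x :: int ^ 'd. \<forall>i. x $ i \<in> A i} = (\<Prod>i\<in>UNIV. card (A i))"
proof -
  have *: "bij_betw vec_nth {x :: int ^ 'd. \<forall>i. x $ i \<in> A i} (PiE UNIV A)"
    by (rule bij_betwI[where g = vec_lambda]) auto
  show "finite {x :: int ^ 'd. \<forall>i. x $ i \<in> A i}"
    using bij_betw_finite[OF *] assms by (simp add: finite_PiE)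
  show "card {x :: int ^ 'd. \<forall>i. x $ i \<in> A i} = (\<Prod>i\<in>UNIV. card (A i))"
    using bij_betw_same_card[OF *] by (simp add: card_PiE)
qed

definition cube :: "nat \<Rightarrow> (int ^ 'd) set" where
  "cube r = {x. nrm x \<le> r}"

lemma cube_alt: "cube r = {x :: int ^ 'd. \<forall>i. x $ i \<in> {- int r..int r}}"
  unfolding cube_def nrm_le_iff by (auto simp: abs_le_iff minus_le_iff)

lemma finite_cube [simp]: "finite (cube r)"
  unfolding cube_alt by (rule card_vec_Pi) simp

lemma card_cube: "card (cube r :: (int ^ 'd) set) = (2 * r + 1) ^ CARD('d)"
  unfolding cube_alt by (subst card_vec_Pi) (simp_all add: nat_add_distrib nat_mult_distrib)

text \<open>A point of norm t has some coordinate equal to t or -t, so it lies on one of d pairs of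
  opposite faces of the cube.\<close>

lemma card_sphere_le:
  "card {x :: int ^ 'd. nrm x = t} \<le> 2 * CARD('d) * (2 * t + 1) ^ (CARD('d) - 1)"
proof -
  let ?S = "\<lambda>i. {x :: int ^ 'd. \<forall>j. x $ j \<in> (if j = i then {int t, - int t} else {- int t..int t})}"
  have sub: "{x :: int ^ 'd. nrm x = t} \<subseteq> (\<Union>i. ?S i)"
  proof
    fix x :: "int ^ 'd" assume "x \<in> {x. nrm x = t}"
    then have x: "nrm x = t" by simp
    have "\<exists>i. \<bar>x $ i\<bar> = int t"
    proof -
      have "linf_norm x \<in> range (\<lambda>i. \<bar>x $ i\<bar>)" unfolding linf_norm_def by (rule Max_in) auto
      then show ?thesis using x linf_norm_eq_nrm[of x] by auto
    qed
    then obtain i where i: "\<bar>x $ i\<bar> = int t" by blast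
    have "x \<in> ?S i" using i abs_nth_le_nrm[of x] x
      by (auto simp: abs_le_iff abs_if split: if_splits) (smt (verit))+
    then show "x \<in> (\<Union>i. ?S i)" by blast
  qed
  have cS: "finite (?S i)" "card (?S i) \<le> 2 * (2 * t + 1) ^ (CARD('d) - 1)" for i
  proof -
    have f: "finite (if j = i then {int t, - int t} else {- int t..int t})" for j by simp
    show "finite (?S i)" by (rule card_vec_Pi) (use f in auto)
    have "card (?S i) = (\<Prod>j\<in>UNIV. card (if j = i then {int t, - int t} else {- int t..int t}))"
      by (rule card_vec_Pi) (use f in auto)
    also have "\<dots> = card {int t, - int t} * (\<Prod>j\<in>UNIV - {i}. card (if j = i then {int t, - int t} else {- int t..int t}))"
      by (subst prod.remove[of _ i]) auto
    also have "(\<Prod>j\<in>UNIV - {i}. card (if j = i then {int t, - int t} else {- int t..int t})) =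
        (\<Prod>j\<in>UNIV - {i}. 2 * t + 1)"
      by (rule prod.cong) auto
    also have "\<dots> = (2 * t + 1) ^ (CARD('d) - 1)" by (simp add: card_Diff_singleton)
    also have "card {int t, - int t} \<le> 2" by (simp add: card_insert_if)
    finally show "card (?S i) \<le> 2 * (2 * t + 1) ^ (CARD('d) - 1)" by simp
  qed
  have "card {x :: int ^ 'd. nrm x = t} \<le> card (\<Union>i. ?S i)"
    by (rule card_mono[OF _ sub]) (use cS in auto)
  also have "\<dots> \<le> (\<Sum>i\<in>UNIV. card (?S i))" by (rule card_UN_le) simp
  also have "\<dots> \<le> (\<Sum>i\<in>(UNIV :: 'd set). 2 * (2 * t + 1) ^ (CARD('d) - 1))"
    by (rule sum_mono) (use cS in auto)
  finally show ?thesis by simp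
qed

lemma finite_sphere [simp]: "finite {x :: int ^ 'd. nrm x = t}"
  by (rule finite_subset[OF _ finite_cube[of t]]) (auto simp: cube_def)

text \<open>Up to constants, \<open>sg \<alpha> r\<close> is the second moment of a step truncated at \<open>r\<close>, and \<open>Psi \<alpha> r\<close> the
  time the walk needs to leave a ball of radius \<open>r\<close>.\<close>

definition sg :: "real \<Rightarrow> nat \<Rightarrow> real" where
  "sg \<alpha> r = (\<Sum>t=1..r. real t powr (1 - \<alpha>))"

definition Psi :: "real \<Rightarrow> nat \<Rightarrow> real" where
  "Psi \<alpha> r = (real r)\<^sup>2 / sg \<alpha> r"

section \<open>Growth of the scale functions\<close>

lemma sg_mono: "a \<le> b \<Longrightarrow> sg \<alpha> a \<le> sg \<alpha> b"
  unfolding sg_def by (rule sum_mono2) auto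

lemma sg_1: "sg \<alpha> (Suc 0) = 1"
  by (simp add: sg_def)

lemma sg_ge_1: "r \<ge> 1 \<Longrightarrow> sg \<alpha> r \<ge> 1"
  using sg_mono[of 1 r \<alpha>] sg_1 by simp

text \<open>For \<alpha> at least 1 the summands decrease, so each is at least the last one. For
  \<alpha> below 1 they increase, and the upper half of the range, where t > r / 2, already
  suffices; this halving costs at most the factor 4.\<close>

lemma sg_lower:
  assumes "\<alpha> > 0"
  shows "real r powr (2 - \<alpha>) \<le> 4 * sg \<alpha> r"
proof (cases "r = 0 \<or> \<alpha> \<ge> 1")
  case True
  then show ?thesis
  proof
    assume "r = 0" then show ?thesis by (simp add: sg_def)
  next
    assume a: "\<alpha> \<ge> 1"
    show ?thesis
    proof (cases "r = 0")
      case False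
      have "real r powr (2 - \<alpha>) = (\<Sum>t=1..r. real r powr (1 - \<alpha>))"
        using False by (simp add: powr_diff powr_one power2_eq_square powr_numeral)
      also have "\<dots> \<le> sg \<alpha> r" unfolding sg_def
        by (rule sum_mono) (use a in \<open>auto intro: powr_mono2'\<close>)
      also have "\<dots> \<le> 4 * sg \<alpha> r" using sg_ge_1[of r \<alpha>] False by simp
      finally show ?thesis .
    qed (simp add: sg_def)
  qed
next
  case False
  then have r: "r \<ge> 1" and a: "\<alpha> < 1" by auto
  define m where "m = r div 2"
  have "(real r / 2) powr (2 - \<alpha>) = (real r / 2) * (real r / 2) powr (1 - \<alpha>)"
    using r by (simp add: powr_diff powr_numeral power2_eq_square)
  also have "\<dots> \<le> (real (r - m)) * (real r / 2) powr (1 - \<alpha>)"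
    by (rule mult_right_mono) (auto simp: m_def)
  also have "\<dots> = (\<Sum>t=m+1..r. (real r / 2) powr (1 - \<alpha>))" by simp
  also have "\<dots> \<le> (\<Sum>t=m+1..r. real t powr (1 - \<alpha>))"
    by (rule sum_mono, rule powr_mono2) (use a in \<open>auto simp: m_def\<close>)
  also have "\<dots> \<le> sg \<alpha> r" unfolding sg_def by (rule sum_mono2) auto
  finally have "real r powr (2 - \<alpha>) / 2 powr (2 - \<alpha>) \<le> sg \<alpha> r"
    using r by (simp add: powr_divide)
  then have "real r powr (2 - \<alpha>) \<le> 2 powr (2 - \<alpha>) * sg \<alpha> r"
    by (simp add: divide_le_eq mult.commute)
  also have "\<dots> \<le> 2 powr 2 * sg \<alpha> r"
    by (intro mult_right_mono powr_mono) (use assms sg_ge_1[OF r, of \<alpha>] in auto)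
  finally show ?thesis by simp
qed

text \<open>For \<alpha> at least 1, \<open>sg \<alpha> r / r\<close> is an average of decreasing
  terms and hence decreases in r. Otherwise every summand is at most
  \<open>b powr (1 - \<alpha>)\<close>, and \<open>sg_lower\<close> at a is used.\<close>

lemma sg_growth:
  assumes "\<alpha> > 0" "1 \<le> a" "a \<le> b"
  shows "sg \<alpha> b \<le> 4 * (real b / real a) powr (2 - min \<alpha> 1) * sg \<alpha> a"
proof (cases "\<alpha> \<ge> 1")
  case True
  have step: "sg \<alpha> (Suc r) / real (Suc r) \<le> sg \<alpha> r / real r" if "r \<ge> 1" for r
  proof -
    have "real r * real (Suc r) powr (1 - \<alpha>) = (\<Sum>t=1..r. real (Suc r) powr (1 - \<alpha>))" by simp
    also have "\<dots> \<le> sg \<alpha> r" unfolding sg_def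
      by (rule sum_mono) (use True in \<open>auto intro: powr_mono2'\<close>)
    finally have "real r * real (Suc r) powr (1 - \<alpha>) \<le> sg \<alpha> r" .
    moreover have "sg \<alpha> (Suc r) = sg \<alpha> r + real (Suc r) powr (1 - \<alpha>)" by (simp add: sg_def)
    ultimately show ?thesis using that by (simp add: field_simps del: of_nat_Suc) (simp add: algebra_simps)
  qed
  have "sg \<alpha> b / real b \<le> sg \<alpha> a / real a" using assms(3)
  proof (induction b rule: dec_induct)
    case (step n)
    then show ?case using \<open>1 \<le> a\<close> assms(2) order_trans[OF \<open>\<And>r. 1 \<le> r \<Longrightarrow> sg \<alpha> (Suc r) / real (Suc r) \<le> sg \<alpha> r / real r\<close>[of n] step.IH] by simp
  qed simp
  then have "sg \<alpha> b \<le> (real b / real a) * sg \<alpha> a" using assms by (simp add: field_simps)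
  also have "\<dots> \<le> 4 * (real b / real a) * sg \<alpha> a"
    using sg_ge_1[OF assms(2), of \<alpha>] by (intro mult_right_mono) (auto simp: divide_right_mono)
  finally show ?thesis using True assms by (auto simp: min_def)
next
  case False
  have "sg \<alpha> b \<le> (\<Sum>t=1..b. real b powr (1 - \<alpha>))" unfolding sg_def
    by (rule sum_mono, rule powr_mono2) (use False in auto)
  also have "\<dots> = real b powr (2 - \<alpha>)" using assms by (simp add: powr_diff powr_numeral power2_eq_square)
  also have "\<dots> = (real b / real a) powr (2 - \<alpha>) * real a powr (2 - \<alpha>)"
    using assms by (simp add: powr_divide)
  also have "\<dots> \<le> (real b / real a) powr (2 - \<alpha>) * (4 * sg \<alpha> a)"
    by (rule mult_left_mono[OF sg_lower[OF assms(1)]]) simp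
  finally show ?thesis using False by (simp add: min_def mult_ac)
qed

lemma Psi_pos: "r \<ge> 1 \<Longrightarrow> Psi \<alpha> r > 0"
  unfolding Psi_def using sg_ge_1[of r \<alpha>] by simp

lemma Psi_upper_scaling:
  assumes "1 \<le> a" "a \<le> b"
  shows "Psi \<alpha> b \<le> (real b / real a)\<^sup>2 * Psi \<alpha> a"
proof -
  have "Psi \<alpha> b \<le> (real b)\<^sup>2 / sg \<alpha> a" unfolding Psi_def
    using sg_mono[OF assms(2), of \<alpha>] sg_ge_1[OF assms(1), of \<alpha>] by (intro divide_left_mono) auto
  then show ?thesis using assms by (simp add: Psi_def field_simps)
qed

text \<open>\<open>Psi\<close> grows at least like a positive power of the radius. The exponent
  \<open>min \<alpha> 1\<close> is not sharp, but it covers all \<alpha> uniformly and makes radii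
  polynomial in times.\<close>

lemma Psi_lower_scaling:
  assumes "\<alpha> > 0" "1 \<le> a" "a \<le> b"
  shows "Psi \<alpha> a \<le> 4 * (real a / real b) powr (min \<alpha> 1) * Psi \<alpha> b"
proof -
  let ?k = "min \<alpha> 1"
  have pos: "sg \<alpha> a > 0" "sg \<alpha> b > 0" using sg_ge_1[of a \<alpha>] sg_ge_1[of b \<alpha>] assms by auto
  have e: "(real b / real a) powr (2 - ?k) = (real b / real a)\<^sup>2 * (real a / real b) powr ?k"
    using assms by (simp add: powr_diff powr_numeral powr_divide field_simps)
  have "sg \<alpha> b \<le> 4 * ((real b / real a)\<^sup>2 * (real a / real b) powr ?k) * sg \<alpha> a"
    using sg_growth[OF assms] e by simp
  then have "(real a)\<^sup>2 * sg \<alpha> b \<le> 4 * (real a / real b) powr ?k * (real b)\<^sup>2 * sg \<alpha> a"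
    using assms by (simp add: field_simps)
  then show ?thesis using pos by (simp add: Psi_def field_simps)
qed

lemma Psi_ge:
  assumes "\<alpha> > 0" "r \<ge> 1"
  shows "real r powr (min \<alpha> 1) \<le> 4 * Psi \<alpha> r"
proof -
  have "1 \<le> 4 * (1 / real r powr (min \<alpha> 1)) * Psi \<alpha> r"
    using Psi_lower_scaling[OF assms(1) _ assms(2)] assms by (simp add: Psi_def sg_1 powr_divide)
  then show ?thesis using assms by (simp add: divide_simps split: if_splits)
qed

section \<open>Symmetric walks on abelian groups\<close>

primrec conv_pow :: "'v :: ab_group_add pmf \<Rightarrow> nat \<Rightarrow> 'v pmf" where
  "conv_pow p 0 = return_pmf 0"
| "conv_pow p (Suc n) = bind_pmf p (\<lambda>y. map_pmf ((+) y) (conv_pow p n))"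

lemma conv_pow_add:
  "conv_pow p (m + n) = bind_pmf (conv_pow p m) (\<lambda>y. map_pmf ((+) y) (conv_pow p n))"
proof (induction m)
  case 0
  show ?case by (simp add: bind_return_pmf map_pmf_idI)
next
  case (Suc m)
  show ?case
    by (simp add: Suc bind_assoc_pmf map_bind_pmf bind_map_pmf pmf.map_comp o_def flip: add.assoc)
qed

lemma conv_pow_Suc_right:
  "conv_pow p (Suc n) = bind_pmf (conv_pow p n) (\<lambda>y. map_pmf ((+) y) p)"
  using conv_pow_add[of p n 1] by (simp add: bind_return_pmf' map_pmf_def bind_return_pmf)

lemma pmf_map_plus: "pmf (map_pmf ((+) y) p) x = pmf p (x - y)" for x y :: "'v :: ab_group_add"
  using pmf_map_inj'[of "(+) y" p "x - y"] by simp

lemma pmf_conv_pow_add: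
  "pmf (conv_pow p (m + n)) x = measure_pmf.expectation (conv_pow p m) (\<lambda>y. pmf (conv_pow p n) (x - y))"
  by (simp add: conv_pow_add pmf_bind pmf_map_plus)

lemma pmf_conv_pow_Suc:
  "pmf (conv_pow p (Suc n)) x = measure_pmf.expectation p (\<lambda>y. pmf (conv_pow p n) (x - y))"
  by (simp add: pmf_bind pmf_map_plus)

lemma integrable_pmf_bounded:
  fixes f :: "'v \<Rightarrow> real"
  assumes "\<And>x. \<bar>f x\<bar> \<le> B"
  shows "integrable (measure_pmf p) f"
  by (rule measure_pmf.integrable_const_bound[of _ B]) (use assms in auto)

lemma expectation_bind_pmf:
  fixes f :: "'w \<Rightarrow> real"
  assumes "\<And>x. \<bar>f x\<bar> \<le> B"
  shows "measure_pmf.expectation (bind_pmf p g) f =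
    measure_pmf.expectation p (\<lambda>y. measure_pmf.expectation (g y) f)"
  unfolding measure_pmf_bind
  by (rule integral_bind[where K = "count_space UNIV" and B' = 1 and B = B])
     (use assms in \<open>auto simp: measure_pmf.emeasure_space_1 space_subprob_algebra
        measure_pmf.subprob_space_axioms measurable_def\<close>)

lemma expectation_conv_pow_add:
  fixes f :: "'v :: ab_group_add \<Rightarrow> real"
  assumes "\<And>x. \<bar>f x\<bar> \<le> B"
  shows "measure_pmf.expectation (conv_pow p (m + n)) f =
    measure_pmf.expectation (conv_pow p m) (\<lambda>y. measure_pmf.expectation (conv_pow p n) (\<lambda>z. f (y + z)))"
  unfolding conv_pow_add by (subst expectation_bind_pmf[OF assms]) simp

lemma expectation_conv_pow_Suc:
  fixes f :: "'v :: ab_group_add \<Rightarrow> real"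
  assumes "\<And>x. \<bar>f x\<bar> \<le> B"
  shows "measure_pmf.expectation (conv_pow p (Suc n)) f =
    measure_pmf.expectation p (\<lambda>y. measure_pmf.expectation (conv_pow p n) (\<lambda>z. f (y + z)))"
  by (simp only: conv_pow.simps) (subst expectation_bind_pmf[OF assms], simp)

section \<open>Positive definiteness and the decay of return probabilities\<close>

locale sym_walk =
  fixes q :: "'v :: ab_group_add pmf"
  assumes sym: "map_pmf uminus q = q"
begin

abbreviation S :: "nat \<Rightarrow> 'v pmf" where "S \<equiv> conv_pow q"

definition b :: "nat \<Rightarrow> real" where "b N = pmf (S (2 * N)) 0"

text \<open>The squared l2 distance between the law of \<open>S N\<close> and its translate by x. It
  therefore behaves like a squared norm difference under addition of shifts.\<close>

definition D :: "nat \<Rightarrow> 'v \<Rightarrow> real" where "D N x = 2 * (b N - pmf (S (2 * N)) x)"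

lemma sym_S: "map_pmf uminus (S n) = S n"
proof (induction n)
  case (Suc n)
  have "map_pmf uminus (S (Suc n)) =
      bind_pmf q (\<lambda>y. map_pmf ((+) (- y)) (map_pmf uminus (S n)))"
    by (simp add: map_bind_pmf pmf.map_comp o_def add.commute)
  also have "\<dots> = bind_pmf (map_pmf uminus q) (\<lambda>y. map_pmf ((+) y) (S n))"
    by (simp add: Suc bind_map_pmf)
  finally show ?case by (simp add: sym)
qed simp

lemma pmf_S_minus: "pmf (S n) (- x) = pmf (S n) x"
  using pmf_map_inj'[of uminus "S n" "- x"] by (simp add: sym_S)

lemma expectation_S_uminus:
  "measure_pmf.expectation (S n) (\<lambda>x. f (- x)) = measure_pmf.expectation (S n) (f :: 'v \<Rightarrow> real)"
  using integral_map_pmf[of uminus "S n" f] by (simp add: sym_S)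

text \<open>Symmetry turns the convolution of the law of \<open>S N\<close> with itself into an
  inner product of two of its translates.\<close>

lemma pmf_S_diff_eq:
  shows "Infinite_Set_Sum.abs_summable_on (\<lambda>z. pmf (S N) (z - x) * pmf (S N) (z - y)) UNIV"
    and "pmf (S (2 * N)) (x - y) = (\<Sum>\<^sub>az. pmf (S N) (z - x) * pmf (S N) (z - y))"
proof -
  let ?u = "pmf (S N)"
  have bij: "bij_betw (\<lambda>z. z - y) UNIV UNIV" by (rule bij_betwI[where g = "\<lambda>z. z + y"]) auto
  have eq: "?u (z - y) * ?u (x - y - (z - y)) = ?u (z - x) * ?u (z - y)" for z
    using pmf_S_minus[of N "z - x"] by (simp add: mult.commute)
  have 1: "Infinite_Set_Sum.abs_summable_on (\<lambda>z. ?u z * ?u (x - y - z)) UNIV"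
    by (rule abs_summable_on_comparison_test[OF pmf_abs_summable[of "S N"]])
       (auto simp: mult_left_le pmf_le_1)
  have "Infinite_Set_Sum.abs_summable_on (\<lambda>z. ?u (z - y) * ?u (x - y - (z - y))) UNIV"
    using abs_summable_on_reindex_bij_betw[OF bij, of "\<lambda>z. ?u z * ?u (x - y - z)"] 1 by simp
  then show "Infinite_Set_Sum.abs_summable_on (\<lambda>z. ?u (z - x) * ?u (z - y)) UNIV" by (simp only: eq)
  have "pmf (S (N + N)) (x - y) = (\<Sum>\<^sub>az. ?u z * ?u (x - y - z))"
    by (simp only: pmf_conv_pow_add pmf_expectation_eq_infsetsum)
  also have "\<dots> = (\<Sum>\<^sub>az. ?u (z - y) * ?u (x - y - (z - y)))"
    using infsetsum_reindex_bij_betw[OF bij, of "\<lambda>z. ?u z * ?u (x - y - z)"] by simp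
  finally show "pmf (S (2 * N)) (x - y) = (\<Sum>\<^sub>az. ?u (z - x) * ?u (z - y))"
    by (simp only: eq mult_2)
qed

text \<open>The matrix of the form is the Gram matrix of translates of \<open>pmf (S N)\<close>, so
  the form is a sum of squares.\<close>

lemma pos_def:
  assumes "finite I"
  shows "0 \<le> (\<Sum>i\<in>I. \<Sum>j\<in>I. c i * c j * pmf (S (2 * N)) (x i - x j))"
proof -
  let ?u = "pmf (S N)"
  have "(\<Sum>i\<in>I. \<Sum>j\<in>I. c i * c j * pmf (S (2 * N)) (x i - x j)) =
      (\<Sum>i\<in>I. \<Sum>j\<in>I. (\<Sum>\<^sub>az. c i * c j * (?u (z - x i) * ?u (z - x j))))"
    by (simp add: pmf_S_diff_eq(2) infsetsum_cmult_right[OF pmf_S_diff_eq(1)])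
  also have "\<dots> = (\<Sum>\<^sub>az. \<Sum>i\<in>I. \<Sum>j\<in>I. c i * c j * (?u (z - x i) * ?u (z - x j)))"
    by (subst sum_infsetsum, intro abs_summable_on_cmult_right pmf_S_diff_eq(1))
       (subst sum_infsetsum, auto intro!: Bochner_Integration.integrable_sum
         abs_summable_on_cmult_right pmf_S_diff_eq(1) simp: Infinite_Set_Sum.abs_summable_on_def[of "\<lambda>x. sum (f x) A" for f A]
           pmf_S_diff_eq(1)[unfolded Infinite_Set_Sum.abs_summable_on_def])
  also have "\<dots> = (\<Sum>\<^sub>az. (\<Sum>i\<in>I. c i * ?u (z - x i))\<^sup>2)"
    by (simp add: power2_eq_square sum_product mult_ac)
  also have "\<dots> \<ge> 0" by (rule infsetsum_nonneg) simp
  finally show ?thesis .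
qed

lemma f_minus_commute: "pmf (S n) (x - y) = pmf (S n) (y - x)"
  using pmf_S_minus[of n "x - y"] by simp

lemma D_minus: "D N (- x) = D N x"
  by (simp add: D_def pmf_S_minus)

lemma D_zero [simp]: "D N 0 = 0"
  by (simp add: D_def b_def)

lemma D_nonneg: "0 \<le> D N x"
  using pos_def[of "{..<2::nat}" "\<lambda>i. if i = 0 then 1 else -1" N "\<lambda>i. if i = 0 then 0 else x"]
  by (simp add: numeral_2_eq_2 lessThan_Suc D_def b_def pmf_S_minus)

lemma pmf_S_le_b: "pmf (S (2 * N)) x \<le> b N"
  using D_nonneg[of N x] by (simp add: D_def)

lemma pos_def_four:
  "0 \<le> (c0\<^sup>2 + c1\<^sup>2 + c2\<^sup>2 + c3\<^sup>2) * b N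
    + 2 * (c0 * c1 * pmf (S (2 * N)) (x0 - x1) + c0 * c2 * pmf (S (2 * N)) (x0 - x2)
         + c0 * c3 * pmf (S (2 * N)) (x0 - x3) + c1 * c2 * pmf (S (2 * N)) (x1 - x2)
         + c1 * c3 * pmf (S (2 * N)) (x1 - x3) + c2 * c3 * pmf (S (2 * N)) (x2 - x3))"
proof -
  let ?c = "\<lambda>i::nat. [c0, c1, c2, c3] ! i" and ?x = "\<lambda>i::nat. [x0, x1, x2, x3] ! i"
  let ?f = "pmf (S (2 * N))"
  have *: "?f (x1 - x0) = ?f (x0 - x1)" "?f (x2 - x0) = ?f (x0 - x2)" "?f (x3 - x0) = ?f (x0 - x3)"
    "?f (x2 - x1) = ?f (x1 - x2)" "?f (x3 - x1) = ?f (x1 - x3)" "?f (x3 - x2) = ?f (x2 - x3)"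
    by (rule f_minus_commute)+
  have "0 \<le> (\<Sum>i\<in>{0, 1, 2, 3::nat}. \<Sum>j\<in>{0, 1, 2, 3::nat}. ?c i * ?c j * ?f (?x i - ?x j))"
    by (rule pos_def) simp
  also have "\<dots> = (c0\<^sup>2 + c1\<^sup>2 + c2\<^sup>2 + c3\<^sup>2) * b N
    + 2 * (c0 * c1 * ?f (x0 - x1) + c0 * c2 * ?f (x0 - x2)
         + c0 * c3 * ?f (x0 - x3) + c1 * c2 * ?f (x1 - x2)
         + c1 * c3 * ?f (x1 - x3) + c2 * c3 * ?f (x2 - x3))"
    by (simp add: * b_def) algebra
  finally show ?thesis .
qed

text \<open>Young's inequality for squared distances: the quadratic form is tested at 0, x and x + y
  with the zero-sum weights r, -(r + t), t, where r t = 1 and r^2 = s.\<close>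

lemma D_weighted_triangle:
  assumes "s > 0"
  shows "D N (x + y) \<le> (1 + s) * D N x + (1 + 1 / s) * D N y"
proof -
  define r t where "r = sqrt s" and "t = 1 / sqrt s"
  have rt: "r * t = 1" "r\<^sup>2 = s" "t\<^sup>2 = 1 / s"
    using assms by (auto simp: r_def t_def power_divide)
  let ?f = "pmf (S (2 * N))"
  have f: "?f (0 - x) = ?f x" "?f (0 - (x + y)) = ?f (x + y)" "?f (x - (x + y)) = ?f y"
    using pmf_S_minus[of "2 * N" x] pmf_S_minus[of "2 * N" "x + y"] pmf_S_minus[of "2 * N" y] by simp_all
  have "0 \<le> (r\<^sup>2 + (- (r + t))\<^sup>2 + t\<^sup>2) * b N
    + 2 * (r * (- (r + t)) * ?f x + r * t * ?f (x + y) + (- (r + t)) * t * ?f y)"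
    using pos_def_four[of r "- (r + t)" t 0 N 0 x "x + y" 0] unfolding f by simp
  also have "\<dots> = r\<^sup>2 * D N x + t\<^sup>2 * D N y + r * t * (D N x + D N y - D N (x + y))"
    unfolding D_def by (simp add: algebra_simps power2_eq_square)
  finally show ?thesis unfolding rt by (simp add: algebra_simps)
qed

lemma D_triangle: "D N (x + y) \<le> 2 * D N x + 2 * D N y"
  using D_weighted_triangle[of 1 N x y] by simp

text \<open>The squared norm of the mixed second difference, with weights 1, -1, -1, 1 at 0, y, z
  and y + z, is nonnegative.\<close>

lemma D_parallelogram: "D N (y + z) + D N (y - z) \<le> 2 * D N y + 2 * D N z"
proof -
  let ?f = "pmf (S (2 * N))"
  have f: "?f (0 - y) = ?f y" "?f (0 - z) = ?f z" "?f (0 - (y + z)) = ?f (y + z)"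
    "?f (y - (y + z)) = ?f z" "?f (z - (y + z)) = ?f y"
    using pmf_S_minus[of "2 * N" y] pmf_S_minus[of "2 * N" "y + z"] pmf_S_minus[of "2 * N" z] by simp_all
  show ?thesis
    using pos_def_four[of 1 "-1" "-1" 1 N 0 y z "y + z"] unfolding f D_def by simp
qed

primrec mult_n :: "nat \<Rightarrow> 'v \<Rightarrow> 'v" where
  "mult_n 0 x = 0"
| "mult_n (Suc n) x = mult_n n x + x"

text \<open>The weight 1 / a in the triangle inequality makes the induction exact, since (1 + 1 / a)
  a^2 + (1 + a) = (a + 1)^2. Constant factors 2 would accumulate exponentially.\<close>

lemma D_mult_n: "D N (mult_n a x) \<le> (real a)\<^sup>2 * D N x"
proof (induction a)
  case (Suc a)
  show ?case
  proof (cases "a = 0")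
    case False
    then have a: "real a > 0" by simp
    have "D N (mult_n (Suc a) x) \<le> (1 + 1 / real a) * D N (mult_n a x) + (1 + real a) * D N x"
      using D_weighted_triangle[of "1 / real a" N "mult_n a x" x] a by simp
    also have "\<dots> \<le> (1 + 1 / real a) * ((real a)\<^sup>2 * D N x) + (1 + real a) * D N x"
      using a by (intro add_right_mono mult_left_mono Suc.IH) auto
    also have "\<dots> = (real (Suc a))\<^sup>2 * D N x"
      using a by (simp add: field_simps power2_eq_square)
    finally show ?thesis .
  qed simp
qed simp

lemma abs_pmf_le_1: "\<bar>pmf p x\<bar> \<le> 1"
  by (simp add: pmf_le_1)

lemma abs_D_le: "\<bar>D N x\<bar> \<le> 4"
proof -
  have "\<bar>b N - pmf (S (2 * N)) x\<bar> \<le> \<bar>b N\<bar> + \<bar>pmf (S (2 * N)) x\<bar>" by (rule abs_triangle_ineq4)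
  then show ?thesis using abs_pmf_le_1[of "S (2 * N)" x] abs_pmf_le_1[of "S (2 * N)" 0]
    unfolding D_def b_def by simp
qed

lemma integrable_D: "integrable (measure_pmf p) (\<lambda>y. D N (g y))"
  by (rule integrable_pmf_bounded[of _ 4]) (rule abs_D_le)

lemma pmf_S_Suc_Suc:
  "pmf (S (2 * Suc N)) x = measure_pmf.expectation (S 2) (\<lambda>y. pmf (S (2 * N)) (x - y))"
  using pmf_conv_pow_add[of q 2 "2 * N" x] by simp

text \<open>The loss of return probability in one double step is a Dirichlet energy: the mean of
  \<open>D N\<close> over a two-step displacement. Lower bounds for this energy drive the decay of
  \<open>b\<close>.\<close>

lemma b_diff: "b N - b (Suc N) = measure_pmf.expectation (S 2) (D N) / 2"
proof -
  have "measure_pmf.expectation (S 2) (D N) =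
      measure_pmf.expectation (S 2) (\<lambda>y. 2 * b N - 2 * pmf (S (2 * N)) (0 - y))"
    by (rule Bochner_Integration.integral_cong) (auto simp: D_def pmf_S_minus)
  also have "\<dots> = 2 * b N - 2 * measure_pmf.expectation (S 2) (\<lambda>y. pmf (S (2 * N)) (0 - y))"
    by (subst Bochner_Integration.integral_diff) (auto intro!: integrable_pmf_bounded[of _ 1] abs_pmf_le_1)
  also have "measure_pmf.expectation (S 2) (\<lambda>y. pmf (S (2 * N)) (0 - y)) = b (Suc N)"
    unfolding b_def pmf_S_Suc_Suc by simp
  finally show ?thesis by simp
qed

lemma b_antimono_Suc: "b (Suc N) \<le> b N"
proof -
  have "0 \<le> measure_pmf.expectation (S 2) (D N)"
    by (rule Bochner_Integration.integral_nonneg) (rule D_nonneg)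
  then show ?thesis using b_diff[of N] by simp
qed

lemma b_antimono: "m \<le> n \<Longrightarrow> b n \<le> b m"
  by (rule lift_Suc_antimono_le[of b]) (rule b_antimono_Suc)

text \<open>The parallelogram inequality is averaged over a two-step displacement z, whose symmetry
  identifies the means of \<open>D N (y + z)\<close> and \<open>D N (y - z)\<close>.\<close>

lemma D_Suc_le: "D (Suc N) y \<le> D N y"
proof -
  let ?E = "measure_pmf.expectation (S 2)"
  have "D (Suc N) y = 2 * (?E (\<lambda>z. pmf (S (2 * N)) (0 - z)) - ?E (\<lambda>z. pmf (S (2 * N)) (y - z)))"
    unfolding D_def b_def pmf_S_Suc_Suc by simp
  also have "\<dots> = ?E (\<lambda>z. 2 * pmf (S (2 * N)) (0 - z) - 2 * pmf (S (2 * N)) (y - z))"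
    by (subst Bochner_Integration.integral_diff) (auto intro!: integrable_pmf_bounded[of _ 1] abs_pmf_le_1)
  also have "\<dots> = ?E (\<lambda>z. D N (y - z) - D N z)"
    by (rule Bochner_Integration.integral_cong) (auto simp: D_def pmf_S_minus)
  also have "\<dots> = ?E (\<lambda>z. D N (y - z)) - ?E (D N)"
    by (subst Bochner_Integration.integral_diff) (auto intro: integrable_D)
  finally have 1: "D (Suc N) y = ?E (\<lambda>z. D N (y - z)) - ?E (D N)" .
  have 2: "?E (\<lambda>z. D N (y - z)) = ?E (\<lambda>z. D N (y + z))"
    using expectation_S_uminus[of 2 "\<lambda>z. D N (y + z)"] by simp
  have "?E (\<lambda>z. D N (y + z)) + ?E (\<lambda>z. D N (y - z)) = ?E (\<lambda>z. D N (y + z) + D N (y - z))"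
    by (subst Bochner_Integration.integral_add) (auto intro: integrable_D)
  also have "\<dots> \<le> ?E (\<lambda>z. 2 * D N y + 2 * D N z)"
    by (rule integral_mono) (auto intro!: integrable_D D_parallelogram Bochner_Integration.integrable_add)
  also have "\<dots> = 2 * D N y + 2 * ?E (D N)"
    by (subst Bochner_Integration.integral_add) (auto intro: integrable_D)
  finally show ?thesis using 1 2 by simp
qed

lemma b_diff_antimono: "m \<le> n \<Longrightarrow> b n - b (Suc n) \<le> b m - b (Suc m)"
proof (rule lift_Suc_antimono_le[of "\<lambda>n. b n - b (Suc n)"])
  show "b (Suc n) - b (Suc (Suc n)) \<le> b n - b (Suc n)" for n
    unfolding b_diff by (intro divide_right_mono integral_mono integrable_D D_Suc_le) auto
qed

text \<open>By convexity of \<open>b\<close> the decrement at n is the smallest of the n - m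
  decrements from m on, and these sum to at most \<open>b m\<close>.\<close>

lemma b_convex:
  assumes "m \<le> n"
  shows "real (n - m) * (b n - b (Suc n)) \<le> b m"
proof -
  have "real (n - m) * (b n - b (Suc n)) = (\<Sum>i=m..<n. b n - b (Suc n))" by simp
  also have "\<dots> \<le> (\<Sum>i=m..<n. b i - b (Suc i))"
    by (rule sum_mono) (auto intro: b_diff_antimono)
  also have "\<dots> = b m - b n" using sum_Suc_diff'[OF assms, of "\<lambda>i. - b i"] by simp
  also have "\<dots> \<le> b m" by (simp add: b_def)
  finally show ?thesis .
qed

lemma pmf_S_le_b_half: "pmf (S n) x \<le> b (n div 2)"
proof (cases "even n")
  case True
  then show ?thesis using pmf_S_le_b[of "n div 2" x] by simp
next
  case False
  then have n: "n = Suc (2 * (n div 2))" by presburger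
  have "pmf (S (Suc (2 * (n div 2)))) x = measure_pmf.expectation q (\<lambda>y. pmf (S (2 * (n div 2))) (x - y))"
    by (rule pmf_conv_pow_Suc)
  also have "\<dots> \<le> measure_pmf.expectation q (\<lambda>y. b (n div 2))"
    by (rule integral_mono) (auto intro: integrable_pmf_bounded[of _ 1] abs_pmf_le_1 pmf_S_le_b)
  finally show ?thesis using n by simp
qed

lemma sum_pmf_le_1: "finite A \<Longrightarrow> sum (pmf p) A \<le> 1"
  using measure_measure_pmf_finite[of A p] by (simp flip: measure_measure_pmf_finite)

text \<open>Where \<open>D N\<close> is small the law of \<open>S (2 * N)\<close> is almost as large
  as at 0, and its total mass on A is at most 1.\<close>

lemma b_le_max_D:
  assumes "finite A" "A \<noteq> {}" "\<And>x. x \<in> A \<Longrightarrow> D N x \<le> d"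
  shows "b N \<le> d / 2 + 1 / real (card A)"
proof -
  have "real (card A) * (b N - d / 2) = (\<Sum>x\<in>A. b N - d / 2)" by simp
  also have "\<dots> \<le> (\<Sum>x\<in>A. pmf (S (2 * N)) x)"
    by (rule sum_mono) (use assms(3) in \<open>force simp: D_def\<close>)
  also have "\<dots> \<le> 1" by (rule sum_pmf_le_1[OF assms(1)])
  finally show ?thesis using assms(1,2) by (simp add: field_simps card_gt_0_iff)
qed

text \<open>The return probability is the squared l2 norm of the law of \<open>S N\<close>, and
  Cauchy-Schwarz on A bounds it below.\<close>

lemma b_ge_of_mass:
  assumes "finite A" "A \<noteq> {}" "measure (S N) A \<ge> 1 / 2"
  shows "b N \<ge> 1 / (4 * real (card A))"
proof -
  let ?u = "pmf (S N)"
  have "b N = (\<Sum>\<^sub>az. ?u z * ?u z)"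
    using pmf_S_diff_eq(2)[of N 0 0] by (simp add: b_def)
  also have "\<dots> \<ge> (\<Sum>z\<in>A. ?u z * ?u z)"
    using infsetsum_mono_neutral_left[of "\<lambda>z. ?u z * ?u z" A "\<lambda>z. ?u z * ?u z" UNIV]
      pmf_S_diff_eq(1)[of N 0 0] assms(1) by simp
  finally have 1: "(\<Sum>z\<in>A. (?u z)\<^sup>2) \<le> b N" by (simp add: power2_eq_square)
  have "(1 / 2)\<^sup>2 \<le> (\<Sum>z\<in>A. ?u z)\<^sup>2"
    using assms by (intro power_mono) (auto simp: measure_measure_pmf_finite)
  also have "\<dots> \<le> real (card A) * (\<Sum>z\<in>A. (?u z)\<^sup>2)"
    using Cauchy_Schwarz_ineq_sum[of "\<lambda>_. 1" ?u A] by simp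
  also have "\<dots> \<le> real (card A) * b N" by (rule mult_left_mono[OF 1]) simp
  finally show ?thesis using assms(1,2) by (simp add: field_simps power2_eq_square card_gt_0_iff)
qed

end

section \<open>Return probabilities and displacement of heavy-tailed walks\<close>

lemma powr_telescope:
  assumes "\<beta> > 0" "x \<ge> (1::real)"
  shows "(x + 1) powr (-1 - \<beta>) \<le> (x powr - \<beta> - (x + 1) powr - \<beta>) / \<beta>"
proof -
  have l: "ln (x / (x + 1)) \<le> - 1 / (x + 1)"
    using ln_le_minus_one[of "x / (x + 1)"] assms by (simp add: field_simps)
  have "1 + \<beta> / (x + 1) \<le> exp (\<beta> / (x + 1))" by (rule exp_ge_add_one_self)
  also have "\<dots> \<le> exp (- \<beta> * ln (x / (x + 1)))"
    using mult_left_mono[OF l, of \<beta>] assms by (simp add: field_simps)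
  also have "\<dots> = (x / (x + 1)) powr - \<beta>" using assms by (simp add: powr_def)
  finally have "(x + 1) powr - \<beta> * (1 + \<beta> / (x + 1)) \<le> (x + 1) powr - \<beta> * (x / (x + 1)) powr - \<beta>"
    by (rule mult_left_mono) simp
  also have "\<dots> = x powr - \<beta>" using assms by (simp add: powr_divide)
  finally have "\<beta> * ((x + 1) powr - \<beta> / (x + 1)) \<le> x powr - \<beta> - (x + 1) powr - \<beta>"
    by (simp add: algebra_simps)
  moreover have "(x + 1) powr (-1 - \<beta>) = (x + 1) powr - \<beta> / (x + 1)"
  proof -
    have e: "-1 - \<beta> = - \<beta> - 1" by simp
    show ?thesis unfolding e powr_diff using assms by simp
  qed
  ultimately show ?thesis using assms(1) by (simp add: field_simps)
qed

lemma sum_powr_tail_le: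
  assumes "\<beta> > 0" "m \<ge> 1"
  shows "(\<Sum>t=m..r. real t powr (-1 - \<beta>)) \<le> (1 + 1 / \<beta>) * real m powr - \<beta>"
proof (cases "m \<le> r")
  case True
  have "(\<Sum>t=m..r. real t powr (-1 - \<beta>)) \<le> real m powr - \<beta> + (real m powr - \<beta> - real r powr - \<beta>) / \<beta>"
    using True
  proof (induction r rule: dec_induct)
    case base
    show ?case using assms by (simp add: powr_mono)
  next
    case (step n)
    have "real (Suc n) powr (-1 - \<beta>) \<le> (real n powr - \<beta> - real (Suc n) powr - \<beta>) / \<beta>"
      using powr_telescope[OF assms(1), of "real n"] step assms by (simp add: add.commute)
    then show ?case using step by (simp add: diff_divide_distrib)
  qed
  also have "\<dots> \<le> (1 + 1 / \<beta>) * real m powr - \<beta>" using assms by (simp add: field_simps)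
  finally show ?thesis .
qed (use assms in simp)

section \<open>Truncated steps and displacement\<close>

locale heavy_walk = sym_walk q for q :: "(int ^ 'd) pmf" +
  fixes \<alpha> cl cu :: real
  assumes dim: "CARD('d) \<ge> 2" and alpha: "\<alpha> > 0" and cl: "cl > 0" and cu: "cu > 0"
    and lower: "x \<noteq> 0 \<Longrightarrow> cl * real (nrm x) powr - (real CARD('d) + \<alpha>) \<le> pmf q x"
    and upper: "x \<noteq> 0 \<Longrightarrow> pmf q x \<le> cu * real (nrm x) powr - (real CARD('d) + \<alpha>)"
begin

text \<open>The kernel constant times the sphere bound of \<open>card_sphere_le\<close>, with 2 t +
  1 replaced by 3 t.\<close>

definition cs :: real where "cs = cu * (2 * CARD('d) * 3 ^ (CARD('d) - 1))"

lemma cs_pos: "cs > 0"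
  using cu by (simp add: cs_def)

lemma sphere_mass:
  assumes "t \<ge> 1"
  shows "(\<Sum>x | nrm x = t. pmf q x) \<le> cs * real t powr (-1 - \<alpha>)"
proof -
  let ?d = "CARD('d)"
  have "(\<Sum>x | nrm x = t. pmf q x) \<le> (\<Sum>x | nrm (x :: int ^ 'd) = t. cu * real t powr - (real ?d + \<alpha>))"
    by (rule sum_mono) (use upper assms in force)
  also have "\<dots> = real (card {x :: int ^ 'd. nrm x = t}) * (cu * real t powr - (real ?d + \<alpha>))" by simp
  also have "\<dots> \<le> real (2 * ?d * (3 * t) ^ (?d - 1)) * (cu * real t powr - (real ?d + \<alpha>))"
  proof (rule mult_right_mono)
    have "card {x :: int ^ 'd. nrm x = t} \<le> 2 * ?d * (2 * t + 1) ^ (?d - 1)" by (rule card_sphere_le)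
    also have "\<dots> \<le> 2 * ?d * (3 * t) ^ (?d - 1)"
      by (intro mult_left_mono power_mono) (use assms in auto)
    finally show "real (card {x :: int ^ 'd. nrm x = t}) \<le> real (2 * ?d * (3 * t) ^ (?d - 1))"
      by (rule of_nat_mono)
  qed (use cu in simp)
  also have "\<dots> = cs * (real t ^ (?d - 1) * real t powr - (real ?d + \<alpha>))"
    by (simp add: cs_def power_mult_distrib)
  also have "real t ^ (?d - 1) * real t powr - (real ?d + \<alpha>) = real t powr (-1 - \<alpha>)"
    using assms dim by (simp add: powr_realpow[symmetric] powr_add[symmetric] of_nat_diff)
  finally show ?thesis .
qed

lemma ball_second_moment:
  "(\<Sum>x\<in>cube r. (real_of_int (x $ i))\<^sup>2 * pmf q x) \<le> cs * sg \<alpha> r"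
proof -
  have "(\<Sum>x\<in>cube r. (real_of_int (x $ i))\<^sup>2 * pmf q x) \<le> (\<Sum>x\<in>cube r. (real (nrm x))\<^sup>2 * pmf q x)"
  proof (intro sum_mono mult_right_mono)
    fix x :: "int ^ 'd"
    have "\<bar>real_of_int (x $ i)\<bar> \<le> real (nrm x)"
      using abs_nth_le_nrm[of x i] by linarith
    then show "(real_of_int (x $ i))\<^sup>2 \<le> (real (nrm x))\<^sup>2" using abs_le_square_iff by fastforce
  qed simp
  also have "\<dots> = (\<Sum>t\<in>{0..r}. \<Sum>x | x \<in> cube r \<and> nrm x = t. (real (nrm x))\<^sup>2 * pmf q x)"
    by (rule sum.group[symmetric, OF finite_cube]) (auto simp: cube_def)
  also have "\<dots> = (\<Sum>t\<in>{0..r}. (real t)\<^sup>2 * (\<Sum>x | nrm x = t. pmf q x))"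
    by (intro sum.cong) (auto simp: cube_def sum_distrib_left intro!: sum.cong)
  also have "\<dots> = (\<Sum>t=1..r. (real t)\<^sup>2 * (\<Sum>x | nrm x = t. pmf q x))"
    by (rule sum.mono_neutral_right) auto
  also have "\<dots> \<le> (\<Sum>t=1..r. cs * real t powr (1 - \<alpha>))"
  proof (rule sum_mono)
    fix t assume "t \<in> {1..r}"
    then have t: "t \<ge> 1" by simp
    have "(real t)\<^sup>2 * (\<Sum>x | nrm x = t. pmf q x) \<le> (real t)\<^sup>2 * (cs * real t powr (-1 - \<alpha>))"
      by (intro mult_left_mono sphere_mass t) simp
    also have "\<dots> = cs * (real t powr 2 * real t powr (-1 - \<alpha>))" using t by (simp add: powr_numeral)
    also have "real t powr 2 * real t powr (-1 - \<alpha>) = real t powr (1 - \<alpha>)"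
      unfolding powr_add[symmetric] by (simp only: diff_conv_add_uminus add.assoc[symmetric]) simp
    finally show "(real t)\<^sup>2 * (\<Sum>x | nrm x = t. pmf q x) \<le> cs * real t powr (1 - \<alpha>)" .
  qed
  finally show ?thesis by (simp add: sg_def sum_distrib_left)
qed

text \<open>The true tail of order \<open>r powr - \<alpha>\<close> is weakened through
  \<open>sg_lower\<close>, so that large jumps and truncated variances are both measured on the
  scale 1 / \<open>Psi \<alpha> r\<close>.\<close>

lemma tail_mass:
  assumes "r \<ge> 1"
  shows "measure q {x. nrm x > r} \<le> cs / \<alpha> * 4 * sg \<alpha> r / (real r)\<^sup>2"
proof -
  let ?A = "\<lambda>n. {x :: int ^ 'd. nrm x = r + n + 1}"
  have U: "{x :: int ^ 'd. nrm x > r} = (\<Union>n. ?A n)"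
  proof (intro equalityI subsetI)
    fix x :: "int ^ 'd" assume "x \<in> {x. nrm x > r}"
    then have "nrm x = r + (nrm x - r - 1) + 1" by simp
    then show "x \<in> (\<Union>n. ?A n)" by blast
  qed auto
  have s1: "(\<lambda>n. measure q (?A n)) sums measure q {x. nrm x > r}"
    unfolding U by (rule measure_pmf.finite_measure_UNION) (auto simp: disjoint_family_on_def)
  let ?h = "\<lambda>n. - (cs / \<alpha> * real (r + n) powr - \<alpha>)"
  have lim: "?h \<longlonglongrightarrow> 0"
  proof -
    have "(\<lambda>n. real (r + n) powr - \<alpha>) \<longlonglongrightarrow> 0"
      by (rule tendsto_neg_powr) (use alpha in \<open>auto intro!: filterlim_tendsto_add_at_top[OF tendsto_const filterlim_real_sequentially]\<close>)
    then have "?h \<longlonglongrightarrow> - (cs / \<alpha> * 0)" by (intro tendsto_minus tendsto_mult tendsto_const)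
    then show ?thesis by simp
  qed
  have s2: "(\<lambda>n. ?h (Suc n) - ?h n) sums (0 - ?h 0)" by (rule telescope_sums[OF lim])
  have "measure q {x. nrm x > r} \<le> 0 - ?h 0"
  proof (rule sums_le[OF _ s1 s2])
    fix n
    have "measure q (?A n) \<le> cs * real (r + n + 1) powr (-1 - \<alpha>)"
      using sphere_mass[of "r + n + 1"] by (simp add: measure_measure_pmf_finite)
    also have "\<dots> \<le> cs * ((real (r + n) powr - \<alpha> - real (r + n + 1) powr - \<alpha>) / \<alpha>)"
      using powr_telescope[OF alpha, of "real (r + n)"] assms cs_pos
      by (intro mult_left_mono) (auto simp: add_ac)
    also have "\<dots> = ?h (Suc n) - ?h n" by (simp add: algebra_simps diff_divide_distrib)
    finally show "measure q (?A n) \<le> ?h (Suc n) - ?h n" .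
  qed
  also have "0 - ?h 0 = cs / \<alpha> * real r powr - \<alpha>" by simp
  also have "real r powr - \<alpha> = real r powr (2 - \<alpha>) / (real r)\<^sup>2"
    using assms by (simp add: powr_diff powr_minus powr_numeral field_simps)
  also have "cs / \<alpha> * \<dots> \<le> cs / \<alpha> * (4 * sg \<alpha> r / (real r)\<^sup>2)"
    using cs_pos alpha by (intro mult_left_mono divide_right_mono sg_lower) auto
  finally show ?thesis by simp
qed

text \<open>Displacement is estimated by truncating the steps at the target radius.\<close>

definition trunc :: "nat \<Rightarrow> (int ^ 'd) pmf" where
  "trunc r = map_pmf (\<lambda>x. if nrm x \<le> r then x else 0) q"

lemma sym_walk_trunc: "sym_walk (trunc r)"
proof
  have "map_pmf uminus (trunc r) = map_pmf (\<lambda>x. if nrm x \<le> r then x else 0) (map_pmf uminus q)"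
    by (auto simp: trunc_def pmf.map_comp o_def intro!: pmf.map_cong0)
  then show "map_pmf uminus (trunc r) = trunc r" by (simp add: sym trunc_def)
qed

lemma set_trunc: "set_pmf (trunc r) \<subseteq> cube r"
  by (auto simp: trunc_def cube_def)

lemma finite_set_conv_trunc: "finite (set_pmf (conv_pow (trunc r) n))"
  using finite_subset[OF set_trunc finite_cube] by (induction n) auto

lemma trunc_second_moment: "measure_pmf.expectation (trunc r) (\<lambda>x. (real_of_int (x $ i))\<^sup>2) \<le> cs * sg \<alpha> r"
proof -
  have "measure_pmf.expectation (trunc r) (\<lambda>x. (real_of_int (x $ i))\<^sup>2) =
      measure_pmf.expectation q (\<lambda>x. if nrm x \<le> r then (real_of_int (x $ i))\<^sup>2 else 0)"
    by (auto simp: trunc_def intro!: Bochner_Integration.integral_cong)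
  also have "\<dots> = (\<Sum>x\<in>cube r. (if nrm x \<le> r then (real_of_int (x $ i))\<^sup>2 else 0) * pmf q x)"
    by (rule integral_measure_pmf_real[OF finite_cube]) (auto simp: cube_def[symmetric] split: if_splits, auto simp: cube_def)
  also have "\<dots> = (\<Sum>x\<in>cube r. (real_of_int (x $ i))\<^sup>2 * pmf q x)"
    by (rule sum.cong) (auto simp: cube_def)
  finally show ?thesis using ball_second_moment[of i r] by simp
qed

text \<open>Truncated steps remain symmetric, hence centred, and the cross terms vanish.\<close>

lemma conv_trunc_second_moment:
  "measure_pmf.expectation (conv_pow (trunc r) n) (\<lambda>x. (real_of_int (x $ i))\<^sup>2) \<le> real n * (cs * sg \<alpha> r)"
proof (induction n)
  case (Suc n)
  interpret T: sym_walk "trunc r" by (rule sym_walk_trunc)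
  let ?E = "measure_pmf.expectation (conv_pow (trunc r) n)"
  have fin: "finite (set_pmf (trunc r))" by (rule finite_subset[OF set_trunc finite_cube])
  have zero: "?E (\<lambda>z. real_of_int (z $ i)) = 0"
    using T.expectation_S_uminus[of n "\<lambda>z. real_of_int (z $ i)"] by simp
  have int: "integrable (measure_pmf (conv_pow (trunc r) n)) f" for f :: "int ^ 'd \<Rightarrow> real"
    by (rule integrable_measure_pmf_finite[OF finite_set_conv_trunc])
  have "measure_pmf.expectation (conv_pow (trunc r) (Suc n)) (\<lambda>x. (real_of_int (x $ i))\<^sup>2) =
      (\<Sum>a\<in>set_pmf (trunc r). pmf (trunc r) a *\<^sub>R ?E (\<lambda>z. (real_of_int ((a + z) $ i))\<^sup>2))"
    unfolding conv_pow.simps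
    by (subst pmf_expectation_bind[OF fin]) (auto simp: finite_set_conv_trunc)
  also have "\<dots> = (\<Sum>a\<in>set_pmf (trunc r). pmf (trunc r) a *
      ((real_of_int (a $ i))\<^sup>2 + ?E (\<lambda>z. (real_of_int (z $ i))\<^sup>2)))"
  proof (rule sum.cong[OF refl])
    fix a assume "a \<in> set_pmf (trunc r)"
    have "?E (\<lambda>z. (real_of_int ((a + z) $ i))\<^sup>2) =
        ?E (\<lambda>z. (real_of_int (a $ i))\<^sup>2 + 2 * real_of_int (a $ i) * real_of_int (z $ i) + (real_of_int (z $ i))\<^sup>2)"
      by (simp add: power2_eq_square algebra_simps)
    also have "\<dots> = (real_of_int (a $ i))\<^sup>2 + ?E (\<lambda>z. (real_of_int (z $ i))\<^sup>2)"
      by (simp add: int zero)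
    finally show "pmf (trunc r) a *\<^sub>R ?E (\<lambda>z. (real_of_int ((a + z) $ i))\<^sup>2) = pmf (trunc r) a *
      ((real_of_int (a $ i))\<^sup>2 + ?E (\<lambda>z. (real_of_int (z $ i))\<^sup>2))" by simp
  qed
  also have "\<dots> = (\<Sum>a\<in>set_pmf (trunc r). (real_of_int (a $ i))\<^sup>2 * pmf (trunc r) a)
      + (\<Sum>a\<in>set_pmf (trunc r). pmf (trunc r) a) * ?E (\<lambda>z. (real_of_int (z $ i))\<^sup>2)"
    by (simp add: algebra_simps sum.distrib sum_distrib_right)
  also have "(\<Sum>a\<in>set_pmf (trunc r). pmf (trunc r) a) = 1" by (rule sum_pmf_eq_1[OF fin]) simp
  also have "(\<Sum>a\<in>set_pmf (trunc r). (real_of_int (a $ i))\<^sup>2 * pmf (trunc r) a) =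
      measure_pmf.expectation (trunc r) (\<lambda>x. (real_of_int (x $ i))\<^sup>2)"
    by (rule integral_measure_pmf_real[symmetric, OF fin])
  finally show ?case using Suc.IH trunc_second_moment[of r i] by (simp add: algebra_simps)
qed simp

text \<open>A union bound over the n steps, each of which differs from its truncation with
  probability at most the tail. An induction over test functions with values in [0, 1] replaces an
  explicit coupling.\<close>

lemma expectation_le_trunc:
  assumes "\<And>x. 0 \<le> f x" "\<And>x. f x \<le> 1"
  shows "measure_pmf.expectation (S n) f \<le>
    measure_pmf.expectation (conv_pow (trunc r) n) f + real n * measure q {x. nrm x > r}"
  using assms
proof (induction n arbitrary: f)
  case (Suc n)
  let ?p = "measure q {x. nrm x > r}"
  let ?h = "\<lambda>y. measure_pmf.expectation (conv_pow (trunc r) n) (\<lambda>z. f (y + z))"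
  have bd: "\<bar>f x\<bar> \<le> 1" for x using Suc.prems by simp
  have h: "0 \<le> ?h y" "?h y \<le> 1" for y
  proof -
    show "0 \<le> ?h y" by (rule Bochner_Integration.integral_nonneg) (rule Suc.prems)
    have "?h y \<le> measure_pmf.expectation (conv_pow (trunc r) n) (\<lambda>z. 1)"
      by (rule integral_mono) (auto intro: integrable_pmf_bounded[of _ 1] bd Suc.prems)
    then show "?h y \<le> 1" by simp
  qed
  have inth: "integrable (measure_pmf p) (\<lambda>y. ?h (g y))" for p :: "'x pmf" and g
    by (rule integrable_pmf_bounded[of _ 1]) (use h in simp)
  have "measure_pmf.expectation (S (Suc n)) f =
      measure_pmf.expectation q (\<lambda>y. measure_pmf.expectation (S n) (\<lambda>z. f (y + z)))"
    by (rule expectation_conv_pow_Suc[OF bd])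
  also have "\<dots> \<le> measure_pmf.expectation q (\<lambda>y. ?h y + real n * ?p)"
  proof (rule integral_mono)
    show "integrable (measure_pmf q) (\<lambda>y. measure_pmf.expectation (S n) (\<lambda>z. f (y + z)))"
    proof (rule integrable_pmf_bounded[of _ 1])
      fix y
      have "\<bar>measure_pmf.expectation (S n) (\<lambda>z. f (y + z))\<bar> \<le> measure_pmf.expectation (S n) (\<lambda>z. \<bar>f (y + z)\<bar>)"
        by (rule integral_abs_bound)
      also have "\<dots> \<le> measure_pmf.expectation (S n) (\<lambda>z. 1)"
        by (rule integral_mono) (auto intro!: integrable_pmf_bounded[of _ 1] bd)
      finally show "\<bar>measure_pmf.expectation (S n) (\<lambda>z. f (y + z))\<bar> \<le> 1" by simp
    qed
    show "measure_pmf.expectation (S n) (\<lambda>z. f (y + z)) \<le> ?h y + real n * ?p" for y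
      by (rule Suc.IH) (use Suc.prems in auto)
    show "integrable (measure_pmf q) (\<lambda>y. ?h y + real n * ?p)"
      using inth[of q id] by simp
  qed
  also have "\<dots> = measure_pmf.expectation q ?h + real n * ?p"
    using inth[of q id] by simp
  also have "measure_pmf.expectation q ?h \<le>
      measure_pmf.expectation q (\<lambda>y. ?h (if nrm y \<le> r then y else 0) + indicator {x. nrm x > r} y)"
  proof (rule integral_mono)
    show "integrable (measure_pmf q) ?h" using inth[of q id] by simp
    show "integrable (measure_pmf q) (\<lambda>y. ?h (if nrm y \<le> r then y else 0) + indicator {x. nrm x > r} y)"
      by (intro Bochner_Integration.integrable_add inth) (auto intro: integrable_pmf_bounded[of _ 1] simp: indicator_def)
    show "?h y \<le> ?h (if nrm y \<le> r then y else 0) + indicator {x. nrm x > r} y" for y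
      using h[of y] h[of 0] by (auto simp: indicator_def)
  qed
  also have "\<dots> = measure_pmf.expectation q (\<lambda>y. ?h (if nrm y \<le> r then y else 0)) + ?p"
    by (subst Bochner_Integration.integral_add[OF inth])
       (auto intro: integrable_pmf_bounded[of _ 1] simp: indicator_def)
  also have "measure_pmf.expectation q (\<lambda>y. ?h (if nrm y \<le> r then y else 0)) =
      measure_pmf.expectation (conv_pow (trunc r) (Suc n)) f"
    by (subst expectation_conv_pow_Suc[OF bd]) (simp add: trunc_def)
  finally show ?case by (simp add: algebra_simps)
qed simp

definition cd :: real where "cd = (4 / \<alpha> + CARD('d)) * cs"

lemma cd_pos: "cd > 0"
  using alpha cs_pos by (simp add: cd_def add_pos_pos)

text \<open>Either some step exceeds r, or the walk with truncated steps leaves the cube. The second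
  case is Chebyshev's inequality in each coordinate, and both have order n /
  \<open>Psi \<alpha> r\<close>.\<close>

lemma displacement:
  assumes "r \<ge> 1"
  shows "measure (S n) {x. nrm x > r} \<le> cd * (real n / Psi \<alpha> r)"
proof -
  let ?T = "measure_pmf (conv_pow (trunc r) n)"
  have "measure (S n) {x. nrm x > r} = measure_pmf.expectation (S n) (indicator {x. nrm x > r})" by simp
  also have "\<dots> \<le> measure_pmf.expectation (conv_pow (trunc r) n) (indicator {x. nrm x > r}) + real n * measure q {x. nrm x > r}"
    by (rule expectation_le_trunc) (auto simp: indicator_def)
  also have "measure_pmf.expectation (conv_pow (trunc r) n) (indicator {x. nrm x > r}) = measure ?T {x. nrm x > r}" by simp
  also have "measure ?T {x. nrm x > r} \<le> measure ?T (\<Union>i. {x. (real_of_int (x $ i))\<^sup>2 \<ge> (real r)\<^sup>2})"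
  proof (rule measure_pmf.finite_measure_mono)
    show "{x :: int ^ 'd. nrm x > r} \<subseteq> (\<Union>i. {x. (real_of_int (x $ i))\<^sup>2 \<ge> (real r)\<^sup>2})"
    proof
      fix x :: "int ^ 'd" assume "x \<in> {x. nrm x > r}"
      then have "\<not> nrm x \<le> r" by simp
      then obtain i where "\<bar>x $ i\<bar> > int r" unfolding nrm_le_iff by (auto simp: not_le)
      then have "real r \<le> \<bar>real_of_int (x $ i)\<bar>" by linarith
      then have "(real r)\<^sup>2 \<le> (real_of_int (x $ i))\<^sup>2" using abs_le_square_iff[of "real r" "real_of_int (x $ i)"] by simp
      then show "x \<in> (\<Union>i. {x. (real_of_int (x $ i))\<^sup>2 \<ge> (real r)\<^sup>2})" by blast
    qed
  qed simp
  also have "\<dots> \<le> (\<Sum>i\<in>UNIV. measure ?T {x. (real_of_int (x $ i))\<^sup>2 \<ge> (real r)\<^sup>2})"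
    by (rule measure_pmf.finite_measure_subadditive_finite) auto
  also have "\<dots> \<le> (\<Sum>i\<in>(UNIV :: 'd set). real n * (cs * sg \<alpha> r) / (real r)\<^sup>2)"
  proof (rule sum_mono)
    fix i :: 'd
    have "measure ?T {x \<in> space ?T. (real_of_int (x $ i))\<^sup>2 \<ge> (real r)\<^sup>2} \<le>
        measure_pmf.expectation (conv_pow (trunc r) n) (\<lambda>x. (real_of_int (x $ i))\<^sup>2) / (real r)\<^sup>2"
      by (rule integral_Markov_inequality_measure[of _ _ UNIV])
         (use assms in \<open>auto intro: integrable_measure_pmf_finite finite_set_conv_trunc\<close>)
    also have "\<dots> \<le> real n * (cs * sg \<alpha> r) / (real r)\<^sup>2"
      by (intro divide_right_mono conv_trunc_second_moment) simp
    finally show "measure ?T {x. (real_of_int (x $ i))\<^sup>2 \<ge> (real r)\<^sup>2} \<le> real n * (cs * sg \<alpha> r) / (real r)\<^sup>2" by simp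
  qed
  also have "\<dots> = CARD('d) * cs * (real n * sg \<alpha> r / (real r)\<^sup>2)" by simp
  also have "real n * measure q {x. nrm x > r} \<le> real n * (cs / \<alpha> * 4 * sg \<alpha> r / (real r)\<^sup>2)"
    by (intro mult_left_mono tail_mass assms) simp
  finally show ?thesis by (simp add: cd_def Psi_def algebra_simps)
qed

section \<open>The energy of a shift against the decrement of return probabilities\<close>

definition c2 :: real where "c2 = cl\<^sup>2 * 2 powr - (real CARD('d) + \<alpha>)"

lemma c2_pos: "c2 > 0"
  using cl by (simp add: c2_def)

lemma two_step_lower:
  assumes "x \<noteq> 0"
  shows "c2 * real (nrm x) powr - (real CARD('d) + \<alpha>) \<le> pmf (S 2) x"
proof -
  let ?i = "undefined :: 'd"
  let ?\<beta> = "real CARD('d) + \<alpha>"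
  have \<beta>: "?\<beta> > 0" using alpha by simp
  have n0: "nrm x \<ge> 1" using assms nrm_eq_0_iff[of x] by linarith
  have "axis ?i (1::int) \<noteq> axis ?i (-1)" by (simp add: axis_eq_axis)
  then obtain a :: int where a: "\<bar>a\<bar> = 1" "axis ?i a \<noteq> x" by (metis abs_1 abs_minus_cancel)
  let ?e = "axis ?i a"
  have e: "nrm ?e = 1" using a by simp
  then have e0: "?e \<noteq> 0" by (metis nrm_zero zero_neq_one)
  have n1: "nrm (x - ?e) \<ge> 1" "nrm (x - ?e) \<le> 2 * nrm x"
  proof -
    have "x - ?e \<noteq> 0" using a(2) by auto
    then show "nrm (x - ?e) \<ge> 1" using nrm_eq_0_iff[of "x - ?e"] by linarith
    show "nrm (x - ?e) \<le> 2 * nrm x" using nrm_triangle_diff[of x ?e] e n0 by linarith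
  qed
  have "cl * 1 \<le> pmf q ?e" using lower[OF e0, unfolded e] by simp
  moreover have "cl * (2 powr - ?\<beta> * real (nrm x) powr - ?\<beta>) \<le> pmf q (x - ?e)"
  proof -
    have "2 powr - ?\<beta> * real (nrm x) powr - ?\<beta> = (2 * real (nrm x)) powr - ?\<beta>" by (simp add: powr_mult)
    also have "\<dots> \<le> real (nrm (x - ?e)) powr - ?\<beta>"
    proof (rule powr_mono2')
      show "real (nrm (x - ?e)) \<le> 2 * real (nrm x)" using n1(2) by linarith
    qed (use n1 \<beta> in auto)
    finally show ?thesis using lower[of "x - ?e"] n1 cl a
      by (auto intro: order_trans[OF mult_left_mono])
  qed
  ultimately have "(cl * 1) * (cl * (2 powr - ?\<beta> * real (nrm x) powr - ?\<beta>)) \<le> pmf q ?e * pmf q (x - ?e)"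
    by (rule mult_mono) (use cl in auto)
  also have "\<dots> = (\<Sum>y\<in>{?e}. pmf q (x - y) * pmf q y)" by (simp add: mult.commute)
  also have "\<dots> = measure_pmf.expectation q (\<lambda>y. indicator {?e} y * pmf q (x - y))"
    by (subst integral_measure_pmf_real[of "{?e}"]) (auto simp: indicator_def)
  also have "\<dots> \<le> measure_pmf.expectation q (\<lambda>y. pmf q (x - y))"
    by (rule integral_mono) (auto intro!: integrable_pmf_bounded[of _ 1] simp: pmf_le_1 indicator_def mult_le_one)
  also have "\<dots> = pmf (S 2) x"
  proof -
    have "S (Suc 0) = q" by (simp add: map_pmf_def[symmetric] bind_return_pmf')
    then show ?thesis using pmf_conv_pow_Suc[of q 1 x] by (simp add: numeral_2_eq_2 del: conv_pow.simps)
  qed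
  finally show ?thesis by (simp add: c2_def power2_eq_square mult_ac)
qed

lemma D_sum_le:
  "finite I \<Longrightarrow> D N (\<Sum>i\<in>I. f i) \<le> 2 ^ card I * (\<Sum>i\<in>I. D N (f i))"
proof (induction I rule: finite_induct)
  case (insert i I)
  have "D N (\<Sum>i\<in>insert i I. f i) \<le> 2 * D N (f i) + 2 * D N (\<Sum>i\<in>I. f i)"
    using D_triangle[of N "f i" "\<Sum>i\<in>I. f i"] insert by simp
  also have "\<dots> \<le> 2 ^ card (insert i I) * D N (f i) + 2 * (2 ^ card I * (\<Sum>i\<in>I. D N (f i)))"
  proof (intro add_mono mult_right_mono mult_left_mono insert.IH)
    show "(2::real) \<le> 2 ^ card (insert i I)" using insert by simp
  qed (auto simp: D_nonneg)
  finally show ?case using insert by (simp add: algebra_simps)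
qed simp

text \<open>The coordinates start at 1, which keeps out the origin, where
  \<open>two_step_lower\<close> says nothing.\<close>

definition box :: "nat \<Rightarrow> (int ^ 'd) set" where
  "box t = {y. \<forall>k. 1 \<le> y $ k \<and> y $ k \<le> int t}"

lemma finite_box: "finite (box t)" and card_box: "card (box t) = t ^ CARD('d)"
  using card_vec_Pi[of "\<lambda>_. {1..int t}"] by (auto simp: box_def)

lemma mult_n_axis: "mult_n a (axis i x) = axis i (int a * x)"
  by (induction a) (auto simp: vec_eq_iff axis_def algebra_simps)

text \<open>Write j = a t + c. By \<open>D_mult_n\<close> the a shifts of length t cost a factor
  a^2, at most (r / t)^2. Each remaining shift by e is split into the shifts y + e and -y and
  averaged over y in \<open>box t\<close>, so that all arguments fall into
  \<open>box (2 * t)\<close>.\<close>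

lemma D_axis_le_box:
  assumes "1 \<le> t" "t \<le> r" "j \<le> r"
  shows "real t ^ CARD('d) * (real t)\<^sup>2 * D N (axis i (int j)) \<le> 16 * (real r)\<^sup>2 * (\<Sum>z\<in>box (2 * t). D N z)"
proof -
  define a c where "a = j div t" and "c = j mod t"
  have cr: "c \<le> t" using assms by (simp add: c_def less_imp_le)
  have ar: "(real a)\<^sup>2 \<le> (real r / real t)\<^sup>2" "1 \<le> (real r / real t)\<^sup>2"
  proof -
    have "real a * real t \<le> real j" unfolding a_def of_nat_mult[symmetric] by (subst of_nat_le_iff) simp
    then have "real a \<le> real r / real t" using assms by (simp add: field_simps)
    then show "(real a)\<^sup>2 \<le> (real r / real t)\<^sup>2" by (rule power_mono) simp
    show "1 \<le> (real r / real t)\<^sup>2" using assms by (simp add: field_simps)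
  qed
  let ?e = "\<lambda>m. axis i (int m) :: int ^ 'd"
  let ?R = "(real r / real t)\<^sup>2"
  have decomp: "?e j = mult_n a (?e t) + ?e c"
    unfolding mult_n_axis a_def c_def
    by (auto simp: vec_eq_iff axis_def) (metis of_nat_add of_nat_mult div_mult_mod_eq)
  have pt: "D N (?e j) \<le> 4 * ?R * (2 * D N y + D N (y + ?e t) + D N (y + ?e c))" for y
  proof -
    have 1: "D N (?e m) \<le> 2 * D N (y + ?e m) + 2 * D N y" for m
      using D_triangle[of N "y + ?e m" "- y"] by (simp add: D_minus)
    have "D N (?e j) \<le> 2 * D N (mult_n a (?e t)) + 2 * D N (?e c)" unfolding decomp by (rule D_triangle)
    also have "\<dots> \<le> 2 * ((real a)\<^sup>2 * D N (?e t)) + 2 * D N (?e c)" using D_mult_n[of N a "?e t"] by simp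
    also have "\<dots> \<le> 2 * (?R * D N (?e t)) + 2 * (?R * D N (?e c))"
      using mult_right_mono[OF ar(1) D_nonneg[of N "?e t"]] mult_right_mono[OF ar(2) D_nonneg[of N "?e c"]] by simp
    also have "\<dots> \<le> 2 * (?R * (2 * D N (y + ?e t) + 2 * D N y)) + 2 * (?R * (2 * D N (y + ?e c) + 2 * D N y))"
      by (intro add_mono mult_left_mono 1) auto
    finally show ?thesis by (simp add: algebra_simps)
  qed
  have shift: "(\<Sum>y\<in>box t. D N (y + ?e m)) \<le> (\<Sum>z\<in>box (2 * t). D N z)" if "m \<le> t" for m
  proof -
    have "(\<Sum>y\<in>box t. D N (y + ?e m)) = (\<Sum>z\<in>(\<lambda>y. y + ?e m) ` box t. D N z)"
      by (subst sum.reindex) (auto simp: inj_on_def)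
    also have "\<dots> \<le> (\<Sum>z\<in>box (2 * t). D N z)"
    proof (intro sum_mono2 finite_box D_nonneg subsetI)
      fix z assume "z \<in> (\<lambda>y. y + ?e m) ` box t"
      then obtain y where y: "y \<in> box t" "z = y + ?e m" by blast
      have "1 \<le> z $ k \<and> z $ k \<le> int (2 * t)" for k
      proof -
        have "1 \<le> y $ k" "y $ k \<le> int t" using y by (auto simp: box_def)
        moreover have "0 \<le> ?e m $ k" "?e m $ k \<le> int t" using that by (auto simp: axis_def)
        ultimately show ?thesis unfolding y by simp
      qed
      then show "z \<in> box (2 * t)" by (simp add: box_def)
    qed
    finally show ?thesis .
  qed
  have "real t ^ CARD('d) * D N (?e j) = (\<Sum>y\<in>box t. D N (?e j))" by (simp add: card_box)
  also have "\<dots> \<le> (\<Sum>y\<in>box t. 4 * ?R * (2 * D N y + D N (y + ?e t) + D N (y + ?e c)))"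
    by (rule sum_mono) (rule pt)
  also have "\<dots> = 4 * ?R * (2 * (\<Sum>y\<in>box t. D N (y + ?e 0)) + (\<Sum>y\<in>box t. D N (y + ?e t)) + (\<Sum>y\<in>box t. D N (y + ?e c)))"
    by (simp add: sum.distrib axis_eq_0_iff[THEN iffD2] flip: sum_distrib_left)
  also have "\<dots> \<le> 4 * ?R * (2 * (\<Sum>z\<in>box (2 * t). D N z) + (\<Sum>z\<in>box (2 * t). D N z) + (\<Sum>z\<in>box (2 * t). D N z))"
    by (intro mult_left_mono add_mono shift cr) auto
  also have "\<dots> = 16 * ?R * (\<Sum>z\<in>box (2 * t). D N z)" by simp
  finally have "real t ^ CARD('d) * D N (?e j) \<le> 16 * ?R * (\<Sum>z\<in>box (2 * t). D N z)" .
  then have "(real t)\<^sup>2 * (real t ^ CARD('d) * D N (?e j)) \<le> (real t)\<^sup>2 * (16 * ?R * (\<Sum>z\<in>box (2 * t). D N z))"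
    by (rule mult_left_mono) simp
  also have "\<dots> = 16 * (real r)\<^sup>2 * (\<Sum>z\<in>box (2 * t). D N z)"
    using assms by (simp add: power_divide)
  finally show ?thesis by (simp add: mult_ac)
qed

definition ce :: real where
  "ce = (let \<beta> = real CARD('d) + \<alpha> in 32 * ((1 + 1 / \<beta>) * 2 powr \<beta>) / c2)"

lemma ce_pos: "ce > 0"
  using c2_pos alpha by (simp add: ce_def Let_def add_pos_pos)

text \<open>\<open>D_axis_le_box\<close> is averaged over the scales t up to r with weights
  \<open>t powr (-1 - \<beta>)\<close>, \<beta> = d + \<alpha>. On the left the weights produce
  exactly \<open>sg \<alpha> r\<close>. On the right a vector z collects the weights of t at least
  \<open>nrm z\<close> / 2, of order \<open>nrm z powr - \<beta>\<close>, which is a constant times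
  its two-step probability at most; so the sum becomes the Dirichlet energy. Averaging over all
  scales is what yields the factor \<open>sg\<close>, including the logarithm at \<alpha> =
  2.\<close>

lemma energy_axis:
  assumes "1 \<le> r" "j \<le> r"
  shows "D N (axis i (int j)) * sg \<alpha> r \<le> ce * (real r)\<^sup>2 * (b N - b (Suc N))"
proof -
  define \<beta> where "\<beta> = real CARD('d) + \<alpha>"
  have \<beta>: "\<beta> > 0" using alpha by (simp add: \<beta>_def)
  let ?X = "D N (axis i (int j))"
  let ?W = "(1 + 1 / \<beta>) * 2 powr \<beta>"
  have "?X * sg \<alpha> r = (\<Sum>t=1..r. ?X * real t powr (1 - \<alpha>))" by (simp add: sg_def sum_distrib_left)
  also have "\<dots> \<le> (\<Sum>t=1..r. \<Sum>z\<in>box (2 * r). 16 * (real r)\<^sup>2 * D N z * (if nrm z \<le> 2 * t then real t powr (-1 - \<beta>) else 0))"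
  proof (rule sum_mono)
    fix t assume t: "t \<in> {1..r}"
    have e: "real t powr (1 - \<alpha>) = real t powr (-1 - \<beta>) * (real t ^ CARD('d) * (real t)\<^sup>2)"
    proof -
      have 1: "real t ^ CARD('d) * (real t)\<^sup>2 = real t powr real (CARD('d) + 2)"
        using t powr_realpow[of "real t" "CARD('d) + 2"] by (simp only: power_add) simp
      have 2: "-1 - \<beta> + real (CARD('d) + 2) = 1 - \<alpha>" by (simp add: \<beta>_def)
      show ?thesis unfolding 1 powr_add[symmetric] 2 ..
    qed
    have "?X * real t powr (1 - \<alpha>) = real t powr (-1 - \<beta>) * (real t ^ CARD('d) * (real t)\<^sup>2 * ?X)"
      unfolding e by (simp add: mult_ac)
    also have "\<dots> \<le> real t powr (-1 - \<beta>) * (16 * (real r)\<^sup>2 * (\<Sum>z\<in>box (2 * t). D N z))"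
      by (rule mult_left_mono[OF D_axis_le_box]) (use t assms in auto)
    also have "\<dots> = (\<Sum>z\<in>box (2 * t). 16 * (real r)\<^sup>2 * D N z * (if nrm z \<le> 2 * t then real t powr (-1 - \<beta>) else 0))"
      unfolding sum_distrib_left
    proof (rule sum.cong[OF refl])
      fix z assume z: "z \<in> box (2 * t)"
      have "\<bar>z $ k\<bar> \<le> int (2 * t)" for k
        using z unfolding box_def by (smt (verit) mem_Collect_eq)
      then have "nrm z \<le> 2 * t" unfolding nrm_le_iff by blast
      then show "real t powr (-1 - \<beta>) * (16 * (real r)\<^sup>2 * D N z) =
          16 * (real r)\<^sup>2 * D N z * (if nrm z \<le> 2 * t then real t powr (-1 - \<beta>) else 0)" by simp
    qed
    also have "\<dots> \<le> (\<Sum>z\<in>box (2 * r). 16 * (real r)\<^sup>2 * D N z * (if nrm z \<le> 2 * t then real t powr (-1 - \<beta>) else 0))"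
      by (rule sum_mono2[OF finite_box]) (use t in \<open>auto simp: box_def D_nonneg intro: order_trans\<close>)
    finally show "?X * real t powr (1 - \<alpha>) \<le> \<dots>" .
  qed
  also have "\<dots> = (\<Sum>z\<in>box (2 * r). 16 * (real r)\<^sup>2 * D N z * (\<Sum>t=1..r. if nrm z \<le> 2 * t then real t powr (-1 - \<beta>) else 0))"
    by (subst sum.swap) (simp add: sum_distrib_left)
  also have "\<dots> \<le> (\<Sum>z\<in>box (2 * r). 16 * (real r)\<^sup>2 * D N z * (?W * (pmf (S 2) z / c2)))"
  proof (intro sum_mono mult_left_mono)
    fix z assume "z \<in> box (2 * r)"
    then have z: "z \<noteq> 0" by (auto simp: box_def)
    then have z1: "nrm z \<ge> 1" using nrm_eq_0_iff[of z] by linarith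
    \<comment> \<open>The least t with \<open>nrm z \<le> 2 * t\<close>.\<close>
    define m where "m = (nrm z + 1) div 2"
    have m: "m \<ge> 1" "real (nrm z) / 2 \<le> real m" using z1 by (auto simp: m_def)
    have "(\<Sum>t=1..r. if nrm z \<le> 2 * t then real t powr (-1 - \<beta>) else 0) = (\<Sum>t\<in>{t\<in>{1..r}. nrm z \<le> 2 * t}. real t powr (-1 - \<beta>))"
      by (rule sum.inter_filter[symmetric]) simp
    also have "\<dots> \<le> (\<Sum>t=m..r. real t powr (-1 - \<beta>))"
      by (rule sum_mono2) (auto simp: m_def)
    also have "\<dots> \<le> (1 + 1 / \<beta>) * real m powr - \<beta>" by (rule sum_powr_tail_le[OF \<beta> m(1)])
    also have "\<dots> \<le> (1 + 1 / \<beta>) * (real (nrm z) / 2) powr - \<beta>"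
      by (intro mult_left_mono powr_mono2') (use m z1 \<beta> in auto)
    also have "\<dots> = ?W * real (nrm z) powr - \<beta>"
      using z1 by (simp add: powr_divide powr_minus field_simps)
    also have "\<dots> \<le> ?W * (pmf (S 2) z / c2)"
    proof (rule mult_left_mono)
      show "real (nrm z) powr - \<beta> \<le> pmf (S 2) z / c2"
        using two_step_lower[OF z] c2_pos by (simp add: \<beta>_def pos_le_divide_eq mult.commute)
    qed (use \<beta> in simp)
    finally show "(\<Sum>t=1..r. if nrm z \<le> 2 * t then real t powr (-1 - \<beta>) else 0) \<le> ?W * (pmf (S 2) z / c2)" .
  qed (auto simp: D_nonneg)
  also have "\<dots> = ce * (real r)\<^sup>2 * ((\<Sum>z\<in>box (2 * r). D N z * pmf (S 2) z) / 2)"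
    by (simp add: ce_def Let_def sum_distrib_left sum_divide_distrib mult_ac flip: \<beta>_def)
  also have "\<dots> \<le> ce * (real r)\<^sup>2 * (b N - b (Suc N))"
  proof (rule mult_left_mono)
    have "(\<Sum>z\<in>box (2 * r). D N z * pmf (S 2) z) = (\<Sum>z\<in>box (2 * r). (indicator (box (2 * r)) z * D N z) * pmf (S 2) z)"
      by (rule sum.cong) auto
    also have "\<dots> = measure_pmf.expectation (S 2) (\<lambda>z. indicator (box (2 * r)) z * D N z)"
      by (rule integral_measure_pmf_real[symmetric, OF finite_box]) (auto simp: indicator_def split: if_splits)
    also have "\<dots> \<le> measure_pmf.expectation (S 2) (D N)"
    proof (rule integral_mono)
      show "integrable (measure_pmf (S 2)) (\<lambda>z. indicator (box (2 * r)) z * D N z)"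
        by (rule integrable_pmf_bounded[of _ 4]) (use abs_D_le in \<open>auto simp: indicator_def\<close>)
      show "integrable (measure_pmf (S 2)) (D N)" using integrable_D[of "S 2" N id] by simp
    qed (auto simp: indicator_def D_nonneg)
    finally show "(\<Sum>z\<in>box (2 * r). D N z * pmf (S 2) z) / 2 \<le> b N - b (Suc N)" unfolding b_diff by simp
  qed (use ce_pos in simp)
  finally show ?thesis .
qed

definition cE :: real where "cE = 2 ^ CARD('d) * CARD('d) * ce"

lemma cE_pos: "cE > 0"
  using ce_pos by (simp add: cE_def)

lemma energy:
  assumes "1 \<le> r" "nrm x \<le> r"
  shows "D N x \<le> cE * Psi \<alpha> r * (b N - b (Suc N))"
proof -
  have ax: "D N (axis i (x $ i)) \<le> ce * Psi \<alpha> r * (b N - b (Suc N))" for i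
  proof -
    have j: "nat \<bar>x $ i\<bar> \<le> r" using assms abs_nth_le_nrm[of x i] by linarith
    have "axis i (x $ i) = axis i (int (nat \<bar>x $ i\<bar>)) \<or> axis i (x $ i) = - axis i (int (nat \<bar>x $ i\<bar>))"
      by (auto simp: abs_if vec_eq_iff axis_def)
    then have "D N (axis i (x $ i)) = D N (axis i (int (nat \<bar>x $ i\<bar>)))" using D_minus by metis
    then have "D N (axis i (x $ i)) * sg \<alpha> r \<le> ce * (real r)\<^sup>2 * (b N - b (Suc N))"
      using energy_axis[OF assms(1) j, of N i] by simp
    then show ?thesis using sg_ge_1[OF assms(1), of \<alpha>] by (simp add: Psi_def field_simps)
  qed
  have "x = (\<Sum>i\<in>UNIV. axis i (x $ i))"
    by (simp add: vec_eq_iff axis_def if_distrib[of "\<lambda>f. f _"] cong: if_cong) 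
  then have "D N x \<le> 2 ^ CARD('d) * (\<Sum>i\<in>UNIV. D N (axis i (x $ i)))"
    using D_sum_le[of "UNIV :: 'd set" N "\<lambda>i. axis i (x $ i)"] by simp
  also have "\<dots> \<le> 2 ^ CARD('d) * (\<Sum>i\<in>(UNIV :: 'd set). ce * Psi \<alpha> r * (b N - b (Suc N)))"
    by (intro mult_left_mono sum_mono ax) simp
  finally show ?thesis by (simp add: cE_def)
qed

end

lemma powr_neg_Bernoulli:
  assumes "0 \<le> u" "u < 1" "0 \<le> (p::real)"
  shows "1 + p * u \<le> (1 - u) powr - p"
proof -
  have "ln (1 - u) \<le> - u" using ln_le_minus_one[of "1 - u"] assms by simp
  then have "p * u \<le> - p * ln (1 - u)" using mult_left_mono[of "ln (1 - u)" "- u" p] assms by simp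
  then have "exp (p * u) \<le> (1 - u) powr - p" using assms by (simp add: powr_def)
  then show ?thesis using exp_ge_add_one_self[of "p * u"] by linarith
qed

section \<open>Nash's argument and the natural radius\<close>

context heavy_walk
begin

definition \<kappa> :: real where "\<kappa> = min \<alpha> 1"

lemma kappa: "0 < \<kappa>" "\<kappa> \<le> 1"
  using alpha by (auto simp: \<kappa>_def)

lemma Psi_large: "\<exists>r\<ge>1. x \<le> Psi \<alpha> r"
proof -
  define r where "r = nat \<lceil>max 1 ((4 * max x 1) powr (1 / \<kappa>))\<rceil>"
  have r: "r \<ge> 1" "(4 * max x 1) powr (1 / \<kappa>) \<le> real r" unfolding r_def by linarith+
  have "4 * max x 1 = ((4 * max x 1) powr (1 / \<kappa>)) powr \<kappa>" using kappa by (simp add: powr_powr)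
  also have "\<dots> \<le> real r powr \<kappa>" by (rule powr_mono2) (use r kappa in auto)
  also have "\<dots> \<le> 4 * Psi \<alpha> r" using Psi_ge[OF alpha r(1)] by (simp add: \<kappa>_def)
  finally show ?thesis using r by (intro exI[of _ r]) auto
qed

text \<open>Up to this time at least half of the mass is still in \<open>cube r\<close>.\<close>

lemma b_ge_of_Psi:
  assumes "r \<ge> 1" "2 * cd * real N \<le> Psi \<alpha> r"
  shows "1 / (4 * (3 * real r) ^ CARD('d)) \<le> b N"
proof -
  have P: "Psi \<alpha> r > 0" by (rule Psi_pos[OF assms(1)])
  have "measure (S N) {x. nrm x > r} \<le> 1 / 2"
  proof -
    have "cd * (real N / Psi \<alpha> r) \<le> 1 / 2" using assms(2) P by (simp add: field_simps)
    then show ?thesis using displacement[OF assms(1), of N] by linarith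
  qed
  moreover have "measure (S N) (cube r) = 1 - measure (S N) {x. nrm x > r}"
  proof -
    have "cube r = space (S N) - {x. nrm x > r}" by (auto simp: cube_def)
    then show ?thesis using measure_pmf.prob_compl[of "{x. nrm x > r}" "S N"] by simp
  qed
  ultimately have "1 / (4 * real (card (cube r :: (int ^ 'd) set))) \<le> b N"
    by (intro b_ge_of_mass finite_cube) (use nrm_zero in \<open>force simp: cube_def\<close>, simp)
  moreover have "1 / (4 * (3 * real r) ^ CARD('d)) \<le> 1 / (4 * real (card (cube r :: (int ^ 'd) set)))"
    using assms(1) unfolding card_cube of_nat_power
    by (intro divide_left_mono mult_left_mono power_mono mult_pos_pos zero_less_power) auto
  ultimately show ?thesis by linarith
qed

lemma b_pos: "b N > 0"
proof -
  obtain r where r: "r \<ge> 1" "2 * cd * real N \<le> Psi \<alpha> r" using Psi_large by blast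
  have "0 < 1 / (4 * (3 * real r) ^ CARD('d))" using r by simp
  also have "\<dots> \<le> b N" by (rule b_ge_of_Psi[OF r])
  finally show ?thesis .
qed

lemma b_le_1: "b N \<le> 1"
  by (simp add: b_def pmf_le_1)

text \<open>Up to a constant, the radius of a cube whose volume is the inverse return probability.
  It is rounded up to \<open>rho\<close> so that the scale functions apply.\<close>

definition R :: "nat \<Rightarrow> real" where "R N = b N powr (- 1 / real CARD('d))"

definition rho :: "nat \<Rightarrow> nat" where "rho N = nat \<lceil>R N\<rceil>"

lemma R_ge_1: "R N \<ge> 1"
  using powr_mono2'[of "- 1 / CARD('d)" "b N" 1] b_pos[of N] b_le_1[of N] by (simp add: R_def)

lemma rho_bounds: "R N \<le> real (rho N)" "real (rho N) \<le> 2 * R N" "1 \<le> rho N"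
  using R_ge_1[of N] unfolding rho_def by linarith+

lemma R_pow: "R N ^ CARD('d) = 1 / b N"
  using b_pos[of N] by (simp add: R_def powr_realpow[symmetric] powr_powr powr_minus field_simps)

lemma rho_pow: "1 / b N \<le> real (rho N) ^ CARD('d)" "real (rho N) ^ CARD('d) \<le> 2 ^ CARD('d) / b N"
proof -
  show "1 / b N \<le> real (rho N) ^ CARD('d)"
    using power_mono[OF rho_bounds(1)[of N], of "CARD('d)"] R_ge_1[of N] R_pow[of N] by simp
  show "real (rho N) ^ CARD('d) \<le> 2 ^ CARD('d) / b N"
    using power_mono[OF rho_bounds(2)[of N], of "CARD('d)"] R_pow[of N] by (simp add: power_mult_distrib)
qed

lemma rho_mono: "m \<le> n \<Longrightarrow> rho m \<le> rho n"
  unfolding rho_def R_def using b_antimono[of m n] b_pos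
  by (intro nat_mono ceiling_mono powr_mono2') auto

text \<open>\<open>b_le_max_D\<close> on the cube of radius \<open>rho N\<close>: its volume is at
  least 2 / \<open>b N\<close>, so the volume term is absorbed by half of
  \<open>b N\<close>.\<close>

lemma b_decrement: "b N \<le> cE * Psi \<alpha> (rho N) * (b N - b (Suc N))"
proof -
  let ?P = "Psi \<alpha> (rho N)"
  have "b N \<le> cE * ?P * (b N - b (Suc N)) / 2 + 1 / real (card (cube (rho N) :: (int ^ 'd) set))"
    by (rule b_le_max_D[OF finite_cube]) (auto simp: cube_def intro: exI[of _ 0] energy rho_bounds)
  moreover have "2 / b N \<le> real (card (cube (rho N) :: (int ^ 'd) set))"
  proof -
    have "2 / b N \<le> 2 * real (rho N) ^ CARD('d)" using rho_pow(1)[of N] by simp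
    also have "\<dots> \<le> 2 ^ CARD('d) * real (rho N) ^ CARD('d)"
      using dim self_le_power[of "2::real" "CARD('d)"] by (intro mult_right_mono) auto
    also have "\<dots> = (2 * real (rho N)) ^ CARD('d)" by (simp add: power_mult_distrib)
    also have "\<dots> \<le> real (2 * rho N + 1) ^ CARD('d)" by (intro power_mono) auto
    finally show ?thesis by (simp add: card_cube)
  qed
  ultimately have "b N \<le> cE * ?P * (b N - b (Suc N)) / 2 + b N / 2"
    using b_pos[of N] le_imp_inverse_le[of "2 / b N" "real (card (cube (rho N) :: (int ^ 'd) set))"]
    by (simp add: field_simps)
  then show ?thesis by simp
qed

definition cl1 :: real where "cl1 = \<kappa> / (8 * real CARD('d) * cE)"

lemma cl1_pos: "cl1 > 0"
  using kappa cE_pos by (simp add: cl1_def)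

text \<open>Nash's argument: with \<open>R = b powr (- 1 / d)\<close> the increments of \<open>R powr \<kappa>\<close> up to time \<open>N\<close> are
  bounded below in terms of \<open>rho N\<close> alone.\<close>

lemma Psi_rho_lower: "cl1 * real N \<le> Psi \<alpha> (rho N)"
proof -
  let ?P = "Psi \<alpha> (rho N)"
  have P: "?P > 0" by (rule Psi_pos[OF rho_bounds(3)])
  have inc: "cl1 * real (rho N) powr \<kappa> / ?P \<le> R (Suc n) powr \<kappa> - R n powr \<kappa>" if "n < N" for n
  proof -
    \<comment> \<open>The relative decrement \<open>?u\<close> of \<open>b\<close> is at least 1 /
      (\<open>cE\<close> \<open>Psi\<close> (\<open>rho n\<close>)), and Bernoulli's inequality
      turns it into a relative increment of \<open>R powr \<kappa>\<close>. Comparing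
      \<open>Psi\<close> at \<open>rho n\<close> and \<open>rho N\<close> brings in
      \<open>R n powr \<kappa>\<close> in the denominator; it cancels, which removes the dependence
      on n. The 8 in \<open>cl1\<close> is 4 from this comparison times 2 from the rounding of
      \<open>rho\<close>.\<close>
    let ?p = "\<kappa> / real CARD('d)" and ?u = "(b n - b (Suc n)) / b n"
    have Pn: "Psi \<alpha> (rho n) > 0" by (rule Psi_pos[OF rho_bounds(3)])
    have u: "0 \<le> ?u" "?u < 1" using b_pos[of n] b_pos[of "Suc n"] b_antimono_Suc[of n] by (auto simp: field_simps)
    have RS: "R m powr \<kappa> = b m powr - ?p" for m by (simp add: R_def powr_powr)
    have "1 / (cE * Psi \<alpha> (rho n)) \<le> ?u"
      using b_decrement[of n] b_pos[of n] cE_pos Pn by (simp add: field_simps)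
    moreover have "Psi \<alpha> (rho n) \<le> 4 * (real (rho n) / real (rho N)) powr \<kappa> * ?P"
      using Psi_lower_scaling[OF alpha rho_bounds(3) rho_mono[of n N]] that by (simp add: \<kappa>_def)
    moreover have "(real (rho n) / real (rho N)) powr \<kappa> \<le> 2 * R n powr \<kappa> / real (rho N) powr \<kappa>"
    proof -
      have "real (rho n) powr \<kappa> \<le> (2 * R n) powr \<kappa>"
        using rho_bounds[of n] kappa by (intro powr_mono2) auto
      also have "\<dots> = 2 powr \<kappa> * R n powr \<kappa>" using R_ge_1[of n] by (simp add: powr_mult)
      also have "\<dots> \<le> 2 powr 1 * R n powr \<kappa>" by (intro mult_right_mono powr_mono) (use kappa in auto)
      finally show ?thesis by (simp add: powr_divide divide_right_mono)
    qed
    ultimately have "1 / (cE * (4 * (2 * R n powr \<kappa> / real (rho N) powr \<kappa>) * ?P)) \<le> ?u"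
    proof -
      assume a: "1 / (cE * Psi \<alpha> (rho n)) \<le> ?u" "Psi \<alpha> (rho n) \<le> 4 * (real (rho n) / real (rho N)) powr \<kappa> * ?P"
        "(real (rho n) / real (rho N)) powr \<kappa> \<le> 2 * R n powr \<kappa> / real (rho N) powr \<kappa>"
      have "Psi \<alpha> (rho n) \<le> 4 * (2 * R n powr \<kappa> / real (rho N) powr \<kappa>) * ?P"
        by (rule order_trans[OF a(2)], intro mult_right_mono mult_left_mono a(3)) (use P in auto)
      then have "1 / (cE * (4 * (2 * R n powr \<kappa> / real (rho N) powr \<kappa>) * ?P)) \<le> 1 / (cE * Psi \<alpha> (rho n))"
        using cE_pos Pn P rho_bounds(3)[of N] R_ge_1[of n]
        by (intro divide_left_mono mult_left_mono mult_pos_pos) auto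
      then show ?thesis using a(1) by linarith
    qed
    then have "?p * (1 / (cE * (4 * (2 * R n powr \<kappa> / real (rho N) powr \<kappa>) * ?P))) \<le> ?p * ?u"
      by (rule mult_left_mono) (use kappa in simp)
    then have "R n powr \<kappa> * (?p * (1 / (cE * (4 * (2 * R n powr \<kappa> / real (rho N) powr \<kappa>) * ?P)))) \<le> R n powr \<kappa> * (?p * ?u)"
      by (rule mult_left_mono) simp
    moreover have "R n powr \<kappa> * (?p * (1 / (cE * (4 * (2 * R n powr \<kappa> / real (rho N) powr \<kappa>) * ?P)))) = cl1 * real (rho N) powr \<kappa> / ?P"
      using R_ge_1[of n] by (simp add: cl1_def field_simps)
    moreover have "R n powr \<kappa> * (1 + ?p * ?u) \<le> R (Suc n) powr \<kappa>"
    proof -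
      have "R n powr \<kappa> * (1 + ?p * ?u) \<le> R n powr \<kappa> * (1 - ?u) powr - ?p"
        by (intro mult_left_mono powr_neg_Bernoulli u) (use kappa in auto)
      also have "\<dots> = (b n * (1 - ?u)) powr - ?p" unfolding RS using u b_pos[of n] by (simp add: powr_mult)
      also have "b n * (1 - ?u) = b (Suc n)" using b_pos[of n] by (simp add: field_simps)
      finally show ?thesis unfolding RS .
    qed
    ultimately show ?thesis by (simp add: algebra_simps)
  qed
  have "real N * (cl1 * real (rho N) powr \<kappa> / ?P) = (\<Sum>n<N. cl1 * real (rho N) powr \<kappa> / ?P)" by simp
  also have "\<dots> \<le> (\<Sum>n<N. R (Suc n) powr \<kappa> - R n powr \<kappa>)" by (rule sum_mono) (use inc in auto)
  also have "\<dots> = R N powr \<kappa> - R 0 powr \<kappa>" by (rule sum_lessThan_telescope)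
  also have "\<dots> \<le> real (rho N) powr \<kappa>"
    using powr_mono2[of \<kappa> "R N" "rho N"] rho_bounds(1)[of N] R_ge_1[of N] kappa by (simp add: algebra_simps add_increasing)
  finally have "real (rho N) powr \<kappa> * (cl1 * real N) \<le> real (rho N) powr \<kappa> * ?P"
    using P by (simp add: field_simps)
  then show ?thesis using rho_bounds(3)[of N] by (simp add: mult_le_cancel_left_pos)
qed

text \<open>Here 2304 = 4 * 24^2, where 24 r bounds \<open>rho N\<close> for the least r with
  \<open>2 * cd * real N \<le> Psi \<alpha> r\<close>; minimality of r gives the other
  factor.\<close>

definition cl2 :: real where "cl2 = 2304 * (8 * cd + 1)"

lemma cl2_pos: "cl2 > 0"
  using cd_pos by (simp add: cl2_def)

lemma Psi_le_Psi: "1 \<le> r \<Longrightarrow> r \<le> s \<Longrightarrow> Psi \<alpha> r \<le> 4 * Psi \<alpha> s"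
proof -
  assume rs: "1 \<le> r" "r \<le> s"
  have "Psi \<alpha> r \<le> 4 * (real r / real s) powr \<kappa> * Psi \<alpha> s"
    using Psi_lower_scaling[OF alpha rs] by (simp add: \<kappa>_def)
  also have "\<dots> \<le> 4 * 1 * Psi \<alpha> s"
    using rs kappa Psi_pos[of s \<alpha>] by (intro mult_right_mono mult_left_mono powr_le1) auto
  finally show "Psi \<alpha> r \<le> 4 * Psi \<alpha> s" by simp
qed

text \<open>At the least radius r whose exit time scale exceeds 2 \<open>cd\<close> N the walk still
  has half of its mass within r. This bounds \<open>b N\<close> below and hence \<open>rho N\<close>
  by 24 r. Minimality bounds \<open>Psi \<alpha> r\<close> by a multiple of N, since passing from r
  - 1 to r multiplies \<open>Psi\<close> by at most 4; the case r = 1 is where N at least 1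
  enters.\<close>

lemma Psi_rho_upper:
  assumes "N \<ge> 1"
  shows "Psi \<alpha> (rho N) \<le> cl2 * real N"
proof -
  define r where "r = (LEAST r. r \<ge> 1 \<and> 2 * cd * real N \<le> Psi \<alpha> r)"
  have r: "r \<ge> 1" "2 * cd * real N \<le> Psi \<alpha> r"
    using LeastI_ex[OF Psi_large[unfolded Bex_def]] Psi_large[of "2 * cd * real N"]
    unfolding r_def by (metis (mono_tags, lifting) LeastI)+
  have Pr: "Psi \<alpha> r \<le> (8 * cd + 1) * real N"
  proof (cases "r = 1")
    case True
    then have "Psi \<alpha> r = 1" by (simp add: Psi_def sg_1)
    then show ?thesis using assms mult_pos_pos[OF cd_pos, of "real N"] by (simp add: algebra_simps)
  next
    case False
    then have r1: "r - 1 \<ge> 1" using r by simp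
    have "\<not> (r - 1 \<ge> 1 \<and> 2 * cd * real N \<le> Psi \<alpha> (r - 1))"
      using not_less_Least[of "r - 1" "\<lambda>r. r \<ge> 1 \<and> 2 * cd * real N \<le> Psi \<alpha> r"] r1 unfolding r_def by linarith
    then have lt: "Psi \<alpha> (r - 1) < 2 * cd * real N" using r1 by simp
    have "real r / real (r - 1) \<le> 2" using r1 by (simp add: field_simps of_nat_diff)
    then have sq: "(real r / real (r - 1))\<^sup>2 \<le> 2\<^sup>2" by (intro power_mono) auto
    have "Psi \<alpha> r \<le> (real r / real (r - 1))\<^sup>2 * Psi \<alpha> (r - 1)" by (rule Psi_upper_scaling) (use r1 in auto)
    also have "\<dots> \<le> 4 * Psi \<alpha> (r - 1)" using sq Psi_pos[OF r1, of \<alpha>] by (intro mult_right_mono) auto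
    also have "\<dots> \<le> 8 * cd * real N" using lt by linarith
    finally show ?thesis by (simp add: algebra_simps)
  qed
  have "rho N \<le> 24 * r"
  proof -
    have "1 / (4 * (3 * real r) ^ CARD('d)) \<le> b N" by (rule b_ge_of_Psi[OF r])
    then have "1 / b N \<le> 4 * (3 * real r) ^ CARD('d)"
      using b_pos[of N] r by (simp add: field_simps)
    also have "\<dots> \<le> 4 ^ CARD('d) * (3 * real r) ^ CARD('d)"
      using dim self_le_power[of "4::real" "CARD('d)"] by (intro mult_right_mono) auto
    also have "\<dots> = (4 * (3 * real r)) ^ CARD('d)" by (rule power_mult_distrib[symmetric])
    also have "\<dots> = (12 * real r) ^ CARD('d)" by simp
    finally have "R N ^ CARD('d) \<le> (12 * real r) ^ CARD('d)" unfolding R_pow .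
    then have "R N \<le> 12 * real r" using power_less_imp_less_base[of "12 * real r" "CARD('d)" "R N"] R_ge_1[of N] power_strict_mono[of "12 * real r" "R N" "CARD('d)"] by (fastforce simp: not_le[symmetric])
    then have "real (rho N) \<le> real (24 * r)" using rho_bounds(2)[of N] by simp
    then show ?thesis by (simp only: of_nat_le_iff)
  qed
  then have "Psi \<alpha> (rho N) \<le> 4 * Psi \<alpha> (24 * r)" by (rule Psi_le_Psi[OF rho_bounds(3)])
  also have "\<dots> \<le> 4 * ((real (24 * r) / real r)\<^sup>2 * Psi \<alpha> r)"
    by (intro mult_left_mono Psi_upper_scaling) (use r in auto)
  also have "\<dots> = 2304 * Psi \<alpha> r" using r by simp
  also have "\<dots> \<le> 2304 * ((8 * cd + 1) * real N)" using Pr by simp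
  also have "\<dots> = cl2 * real N" by (simp add: cl2_def)
  finally show ?thesis .
qed

text \<open>With N of order \<open>Psi\<close> (\<open>rho N\<close>) and \<open>b N\<close> of
  order \<open>rho N\<close> to the power -d, the product N \<open>b N\<close> is of order 1 /
  (\<open>sg\<close> (\<open>rho N\<close>) \<open>rho N\<close>^(d - 2)). This decreases because d
  is at least 2.\<close>

lemma n_b_almost_decreasing:
  assumes "1 \<le> m" "m \<le> n"
  shows "real n * b n \<le> 2 ^ CARD('d) * cl2 / cl1 * (real m * b m)"
proof -
  let ?rn = "real (rho n)" and ?rm = "real (rho m)"
  have pos: "?rm \<ge> 1" "?rn \<ge> 1" "?rm \<le> ?rn" using rho_bounds(3) rho_mono[OF assms(2)] by auto
  have sgp: "sg \<alpha> (rho m) \<ge> 1" "sg \<alpha> (rho m) \<le> sg \<alpha> (rho n)"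
    using sg_ge_1[OF rho_bounds(3)] sg_mono[OF rho_mono[OF assms(2)]] by auto
  have dd: "x ^ CARD('d) = x\<^sup>2 * x ^ (CARD('d) - 2)" for x :: real using dim
    by (metis le_add_diff_inverse power_add)
  have "cl1 * (real n * b n) \<le> Psi \<alpha> (rho n) * b n"
    using Psi_rho_lower[of n] b_pos[of n] by (simp add: mult.assoc[symmetric] mult_right_mono)
  also have "\<dots> \<le> Psi \<alpha> (rho n) * (2 ^ CARD('d) / ?rn ^ CARD('d))"
    using rho_pow(2)[of n] b_pos[of n] pos Psi_pos[OF rho_bounds(3), of \<alpha> n] by (intro mult_left_mono) (auto simp: field_simps)
  also have "\<dots> = 2 ^ CARD('d) / (sg \<alpha> (rho n) * ?rn ^ (CARD('d) - 2))"
    using pos unfolding Psi_def dd[of ?rn] by (simp add: field_simps)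
  also have "\<dots> \<le> 2 ^ CARD('d) / (sg \<alpha> (rho m) * ?rm ^ (CARD('d) - 2))"
    using pos sgp by (intro divide_left_mono mult_mono power_mono mult_pos_pos zero_less_power) auto
  also have "\<dots> = 2 ^ CARD('d) * (Psi \<alpha> (rho m) * (1 / ?rm ^ CARD('d)))"
    using pos unfolding Psi_def dd[of ?rm] by (simp add: field_simps)
  also have "\<dots> \<le> 2 ^ CARD('d) * (cl2 * real m * b m)"
    using Psi_rho_upper[OF assms(1)] rho_pow(1)[of m] b_pos[of m] pos cl2_pos
    by (intro mult_left_mono mult_mono) (auto simp: field_simps)
  finally show ?thesis using cl1_pos by (simp add: field_simps)
qed

definition cp :: real where "cp = 2 ^ CARD('d) * (4 * cl2 / cl1) powr (real CARD('d) / \<kappa>)"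

lemma cp_pos: "cp > 0"
  using cl1_pos cl2_pos by (simp add: cp_def)

text \<open>The two-sided comparison of \<open>Psi\<close> (\<open>rho N\<close>) with N and the
  power growth of \<open>Psi\<close> bound the ratio of radii by a power of the ratio of
  times.\<close>

lemma b_poly_scaling:
  assumes "1 \<le> m" "m \<le> n"
  shows "b m \<le> cp * (real n / real m) powr (real CARD('d) / \<kappa>) * b n"
proof -
  let ?rn = "real (rho n)" and ?rm = "real (rho m)"
  have pos: "?rm \<ge> 1" "?rn \<ge> 1" using rho_bounds(3) by auto
  have "cl1 * real m \<le> 4 * (?rm / ?rn) powr \<kappa> * Psi \<alpha> (rho n)"
    using Psi_rho_lower[of m] Psi_lower_scaling[OF alpha rho_bounds(3) rho_mono[OF assms(2)]]
    by (simp add: \<kappa>_def)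
  also have "\<dots> \<le> 4 * (?rm / ?rn) powr \<kappa> * (cl2 * real n)"
    by (intro mult_left_mono Psi_rho_upper) (use assms in auto)
  finally have "(?rn / ?rm) powr \<kappa> \<le> 4 * cl2 / cl1 * (real n / real m)"
    using pos cl1_pos assms by (simp add: powr_divide field_simps)
  then have "((?rn / ?rm) powr \<kappa>) powr (real CARD('d) / \<kappa>) \<le> (4 * cl2 / cl1 * (real n / real m)) powr (real CARD('d) / \<kappa>)"
    by (intro powr_mono2) (use kappa in auto)
  then have "(?rn / ?rm) ^ CARD('d) \<le> (4 * cl2 / cl1) powr (real CARD('d) / \<kappa>) * (real n / real m) powr (real CARD('d) / \<kappa>)"
  proof -
    have "((?rn / ?rm) powr \<kappa>) powr (real CARD('d) / \<kappa>) = (?rn / ?rm) ^ CARD('d)"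
      using pos kappa by (simp add: powr_powr powr_realpow)
    moreover have "(4 * cl2 / cl1 * (real n / real m)) powr (real CARD('d) / \<kappa>) =
        (4 * cl2 / cl1) powr (real CARD('d) / \<kappa>) * (real n / real m) powr (real CARD('d) / \<kappa>)"
      by (rule powr_mult)
    ultimately show ?thesis using \<open>((?rn / ?rm) powr \<kappa>) powr _ \<le> _\<close> by simp
  qed
  then have *: "?rn ^ CARD('d) \<le> (4 * cl2 / cl1) powr (real CARD('d) / \<kappa>) * (real n / real m) powr (real CARD('d) / \<kappa>) * ?rm ^ CARD('d)"
    using pos by (simp add: power_divide field_simps)
  have "1 / b n \<le> (4 * cl2 / cl1) powr (real CARD('d) / \<kappa>) * (real n / real m) powr (real CARD('d) / \<kappa>) * (2 ^ CARD('d) / b m)"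
    by (rule order_trans[OF rho_pow(1)], rule order_trans[OF *], intro mult_left_mono rho_pow) simp
  then show ?thesis using b_pos[of m] b_pos[of n] by (simp add: cp_def field_simps)
qed

text \<open>The summand 1 / \<open>b 1\<close> serves N = 1, where \<open>N div 2\<close> is 0;
  otherwise N is at most 3 (\<open>N div 2\<close>).\<close>

lemma b_half_le: "N \<ge> 1 \<Longrightarrow> b (N div 2) \<le> (cp * 3 powr (real CARD('d) / \<kappa>) + 1 / b 1) * b N"
proof (cases "N = 1")
  case False
  assume "N \<ge> 1"
  with False have N: "N \<ge> 2" by simp
  have "real N / real (N div 2) \<le> 3"
  proof -
    have "N \<le> 3 * (N div 2)" using N by presburger
    then have "real N \<le> 3 * real (N div 2)" by linarith
    then show ?thesis using N by (simp add: field_simps)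
  qed
  then have "(real N / real (N div 2)) powr (real CARD('d) / \<kappa>) \<le> 3 powr (real CARD('d) / \<kappa>)"
    by (intro powr_mono2) (use kappa in auto)
  have "b (N div 2) \<le> cp * (real N / real (N div 2)) powr (real CARD('d) / \<kappa>) * b N"
    by (rule b_poly_scaling) (use N in auto)
  also have "\<dots> \<le> cp * 3 powr (real CARD('d) / \<kappa>) * b N"
    using \<open>_ \<le> 3 powr (real CARD('d) / \<kappa>)\<close> cp_pos b_pos[of N] by (intro mult_right_mono mult_left_mono) auto
  also have "\<dots> \<le> (cp * 3 powr (real CARD('d) / \<kappa>) + 1 / b 1) * b N"
    using b_pos[of N] b_pos[of 1] by (intro mult_right_mono) auto
  finally show ?thesis .
next
  case True
  have "b 0 \<le> 1 + cp * 3 powr (real CARD('d) / \<kappa>) * b 1"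
    using b_le_1[of 0] cp_pos b_pos[of 1] by (simp add: add_increasing2)
  also have "\<dots> = (cp * 3 powr (real CARD('d) / \<kappa>) + 1 / b 1) * b 1"
    using b_pos[of 1] by (simp add: algebra_simps)
  finally show ?thesis using True by simp
qed

text \<open>Convexity bounds the decrement of \<open>b\<close> at N by a multiple of
  \<open>b N\<close> / N, and \<open>Psi\<close> at \<open>nrm x\<close> is at most a multiple of
  \<open>c powr \<kappa>\<close> times N. So \<open>energy\<close> gives
  \<open>D N x \<le> b N\<close> for small c. In the constant \<open>B\<close> the factor 8 is 4
  from the scaling of \<open>Psi\<close> times 2 from halving the time range.\<close>

lemma near_diagonal:
  "\<exists>c>0. \<forall>N\<ge>1. \<forall>x. real (nrm x) \<le> c * real (rho N) \<longrightarrow> b N / 2 \<le> pmf (S (2 * N)) x"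
proof -
  define c'' where "c'' = cp * 3 powr (real CARD('d) / \<kappa>) + 1 / b 1"
  have c''_pos: "c'' > 0" using cp_pos b_pos[of 1] by (simp add: c''_def add_pos_pos)
  define B where "B = 8 * cE * cl2 * c''"
  have B: "B > 0" using cE_pos cl2_pos c''_pos by (simp add: B_def)
  define c where "c = min 1 ((1 / B) powr (1 / \<kappa>))"
  have c: "0 < c" "c \<le> 1" using B by (auto simp: c_def)
  have cB: "c powr \<kappa> * B \<le> 1"
  proof -
    have "c powr \<kappa> \<le> ((1 / B) powr (1 / \<kappa>)) powr \<kappa>" using c kappa by (intro powr_mono2) (auto simp: c_def)
    also have "\<dots> = 1 / B" using kappa B by (simp add: powr_powr)
    finally show ?thesis using B by (simp add: field_simps)
  qed
  have "b N / 2 \<le> pmf (S (2 * N)) x" if N: "N \<ge> 1" and x: "real (nrm x) \<le> c * real (rho N)" for N x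
  proof (cases "x = 0")
    case True
    then show ?thesis using b_pos[of N] by (simp add: b_def)
  next
    case False
    then have r: "nrm x \<ge> 1" using nrm_eq_0_iff[of x] by linarith
    have "c * real (rho N) \<le> 1 * real (rho N)" by (rule mult_right_mono) (use c in auto)
    then have r2: "nrm x \<le> rho N" using x by linarith
    have "Psi \<alpha> (nrm x) \<le> 4 * (real (nrm x) / real (rho N)) powr \<kappa> * Psi \<alpha> (rho N)"
      using Psi_lower_scaling[OF alpha r r2] by (simp add: \<kappa>_def)
    also have "\<dots> \<le> 4 * c powr \<kappa> * (cl2 * real N)"
      using x r rho_bounds(3)[of N] kappa Psi_pos[OF rho_bounds(3), of \<alpha> N]
      by (intro mult_mono mult_left_mono powr_mono2 Psi_rho_upper[OF N]) (auto simp: field_simps)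
    finally have P: "Psi \<alpha> (nrm x) \<le> 4 * c powr \<kappa> * (cl2 * real N)" .
    have "real N * (b N - b (Suc N)) \<le> 2 * (real (N - N div 2) * (b N - b (Suc N)))"
    proof -
      have "N \<le> 2 * (N - N div 2)" by simp
      then have "real N \<le> 2 * real (N - N div 2)" by linarith
      then have "real N * (b N - b (Suc N)) \<le> 2 * real (N - N div 2) * (b N - b (Suc N))"
        by (rule mult_right_mono) (use b_antimono_Suc[of N] in simp)
      then show ?thesis by (simp only: mult.assoc)
    qed
    also have "\<dots> \<le> 2 * b (N div 2)" using b_convex[of "N div 2" N] by simp
    also have "\<dots> \<le> 2 * (c'' * b N)" using b_half_le[OF N] by (simp add: c''_def)
    finally have E: "real N * (b N - b (Suc N)) \<le> 2 * (c'' * b N)" .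
    have "D N x \<le> cE * Psi \<alpha> (nrm x) * (b N - b (Suc N))" by (rule energy[OF r]) simp
    also have "\<dots> \<le> cE * (4 * c powr \<kappa> * (cl2 * real N)) * (b N - b (Suc N))"
      using P cE_pos b_antimono_Suc[of N] by (intro mult_right_mono mult_left_mono) auto
    also have "\<dots> = cE * 4 * c powr \<kappa> * cl2 * (real N * (b N - b (Suc N)))" by simp
    also have "\<dots> \<le> cE * 4 * c powr \<kappa> * cl2 * (2 * (c'' * b N))"
      by (rule mult_left_mono[OF E]) (use cE_pos cl2_pos in simp)
    also have "\<dots> = (c powr \<kappa> * B) * b N" by (simp add: B_def)
    also have "\<dots> \<le> 1 * b N" by (rule mult_right_mono[OF cB]) (use b_pos[of N] in simp)
    finally show ?thesis unfolding D_def by simp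
  qed
  then show ?thesis using c by blast
qed

lemma natural_displacement:
  assumes "\<delta> > 0"
  shows "\<exists>K\<ge>1. \<forall>N\<ge>1. \<forall>n\<le>N. measure (S n) {x. nrm x > K * rho N} \<le> \<delta>"
proof -
  define K where "K = nat \<lceil>max 1 ((4 * cd / (cl1 * \<delta>)) powr (1 / \<kappa>))\<rceil>"
  have K: "K \<ge> 1" "(4 * cd / (cl1 * \<delta>)) powr (1 / \<kappa>) \<le> real K" unfolding K_def by linarith+
  have Kk: "4 * cd / (cl1 * \<delta>) \<le> real K powr \<kappa>"
  proof -
    have "4 * cd / (cl1 * \<delta>) = ((4 * cd / (cl1 * \<delta>)) powr (1 / \<kappa>)) powr \<kappa>"
      using kappa cd_pos cl1_pos assms by (simp add: powr_powr)
    also have "\<dots> \<le> real K powr \<kappa>" by (rule powr_mono2) (use K kappa in auto)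
    finally show ?thesis .
  qed
  have "measure (S n) {x. nrm x > K * rho N} \<le> \<delta>" if N: "N \<ge> 1" and n: "n \<le> N" for N n
  proof -
    let ?P = "Psi \<alpha> (K * rho N)"
    have Kr: "1 \<le> K * rho N" "rho N \<le> K * rho N" using K rho_bounds(3)[of N] by auto
    have P: "?P > 0" by (rule Psi_pos[OF Kr(1)])
    have "cl1 * real N \<le> 4 * (real (rho N) / real (K * rho N)) powr \<kappa> * ?P"
      using Psi_rho_lower[of N] Psi_lower_scaling[OF alpha rho_bounds(3)[of N] Kr(2)] by (simp add: \<kappa>_def)
    also have "(real (rho N) / real (K * rho N)) powr \<kappa> = 1 / real K powr \<kappa>"
      using rho_bounds(3)[of N] K by (simp add: powr_divide)
    finally have "real K powr \<kappa> * (cl1 * real N) \<le> 4 * ?P" using K by (simp add: field_simps)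
    moreover have "4 * cd / (cl1 * \<delta>) * (cl1 * real N) \<le> real K powr \<kappa> * (cl1 * real N)"
      by (rule mult_right_mono[OF Kk]) (use cl1_pos in simp)
    ultimately have "4 * cd / (cl1 * \<delta>) * (cl1 * real N) \<le> 4 * ?P" by linarith
    then have "cd * (real N / ?P) \<le> \<delta>" using cl1_pos assms P by (simp add: field_simps)
    moreover have "cd * (real n / ?P) \<le> cd * (real N / ?P)"
      using n P cd_pos by (intro mult_left_mono divide_right_mono) auto
    ultimately show ?thesis using displacement[OF Kr(1), of n] by linarith
  qed
  then show ?thesis using K(1) by blast
qed

text \<open>A cruder bound at arbitrary radii; it controls paths that wrap around the torus or leave
  a large cube about the origin.\<close>

lemma poly_displacement:
  assumes "r \<ge> 1"
  shows "measure (S n) {x. nrm x > r} \<le> 4 * cd * real n * real r powr - \<kappa>"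
proof -
  have P: "Psi \<alpha> r > 0" by (rule Psi_pos[OF assms])
  have "real r powr \<kappa> \<le> 4 * Psi \<alpha> r" using Psi_ge[OF alpha assms] by (simp add: \<kappa>_def)
  then have "real n / Psi \<alpha> r \<le> 4 * real n * real r powr - \<kappa>"
    using P assms mult_left_mono[of "real r powr \<kappa>" "4 * Psi \<alpha> r" "real n"] by (simp add: powr_minus field_simps)
  then have "cd * (real n / Psi \<alpha> r) \<le> cd * (4 * real n * real r powr - \<kappa>)"
    by (rule mult_left_mono) (use cd_pos in simp)
  then show ?thesis using displacement[OF assms, of n] by simp
qed

end

text \<open>What the rest of the proof uses about the kernel: \<open>b N\<close> is the return probability at time
  \<open>2 * N\<close> and \<open>rho N\<close>, of order \<open>b N powr (- 1 / real CARD('d))\<close>, is the radius explored by that time.\<close>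

locale walk_estimates = sym_walk q for q :: "(int ^ 'd) pmf" +
  fixes A p c \<kappa> :: real and rho :: "nat \<Rightarrow> nat" and K :: "real \<Rightarrow> nat"
  assumes A: "A \<ge> 1" and p: "p \<ge> 1" and c: "0 < c" "c \<le> 1" and kap: "0 < \<kappa>"
    and b_pos: "b N > 0"
    and rho_pow: "1 / b N \<le> real (rho N) ^ CARD('d)" "real (rho N) ^ CARD('d) \<le> A / b N"
    and rho_mono: "m \<le> n \<Longrightarrow> rho m \<le> rho n"
    and nb_decr: "1 \<le> m \<Longrightarrow> m \<le> n \<Longrightarrow> real n * b n \<le> A * (real m * b m)"
    and b_scaling: "1 \<le> m \<Longrightarrow> m \<le> n \<Longrightarrow> b m \<le> A * (real n / real m) powr p * b n"
    and near_diag: "N \<ge> 1 \<Longrightarrow> real (nrm x) \<le> c * real (rho N) \<Longrightarrow> b N / 2 \<le> pmf (S (2 * N)) x"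
    and nat_disp: "\<delta> > 0 \<Longrightarrow> N \<ge> 1 \<Longrightarrow> n \<le> N \<Longrightarrow> measure (S n) {x. nrm x > K \<delta> * rho N} \<le> \<delta>"
    and poly_disp: "r \<ge> 1 \<Longrightarrow> measure (S n) {x. nrm x > r} \<le> A * real n * real r powr - \<kappa>"

lemma (in heavy_walk) walk_estimates: "\<exists>A p c K. walk_estimates q A p c \<kappa> rho K"
proof -
  obtain c where c: "c > 0"
    "\<And>N x. N \<ge> 1 \<Longrightarrow> real (nrm x) \<le> c * real (rho N) \<Longrightarrow> b N / 2 \<le> pmf (S (2 * N)) x"
    using near_diagonal by blast
  have "\<forall>\<delta>. \<exists>K\<ge>1. \<delta> > 0 \<longrightarrow> (\<forall>N\<ge>1. \<forall>n\<le>N. measure (S n) {x. nrm x > K * rho N} \<le> \<delta>)"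
    using natural_displacement by (metis le_refl)
  then obtain K :: "real \<Rightarrow> nat" where K: "\<And>\<delta>. 1 \<le> K \<delta>"
    "\<And>\<delta> N n. \<delta> > 0 \<Longrightarrow> N \<ge> 1 \<Longrightarrow> n \<le> N \<Longrightarrow> measure (S n) {x. nrm x > K \<delta> * rho N} \<le> \<delta>"
    by metis
  define A where "A = 1 + 2 ^ CARD('d) + 2 ^ CARD('d) * cl2 / cl1 + cp + 4 * cd"
  have pos: "0 < 2 ^ CARD('d) * cl2 / cl1" "0 < cp" "0 < cd" using cl1_pos cl2_pos cp_pos cd_pos by auto
  have A: "1 \<le> A" "2 ^ CARD('d) \<le> A" "2 ^ CARD('d) * cl2 / cl1 \<le> A" "cp \<le> A" "4 * cd \<le> A"
    using pos by (auto simp: A_def add_increasing add_increasing2)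
  have "walk_estimates q A (real CARD('d) / \<kappa>) (min c 1) \<kappa> rho K"
  proof
    show "real CARD('d) / \<kappa> \<ge> 1" using kappa dim by (simp add: field_simps)
    show "real (rho N) ^ CARD('d) \<le> A / b N" for N
      using rho_pow(2)[of N] A b_pos[of N] by (elim order_trans) (intro divide_right_mono, auto)
    show "real n * b n \<le> A * (real m * b m)" if "1 \<le> m" "m \<le> n" for m n
      using n_b_almost_decreasing[OF that] A b_pos[of m]
      by (elim order_trans) (intro mult_right_mono, auto)
    show "b m \<le> A * (real n / real m) powr (real CARD('d) / \<kappa>) * b n" if "1 \<le> m" "m \<le> n" for m n
      using b_poly_scaling[OF that] A b_pos[of n]
      by (elim order_trans) (intro mult_right_mono, auto)
    show "b N / 2 \<le> pmf (S (2 * N)) x" if "N \<ge> 1" "real (nrm x) \<le> min c 1 * real (rho N)" for N x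
      using that by (intro c(2)) (auto elim!: order_trans intro!: mult_right_mono)
    show "measure (S n) {x. nrm x > r} \<le> A * real n * real r powr - \<kappa>" if "r \<ge> 1" for r n
      using poly_displacement[OF that, of n] A
      by (elim order_trans) (intro mult_right_mono, auto)
  qed (use A c K kappa b_pos rho_bounds rho_pow rho_mono in auto)
  then show ?thesis by blast
qed

section \<open>Walks on the torus\<close>

lemma nth_torus_proj: "torus_proj L x $ i = x $ i mod int L"
  by (simp add: torus_proj_def)

lemma torus_proj_in_torus: "L \<ge> 1 \<Longrightarrow> torus_proj L x \<in> torus L"
  by (simp add: torus_def nth_torus_proj)

lemma torus_proj_id: "x \<in> torus L \<Longrightarrow> torus_proj L x = x"
  by (auto simp: torus_def vec_eq_iff nth_torus_proj)

lemma torus_proj_eq_iff: "torus_proj L x = torus_proj L y \<longleftrightarrow> (\<forall>i. int L dvd x $ i - y $ i)"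
  by (simp add: vec_eq_iff nth_torus_proj mod_eq_dvd_iff)

lemma torus_proj_idem [simp]: "torus_proj L (torus_proj L x) = torus_proj L x"
  by (simp add: vec_eq_iff nth_torus_proj)

lemma torus_proj_add_cong:
  "torus_proj L x = torus_proj L x' \<Longrightarrow> torus_proj L y = torus_proj L y' \<Longrightarrow>
    torus_proj L (x + y) = torus_proj L (x' + y')"
  by (auto simp: vec_eq_iff nth_torus_proj intro: mod_add_cong)

lemma torus_proj_diff_cong:
  "torus_proj L x = torus_proj L x' \<Longrightarrow> torus_proj L y = torus_proj L y' \<Longrightarrow>
    torus_proj L (x - y) = torus_proj L (x' - y')"
  by (auto simp: vec_eq_iff nth_torus_proj intro: mod_diff_cong)

lemma torus_proj_minus_eq_iff: "torus_proj L (- x) = torus_proj L (- y) \<longleftrightarrow> torus_proj L x = torus_proj L y"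
  by (simp add: torus_proj_eq_iff dvd_minus_iff[symmetric, of _ "- x"] dvd_diff_commute)

lemma torus_alt: "torus L = {x :: int ^ 'd. \<forall>i. x $ i \<in> {0..<int L}}"
  by (auto simp: torus_def)

lemma finite_torus [simp]: "finite (torus L)"
  unfolding torus_alt by (rule card_vec_Pi) simp

lemma card_torus: "card (torus L :: (int ^ 'd) set) = L ^ CARD('d)"
  unfolding torus_alt by (subst card_vec_Pi) simp_all

lemma zero_in_torus: "L \<ge> 1 \<Longrightarrow> 0 \<in> torus L"
  by (simp add: torus_def)

lemma same_proj_far:
  assumes "torus_proj L x = torus_proj L y" "x \<noteq> y"
  shows "L \<le> nrm (x - y)"
proof -
  obtain i where i: "x $ i \<noteq> y $ i" using assms(2) by (auto simp: vec_eq_iff)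
  have "int L dvd x $ i - y $ i" using assms(1) by (simp add: torus_proj_eq_iff)
  then have "int L \<le> \<bar>x $ i - y $ i\<bar>" using i by (meson dvd_abs_iff eq_iff_diff_eq_0 zdvd_imp_le zero_less_abs_iff)
  also have "\<dots> \<le> int (nrm (x - y))" using abs_nth_le_nrm[of "x - y" i] by simp
  finally show ?thesis by simp
qed

section \<open>Transition probabilities of the projected walk\<close>

locale torus_walk = sym_walk q for q :: "(int ^ 'd) pmf" +
  fixes L :: nat
  assumes L: "L \<ge> 1"
begin

abbreviation T :: "(int ^ 'd) set" where "T \<equiv> torus L"

abbreviation pr :: "int ^ 'd \<Rightarrow> int ^ 'd" where "pr \<equiv> torus_proj L"

definition tk :: "nat \<Rightarrow> int ^ 'd \<Rightarrow> int ^ 'd \<Rightarrow> real" where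
  "tk n v u = measure (S n) {x. pr x = pr (u - v)}"

lemma tk_nonneg [simp]: "0 \<le> tk n v u"
  by (simp add: tk_def)

lemma tk_cong: "pr (u - v) = pr (u' - v') \<Longrightarrow> tk n v u = tk n v' u'"
  by (simp add: tk_def)

lemma tk_proj_left: "tk n (pr v) u = tk n v u"
  by (rule tk_cong, rule torus_proj_diff_cong) simp_all

lemma tk_proj_right: "tk n v (pr u) = tk n v u"
  by (rule tk_cong, rule torus_proj_diff_cong) simp_all

lemma tk_0: "v \<in> T \<Longrightarrow> u \<in> T \<Longrightarrow> tk 0 v u = (if v = u then 1 else 0)"
proof -
  assume vu: "v \<in> T" "u \<in> T"
  have "pr 0 = pr (u - v) \<longleftrightarrow> pr v = pr u"
    by (auto simp: torus_proj_eq_iff dvd_diff_commute)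
  then show ?thesis using vu by (auto simp: tk_def torus_proj_id)
qed

lemma tk_add: "tk (m + n) v u = (\<Sum>w\<in>T. tk m v w * tk n w u)"
proof -
  let ?A = "\<lambda>u v. {x. pr x = pr (u - v)}"
  have "tk (m + n) v u = measure_pmf.expectation (S (m + n)) (indicator (?A u v))" by (simp add: tk_def)
  also have "\<dots> = measure_pmf.expectation (S m) (\<lambda>y. measure_pmf.expectation (S n) (\<lambda>z. indicator (?A u v) (y + z)))"
    by (rule expectation_conv_pow_add[of _ 1]) (simp add: indicator_def)
  also have "\<dots> = measure_pmf.expectation (S m) (\<lambda>y. \<Sum>w\<in>T. indicator (?A w v) y * tk n w u)"
  proof (rule Bochner_Integration.integral_cong[OF refl])
    fix y
    have "(\<lambda>z. indicator (?A u v) (y + z) :: real) = indicator (?A u (v + y))"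
    proof
      fix z
      have "pr (y + z) = pr (u - v) \<longleftrightarrow> pr z = pr (u - (v + y))"
        by (auto simp: torus_proj_eq_iff algebra_simps)
      then show "(indicator (?A u v) (y + z) :: real) = indicator (?A u (v + y)) z" by (simp add: indicator_def)
    qed
    then have "measure_pmf.expectation (S n) (\<lambda>z. indicator (?A u v) (y + z)) = tk n (v + y) u"
      by (simp add: tk_def)
    also have "\<dots> = (\<Sum>w\<in>T. if pr (v + y) = w then tk n w u else 0)"
      by (simp add: torus_proj_in_torus[OF L] tk_proj_left)
    also have "\<dots> = (\<Sum>w\<in>T. indicator (?A w v) y * tk n w u)"
    proof (rule sum.cong[OF refl])
      fix w assume w: "w \<in> T"
      have "pr (v + y) = w \<longleftrightarrow> pr (v + y) = pr w" using w by (simp add: torus_proj_id)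
      also have "\<dots> \<longleftrightarrow> pr y = pr (w - v)" by (auto simp: torus_proj_eq_iff algebra_simps)
      finally show "(if pr (v + y) = w then tk n w u else 0) = indicator (?A w v) y * tk n w u"
        by (simp add: indicator_def)
    qed
    finally show "measure_pmf.expectation (S n) (\<lambda>z. indicator (?A u v) (y + z)) = (\<Sum>w\<in>T. indicator (?A w v) y * tk n w u)" .
  qed
  also have "\<dots> = (\<Sum>w\<in>T. tk m v w * tk n w u)"
  proof (subst Bochner_Integration.integral_sum)
    show "integrable (measure_pmf (S m)) (\<lambda>y. indicator (?A w v) y * tk n w u)" for w
      by (rule integrable_pmf_bounded[of _ 1]) (auto simp: indicator_def tk_def)
    show "(\<Sum>w\<in>T. measure_pmf.expectation (S m) (\<lambda>y. indicator (?A w v) y * tk n w u)) = (\<Sum>w\<in>T. tk m v w * tk n w u)"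
      by (simp add: tk_def)
  qed
  finally show ?thesis .
qed

lemma tk_sym: "tk n v u = tk n u v"
proof -
  have "tk n u v = measure (map_pmf uminus (S n)) {x. pr x = pr (v - u)}" by (simp add: tk_def sym_S)
  also have "\<dots> = measure (S n) {x. pr (- x) = pr (v - u)}" by (simp add: vimage_def)
  also have "{x. pr (- x) = pr (v - u)} = {x. pr x = pr (u - v)}"
    using torus_proj_minus_eq_iff[of L _ "u - v"] by auto
  finally show ?thesis by (simp add: tk_def)
qed

lemma sum_tk: "(\<Sum>u\<in>T. tk n v u) = 1"
proof -
  have "(\<Sum>u\<in>T. tk n v u) = measure (S n) (\<Union>u\<in>T. {x. pr x = pr (u - v)})"
    unfolding tk_def
  proof (rule measure_pmf.finite_measure_finite_Union[symmetric])
    show "disjoint_family_on (\<lambda>u. {x. pr x = pr (u - v)}) T"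
    proof (unfold disjoint_family_on_def, intro ballI impI)
      fix u w assume uw: "u \<in> T" "w \<in> T" "u \<noteq> w"
      have "u = w" if "pr (u - v) = pr (w - v)"
        using torus_proj_add_cong[OF that refl[of "pr v"]] uw by (simp add: torus_proj_id)
      then show "{x. pr x = pr (u - v)} \<inter> {x. pr x = pr (w - v)} = {}" using uw by auto
    qed
  qed auto
  also have "(\<Union>u\<in>T. {x. pr x = pr (u - v)}) = UNIV"
  proof -
    have "\<exists>u\<in>T. pr x = pr (u - v)" for x
    proof
      show "pr x = pr (pr (x + v) - v)"
        using torus_proj_diff_cong[of L "pr (x + v)" "x + v" v v] by simp
    qed (rule torus_proj_in_torus[OF L])
    then show ?thesis by auto
  qed
  finally show ?thesis by simp
qed

lemma sum_tk_left: "(\<Sum>v\<in>T. tk n v u) = 1"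
  using sum_tk[of n u] by (simp add: tk_sym[of n _ u])

lemma pmf_le_tk: "pmf (S n) (u - v) \<le> tk n v u"
  unfolding tk_def measure_pmf_single[symmetric] by (rule measure_pmf.finite_measure_mono) auto

text \<open>Two lifts of one torus vertex are at distance at least L, so at most one of them has
  norm at most r.\<close>

lemma tk_le_b:
  assumes "2 * r < L"
  shows "tk n v u \<le> b (n div 2) + measure (S n) {x. nrm x > r}"
proof -
  let ?A = "{x. pr x = pr (u - v)}"
  have "tk n v u \<le> measure (S n) ((?A \<inter> {x. nrm x \<le> r}) \<union> {x. nrm x > r})"
    unfolding tk_def by (rule measure_pmf.finite_measure_mono) auto
  also have "\<dots> \<le> measure (S n) (?A \<inter> {x. nrm x \<le> r}) + measure (S n) {x. nrm x > r}"
    by (rule measure_Un_le) auto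
  also have "measure (S n) (?A \<inter> {x. nrm x \<le> r}) \<le> b (n div 2)"
  proof (cases "?A \<inter> {x. nrm x \<le> r} = {}")
    case True
    then show ?thesis by (simp add: b_def)
  next
    case False
    then obtain y where y: "pr y = pr (u - v)" "nrm y \<le> r" by auto
    have "x = y" if "pr x = pr (u - v)" "nrm x \<le> r" for x
    proof (rule ccontr)
      assume "x \<noteq> y"
      then have "L \<le> nrm (x - y)" using same_proj_far[of L x y] that y by simp
      then show False using nrm_triangle_diff[of x y] that y assms by linarith
    qed
    then have "?A \<inter> {x. nrm x \<le> r} \<subseteq> {y}" by auto
    then have "measure (S n) (?A \<inter> {x. nrm x \<le> r}) \<le> measure (S n) {y}"
      by (intro measure_pmf.finite_measure_mono) auto
    also have "\<dots> \<le> b (n div 2)" by (simp add: measure_pmf_single pmf_S_le_b_half)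
    finally show ?thesis .
  qed
  finally show ?thesis by simp
qed

text \<open>For distinct starting points v the displacements leading to u are disjoint events, all
  contained in the event of a large displacement. The sum is therefore the probability of a single
  event, with no factor for the size of V.\<close>

lemma sum_tk_far:
  assumes "V \<subseteq> T" "\<And>v x. v \<in> V \<Longrightarrow> pr (v + x) = pr u \<Longrightarrow> r < nrm x"
  shows "(\<Sum>v\<in>V. tk n v u) \<le> measure (S n) {x. nrm x > r}"
proof -
  have fin: "finite V" by (rule finite_subset[OF assms(1)]) simp
  have "(\<Sum>v\<in>V. tk n v u) = measure (S n) (\<Union>v\<in>V. {x. pr x = pr (u - v)})"
    unfolding tk_def
  proof (rule measure_pmf.finite_measure_finite_Union[symmetric, OF fin])
    show "disjoint_family_on (\<lambda>v. {x. pr x = pr (u - v)}) V"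
    proof (unfold disjoint_family_on_def, intro ballI impI)
      fix w v assume uw: "w \<in> V" "v \<in> V" "w \<noteq> v"
      have "w = v" if "pr (u - w) = pr (u - v)"
        using torus_proj_diff_cong[OF refl[of "pr u"] that] uw assms(1) by (simp add: torus_proj_id subset_eq)
      then show "{x. pr x = pr (u - w)} \<inter> {x. pr x = pr (u - v)} = {}" using uw by auto
    qed
  qed auto
  also have "\<dots> \<le> measure (S n) {x. nrm x > r}"
  proof (rule measure_pmf.finite_measure_mono)
    show "(\<Union>v\<in>V. {x. pr x = pr (u - v)}) \<subseteq> {x. nrm x > r}"
    proof clarify
      fix x v assume v: "v \<in> V" and x: "pr x = pr (u - v)"
      have "pr (v + x) = pr u" using torus_proj_add_cong[OF refl[of "pr v"] x] by simp
      then show "r < nrm x" by (rule assms(2)[OF v])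
    qed
  qed simp
  finally show ?thesis .
qed

text \<open>The probability of meeting Y within l steps from v, given by its first-step recursion;
  \<open>prob_avoid\<close> identifies it with the trajectories of the model.\<close>

primrec hit :: "nat \<Rightarrow> (int ^ 'd) set \<Rightarrow> int ^ 'd \<Rightarrow> real" where
  "hit 0 Y v = (if v \<in> Y then 1 else 0)"
| "hit (Suc l) Y v = (if v \<in> Y then 1 else (\<Sum>w\<in>T. tk 1 v w * hit l Y w))"

lemma sum_tk_mult_le: "(\<And>w. w \<in> T \<Longrightarrow> f w \<le> g w) \<Longrightarrow> (\<Sum>w\<in>T. tk n v w * f w) \<le> (\<Sum>w\<in>T. tk n v w * g w)"
  by (intro sum_mono mult_left_mono) auto

lemma hit_nonneg [simp]: "0 \<le> hit l Y v"
  by (induction l arbitrary: v) (auto intro!: sum_nonneg mult_nonneg_nonneg)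

lemma hit_le_1: "hit l Y v \<le> 1"
proof (induction l arbitrary: v)
  case (Suc l)
  have "(\<Sum>w\<in>T. tk 1 v w * hit l Y w) \<le> (\<Sum>w\<in>T. tk 1 v w * 1)"
    by (rule sum_tk_mult_le) (rule Suc.IH)
  then show ?case by (simp add: sum_tk)
qed simp

lemma hit_in: "v \<in> Y \<Longrightarrow> hit l Y v = 1"
  by (cases l) auto

lemma hit_mono_time_Suc: "hit l Y v \<le> hit (Suc l) Y v"
proof (induction l arbitrary: v)
  case 0
  show ?case using hit_nonneg[of "Suc 0" Y v] by (auto simp del: hit_nonneg)
next
  case (Suc l)
  show ?case using sum_tk_mult_le[of "hit l Y" "hit (Suc l) Y" 1 v] Suc.IH by auto
qed

lemma hit_mono_time: "l \<le> l' \<Longrightarrow> hit l Y v \<le> hit l' Y v"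
  by (rule lift_Suc_mono_le[of "\<lambda>l. hit l Y v"]) (rule hit_mono_time_Suc)

lemma hit_Un_le: "hit l (Y \<union> Z) v \<le> hit l Y v + hit l Z v"
proof (induction l arbitrary: v)
  case (Suc l)
  have "(\<Sum>w\<in>T. tk 1 v w * hit l (Y \<union> Z) w) \<le> (\<Sum>w\<in>T. tk 1 v w * (hit l Y w + hit l Z w))"
    by (rule sum_tk_mult_le) (rule Suc.IH)
  then show ?case
    using hit_nonneg[of "Suc l" Y v] hit_nonneg[of "Suc l" Z v]
    by (auto simp: algebra_simps sum.distrib simp del: hit_nonneg)
qed simp

lemma hit_mono_set: "Y \<subseteq> Z \<Longrightarrow> hit l Y v \<le> hit l Z v"
proof (induction l arbitrary: v)
  case (Suc l)
  have *: "(\<Sum>w\<in>T. tk 1 v w * hit l Y w) \<le> (\<Sum>w\<in>T. tk 1 v w * hit l Z w)"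
    by (rule sum_tk_mult_le) (rule Suc.IH[OF Suc.prems])
  show ?case using * Suc.prems hit_le_1[of "Suc l" Y v] by auto
qed auto

lemma sum_tk_step:
  "(\<Sum>n\<le>Suc l. \<Sum>y\<in>Y. tk n v y) = (\<Sum>y\<in>Y. tk 0 v y) + (\<Sum>w\<in>T. tk 1 v w * (\<Sum>n\<le>l. \<Sum>y\<in>Y. tk n w y))"
proof -
  have "(\<Sum>n\<le>Suc l. \<Sum>y\<in>Y. tk n v y) = (\<Sum>y\<in>Y. tk 0 v y) + (\<Sum>n\<le>l. \<Sum>y\<in>Y. tk (1 + n) v y)"
    by (simp only: sum.atMost_Suc_shift) simp
  also have "(\<Sum>n\<le>l. \<Sum>y\<in>Y. tk (1 + n) v y) = (\<Sum>n\<le>l. \<Sum>y\<in>Y. \<Sum>w\<in>T. tk 1 v w * tk n w y)"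
    by (simp only: tk_add)
  also have "\<dots> = (\<Sum>w\<in>T. tk 1 v w * (\<Sum>n\<le>l. \<Sum>y\<in>Y. tk n w y))"
    by (simp add: sum_distrib_left sum.swap[of _ T])
  finally show ?thesis .
qed

lemma sum_tk_0: "finite Y \<Longrightarrow> Y \<subseteq> T \<Longrightarrow> v \<in> T \<Longrightarrow> (\<Sum>y\<in>Y. tk 0 v y) = (if v \<in> Y then 1 else 0)"
proof -
  assume Y: "finite Y" "Y \<subseteq> T" "v \<in> T"
  have "(\<Sum>y\<in>Y. tk 0 v y) = (\<Sum>y\<in>Y. if v = y then 1 else 0)"
    by (rule sum.cong) (use Y tk_0 in auto)
  then show ?thesis using Y by simp
qed

text \<open>The expected time spent in Y is the probability of reaching Y times the expected time
  afterwards, at most B. The induction over first steps stands for the strong Markov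
  property.\<close>

lemma green_le_hit:
  assumes "Y \<subseteq> T" "v \<in> T" "0 \<le> B" "\<And>y. y \<in> Y \<Longrightarrow> (\<Sum>n\<le>l. \<Sum>y'\<in>Y. tk n y y') \<le> B"
  shows "(\<Sum>n\<le>l. \<Sum>y\<in>Y. tk n v y) \<le> hit l Y v * B"
  using assms
proof (induction l arbitrary: v)
  case 0
  have fin: "finite Y" by (rule finite_subset[OF assms(1)]) simp
  show ?case
  proof (cases "v \<in> Y")
    case True
    then show ?thesis using 0(4)[OF True] by simp
  next
    case False
    then show ?thesis using sum_tk_0[OF fin assms(1) 0(2)] by simp
  qed
next
  case (Suc l)
  have fin: "finite Y" by (rule finite_subset[OF assms(1)]) simp
  show ?case
  proof (cases "v \<in> Y")
    case True
    then show ?thesis using Suc.prems(4)[OF True] by (simp add: hit_in)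
  next
    case False
    have IH: "(\<Sum>n\<le>l. \<Sum>y\<in>Y. tk n w y) \<le> hit l Y w * B" if "w \<in> T" for w
    proof (rule Suc.IH[OF assms(1) that assms(3)])
      fix y assume "y \<in> Y"
      have "(\<Sum>n\<le>l. \<Sum>y'\<in>Y. tk n y y') \<le> (\<Sum>n\<le>Suc l. \<Sum>y'\<in>Y. tk n y y')"
        by (rule sum_mono2) (auto intro: sum_nonneg)
      also have "\<dots> \<le> B" by (rule Suc.prems(4)) fact
      finally show "(\<Sum>n\<le>l. \<Sum>y'\<in>Y. tk n y y') \<le> B" .
    qed
    have "(\<Sum>n\<le>Suc l. \<Sum>y\<in>Y. tk n v y) = (\<Sum>w\<in>T. tk 1 v w * (\<Sum>n\<le>l. \<Sum>y\<in>Y. tk n w y))"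
      using False Suc.prems(2) by (simp only: sum_tk_step sum_tk_0[OF fin assms(1)]) simp
    also have "\<dots> \<le> (\<Sum>w\<in>T. tk 1 v w * (hit l Y w * B))" by (rule sum_tk_mult_le) (rule IH)
    also have "\<dots> = hit (Suc l) Y v * B" using False by (simp add: sum_distrib_right mult.assoc)
    finally show ?thesis .
  qed
qed

text \<open>The reverse bound: a walk that meets Y by time l still has m steps left by time l + m,
  in which it spends an expected time at least B in Y.\<close>

lemma hit_le_green:
  assumes "Y \<subseteq> T" "v \<in> T" "0 \<le> B" "\<And>y. y \<in> Y \<Longrightarrow> B \<le> (\<Sum>n\<le>m. \<Sum>y'\<in>Y. tk n y y')"
  shows "hit l Y v * B \<le> (\<Sum>n\<le>l + m. \<Sum>y\<in>Y. tk n v y)"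
  using assms(2)
proof (induction l arbitrary: v)
  case 0
  then show ?case using assms by (auto intro!: sum_nonneg)
next
  case (Suc l)
  have fin: "finite Y" by (rule finite_subset[OF assms(1)]) simp
  show ?case
  proof (cases "v \<in> Y")
    case True
    have "B \<le> (\<Sum>n\<le>m. \<Sum>y'\<in>Y. tk n v y')" by (rule assms(4)[OF True])
    also have "\<dots> \<le> (\<Sum>n\<le>Suc l + m. \<Sum>y'\<in>Y. tk n v y')"
      by (rule sum_mono2) (auto intro: sum_nonneg)
    finally show ?thesis using True by (simp add: hit_in)
  next
    case False
    have "hit (Suc l) Y v * B = (\<Sum>w\<in>T. tk 1 v w * (hit l Y w * B))"
      using False by (simp add: sum_distrib_right mult.assoc)
    also have "\<dots> \<le> (\<Sum>w\<in>T. tk 1 v w * (\<Sum>n\<le>l + m. \<Sum>y\<in>Y. tk n w y))"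
      by (rule sum_tk_mult_le) (rule Suc.IH)
    also have "\<dots> = (\<Sum>n\<le>Suc l + m. \<Sum>y\<in>Y. tk n v y)"
      using False Suc.prems by (simp only: sum_tk_step sum_tk_0[OF fin assms(1)] add_Suc) simp
    finally show ?thesis .
  qed
qed

lemma hit_le_sum_tk:
  assumes "Y \<subseteq> T" "v \<in> T"
  shows "hit l Y v \<le> (\<Sum>n\<le>l. \<Sum>y\<in>Y. tk n v y)"
proof -
  have fin: "finite Y" by (rule finite_subset[OF assms(1)]) simp
  have "(1::real) \<le> (\<Sum>n\<le>0. \<Sum>y'\<in>Y. tk n y y')" if "y \<in> Y" for y
    using sum_tk_0[OF fin assms(1)] that assms(1) by auto
  then show ?thesis using hit_le_green[OF assms, of 1 0 l] by simp
qed

lemma sum_hit_le: 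
  assumes "v \<in> T"
  shows "(\<Sum>w\<in>T. hit l {w} v) \<le> real l + 1"
proof -
  have "(\<Sum>w\<in>T. hit l {w} v) \<le> (\<Sum>w\<in>T. \<Sum>n\<le>l. tk n v w)"
    by (rule sum_mono) (use hit_le_sum_tk[of "{_}" v l] assms in auto)
  also have "\<dots> = real l + 1" by (subst sum.swap) (simp add: sum_tk)
  finally show ?thesis .
qed

text \<open>By inclusion and exclusion the summand is the probability of meeting both u and w, and a
  path of l steps meets at most l + 1 vertices w. In the second moment argument this bounds the
  total correlation.\<close>

lemma sum_hit_both_le:
  assumes "v \<in> T" "u \<in> T"
  shows "(\<Sum>w\<in>T. hit l {u} v + hit l {w} v - hit l {u, w} v) \<le> (real l + 1) * hit l {u} v"
  using assms(1)
proof (induction l arbitrary: v)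
  case 0
  have "(\<Sum>w\<in>T. hit 0 {u} v + hit 0 {w} v - hit 0 {u, w} v) = (\<Sum>w\<in>T. if w = v then hit 0 {u} v else 0)"
    by (rule sum.cong) auto
  then show ?case using 0 by simp
next
  case (Suc l)
  show ?case
  proof (cases "v = u")
    case True
    then have "(\<Sum>w\<in>T. hit (Suc l) {u} v + hit (Suc l) {w} v - hit (Suc l) {u, w} v) = (\<Sum>w\<in>T. hit (Suc l) {w} v)"
      by (intro sum.cong) auto
    then show ?thesis using sum_hit_le[OF Suc.prems, of "Suc l"] True by (simp add: hit_in del: hit.simps)
  next
    case False
    let ?J = "\<lambda>l v w. hit l {u} v + hit l {w} v - hit l {u, w} v"
    have J: "?J (Suc l) v w = (\<Sum>z\<in>T. tk 1 v z * ?J l z w)" if "w \<noteq> v" for w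
      using False that by (simp add: algebra_simps sum.distrib sum_subtractf)
    have "(\<Sum>w\<in>T. ?J (Suc l) v w) = ?J (Suc l) v v + (\<Sum>w\<in>T - {v}. ?J (Suc l) v w)"
      by (rule sum.remove) (use Suc.prems in auto)
    also have "?J (Suc l) v v = hit (Suc l) {u} v" by (simp add: hit_in del: hit.simps)
    also have "(\<Sum>w\<in>T - {v}. ?J (Suc l) v w) = (\<Sum>w\<in>T - {v}. \<Sum>z\<in>T. tk 1 v z * ?J l z w)"
      by (rule sum.cong) (use J in auto)
    also have "\<dots> \<le> (\<Sum>w\<in>T. \<Sum>z\<in>T. tk 1 v z * ?J l z w)"
    proof (rule sum_mono2)
      fix w
      have "0 \<le> ?J l z w" for z using hit_Un_le[of l "{u}" "{w}" z] by (simp add: insert_commute)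
      then show "0 \<le> (\<Sum>z\<in>T. tk 1 v z * ?J l z w)" by (intro sum_nonneg mult_nonneg_nonneg) auto
    qed auto
    also have "\<dots> = (\<Sum>z\<in>T. tk 1 v z * (\<Sum>w\<in>T. ?J l z w))" by (subst sum.swap) (simp add: sum_distrib_left)
    also have "\<dots> \<le> (\<Sum>z\<in>T. tk 1 v z * ((real l + 1) * hit l {u} z))" by (rule sum_tk_mult_le) (rule Suc.IH)
    also have "\<dots> = (real l + 1) * hit (Suc l) {u} v" using False by (simp add: sum_distrib_left mult_ac)
    finally show ?thesis by (simp add: algebra_simps)
  qed
qed

text \<open>The Markov property at time l.\<close>

lemma avoid_add_le:
  assumes "\<And>w. w \<in> T \<Longrightarrow> 1 - hit k Y w \<le> s" "v \<in> T"
  shows "1 - hit (l + k) Y v \<le> (1 - hit l Y v) * s"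
  using assms(2)
proof (induction l arbitrary: v)
  case 0
  then show ?case using assms(1)[of v] by (auto simp: hit_in)
next
  case (Suc l)
  show ?case
  proof (cases "v \<in> Y")
    case False
    have compl: "1 - (\<Sum>w\<in>T. tk 1 v w * f w) = (\<Sum>w\<in>T. tk 1 v w * (1 - f w))" for f :: "_ \<Rightarrow> real"
      by (simp add: algebra_simps sum_subtractf sum_tk)
    have "1 - hit (Suc l + k) Y v = (\<Sum>w\<in>T. tk 1 v w * (1 - hit (l + k) Y w))" using False compl by simp
    also have "\<dots> \<le> (\<Sum>w\<in>T. tk 1 v w * ((1 - hit l Y w) * s))" by (rule sum_tk_mult_le) (rule Suc.IH)
    also have "\<dots> = (1 - hit (Suc l) Y v) * s" using False compl by (simp add: sum_distrib_right mult.assoc)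
    finally show ?thesis .
  qed (simp add: hit_in)
qed

lemma avoid_mult_le:
  assumes "\<And>w. w \<in> T \<Longrightarrow> 1 - hit k Y w \<le> s" "0 \<le> s" "v \<in> T"
  shows "1 - hit (m * k) Y v \<le> s ^ m"
  using assms(3)
proof (induction m)
  case 0
  then show ?case by simp
next
  case (Suc m)
  have "1 - hit (m * k + k) Y v \<le> (1 - hit (m * k) Y v) * s"
    by (rule avoid_add_le[OF assms(1) assms(3)])
  also have "\<dots> \<le> s ^ m * s" by (rule mult_right_mono[OF Suc.IH[OF Suc.prems] assms(2)])
  finally show ?case by (simp add: add.commute mult.commute)
qed

end

section \<open>Void probabilities of the frog model\<close>

text \<open>The Poisson probability generating function at 1 - h: none of the particles succeeds
  when each one does so independently with probability h.\<close>

lemma poisson_thinning_sums: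
  assumes "lam > 0"
  shows "(\<lambda>m. pmf (poisson_pmf lam) m * (1 - h) ^ m) sums exp (- lam * h)"
proof -
  have "(\<lambda>m. exp (- lam) * ((lam * (1 - h)) ^ m /\<^sub>R fact m)) sums (exp (- lam) * exp (lam * (1 - h)))"
    by (intro sums_mult exp_converges)
  moreover have "exp (- lam) * exp (lam * (1 - h)) = exp (- lam * h)"
    by (simp add: exp_add[symmetric] algebra_simps)
  moreover have "exp (- lam) * ((lam * (1 - h)) ^ m /\<^sub>R fact m) = pmf (poisson_pmf lam) m * (1 - h) ^ m" for m
    using assms by (simp add: power_mult_distrib divide_inverse mult_ac)
  ultimately show ?thesis by simp
qed

section \<open>The model and its avoidance events\<close>

locale frog = torus_walk q L + prob_space M
  for q :: "(int ^ 'd) pmf" and L :: nat and M :: "'a measure" +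
  fixes Q :: "int ^ 'd \<Rightarrow> int ^ 'd \<Rightarrow> real" and lam :: real
    and N :: "int ^ 'd \<Rightarrow> 'a \<Rightarrow> nat" and X :: "(int ^ 'd) particle \<Rightarrow> 'a \<Rightarrow> nat \<Rightarrow> int ^ 'd"
  assumes Q_eq: "Q x y = pmf q (y - x)" and lam: "lam > 0"
    and model: "frog_model Q lam L M N X"
begin

abbreviation PM :: "(nat \<Rightarrow> int ^ 'd) measure" where
  "PM \<equiv> PiM UNIV (\<lambda>_. count_space T)"

lemma torus_kernel_eq: "torus_kernel Q L v w = tk 1 v w"
proof -
  let ?A = "{x. pr x = pr (w - v)}"
  have "torus_kernel Q L v w = (\<Sum>\<^sub>\<infinity>x\<in>?A. pmf q x)" by (simp add: torus_kernel_def Q_eq)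
  also have "\<dots> = measure q ?A"
    unfolding measure_pmf_conv_infsetsum by (rule infsetsum_infsum[symmetric]) (rule pmf_abs_summable)
  also have "q = S 1" by (simp add: map_pmf_def[symmetric] bind_return_pmf')
  finally show ?thesis by (simp add: tk_def)
qed

lemma X_meas: "p \<in> particles L \<Longrightarrow> X p \<in> M \<rightarrow>\<^sub>M PM"
  and N_distr: "v \<in> T \<Longrightarrow> distr M (count_space UNIV) (N v) = measure_pmf (poisson_pmf lam)"
  and N_indep: "indep_vars (\<lambda>_. count_space UNIV) N T"
  and X_indep: "indep_vars (\<lambda>_. PM) X (particles L)"
  and NX_indep: "indep_set
       (sets (vimage_algebra (space M) (\<lambda>\<omega>. \<lambda>v\<in>T. N v \<omega>) (PiM T (\<lambda>_. count_space UNIV))))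
       (sets (vimage_algebra (space M) (\<lambda>\<omega>. \<lambda>p\<in>particles L. X p \<omega>) (PiM (particles L) (\<lambda>_. PM))))"
  using model by (auto simp: frog_model_def random_walk_def)

lemma path_prob:
  assumes "p \<in> particles L" "\<And>i. i \<le> n \<Longrightarrow> x i \<in> T"
  shows "prob {\<omega> \<in> space M. \<forall>i\<le>n. X p \<omega> i = x i} =
    (if x 0 = start p then \<Prod>i<n. tk 1 (x i) (x (Suc i)) else 0)"
  using model assms unfolding frog_model_def random_walk_def torus_kernel_eq by blast

lemma N_meas: "v \<in> T \<Longrightarrow> N v \<in> M \<rightarrow>\<^sub>M count_space UNIV"
  using N_indep by (simp add: indep_vars_def)

lemma X_in_T: "p \<in> particles L \<Longrightarrow> \<omega> \<in> space M \<Longrightarrow> X p \<omega> i \<in> T"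
  using measurable_space[OF X_meas] by (auto simp: space_PiM PiE_def Pi_def)

lemma coord_meas: "p \<in> particles L \<Longrightarrow> (\<lambda>\<omega>. X p \<omega> i) \<in> M \<rightarrow>\<^sub>M count_space T"
  using measurable_compose[OF X_meas measurable_component_singleton[of i UNIV "\<lambda>_. count_space T"]] by simp

definition av :: "nat \<Rightarrow> (int ^ 'd) set \<Rightarrow> (nat \<Rightarrow> int ^ 'd) set" where
  "av l Y = {f \<in> space PM. \<forall>k\<le>l. f k \<notin> Y}"

lemma av_sets: "av l Y \<in> sets PM"
proof -
  have "av l Y = (\<Inter>k\<in>{..l}. (\<lambda>f. f k) -` (T - Y) \<inter> space PM)"
    by (auto simp: av_def space_PiM PiE_def Pi_def)
  also have "\<dots> \<in> sets PM"
    by (intro sets.finite_INT measurable_sets[OF measurable_component_singleton]) auto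
  finally show ?thesis .
qed

lemma sum_paths_Suc:
  fixes F :: "(nat \<Rightarrow> 'v) \<Rightarrow> real"
  assumes "finite A"
  shows "(\<Sum>x\<in>PiE {..Suc l} (\<lambda>_. A). F x) = (\<Sum>x\<in>PiE {..l} (\<lambda>_. A). \<Sum>y\<in>A. F (x(Suc l := y)))"
proof -
  have "(\<Sum>x\<in>PiE {..Suc l} (\<lambda>_. A). F x) = (\<Sum>x\<in>(\<lambda>(y, g). g(Suc l := y)) ` (A \<times> PiE {..l} (\<lambda>_. A)). F x)"
    by (simp add: atMost_Suc PiE_insert_eq)
  also have "\<dots> = (\<Sum>(y, g)\<in>A \<times> PiE {..l} (\<lambda>_. A). F (g(Suc l := y)))"
    by (subst sum.reindex) (use inj_combinator[of "Suc l" "{..l}" "\<lambda>_. A"] in \<open>simp_all add: case_prod_unfold\<close>)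
  also have "\<dots> = (\<Sum>y\<in>A. \<Sum>g\<in>PiE {..l} (\<lambda>_. A). F (g(Suc l := y)))"
    by (simp add: sum.cartesian_product)
  also have "\<dots> = (\<Sum>x\<in>PiE {..l} (\<lambda>_. A). \<Sum>y\<in>A. F (x(Suc l := y)))" by (rule sum.swap)
  finally show ?thesis .
qed

lemma avoid_paths_sum:
  assumes "v \<in> T"
  shows "(\<Sum>x\<in>PiE {..l} (\<lambda>_. T - Y). if x 0 = v then \<Prod>i<l. tk 1 (x i) (x (Suc i)) else 0) = 1 - hit l Y v"
proof -
  let ?A = "T - Y"
  \<comment> \<open>\<open>P\<close> is the one-step operator killed on Y. Keeping a general
    terminal weight \<phi> allows the induction to absorb the last step of the path into the
    weight.\<close>
  define P where "P = (\<lambda>\<phi> z. \<Sum>y\<in>?A. tk 1 z y * \<phi> y)"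
  have P_apply: "P \<phi> z = (\<Sum>y\<in>?A. tk 1 z y * \<phi> y)" for \<phi> z by (simp add: P_def)
  have *: "(\<Sum>x\<in>PiE {..l} (\<lambda>_. ?A). if x 0 = v then (\<Prod>i<l. tk 1 (x i) (x (Suc i))) * \<phi> (x l) else 0) =
      (if v \<in> ?A then (P ^^ l) \<phi> v else 0)" for l \<phi>
  proof (induction l arbitrary: \<phi>)
    case 0
    have "(\<Sum>x\<in>PiE {..0::nat} (\<lambda>_. ?A). if x 0 = v then (\<Prod>i<0. tk 1 (x i) (x (Suc i))) * \<phi> (x 0) else 0) =
        (\<Sum>y\<in>?A. if y = v then \<phi> y else 0)"
      by (rule sum.reindex_bij_witness[of _ "\<lambda>y. (\<lambda>i\<in>{..0}. y)" "\<lambda>x. x 0"])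
         (auto simp: PiE_def extensional_def fun_eq_iff)
    then show ?case by simp
  next
    case (Suc l)
    have "(\<Sum>x\<in>PiE {..Suc l} (\<lambda>_. ?A). if x 0 = v then (\<Prod>i<Suc l. tk 1 (x i) (x (Suc i))) * \<phi> (x (Suc l)) else 0) =
        (\<Sum>x\<in>PiE {..l} (\<lambda>_. ?A). \<Sum>y\<in>?A. if x 0 = v then (\<Prod>i<l. tk 1 (x i) (x (Suc i))) * (tk 1 (x l) y * \<phi> y) else 0)"
      by (subst sum_paths_Suc) (auto intro!: sum.cong prod.cong simp: mult.assoc)
    also have "\<dots> = (\<Sum>x\<in>PiE {..l} (\<lambda>_. ?A). if x 0 = v then (\<Prod>i<l. tk 1 (x i) (x (Suc i))) * P \<phi> (x l) else 0)"
      by (rule sum.cong) (auto simp: P_def sum_distrib_left)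
    also have "\<dots> = (if v \<in> ?A then (P ^^ l) (P \<phi>) v else 0)" by (rule Suc.IH)
    finally show ?case by (simp add: funpow_swap1)
  qed
  have "(P ^^ l) (\<lambda>_. 1) v = 1 - hit l Y v" if "v \<notin> Y" "v \<in> T" for l v
    using that
  proof (induction l arbitrary: v)
    case (Suc l)
    have "(P ^^ Suc l) (\<lambda>_. 1) v = (\<Sum>y\<in>?A. tk 1 v y * (1 - hit l Y y))"
    proof -
      have "(P ^^ Suc l) (\<lambda>_. 1) v = P ((P ^^ l) (\<lambda>_. 1)) v" by simp
      also have "\<dots> = (\<Sum>y\<in>?A. tk 1 v y * (P ^^ l) (\<lambda>_. 1) y)" by (rule P_apply)
      also have "\<dots> = (\<Sum>y\<in>?A. tk 1 v y * (1 - hit l Y y))"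
        by (rule sum.cong) (auto simp: Suc.IH)
      finally show ?thesis .
    qed
    also have "\<dots> = (\<Sum>y\<in>T. tk 1 v y * (1 - hit l Y y))"
      by (rule sum.mono_neutral_left) (auto simp: hit_in)
    also have "\<dots> = 1 - hit (Suc l) Y v"
      using Suc.prems by (simp add: right_diff_distrib sum_subtractf sum_tk)
    finally show ?case .
  qed simp
  then show ?thesis using *[of l "\<lambda>_. 1", unfolded mult_1_right] assms by (auto simp: hit_in)
qed

lemma prob_avoid:
  assumes "p \<in> particles L"
  shows "prob (X p -` av l Y \<inter> space M) = 1 - hit l Y (start p)"
proof -
  have st: "start p \<in> T" using assms by (simp add: particles_def)
  let ?E = "\<lambda>x. {\<omega> \<in> space M. \<forall>i\<le>l. X p \<omega> i = x i}"
  have eq: "X p -` av l Y \<inter> space M = (\<Union>x\<in>PiE {..l} (\<lambda>_. T - Y). ?E x)"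
  proof (intro equalityI subsetI)
    fix \<omega> assume "\<omega> \<in> X p -` av l Y \<inter> space M"
    then have w: "\<omega> \<in> space M" "\<forall>k\<le>l. X p \<omega> k \<notin> Y" by (auto simp: av_def)
    then have "restrict (X p \<omega>) {..l} \<in> PiE {..l} (\<lambda>_. T - Y)" using X_in_T[OF assms] by auto
    moreover have "\<omega> \<in> ?E (restrict (X p \<omega>) {..l})" using w by auto
    ultimately show "\<omega> \<in> (\<Union>x\<in>PiE {..l} (\<lambda>_. T - Y). ?E x)" by blast
  next
    fix \<omega> assume "\<omega> \<in> (\<Union>x\<in>PiE {..l} (\<lambda>_. T - Y). ?E x)"
    then show "\<omega> \<in> X p -` av l Y \<inter> space M"
      using measurable_space[OF X_meas[OF assms], of \<omega>] by (auto simp: av_def PiE_def Pi_def)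
  qed
  have fin: "finite (PiE {..l} (\<lambda>_. T - Y))" by (rule finite_PiE) auto
  have E_sets: "?E x \<in> events" if x: "x \<in> PiE {..l} (\<lambda>_. T - Y)" for x
  proof -
    have "?E x = (\<Inter>i\<in>{..l}. (\<lambda>\<omega>. X p \<omega> i) -` {x i} \<inter> space M)" by auto
    also have "\<dots> \<in> events"
      using x by (intro sets.finite_INT measurable_sets[OF coord_meas[OF assms]]) (auto simp: PiE_def Pi_def)
    finally show ?thesis .
  qed
  have "prob (X p -` av l Y \<inter> space M) = (\<Sum>x\<in>PiE {..l} (\<lambda>_. T - Y). prob (?E x))"
    unfolding eq
  proof (rule finite_measure_finite_Union[OF fin])
    show "?E ` PiE {..l} (\<lambda>_. T - Y) \<subseteq> events" using E_sets by blast
    show "disjoint_family_on ?E (PiE {..l} (\<lambda>_. T - Y))"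
      by (auto simp: disjoint_family_on_def intro!: PiE_ext)
  qed
  also have "\<dots> = (\<Sum>x\<in>PiE {..l} (\<lambda>_. T - Y). if x 0 = start p then \<Prod>i<l. tk 1 (x i) (x (Suc i)) else 0)"
    by (rule sum.cong[OF refl], rule path_prob[OF assms]) (auto simp: PiE_def Pi_def)
  also have "\<dots> = 1 - hit l Y (start p)" by (rule avoid_paths_sum[OF st])
  finally show ?thesis .
qed

lemma Ordinary_particles [simp]: "Ordinary v j \<in> particles L \<longleftrightarrow> v \<in> T"
  by (simp add: particles_def)

lemma Planted_particles [simp]: "Planted \<in> particles L"
  by (simp add: particles_def zero_in_torus[OF L])

lemma prob_N: "v \<in> T \<Longrightarrow> prob (N v -` {n} \<inter> space M) = pmf (poisson_pmf lam) n"
  using measure_distr[OF N_meas, of v "{n}"] by (simp add: N_distr measure_pmf_single)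

context
  fixes l :: nat and Y :: "int ^ 'd \<Rightarrow> (int ^ 'd) set" and B :: "(nat \<Rightarrow> int ^ 'd) set"
  assumes B: "B \<in> sets PM"
begin

text \<open>An interpolation: the particle counts are prescribed by n outside U and free on U. For
  empty U only finitely many trajectories are involved, so the independence assumptions apply
  directly; vertices then move into U one at a time.\<close>

definition void_ev :: "(int ^ 'd) set \<Rightarrow> (int ^ 'd \<Rightarrow> nat) \<Rightarrow> 'a set" where
  "void_ev U n = {\<omega> \<in> space M. X Planted \<omega> \<in> B \<and>
     (\<forall>v\<in>U. \<forall>j<N v \<omega>. X (Ordinary v j) \<omega> \<in> av l (Y v)) \<and>
     (\<forall>v\<in>T - U. N v \<omega> = n v \<and> (\<forall>j<n v. X (Ordinary v j) \<omega> \<in> av l (Y v)))}"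

lemma void_ev_empty:
  "void_ev {} n \<in> events \<and> prob (void_ev {} n) = prob (X Planted -` B \<inter> space M) *
    (\<Prod>v\<in>T. pmf (poisson_pmf lam) (n v) * (1 - hit l (Y v) v) ^ n v)"
proof -
  let ?O = "(\<lambda>(v, j). Ordinary v j) ` (SIGMA v:T. {..<n v})"
  define J where "J = insert Planted ?O"
  define A where "A = case_particle B (\<lambda>v j. av l (Y v))"
  let ?a = "{\<omega> \<in> space M. \<forall>v\<in>T. N v \<omega> = n v}"
  let ?c = "{\<omega> \<in> space M. \<forall>p\<in>J. X p \<omega> \<in> A p}"
  have J: "finite J" "J \<subseteq> particles L" "J \<noteq> {}" by (auto simp: J_def)
  have A: "A p \<in> sets PM" for p by (cases p) (auto simp: A_def B av_sets)
  have split: "void_ev {} n = ?a \<inter> ?c"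
    by (auto simp: void_ev_def J_def A_def)
  have a_alt: "?a = (\<Inter>v\<in>T. N v -` {n v} \<inter> space M)" using zero_in_torus[OF L] by auto
  have c_alt: "?c = (\<Inter>p\<in>J. X p -` A p \<inter> space M)" using J(3) by auto
  have a_ev: "?a \<in> events" unfolding a_alt
    using zero_in_torus[OF L] by (intro sets.finite_INT measurable_sets[OF N_meas]) auto
  have c_ev: "?c \<in> events" unfolding c_alt
    using J A by (intro sets.finite_INT measurable_sets[OF X_meas]) auto
  have a_in: "?a \<in> sets (vimage_algebra (space M) (\<lambda>\<omega>. \<lambda>v\<in>T. N v \<omega>) (PiM T (\<lambda>_. count_space UNIV)))"
  proof -
    have "?a = (\<lambda>\<omega>. \<lambda>v\<in>T. N v \<omega>) -` (PiE T (\<lambda>v. {n v})) \<inter> space M" by auto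
    moreover have "PiE T (\<lambda>v. {n v}) \<in> sets (PiM T (\<lambda>_. count_space UNIV))"
      by (rule sets_PiM_I_finite) auto
    ultimately show ?thesis by (auto intro: in_vimage_algebra)
  qed
  have c_in: "?c \<in> sets (vimage_algebra (space M) (\<lambda>\<omega>. \<lambda>p\<in>particles L. X p \<omega>) (PiM (particles L) (\<lambda>_. PM)))"
  proof -
    have "?c = (\<lambda>\<omega>. \<lambda>p\<in>particles L. X p \<omega>) -` (prod_emb (particles L) (\<lambda>_. PM) J (PiE J A)) \<inter> space M"
      using J(2) measurable_space[OF X_meas] by (auto simp: prod_emb_def PiE_def Pi_def space_PiM subset_eq)
    moreover have "prod_emb (particles L) (\<lambda>_. PM) J (PiE J A) \<in> sets (PiM (particles L) (\<lambda>_. PM))"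
      by (rule sets_PiM_I) (use J A in auto)
    ultimately show ?thesis by (auto intro: in_vimage_algebra)
  qed
  have pa: "prob ?a = (\<Prod>v\<in>T. pmf (poisson_pmf lam) (n v))"
    unfolding a_alt using indep_varsD[OF N_indep, of T "\<lambda>v. {n v}"] zero_in_torus[OF L]
    by (auto simp: prob_N)
  have "prob ?c = (\<Prod>p\<in>J. prob (X p -` A p \<inter> space M))"
    unfolding c_alt using indep_varsD[OF X_indep J(3,1,2)] A by simp
  also have "\<dots> = prob (X Planted -` B \<inter> space M) * (\<Prod>p\<in>?O. prob (X p -` A p \<inter> space M))"
    unfolding J_def by (subst prod.insert) (auto simp: A_def)
  also have "(\<Prod>p\<in>?O. prob (X p -` A p \<inter> space M)) =
      (\<Prod>(v, j)\<in>(SIGMA v:T. {..<n v}). prob (X (Ordinary v j) -` av l (Y v) \<inter> space M))"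
    by (subst prod.reindex) (auto simp: inj_on_def A_def intro!: prod.cong)
  also have "\<dots> = (\<Prod>v\<in>T. \<Prod>j<n v. prob (X (Ordinary v j) -` av l (Y v) \<inter> space M))"
    by (subst prod.Sigma) auto
  also have "\<dots> = (\<Prod>v\<in>T. (1 - hit l (Y v) v) ^ n v)"
    by (rule prod.cong) (auto simp: prob_avoid)
  finally have pc: "prob ?c = prob (X Planted -` B \<inter> space M) * (\<Prod>v\<in>T. (1 - hit l (Y v) v) ^ n v)" .
  have "prob (?a \<inter> ?c) = prob ?a * prob ?c" by (rule indep_setD[OF NX_indep a_in c_in])
  then show ?thesis unfolding split using a_ev c_ev pa pc by (simp add: prod.distrib)
qed

text \<open>Freeing the count at one more vertex is a countable disjoint union over its values, and
  the Poisson sum replaces the factor of that vertex by an exponential.\<close>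

lemma void_ev_prob:
  assumes "U \<subseteq> T"
  shows "void_ev U n \<in> events \<and> prob (void_ev U n) = prob (X Planted -` B \<inter> space M) *
    (\<Prod>v\<in>U. exp (- lam * hit l (Y v) v)) *
    (\<Prod>v\<in>T - U. pmf (poisson_pmf lam) (n v) * (1 - hit l (Y v) v) ^ n v)"
proof -
  have "finite U" by (rule finite_subset[OF assms]) simp
  then show ?thesis using assms
  proof (induction U arbitrary: n rule: finite_induct)
    case empty
    show ?case using void_ev_empty[of n] by simp
  next
    case (insert a U)
    let ?g = "\<lambda>n v. pmf (poisson_pmf lam) (n v) * (1 - hit l (Y v) v) ^ n v"
    let ?C = "prob (X Planted -` B \<inter> space M) * (\<Prod>v\<in>U. exp (- lam * hit l (Y v) v)) * (\<Prod>v\<in>T - insert a U. ?g n v)"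
    have aT: "a \<in> T" "U \<subseteq> T" using insert by auto
    have U: "void_ev (insert a U) n = (\<Union>m. void_ev U (n(a := m)))"
      using insert.hyps(2) aT by (auto simp: void_ev_def)
    have IH: "void_ev U (n(a := m)) \<in> events" 
      "prob (void_ev U (n(a := m))) = ?C * (pmf (poisson_pmf lam) m * (1 - hit l (Y a) a) ^ m)" for m
    proof -
      note I = insert.IH[OF aT(2), of "n(a := m)"]
      show "void_ev U (n(a := m)) \<in> events" by (rule I[THEN conjunct1])
      have TU: "T - U = insert a (T - insert a U)" using aT insert.hyps(2) by auto
      have "(\<Prod>v\<in>T - U. ?g (n(a := m)) v) = ?g (n(a := m)) a * (\<Prod>v\<in>T - insert a U. ?g (n(a := m)) v)"
        unfolding TU by (rule prod.insert) auto
      also have "(\<Prod>v\<in>T - insert a U. ?g (n(a := m)) v) = (\<Prod>v\<in>T - insert a U. ?g n v)"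
        by (rule prod.cong) auto
      finally show "prob (void_ev U (n(a := m))) = ?C * (pmf (poisson_pmf lam) m * (1 - hit l (Y a) a) ^ m)"
        using I[THEN conjunct2] by (simp only: mult_ac fun_upd_same)
    qed
    have ev: "void_ev (insert a U) n \<in> events" unfolding U by (rule sets.countable_UN) (use IH in auto)
    have "(\<lambda>m. prob (void_ev U (n(a := m)))) sums prob (\<Union>m. void_ev U (n(a := m)))"
    proof (rule finite_measure_UNION)
      show "range (\<lambda>m. void_ev U (n(a := m))) \<subseteq> events" using IH by auto
      show "disjoint_family (\<lambda>m. void_ev U (n(a := m)))"
        using aT insert.hyps(2) by (fastforce simp: disjoint_family_on_def void_ev_def)
    qed
    moreover have "(\<lambda>m. prob (void_ev U (n(a := m)))) sums (?C * exp (- lam * hit l (Y a) a))"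
      unfolding IH(2) by (intro sums_mult poisson_thinning_sums) (use lam in simp)
    ultimately have "prob (void_ev (insert a U) n) = ?C * exp (- lam * hit l (Y a) a)"
      unfolding U by (rule sums_unique2)
    then show ?case using ev insert.hyps by (simp add: mult_ac)
  qed
qed

end

text \<open>Only ordinary particles enter \<open>rel\<close>; the planted one is treated separately.\<close>

definition rel :: "nat \<Rightarrow> 'a \<Rightarrow> ((int ^ 'd) \<times> (int ^ 'd)) set" where
  "rel l \<omega> = {(v, u). v \<in> T \<and> u \<in> T \<and> (\<exists>j<N v \<omega>. \<exists>k\<le>l. X (Ordinary v j) \<omega> k = u)}"

lemma rel_subset: "rel l \<omega> \<subseteq> T \<times> T"
  by (auto simp: rel_def)

lemma rel_void:
  assumes "B \<in> sets PM" "\<rho> \<subseteq> T \<times> T"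
  shows "{\<omega> \<in> space M. rel l \<omega> \<inter> \<rho> = {} \<and> X Planted \<omega> \<in> B} \<in> events"
    and "prob {\<omega> \<in> space M. rel l \<omega> \<inter> \<rho> = {} \<and> X Planted \<omega> \<in> B} =
      prob (X Planted -` B \<inter> space M) * exp (- lam * (\<Sum>v\<in>T. hit l (\<rho> `` {v}) v))"
proof -
  have in_av: "X (Ordinary v j) \<omega> \<in> av l (\<rho> `` {v}) \<longleftrightarrow> (\<forall>k\<le>l. (v, X (Ordinary v j) \<omega> k) \<notin> \<rho>)"
    if "\<omega> \<in> space M" "v \<in> T" for \<omega> v j
    using measurable_space[OF X_meas, of "Ordinary v j" \<omega>] that by (auto simp: av_def)
  have "{\<omega> \<in> space M. rel l \<omega> \<inter> \<rho> = {} \<and> X Planted \<omega> \<in> B} = void_ev l (\<lambda>v. \<rho> `` {v}) B T (\<lambda>_. 0)"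
    (is "?E = ?V")
  proof (intro equalityI subsetI)
    fix \<omega> assume w: "\<omega> \<in> ?E"
    have "(v, X (Ordinary v j) \<omega> k) \<notin> \<rho>" if "v \<in> T" "j < N v \<omega>" "k \<le> l" for v j k
    proof
      assume r: "(v, X (Ordinary v j) \<omega> k) \<in> \<rho>"
      then have "(v, X (Ordinary v j) \<omega> k) \<in> rel l \<omega>"
        using that assms(2) by (auto simp: rel_def)
      then show False using w r by auto
    qed
    then show "\<omega> \<in> ?V" using w in_av by (auto simp: void_ev_def[OF assms(1)])
  next
    fix \<omega> assume w: "\<omega> \<in> ?V"
    then show "\<omega> \<in> ?E" using in_av by (auto simp: void_ev_def[OF assms(1)] rel_def)
  qed
  then show "?E \<in> events" "prob ?E = prob (X Planted -` B \<inter> space M) * exp (- lam * (\<Sum>v\<in>T. hit l (\<rho> `` {v}) v))"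
    using void_ev_prob[OF assms(1) order_refl, of l "\<lambda>v. \<rho> `` {v}" "\<lambda>_. 0"]
    by (auto simp: exp_sum sum_distrib_left sum_negf[symmetric])
qed

lemma space_PM_Planted: "X Planted -` space PM \<inter> space M = space M"
  using measurable_space[OF X_meas[OF Planted_particles]] by auto

text \<open>The void formula gives the factorisation for the events that \<open>rel l\<close> is
  contained in c, which are the sets \<open>?F\<close>. The events of equality follow by induction
  on the size of c, subtracting the proper subsets.\<close>

lemma rel_planted_indep_single:
  assumes "B \<in> sets PM" "c \<subseteq> T \<times> T"
  shows "{\<omega> \<in> space M. rel l \<omega> = c \<and> X Planted \<omega> \<in> B} \<in> events \<and>
    prob {\<omega> \<in> space M. rel l \<omega> = c \<and> X Planted \<omega> \<in> B} =
      prob (X Planted -` B \<inter> space M) * prob {\<omega> \<in> space M. rel l \<omega> = c \<and> X Planted \<omega> \<in> space PM}"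
proof -
  let ?E = "\<lambda>B c. {\<omega> \<in> space M. rel l \<omega> = c \<and> X Planted \<omega> \<in> B}"
  let ?F = "\<lambda>B c. {\<omega> \<in> space M. rel l \<omega> \<inter> (T \<times> T - c) = {} \<and> X Planted \<omega> \<in> B}"
  have fin: "finite c" if "c \<subseteq> T \<times> T" for c :: "((int ^ 'd) \<times> (int ^ 'd)) set"
    by (rule finite_subset[OF that]) simp
  have F_ev: "?F B c \<in> events" if "B \<in> sets PM" for B c by (rule rel_void(1)[OF that]) auto
  have E_ev: "?E B c \<in> events" if "B \<in> sets PM" "c \<subseteq> T \<times> T" for B c
  proof -
    have "?E B c = ?F B c - (\<Union>x\<in>c. ?F B (c - {x}))"
      using rel_subset[of l] by auto
    also have "\<dots> \<in> events" using fin[OF that(2)] F_ev[OF that(1)] by (intro sets.Diff sets.finite_UN) auto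
    finally show ?thesis .
  qed
  have F_sum: "prob (?F B c) = (\<Sum>r\<in>Pow c. prob (?E B r))" if B: "B \<in> sets PM" and c: "c \<subseteq> T \<times> T" for B c
  proof -
    have "?F B c = (\<Union>r\<in>Pow c. ?E B r)" using rel_subset[of l] by auto
    also have "prob \<dots> = (\<Sum>r\<in>Pow c. prob (?E B r))"
    proof (rule finite_measure_finite_Union)
      show "?E B ` Pow c \<subseteq> events" using E_ev[OF B] c by auto
    qed (auto simp: disjoint_family_on_def fin[OF c])
    finally show ?thesis .
  qed
  let ?\<beta> = "prob (X Planted -` B \<inter> space M)"
  have F_ind: "prob (?F B c) = ?\<beta> * prob (?F (space PM) c)" if "c \<subseteq> T \<times> T" for c
    using rel_void(2)[OF assms(1), of "T \<times> T - c" l] rel_void(2)[OF sets.top, of "T \<times> T - c" l]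
    by (simp add: space_PM_Planted prob_space)
  have "prob (?E B c) = ?\<beta> * prob (?E (space PM) c)" using assms(2)
  proof (induction "card c" arbitrary: c rule: less_induct)
    case less
    have split: "(\<Sum>r\<in>Pow c. g r) = g c + (\<Sum>r\<in>Pow c - {c}. g r)" for g :: "_ \<Rightarrow> real"
      by (rule sum.remove) (use fin[OF less.prems] in auto)
    have "(\<Sum>r\<in>Pow c - {c}. prob (?E B r)) = (\<Sum>r\<in>Pow c - {c}. ?\<beta> * prob (?E (space PM) r))"
    proof (rule sum.cong[OF refl])
      fix r assume r: "r \<in> Pow c - {c}"
      then have "card r < card c" using fin[OF less.prems] by (intro psubset_card_mono) auto
      then show "prob (?E B r) = ?\<beta> * prob (?E (space PM) r)" using r less.prems by (intro less.hyps) auto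
    qed
    then show ?case
      using F_ind[OF less.prems] F_sum[OF assms(1) less.prems] F_sum[OF sets.top less.prems]
      by (simp add: split sum_distrib_left algebra_simps)
  qed
  then show ?thesis using E_ev[OF assms] by simp
qed

lemma rel_planted_indep:
  assumes "B \<in> sets PM"
  shows "{\<omega> \<in> space M. P (rel l \<omega>) \<and> X Planted \<omega> \<in> B} \<in> events"
    and "prob {\<omega> \<in> space M. P (rel l \<omega>) \<and> X Planted \<omega> \<in> B} =
      prob (X Planted -` B \<inter> space M) * prob {\<omega> \<in> space M. P (rel l \<omega>)}"
    and "{\<omega> \<in> space M. P (rel l \<omega>)} \<in> events"
proof -
  let ?C = "{c. c \<subseteq> T \<times> T \<and> P c}"
  have finC: "finite ?C" by (rule finite_subset[of _ "Pow (T \<times> T)"]) auto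
  let ?E = "\<lambda>B c. {\<omega> \<in> space M. rel l \<omega> = c \<and> X Planted \<omega> \<in> B}"
  have U: "{\<omega> \<in> space M. P (rel l \<omega>) \<and> X Planted \<omega> \<in> B} = (\<Union>c\<in>?C. ?E B c)" for B
    using rel_subset[of l] by auto
  have ev: "{\<omega> \<in> space M. P (rel l \<omega>) \<and> X Planted \<omega> \<in> B} \<in> events" if "B \<in> sets PM" for B
    unfolding U using rel_planted_indep_single[OF that] by (intro sets.finite_UN[OF finC]) auto
  have pr: "prob {\<omega> \<in> space M. P (rel l \<omega>) \<and> X Planted \<omega> \<in> B} = (\<Sum>c\<in>?C. prob (?E B c))"
    if "B \<in> sets PM" for B
    unfolding U
  proof (rule finite_measure_finite_Union[OF finC])
    show "?E B ` ?C \<subseteq> events" using rel_planted_indep_single[OF that] by auto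
  qed (auto simp: disjoint_family_on_def)
  have S: "{\<omega> \<in> space M. P (rel l \<omega>)} = {\<omega> \<in> space M. P (rel l \<omega>) \<and> X Planted \<omega> \<in> space PM}"
    using space_PM_Planted by auto
  show "{\<omega> \<in> space M. P (rel l \<omega>) \<and> X Planted \<omega> \<in> B} \<in> events" by (rule ev[OF assms])
  show "{\<omega> \<in> space M. P (rel l \<omega>)} \<in> events" unfolding S by (rule ev) simp
  show "prob {\<omega> \<in> space M. P (rel l \<omega>) \<and> X Planted \<omega> \<in> B} =
      prob (X Planted -` B \<inter> space M) * prob {\<omega> \<in> space M. P (rel l \<omega>)}"
    unfolding S pr[OF assms] pr[OF sets.top] sum_distrib_left
    by (rule sum.cong) (use rel_planted_indep_single[OF assms] in auto)
qed

lemma prob_void: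
  assumes "V \<subseteq> T" "Y \<subseteq> T"
  shows "{\<omega> \<in> space M. rel l \<omega> \<inter> V \<times> Y = {}} \<in> events"
    and "prob {\<omega> \<in> space M. rel l \<omega> \<inter> V \<times> Y = {}} = exp (- lam * (\<Sum>v\<in>V. hit l Y v))"
proof -
  show "{\<omega> \<in> space M. rel l \<omega> \<inter> V \<times> Y = {}} \<in> events" by (rule rel_planted_indep(3)[OF sets.top])
  have 0: "hit l {} v = 0" for v by (induction l arbitrary: v) auto
  have "(\<Sum>v\<in>T. hit l ((V \<times> Y) `` {v}) v) = (\<Sum>v\<in>T. if v \<in> V then hit l Y v else 0)"
    by (rule sum.cong) (auto simp: 0 Image_def)
  also have "\<dots> = (\<Sum>v\<in>V. hit l Y v)" using assms(1) by (simp add: sum.If_cases Int_absorb1)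
  finally have *: "(\<Sum>v\<in>T. hit l ((V \<times> Y) `` {v}) v) = (\<Sum>v\<in>V. hit l Y v)" .
  have "{\<omega> \<in> space M. rel l \<omega> \<inter> V \<times> Y = {}} =
      {\<omega> \<in> space M. rel l \<omega> \<inter> V \<times> Y = {} \<and> X Planted \<omega> \<in> space PM}"
    using space_PM_Planted by auto
  also have "prob \<dots> = exp (- lam * (\<Sum>v\<in>V. hit l Y v))"
    using rel_void(2)[OF sets.top, of "V \<times> Y" l] assms * by (auto simp: space_PM_Planted prob_space)
  finally show "prob {\<omega> \<in> space M. rel l \<omega> \<inter> V \<times> Y = {}} = exp (- lam * (\<Sum>v\<in>V. hit l Y v))" .
qed

end

section \<open>Backward clusters\<close>

lemma card_small_subsets:
  assumes "finite V"
  shows "card {D. D \<subseteq> V \<and> card D \<le> m} \<le> (card V + 1) ^ m"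
proof (induction m)
  case 0
  have "{D. D \<subseteq> V \<and> card D \<le> 0} = {{}}"
    using assms by (auto dest: finite_subset)
  then show ?case by simp
next
  case (Suc m)
  let ?F = "\<lambda>m. {D. D \<subseteq> V \<and> card D \<le> m}"
  have fin: "finite (?F m)" for m by (rule finite_subset[of _ "Pow V"]) (use assms in auto)
  have "?F (Suc m) \<subseteq> ?F m \<union> (\<lambda>(x, D). insert x D) ` (V \<times> ?F m)"
  proof
    fix D assume D: "D \<in> ?F (Suc m)"
    show "D \<in> ?F m \<union> (\<lambda>(x, D). insert x D) ` (V \<times> ?F m)"
    proof (cases "card D \<le> m")
      case False
      then obtain x where x: "x \<in> D" by fastforce
      have "finite D" using D assms finite_subset by auto
      then have "D - {x} \<in> ?F m" using D x by auto
      moreover have "D = insert x (D - {x})" using x by auto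
      ultimately show ?thesis using D x by (intro UnI2 image_eqI[of _ _ "(x, D - {x})"]) auto
    qed (use D in auto)
  qed
  then have "card (?F (Suc m)) \<le> card (?F m \<union> (\<lambda>(x, D). insert x D) ` (V \<times> ?F m))"
    by (rule card_mono[rotated]) (use fin assms in auto)
  also have "\<dots> \<le> card (?F m) + card (V \<times> ?F m)"
    by (rule order_trans[OF card_Un_le]) (intro add_left_mono card_image_le finite_cartesian_product assms fin)
  also have "\<dots> = (card V + 1) * card (?F m)" by (simp add: card_cartesian_product)
  also have "\<dots> \<le> (card V + 1) * (card V + 1) ^ m" by (rule mult_left_mono[OF Suc.IH]) simp
  finally show ?case by simp
qed

definition Back :: "('v \<times> 'v) set \<Rightarrow> 'v \<Rightarrow> 'v set" where
  "Back r u = {v. (v, u) \<in> r\<^sup>*}"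

lemma Back_refl: "u \<in> Back r u"
  by (simp add: Back_def)

lemma Back_step: "(v, w) \<in> r \<Longrightarrow> w \<in> Back r u \<Longrightarrow> v \<in> Back r u"
  by (auto simp: Back_def intro: converse_rtrancl_into_rtrancl)

lemma unit_step_towards:
  fixes x z :: "int ^ 'd"
  assumes "x \<noteq> z"
  obtains \<delta> where "nrm \<delta> \<le> 1" "nrm (z - (x + \<delta>)) < nrm (z - x)"
    "\<And>D. nrm x \<le> D \<Longrightarrow> nrm z \<le> D \<Longrightarrow> nrm (x + \<delta>) \<le> D"
proof -
  define \<delta> where "\<delta> = (\<chi> i. sgn (z $ i - x $ i))"
  have comp: "\<bar>z $ i - (x $ i + sgn (z $ i - x $ i))\<bar> \<le> \<bar>z $ i - x $ i\<bar> - (if z $ i = x $ i then 0 else 1)" for i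
    by (auto simp: sgn_if)
  have n: "nrm (z - x) \<ge> 1" using assms nrm_eq_0_iff[of "z - x"] by (metis One_nat_def Suc_leI eq_iff_diff_eq_0 gr0I)
  show ?thesis
  proof
    show "nrm \<delta> \<le> 1" by (auto simp: nrm_le_iff \<delta>_def sgn_if)
    have "nrm (z - (x + \<delta>)) \<le> nrm (z - x) - 1"
      unfolding nrm_le_iff
    proof
      fix i
      have "\<bar>(z - x) $ i\<bar> \<le> int (nrm (z - x))" by (rule abs_nth_le_nrm)
      then show "\<bar>(z - (x + \<delta>)) $ i\<bar> \<le> int (nrm (z - x) - 1)"
        using comp[of i] n by (auto simp: \<delta>_def of_nat_diff split: if_splits)
    qed
    then show "nrm (z - (x + \<delta>)) < nrm (z - x)" using n by linarith
    fix D assume D: "nrm x \<le> D" "nrm z \<le> D"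
    show "nrm (x + \<delta>) \<le> D" unfolding nrm_le_iff
    proof
      fix i
      have "\<bar>x $ i\<bar> \<le> int D" "\<bar>z $ i\<bar> \<le> int D" using D by (auto simp: nrm_le_iff)
      then show "\<bar>(x + \<delta>) $ i\<bar> \<le> int D" by (auto simp: \<delta>_def sgn_if)
    qed
  qed
qed

text \<open>Unit steps towards z never leave a cube that contains both end points.\<close>

lemma cube_connected:
  fixes P :: "int ^ 'd \<Rightarrow> bool"
  assumes "P x" "nrm x \<le> D" "nrm z \<le> D"
    and step: "\<And>x \<delta>. nrm x \<le> D \<Longrightarrow> nrm \<delta> \<le> 1 \<Longrightarrow> P x \<Longrightarrow> P (x + \<delta>)"
  shows "P z"
  using assms(1,2)
proof (induction "nrm (z - x)" arbitrary: x rule: less_induct)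
  case less
  show ?case
  proof (cases "x = z")
    case False
    then obtain \<delta> where d: "nrm \<delta> \<le> 1" "nrm (z - (x + \<delta>)) < nrm (z - x)"
      "\<And>D. nrm x \<le> D \<Longrightarrow> nrm z \<le> D \<Longrightarrow> nrm (x + \<delta>) \<le> D" using unit_step_towards by blast
    show ?thesis
      by (rule less.hyps[OF d(2)]) (use step[of x \<delta>] d less.prems assms(3) in auto)
  qed (use less.prems in simp)
qed

lemma card_cube_le: "card ((\<lambda>x. f x) ` cube s :: 'v set) \<le> (2 * s + 1) ^ CARD('d)" for f :: "int ^ 'd \<Rightarrow> 'v"
  using card_image_le[OF finite_cube, of f s] by (simp add: card_cube)

section \<open>Propagation of backward clusters between boxes\<close>

context torus_walk
begin

definition Bx :: "nat \<Rightarrow> int ^ 'd \<Rightarrow> (int ^ 'd) set" where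
  "Bx s z = (\<lambda>x. pr (z + x)) ` cube s"

lemma Bx_subset: "Bx s z \<subseteq> T"
  by (auto simp: Bx_def torus_proj_in_torus[OF L])

lemma finite_Bx [simp]: "finite (Bx s z)"
  by (simp add: Bx_def)

lemma Bx_cong: "pr z = pr z' \<Longrightarrow> Bx s z = Bx s z'"
  unfolding Bx_def by (intro image_cong refl torus_proj_add_cong)

lemma card_Bx_le: "card (Bx s z) \<le> (2 * s + 1) ^ CARD('d)"
  unfolding Bx_def by (rule card_cube_le)

lemma card_Bx:
  assumes "2 * s < L"
  shows "card (Bx s z) = (2 * s + 1) ^ CARD('d)"
proof -
  have "inj_on (\<lambda>x. pr (z + x)) (cube s)"
  proof (rule inj_onI, rule ccontr)
    fix x y assume xy: "x \<in> cube s" "y \<in> cube s" "pr (z + x) = pr (z + y)" "x \<noteq> y"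
    then have "L \<le> nrm ((z + x) - (z + y))" by (intro same_proj_far) auto
    also have "\<dots> \<le> nrm x + nrm y" using nrm_triangle_diff[of x y] by simp
    finally show False using xy assms by (auto simp: cube_def)
  qed
  then show ?thesis unfolding Bx_def by (simp add: card_image card_cube)
qed

text \<open>All n-element sets Z are quantified over, so that the property may be applied to a part
  of the backward cluster, which is itself random. The price is a union bound over these
  sets.\<close>

definition expands :: "((int ^ 'd) \<times> (int ^ 'd)) set \<Rightarrow> nat \<Rightarrow> nat \<Rightarrow> nat \<Rightarrow> int ^ 'd \<Rightarrow> bool" where
  "expands r s n m z \<longleftrightarrow> (\<forall>\<delta>\<in>cube 1. \<forall>Z\<subseteq>Bx s z. card Z = n \<longrightarrow>
      m \<le> card {v \<in> Bx s (z + \<delta>). \<exists>y\<in>Z. (v, y) \<in> r})"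

lemma expands_Back:
  assumes "expands r s n m z" "nrm \<delta> \<le> 1" "n \<le> card (Back r u \<inter> Bx s z)"
  shows "m \<le> card (Back r u \<inter> Bx s (z + \<delta>))"
proof -
  obtain Z where Z: "Z \<subseteq> Back r u \<inter> Bx s z" "card Z = n" by (rule obtain_subset_with_card_n[OF assms(3)])
  have "m \<le> card {v \<in> Bx s (z + \<delta>). \<exists>y\<in>Z. (v, y) \<in> r}"
    using assms(1,2) Z unfolding expands_def cube_def by blast
  also have "\<dots> \<le> card (Back r u \<inter> Bx s (z + \<delta>))"
  proof (rule card_mono)
    show "{v \<in> Bx s (z + \<delta>). \<exists>y\<in>Z. (v, y) \<in> r} \<subseteq> Back r u \<inter> Bx s (z + \<delta>)"
      using Z(1) Back_step[of _ _ r u] by blast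
  qed simp
  finally show ?thesis .
qed

lemma expands_proj: "expands r s n m (pr z) \<longleftrightarrow> expands r s n m z"
proof -
  have "Bx s (pr z + \<delta>) = Bx s (z + \<delta>)" for \<delta>
    by (rule Bx_cong, rule torus_proj_add_cong) simp_all
  moreover have "Bx s (pr z) = Bx s z" by (rule Bx_cong) simp
  ultimately show ?thesis by (simp add: expands_def)
qed

lemma Back_everywhere:
  assumes "\<And>z. z \<in> T \<Longrightarrow> expands r s n n z" "n \<le> card (Back r u \<inter> Bx s z0)"
  shows "n \<le> card (Back r u \<inter> Bx s z)"
proof (rule cube_connected[of "\<lambda>z. n \<le> card (Back r u \<inter> Bx s z)" z0 "max (nrm z0) (nrm z)"])
  fix x \<delta> :: "int ^ 'd" assume "nrm \<delta> \<le> 1" "n \<le> card (Back r u \<inter> Bx s x)"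
  moreover have "expands r s n n x" using assms(1)[of "pr x"] torus_proj_in_torus[OF L] expands_proj by blast
  ultimately show "n \<le> card (Back r u \<inter> Bx s (x + \<delta>))" using expands_Back by blast
qed (use assms(2) in auto)

text \<open>Starting from the single vertex x, the zero shift with doubling raises the cluster in
  the box at x to size n'. After that the box is moved by unit shifts, where growth from n' to 2 n'
  more than preserves the size.\<close>

lemma Back_grows:
  assumes exp: "\<And>n z. 1 \<le> n \<Longrightarrow> n \<le> n' \<Longrightarrow> nrm z \<le> D0 \<Longrightarrow> expands r s n (2 * n) z"
    and x: "nrm x \<le> D0" "pr x \<in> Back r u" and z: "nrm z \<le> D0" and n': "n' \<ge> 1"
  shows "n' \<le> card (Back r u \<inter> Bx s z)"
proof -
  have at_x: "n \<le> card (Back r u \<inter> Bx s x)" if "n \<le> n'" for n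
    using that
  proof (induction n)
    case (Suc n)
    show ?case
    proof (cases "n = 0")
      case True
      have "pr x \<in> Back r u \<inter> Bx s x" using x by (auto simp: Bx_def cube_def intro!: image_eqI[of _ _ 0])
      then have "card (Back r u \<inter> Bx s x) > 0" by (auto simp: card_gt_0_iff)
      then show ?thesis using True by simp
    next
      case False
      have "2 * n \<le> card (Back r u \<inter> Bx s (x + 0))"
        by (rule expands_Back[OF exp[of n x]]) (use False Suc x in auto)
      then show ?thesis using False by simp
    qed
  qed simp
  show ?thesis
  proof (rule cube_connected[of "\<lambda>z. n' \<le> card (Back r u \<inter> Bx s z)" x D0 z])
    fix y \<delta> :: "int ^ 'd" assume y: "nrm y \<le> D0" "nrm \<delta> \<le> 1" "n' \<le> card (Back r u \<inter> Bx s y)"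
    have "2 * n' \<le> card (Back r u \<inter> Bx s (y + \<delta>))"
      by (rule expands_Back[OF exp[of n' y]]) (use y n' in auto)
    then show "n' \<le> card (Back r u \<inter> Bx s (y + \<delta>))" by simp
  qed (use at_x x z in auto)
qed

end

section \<open>Union bounds for expansion and activation\<close>

context frog
begin

lemma rel_event: "{\<omega> \<in> space M. P (rel l \<omega>)} \<in> events"
  by (rule rel_planted_indep(3)[OF sets.top])

text \<open>If the set D of in-neighbours has fewer than m elements, no particle leads from V - D to
  Y. The union over D costs the power of \<open>card V + 1\<close>, and removing D costs at most m
  in the mean because each \<open>hit\<close> is at most 1.\<close>

lemma few_in_neighbours:
  assumes "V \<subseteq> T" "Y \<subseteq> T"
  shows "prob {\<omega> \<in> space M. card {v \<in> V. \<exists>y\<in>Y. (v, y) \<in> rel l \<omega>} < m} \<le>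
    (real (card V) + 1) ^ m * exp (- lam * ((\<Sum>v\<in>V. hit l Y v) - real m))"
proof -
  let ?F = "{D. D \<subseteq> V \<and> card D \<le> m}"
  have finV: "finite V" by (rule finite_subset[OF assms(1)]) simp
  have finF: "finite ?F" by (rule finite_subset[of _ "Pow V"]) (use finV in auto)
  let ?E = "\<lambda>D. {\<omega> \<in> space M. rel l \<omega> \<inter> (V - D) \<times> Y = {}}"
  have "prob {\<omega> \<in> space M. card {v \<in> V. \<exists>y\<in>Y. (v, y) \<in> rel l \<omega>} < m} \<le> prob (\<Union>D\<in>?F. ?E D)"
  proof (rule finite_measure_mono)
    show "{\<omega> \<in> space M. card {v \<in> V. \<exists>y\<in>Y. (v, y) \<in> rel l \<omega>} < m} \<subseteq> (\<Union>D\<in>?F. ?E D)"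
    proof clarify
      fix \<omega> assume "\<omega> \<in> space M" "card {v \<in> V. \<exists>y\<in>Y. (v, y) \<in> rel l \<omega>} < m"
      then show "\<omega> \<in> (\<Union>D\<in>?F. ?E D)"
        by (intro UN_I[of "{v \<in> V. \<exists>y\<in>Y. (v, y) \<in> rel l \<omega>}"]) auto
    qed
    show "(\<Union>D\<in>?F. ?E D) \<in> events" by (intro sets.finite_UN finF rel_event)
  qed
  also have "\<dots> \<le> (\<Sum>D\<in>?F. prob (?E D))"
    by (rule finite_measure_subadditive_finite[OF finF]) (auto intro: rel_event)
  also have "\<dots> \<le> (\<Sum>D\<in>?F. exp (- lam * ((\<Sum>v\<in>V. hit l Y v) - real m)))"
  proof (rule sum_mono)
    fix D assume D: "D \<in> ?F"
    have "prob (?E D) = exp (- lam * (\<Sum>v\<in>V - D. hit l Y v))" by (rule prob_void) (use assms in auto)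
    also have "\<dots> \<le> exp (- lam * ((\<Sum>v\<in>V. hit l Y v) - real m))"
    proof -
      have "(\<Sum>v\<in>V. hit l Y v) = (\<Sum>v\<in>V - D. hit l Y v) + (\<Sum>v\<in>D. hit l Y v)"
        by (rule sum.subset_diff) (use D finV in auto)
      moreover have "(\<Sum>v\<in>D. hit l Y v) \<le> real (card D)"
        using sum_mono[of D "hit l Y" "\<lambda>_. 1"] hit_le_1 by simp
      moreover have "real (card D) \<le> real m" using D by simp
      ultimately have "(\<Sum>v\<in>V. hit l Y v) - real m \<le> (\<Sum>v\<in>V - D. hit l Y v)" by linarith
      then show ?thesis using mult_left_mono[of _ _ lam] lam by fastforce
    qed
    finally show "prob (?E D) \<le> exp (- lam * ((\<Sum>v\<in>V. hit l Y v) - real m))" .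
  qed
  also have "\<dots> = real (card ?F) * exp (- lam * ((\<Sum>v\<in>V. hit l Y v) - real m))" by simp
  also have "\<dots> \<le> (real (card V) + 1) ^ m * exp (- lam * ((\<Sum>v\<in>V. hit l Y v) - real m))"
  proof (rule mult_right_mono)
    have "real (card ?F) \<le> real ((card V + 1) ^ m)" using card_small_subsets[OF finV, of m] by (rule of_nat_mono)
    then show "real (card ?F) \<le> (real (card V) + 1) ^ m" by (simp add: add.commute)
  qed simp
  finally show ?thesis .
qed

lemma prob_finite_union_le:
  assumes "finite I" "\<And>i. i \<in> I \<Longrightarrow> E i \<in> events" "\<And>i. i \<in> I \<Longrightarrow> prob (E i) \<le> x" "F \<subseteq> (\<Union>i\<in>I. E i)"
  shows "prob F \<le> real (card I) * x"
proof -
  have "prob F \<le> prob (\<Union>i\<in>I. E i)" by (rule finite_measure_mono[OF assms(4)]) (use assms in auto)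
  also have "\<dots> \<le> (\<Sum>i\<in>I. prob (E i))" by (rule finite_measure_subadditive_finite) (use assms in auto)
  also have "\<dots> \<le> (\<Sum>i\<in>I. x)" by (rule sum_mono) (use assms in auto)
  finally show ?thesis by simp
qed

lemma prob_not_expands:
  assumes "finite C"
    and \<mu>: "\<And>z \<delta> Z. z \<in> C \<Longrightarrow> nrm \<delta> \<le> 1 \<Longrightarrow> Z \<subseteq> Bx s z \<Longrightarrow> card Z = n \<Longrightarrow> \<mu> \<le> (\<Sum>v\<in>Bx s (z + \<delta>). hit l Z v)"
  shows "prob {\<omega> \<in> space M. \<exists>z\<in>C. \<not> expands (rel l \<omega>) s n m z} \<le>
    real (card C) * 3 ^ CARD('d) * ((2 * real s + 1) ^ CARD('d) + 1) ^ (n + m) * exp (- lam * (\<mu> - real m))"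
proof -
  let ?V = "(2 * real s + 1) ^ CARD('d) + 1"
  define I where "I = (SIGMA z:C. (cube 1 :: (int ^ 'd) set) \<times> {Z. Z \<subseteq> Bx s z \<and> card Z = n})"
  define E where "E = (\<lambda>(z, \<delta>, Z). {\<omega> \<in> space M. card {v \<in> Bx s (z + \<delta>). \<exists>y\<in>Z. (v, y) \<in> rel l \<omega>} < m})"
  have fin: "finite {Z. Z \<subseteq> Bx s z \<and> card Z = n}" for z
    by (rule finite_subset[of _ "Pow (Bx s z)"]) auto
  have V: "real (card (Bx s z)) + 1 \<le> ?V" for z
  proof -
    have "real (card (Bx s z)) \<le> real ((2 * s + 1) ^ CARD('d))" by (rule of_nat_mono[OF card_Bx_le])
    then show ?thesis by (simp add: add.commute)
  qed
  have finI: "finite I" unfolding I_def using assms(1) fin by (intro finite_SigmaI finite_cartesian_product finite_cube) auto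
  have "prob {\<omega> \<in> space M. \<exists>z\<in>C. \<not> expands (rel l \<omega>) s n m z} \<le> real (card I) * (?V ^ m * exp (- lam * (\<mu> - real m)))"
  proof (rule prob_finite_union_le[OF finI, of E])
    show "E i \<in> events" for i
      by (cases i) (simp only: E_def prod.case, rule rel_event)
    show "prob (E i) \<le> ?V ^ m * exp (- lam * (\<mu> - real m))" if i: "i \<in> I" for i
    proof -
      obtain z \<delta> Z where i': "i = (z, \<delta>, Z)" by (cases i)
      have zZ: "z \<in> C" "nrm \<delta> \<le> 1" "Z \<subseteq> Bx s z" "card Z = n" using i by (auto simp: I_def i' cube_def)
      have "prob (E i) \<le> (real (card (Bx s (z + \<delta>))) + 1) ^ m * exp (- lam * ((\<Sum>v\<in>Bx s (z + \<delta>). hit l Z v) - real m))"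
        unfolding E_def i' prod.case by (rule few_in_neighbours) (use zZ Bx_subset in auto)
      also have "\<dots> \<le> ?V ^ m * exp (- lam * (\<mu> - real m))"
        using \<mu>[OF zZ] lam by (intro mult_mono power_mono V) (auto simp: mult_left_mono)
      finally show ?thesis .
    qed
    show "{\<omega> \<in> space M. \<exists>z\<in>C. \<not> expands (rel l \<omega>) s n m z} \<subseteq> (\<Union>i\<in>I. E i)"
    proof clarify
      fix \<omega> z assume w: "\<omega> \<in> space M" "z \<in> C" "\<not> expands (rel l \<omega>) s n m z"
      then obtain \<delta> Z where "\<delta> \<in> cube 1" "Z \<subseteq> Bx s z" "card Z = n"
        "\<not> m \<le> card {v \<in> Bx s (z + \<delta>). \<exists>y\<in>Z. (v, y) \<in> rel l \<omega>}" unfolding expands_def by blast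
      then show "\<omega> \<in> (\<Union>i\<in>I. E i)" using w by (intro UN_I[of "(z, \<delta>, Z)"]) (auto simp: I_def E_def)
    qed
  qed
  also have "\<dots> \<le> (real (card C) * 3 ^ CARD('d) * ?V ^ n) * (?V ^ m * exp (- lam * (\<mu> - real m)))"
  proof (rule mult_right_mono)
    have one: "real (card ((cube 1 :: (int ^ 'd) set) \<times> {Z. Z \<subseteq> Bx s z \<and> card Z = n})) \<le> 3 ^ CARD('d) * ?V ^ n" for z
    proof -
      have "card {Z. Z \<subseteq> Bx s z \<and> card Z = n} \<le> card {Z. Z \<subseteq> Bx s z \<and> card Z \<le> n}"
        by (rule card_mono) (auto intro: finite_subset[of _ "Pow (Bx s z)"])
      also have "\<dots> \<le> (card (Bx s z) + 1) ^ n" by (rule card_small_subsets) simp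
      finally have "real (card {Z. Z \<subseteq> Bx s z \<and> card Z = n}) \<le> real ((card (Bx s z) + 1) ^ n)" by (rule of_nat_mono)
      also have "\<dots> = (real (card (Bx s z)) + 1) ^ n" by (simp add: add.commute)
      also have "\<dots> \<le> ?V ^ n" by (rule power_mono[OF V]) simp
      finally show ?thesis by (simp add: card_cartesian_product card_cube)
    qed
    have "real (card I) = (\<Sum>z\<in>C. real (card ((cube 1 :: (int ^ 'd) set) \<times> {Z. Z \<subseteq> Bx s z \<and> card Z = n})))"
      unfolding I_def by (subst card_SigmaI) (use assms(1) fin in \<open>auto intro!: finite_cartesian_product\<close>)
    also have "\<dots> \<le> (\<Sum>z\<in>C. 3 ^ CARD('d) * ?V ^ n)" by (rule sum_mono) (rule one)
    finally show "real (card I) \<le> real (card C) * 3 ^ CARD('d) * ?V ^ n" by (simp add: mult.assoc)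
  qed simp
  also have "\<dots> = real (card C) * 3 ^ CARD('d) * ?V ^ (n + m) * exp (- lam * (\<mu> - real m))"
    by (simp add: power_add)
  finally show ?thesis .
qed

text \<open>The first step back from a single vertex: its in-neighbours in a window covered by boxes are
  so many that one of the boxes receives at least \<open>y\<close> of them.\<close>

lemma prob_no_rich_box:
  assumes "u \<in> T" "finite J" "J \<noteq> {}"
    and \<mu>: "\<mu> \<le> (\<Sum>v\<in>(\<Union>t\<in>J. Bx s (u + t)). hit l {u} v)"
  shows "prob {\<omega> \<in> space M. \<forall>z. card (Back (rel l \<omega>) u \<inter> Bx s z) < y} \<le>
    (real (card J) * (2 * real s + 1) ^ CARD('d) + 1) ^ (card J * y) * exp (- lam * (\<mu> - real (card J * y)))"
proof -
  let ?W = "\<Union>t\<in>J. Bx s (u + t)"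
  let ?V = "real (card J) * (2 * real s + 1) ^ CARD('d) + 1"
  have finW: "finite ?W" using assms by auto
  have "prob {\<omega> \<in> space M. \<forall>z. card (Back (rel l \<omega>) u \<inter> Bx s z) < y} \<le>
      prob {\<omega> \<in> space M. card {v \<in> ?W. \<exists>y\<in>{u}. (v, y) \<in> rel l \<omega>} < card J * y}"
  proof (rule finite_measure_mono)
    show "{\<omega> \<in> space M. \<forall>z. card (Back (rel l \<omega>) u \<inter> Bx s z) < y} \<subseteq>
        {\<omega> \<in> space M. card {v \<in> ?W. \<exists>y\<in>{u}. (v, y) \<in> rel l \<omega>} < card J * y}"
    proof clarify
      fix \<omega> assume w: "\<omega> \<in> space M" and b: "\<forall>z. card (Back (rel l \<omega>) u \<inter> Bx s z) < y"
      have "card {v \<in> ?W. \<exists>y\<in>{u}. (v, y) \<in> rel l \<omega>} \<le> card (\<Union>t\<in>J. Back (rel l \<omega>) u \<inter> Bx s (u + t))"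
        by (rule card_mono) (use assms(2) Back_step[OF _ Back_refl] in auto)
      also have "\<dots> \<le> (\<Sum>t\<in>J. card (Back (rel l \<omega>) u \<inter> Bx s (u + t)))" by (rule card_UN_le[OF assms(2)])
      also have "\<dots> < (\<Sum>t\<in>J. y)" by (rule sum_strict_mono[OF assms(2,3)]) (use b in auto)
      finally show "card {v \<in> ?W. \<exists>y\<in>{u}. (v, y) \<in> rel l \<omega>} < card J * y" by simp
    qed
  qed (rule rel_event)
  also have "\<dots> \<le> (real (card ?W) + 1) ^ (card J * y) * exp (- lam * ((\<Sum>v\<in>?W. hit l {u} v) - real (card J * y)))"
    by (rule few_in_neighbours) (use assms(1) Bx_subset in auto)
  also have "\<dots> \<le> ?V ^ (card J * y) * exp (- lam * (\<mu> - real (card J * y)))"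
  proof (intro mult_mono power_mono)
    have "card ?W \<le> (\<Sum>t\<in>J. card (Bx s (u + t)))" by (rule card_UN_le[OF assms(2)])
    also have "\<dots> \<le> (\<Sum>t\<in>J. (2 * s + 1) ^ CARD('d))" by (rule sum_mono) (rule card_Bx_le)
    finally have "card ?W \<le> card J * (2 * s + 1) ^ CARD('d)" by simp
    then have "real (card ?W) \<le> real (card J * (2 * s + 1) ^ CARD('d))" by (rule of_nat_mono)
    then show "real (card ?W) + 1 \<le> ?V" by (simp add: add.commute)
    show "exp (- lam * ((\<Sum>v\<in>?W. hit l {u} v) - real (card J * y))) \<le> exp (- lam * (\<mu> - real (card J * y)))"
      using \<mu> lam by (simp add: mult_left_mono)
  qed auto
  finally show ?thesis .
qed

text \<open>The planted particle is independent of the ordinary ones, so we may condition on \<open>rel\<close>.\<close>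

lemma prob_planted_given_rel:
  assumes "\<And>r. r \<subseteq> T \<times> T \<Longrightarrow> P r \<Longrightarrow> prob (X Planted -` B r \<inter> space M) \<le> x" "\<And>r. B r \<in> sets PM" "0 \<le> x"
  shows "{\<omega> \<in> space M. P (rel l \<omega>) \<and> X Planted \<omega> \<in> B (rel l \<omega>)} \<in> events"
    and "prob {\<omega> \<in> space M. P (rel l \<omega>) \<and> X Planted \<omega> \<in> B (rel l \<omega>)} \<le> x"
proof -
  let ?C = "{r. r \<subseteq> T \<times> T \<and> P r}"
  let ?E = "\<lambda>r. {\<omega> \<in> space M. rel l \<omega> = r \<and> X Planted \<omega> \<in> B r}"
  have finC: "finite ?C" by (rule finite_subset[of _ "Pow (T \<times> T)"]) auto
  have U: "{\<omega> \<in> space M. P (rel l \<omega>) \<and> X Planted \<omega> \<in> B (rel l \<omega>)} = (\<Union>r\<in>?C. ?E r)"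
    using rel_subset[of l] by auto
  have ev: "?E r \<in> events" for r by (rule rel_planted_indep(1)[OF assms(2)])
  show "{\<omega> \<in> space M. P (rel l \<omega>) \<and> X Planted \<omega> \<in> B (rel l \<omega>)} \<in> events"
    unfolding U by (intro sets.finite_UN finC ev)
  have "prob (\<Union>r\<in>?C. ?E r) = (\<Sum>r\<in>?C. prob (?E r))"
    by (rule finite_measure_finite_Union[OF finC]) (use ev in \<open>auto simp: disjoint_family_on_def\<close>)
  also have "\<dots> \<le> (\<Sum>r\<in>?C. x * prob {\<omega> \<in> space M. rel l \<omega> = r})"
  proof (rule sum_mono)
    fix r assume r: "r \<in> ?C"
    have "prob (?E r) = prob (X Planted -` B r \<inter> space M) * prob {\<omega> \<in> space M. rel l \<omega> = r}"
      by (rule rel_planted_indep(2)[OF assms(2)])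
    also have "\<dots> \<le> x * prob {\<omega> \<in> space M. rel l \<omega> = r}"
      by (rule mult_right_mono) (use assms(1) r in auto)
    finally show "prob (?E r) \<le> x * prob {\<omega> \<in> space M. rel l \<omega> = r}" .
  qed
  also have "\<dots> = x * prob (\<Union>r\<in>?C. {\<omega> \<in> space M. rel l \<omega> = r})"
    unfolding sum_distrib_left[symmetric]
    by (subst finite_measure_finite_Union[OF finC]) (use rel_event in \<open>auto simp: disjoint_family_on_def\<close>)
  also have "\<dots> \<le> x * 1" by (rule mult_left_mono[OF prob_le_1 assms(3)])
  finally show "prob {\<omega> \<in> space M. P (rel l \<omega>) \<and> X Planted \<omega> \<in> B (rel l \<omega>)} \<le> x" unfolding U by simp
qed

lemma prob_many_le:
  assumes "finite I" "\<And>i. i \<in> I \<Longrightarrow> E i \<in> events" "\<And>i. i \<in> I \<Longrightarrow> prob (E i) \<le> x" "n \<ge> 1"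
  shows "prob {\<omega> \<in> space M. n \<le> card {i \<in> I. \<omega> \<in> E i}} \<le> real (card I) * x / real n"
proof -
  let ?F = "\<lambda>\<omega>. \<Sum>i\<in>I. indicator (E i) \<omega> :: real"
  have card: "real (card {i \<in> I. \<omega> \<in> E i}) = ?F \<omega>" for \<omega>
    using assms(1) by (simp add: indicator_def sum.If_cases Int_def)
  have int: "integrable M (indicator (E i) :: 'a \<Rightarrow> real)" if "i \<in> I" for i
    using integrable_real_indicator[OF assms(2)[OF that]] by (simp add: emeasure_eq_measure)
  have "prob {\<omega> \<in> space M. ?F \<omega> \<ge> real n} \<le> expectation ?F / real n"
    by (rule integral_Markov_inequality_measure[of _ _ "space M"])
       (use assms in \<open>auto intro!: sum_nonneg Bochner_Integration.integrable_sum int\<close>)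
  also have "expectation ?F = (\<Sum>i\<in>I. prob (E i))"
    using assms(2) int by (subst Bochner_Integration.integral_sum) (auto intro!: sum.cong simp: Int_absorb1 sets.sets_into_space)
  also have "\<dots> / real n \<le> (\<Sum>i\<in>I. x) / real n"
    by (intro divide_right_mono sum_mono) (use assms in auto)
  also have "{\<omega> \<in> space M. ?F \<omega> \<ge> real n} = {\<omega> \<in> space M. n \<le> card {i \<in> I. \<omega> \<in> E i}}"
    unfolding card[symmetric] of_nat_le_iff ..
  finally show ?thesis by simp
qed

lemma reaches_rel: "(v, u) \<in> rel l \<omega> \<Longrightarrow> reaches L (\<lambda>v. N v \<omega>) (\<lambda>p. X p \<omega>) l v u"
  unfolding rel_def reaches_def by (force simp: present_def)

lemma reaches_planted: "k \<le> l \<Longrightarrow> reaches L (\<lambda>v. N v \<omega>) (\<lambda>p. X p \<omega>) l 0 (X Planted \<omega> k)"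
  unfolding reaches_def by (rule bexI[of _ Planted]) (auto simp: present_def)

abbreviation act :: "nat \<Rightarrow> 'a \<Rightarrow> (int ^ 'd) set" where
  "act l \<omega> \<equiv> activated L (\<lambda>v. N v \<omega>) (\<lambda>p. X p \<omega>) l"

lemma act_Back: "v \<in> act l \<omega> \<Longrightarrow> v \<in> Back (rel l \<omega>) u \<Longrightarrow> u \<in> act l \<omega>"
proof -
  assume v: "v \<in> act l \<omega>" "v \<in> Back (rel l \<omega>) u"
  have "(reaches L (\<lambda>v. N v \<omega>) (\<lambda>p. X p \<omega>) l)\<^sup>*\<^sup>* v u"
    using v(2) unfolding Back_def mem_Collect_eq
    by (induction rule: rtrancl_induct) (auto intro: rtranclp.rtrancl_into_rtrancl reaches_rel)
  then show ?thesis using v(1) by (auto simp: activated_def intro: rtranclp_trans)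
qed

lemma act_planted_Back:
  assumes "\<omega> \<in> space M" "X Planted \<omega> \<notin> av l (Back (rel l \<omega>) u)"
  shows "u \<in> act l \<omega>"
proof -
  obtain k where k: "k \<le> l" "X Planted \<omega> k \<in> Back (rel l \<omega>) u"
    using assms measurable_space[OF X_meas[OF Planted_particles]] by (auto simp: av_def)
  have "X Planted \<omega> k \<in> act l \<omega>" using reaches_planted[OF k(1)] by (auto simp: activated_def)
  then show ?thesis using act_Back k(2) by blast
qed

lemma act_subset: "\<omega> \<in> space M \<Longrightarrow> act l \<omega> \<subseteq> T"
proof
  fix u assume w: "\<omega> \<in> space M" and "u \<in> act l \<omega>"
  then have "(reaches L (\<lambda>v. N v \<omega>) (\<lambda>p. X p \<omega>) l)\<^sup>*\<^sup>* 0 u" by (simp add: activated_def)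
  then show "u \<in> T"
    by (induction rule: rtranclp_induct) (auto simp: zero_in_torus[OF L] reaches_def intro: X_in_T[OF _ w])
qed

text \<open>A union bound over u is impossible because x need not be small compared with 1 / L^d. If
  u is inactive, however, so is all of its backward cluster, and the planted particle misses the
  backward cluster of each of the at least n cluster members in \<open>Bx s 0\<close>. Hence at
  least n vertices of a single fixed box are bad, and Markov's inequality bounds this by volume
  times x / n.\<close>

lemma prob_not_all_activated:
  assumes n: "n \<ge> 1" and x: "0 \<le> x"
    and Gev: "prob {\<omega> \<in> space M. \<not> G (rel l \<omega>)} \<le> g"
    and G: "\<And>r u. G r \<Longrightarrow> u \<in> T \<Longrightarrow> n \<le> card (Back r u \<inter> Bx s 0)"
    and miss: "\<And>r u. r \<subseteq> T \<times> T \<Longrightarrow> G r \<Longrightarrow> u \<in> T \<Longrightarrow> 1 - hit l (Back r u) 0 \<le> x"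
  shows "\<exists>E\<in>events. {\<omega> \<in> space M. act l \<omega> \<noteq> T} \<subseteq> E \<and>
    prob E \<le> g + (2 * real s + 1) ^ CARD('d) * x / real n"
proof -
  define E where "E = (\<lambda>u. {\<omega> \<in> space M. G (rel l \<omega>) \<and> X Planted \<omega> \<in> av l (Back (rel l \<omega>) u)})"
  have E: "E u \<in> events" "prob (E u) \<le> x" if "u \<in> T" for u
    unfolding E_def
    by (rule prob_planted_given_rel; use x av_sets prob_avoid[OF Planted_particles] miss that in auto)+
  let ?A = "{\<omega> \<in> space M. n \<le> card {u \<in> Bx s 0. \<omega> \<in> E u}}"
  let ?B = "{\<omega> \<in> space M. \<not> G (rel l \<omega>)}"
  have A_ev: "?A \<in> events"
  proof -
    let ?P = "{D. D \<subseteq> Bx s 0 \<and> n \<le> card D}"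
    have "?A = (\<Union>D\<in>?P. \<Inter>u\<in>D. E u)"
    proof (intro equalityI subsetI)
      fix \<omega> assume w: "\<omega> \<in> ?A"
      then show "\<omega> \<in> (\<Union>D\<in>?P. \<Inter>u\<in>D. E u)" by (intro UN_I[of "{u \<in> Bx s 0. \<omega> \<in> E u}"]) auto
    next
      fix \<omega> assume "\<omega> \<in> (\<Union>D\<in>?P. \<Inter>u\<in>D. E u)"
      then obtain D where D: "D \<subseteq> Bx s 0" "n \<le> card D" "\<And>u. u \<in> D \<Longrightarrow> \<omega> \<in> E u" by auto
      then have "card D \<le> card {u \<in> Bx s 0. \<omega> \<in> E u}" by (intro card_mono) auto
      moreover have "D \<noteq> {}" using D(2) n by auto
      then have "\<omega> \<in> space M" using D(3) by (auto simp: E_def)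
      ultimately show "\<omega> \<in> ?A" using D(2) by auto
    qed
    also have "\<dots> \<in> events"
    proof (intro sets.finite_UN sets.finite_INT)
      show "finite ?P" by (rule finite_subset[of _ "Pow (Bx s 0)"]) auto
      fix D assume D: "D \<in> ?P"
      show "finite D" using D finite_subset[OF _ finite_Bx[of s 0]] by auto
      show "D \<noteq> {}" using D n by auto
      show "E u \<in> events" if "u \<in> D" for u using D E(1) Bx_subset that by blast
    qed
    finally show ?thesis .
  qed
  have "prob ?A \<le> real (card (Bx s 0)) * x / real n"
    by (rule prob_many_le) (use E[OF subsetD[OF Bx_subset]] n in auto)
  also have "\<dots> \<le> (2 * real s + 1) ^ CARD('d) * x / real n"
  proof (intro divide_right_mono mult_right_mono x)
    have "real (card (Bx s 0)) \<le> real ((2 * s + 1) ^ CARD('d))" by (rule of_nat_mono[OF card_Bx_le])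
    then show "real (card (Bx s 0)) \<le> (2 * real s + 1) ^ CARD('d)" by (simp add: add.commute)
  qed simp
  finally have pA: "prob ?A \<le> (2 * real s + 1) ^ CARD('d) * x / real n" .
  have "{\<omega> \<in> space M. act l \<omega> \<noteq> T} \<subseteq> ?B \<union> ?A"
  proof (rule ccontr)
    assume "\<not> {\<omega> \<in> space M. act l \<omega> \<noteq> T} \<subseteq> ?B \<union> ?A"
    then obtain \<omega> where w0: "\<omega> \<in> {\<omega> \<in> space M. act l \<omega> \<noteq> T}" "\<omega> \<notin> ?B" "\<omega> \<notin> ?A" by blast
    then have w: "\<omega> \<in> space M" "act l \<omega> \<noteq> T" "G (rel l \<omega>)" "card {u \<in> Bx s 0. \<omega> \<in> E u} < n"
      by (auto simp: not_le)
    obtain u where u: "u \<in> T" "u \<notin> act l \<omega>" using act_subset[OF w(1), of l] w(2) by auto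
    have "\<not> Back (rel l \<omega>) u \<inter> Bx s 0 \<subseteq> {u \<in> Bx s 0. \<omega> \<in> E u}"
    proof
      assume "Back (rel l \<omega>) u \<inter> Bx s 0 \<subseteq> {u \<in> Bx s 0. \<omega> \<in> E u}"
      then have "card (Back (rel l \<omega>) u \<inter> Bx s 0) \<le> card {u \<in> Bx s 0. \<omega> \<in> E u}" by (intro card_mono) auto
      then show False using G[OF w(3) u(1)] w(4) by simp
    qed
    then obtain v where v: "v \<in> Back (rel l \<omega>) u" "\<omega> \<notin> E v" by auto
    then have "v \<in> act l \<omega>" using w by (intro act_planted_Back) (auto simp: E_def)
    then show False using act_Back v(1) u(2) by blast
  qed
  moreover have "prob (?B \<union> ?A) \<le> g + (2 * real s + 1) ^ CARD('d) * x / real n"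
    using measure_Un_le[OF rel_event A_ev, of "\<lambda>r. \<not> G r" l] Gev pA by linarith
  moreover have "?B \<union> ?A \<in> events" using rel_event A_ev by (intro sets.Un)
  ultimately show ?thesis by blast
qed

end

section \<open>Union bounds at explicit scales\<close>

context walk_estimates
begin

text \<open>\<open>err0 L k\<close> bounds the probability to be further than half the side of the torus away at a
  time up to \<open>k\<close>, and \<open>greenB0\<close> the expected time spent in a set of \<open>n\<close> vertices: at most \<open>m0\<close>
  during the first \<open>m0\<close> steps, and uniform bounds on the transition probabilities afterwards.\<close>

definition err0 :: "nat \<Rightarrow> nat \<Rightarrow> real" where
  "err0 L k = A * real k * real ((L - 1) div 2) powr - \<kappa>"

definition G :: "nat \<Rightarrow> real" where
  "G l = (\<Sum>n\<le>l. pmf (S n) 0)"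

definition greenB0 :: "nat \<Rightarrow> nat \<Rightarrow> nat \<Rightarrow> nat \<Rightarrow> real" where
  "greenB0 L k m0 n = real m0 + real n * ((\<Sum>m=m0..k. b (m div 2)) + real (k + 1) * err0 L k)"

lemma G_ge_1: "1 \<le> G l"
proof -
  have "(\<Sum>n\<le>0. pmf (S n) 0) \<le> G l" unfolding G_def by (rule sum_mono2) auto
  then show ?thesis by simp
qed

lemma G_mono: "m \<le> n \<Longrightarrow> G m \<le> G n"
  unfolding G_def by (rule sum_mono2) auto

end

section \<open>Green sums and hitting probabilities on the torus\<close>

locale torus_estimates = walk_estimates q A p c \<kappa> rho K + torus_walk q L
  for q :: "(int ^ 'd) pmf" and A p c \<kappa> :: real and rho :: "nat \<Rightarrow> nat" and K :: "real \<Rightarrow> nat" and L :: nat +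
  assumes L3: "L \<ge> 3"
begin

abbreviation err :: "nat \<Rightarrow> real" where "err \<equiv> err0 L"

abbreviation greenB :: "nat \<Rightarrow> nat \<Rightarrow> nat \<Rightarrow> real" where "greenB \<equiv> greenB0 L"

lemma err_nonneg: "0 \<le> err k"
  using A by (simp add: err0_def)

lemma displacement_err: "m \<le> k \<Longrightarrow> measure (S m) {x. nrm x > (L - 1) div 2} \<le> err k"
proof -
  assume m: "m \<le> k"
  have "measure (S m) {x. nrm x > (L - 1) div 2} \<le> A * real m * real ((L - 1) div 2) powr - \<kappa>"
    by (rule poly_disp) (use L3 in linarith)
  also have "\<dots> \<le> err k" unfolding err0_def using m A by (intro mult_right_mono mult_left_mono) auto
  finally show ?thesis .
qed

text \<open>\<open>(L - 1) div 2\<close> is the largest radius below half the side, as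
  \<open>tk_le_b\<close> requires.\<close>

lemma tk_upper: "m \<le> k \<Longrightarrow> tk m v u \<le> b (m div 2) + err k"
  using tk_le_b[of "(L - 1) div 2" m v u] displacement_err[of m k] L3 by fastforce

lemma tk_diag_lower: "pmf (S m) 0 \<le> tk m u u"
  using pmf_le_tk[of m u u] by simp

lemma tk_diag_upper:
  assumes "m \<le> k"
  shows "tk m u u \<le> pmf (S m) 0 + err k"
proof -
  have "{x :: int ^ 'd. pr x = pr (u - u)} \<subseteq> {0} \<union> {x. nrm x > (L - 1) div 2}"
  proof
    fix x :: "int ^ 'd" assume "x \<in> {x. pr x = pr (u - u)}"
    then have "pr x = pr 0" by simp
    then have "x = 0 \<or> L \<le> nrm x" using same_proj_far[of L x 0] by auto
    then show "x \<in> {0} \<union> {x. nrm x > (L - 1) div 2}" using L3 by auto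
  qed
  then have "tk m u u \<le> measure (S m) ({0} \<union> {x. nrm x > (L - 1) div 2})"
    unfolding tk_def by (rule measure_pmf.finite_measure_mono) simp
  also have "\<dots> \<le> measure (S m) {0} + measure (S m) {x. nrm x > (L - 1) div 2}" by (rule measure_Un_le) auto
  finally show ?thesis using displacement_err[OF assms] by (simp add: measure_pmf_single)
qed

lemma green_diag_lower: "G l \<le> (\<Sum>n\<le>l. tk n u u)"
  unfolding G_def by (rule sum_mono) (rule tk_diag_lower)

lemma green_diag_upper: "(\<Sum>n\<le>l. tk n u u) \<le> G l + real (l + 1) * err l"
proof -
  have "(\<Sum>n\<le>l. tk n u u) \<le> (\<Sum>n\<le>l. pmf (S n) 0 + err l)" by (rule sum_mono) (simp add: tk_diag_upper)
  then show ?thesis by (simp add: G_def sum.distrib)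
qed

lemma greenB_mono: "n \<le> n' \<Longrightarrow> greenB k m0 n \<le> greenB k m0 n'"
  unfolding greenB0_def using b_pos err_nonneg[of k]
  by (intro add_left_mono mult_right_mono add_nonneg_nonneg sum_nonneg) (auto simp: less_imp_le)

lemma green_set_upper:
  assumes "Z \<subseteq> T" "m0 \<le> k + 1"
  shows "(\<Sum>n\<le>k. \<Sum>y'\<in>Z. tk n y y') \<le> greenB k m0 (card Z)"
proof -
  have finZ: "finite Z" by (rule finite_subset[OF assms(1)]) simp
  have "(\<Sum>n\<le>k. \<Sum>y'\<in>Z. tk n y y') = (\<Sum>n<m0. \<Sum>y'\<in>Z. tk n y y') + (\<Sum>n=m0..k. \<Sum>y'\<in>Z. tk n y y')"
  proof -
    have "{..k} = {..<m0} \<union> {m0..k}" using assms(2) by auto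
    then show ?thesis by (simp only:) (subst sum.union_disjoint; auto)
  qed
  also have "(\<Sum>n<m0. \<Sum>y'\<in>Z. tk n y y') \<le> (\<Sum>n<m0. 1)"
  proof (rule sum_mono)
    fix n
    have "(\<Sum>y'\<in>Z. tk n y y') \<le> (\<Sum>y'\<in>T. tk n y y')" by (rule sum_mono2) (use assms in auto)
    then show "(\<Sum>y'\<in>Z. tk n y y') \<le> 1" by (simp add: sum_tk)
  qed
  also have "(\<Sum>n=m0..k. \<Sum>y'\<in>Z. tk n y y') \<le> (\<Sum>n=m0..k. real (card Z) * (b (n div 2) + err k))"
  proof (rule sum_mono)
    fix n assume "n \<in> {m0..k}"
    then have "(\<Sum>y'\<in>Z. tk n y y') \<le> (\<Sum>y'\<in>Z. b (n div 2) + err k)" by (intro sum_mono tk_upper) auto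
    then show "(\<Sum>y'\<in>Z. tk n y y') \<le> real (card Z) * (b (n div 2) + err k)" by simp
  qed
  also have "\<dots> = real (card Z) * (\<Sum>m=m0..k. b (m div 2)) + real (card Z) * (real (k + 1 - m0) * err k)"
    by (simp add: sum.distrib algebra_simps flip: sum_distrib_left)
  also have "\<dots> \<le> real (card Z) * (\<Sum>m=m0..k. b (m div 2)) + real (card Z) * (real (k + 1) * err k)"
    by (intro add_left_mono mult_left_mono mult_right_mono err_nonneg) auto
  finally show ?thesis by (simp add: greenB0_def algebra_simps)
qed

text \<open>Only the even times 2 n with n in (k / 4, k / 2] are counted, since
  \<open>near_diag\<close> concerns even times. There are at least k / 8 of them, each contributing
  at least \<open>b k\<close> / 2.\<close>

lemma green_near_lower:
  assumes k: "k \<ge> 8" and s: "3 * real s \<le> c * real (rho (k div 4))" and xy: "nrm (x - y) \<le> 3 * s"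
  shows "real k * b k / 16 \<le> (\<Sum>n\<le>k. tk n (pr y) (pr x))"
proof -
  let ?I = "{k div 4 + 1..k div 2}"
  have cnt: "real k / 8 \<le> real (card ?I)"
  proof -
    have "k < 4 * (k div 4) + 4" "2 \<le> k div 4" using k by linarith+
    moreover have "2 * (k div 4) \<le> k div 2" by linarith
    ultimately have "k \<le> 8 * (k div 2 - k div 4)" by linarith
    then have "real k \<le> 8 * real (k div 2 - k div 4)" by linarith
    then show ?thesis by simp
  qed
  have "real k * b k / 16 = real k / 8 * (b k / 2)" by simp
  also have "\<dots> \<le> real (card ?I) * (b k / 2)" using cnt b_pos[of k] by (intro mult_right_mono) auto
  also have "\<dots> = (\<Sum>n\<in>?I. b k / 2)" by simp
  also have "\<dots> \<le> (\<Sum>n\<in>?I. tk (2 * n) (pr y) (pr x))"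
  proof (rule sum_mono)
    fix n assume n: "n \<in> ?I"
    have "real (nrm (x - y)) \<le> 3 * real s" using xy by linarith
    also have "\<dots> \<le> c * real (rho (k div 4))" by (rule s)
    also have "\<dots> \<le> c * real (rho n)" using rho_mono[of "k div 4" n] n c by (intro mult_left_mono) auto
    finally have "b n / 2 \<le> pmf (S (2 * n)) (x - y)" by (rule near_diag[rotated]) (use n in auto)
    also have "\<dots> \<le> tk (2 * n) y x" by (rule pmf_le_tk)
    also have "\<dots> = tk (2 * n) (pr y) (pr x)" by (simp add: tk_proj_left tk_proj_right)
    finally have "b n / 2 \<le> tk (2 * n) (pr y) (pr x)" .
    moreover have "n \<le> k" using n div_le_dividend[of k 2] by (meson atLeastAtMost_iff order_trans)
    ultimately show "b k / 2 \<le> tk (2 * n) (pr y) (pr x)" using b_antimono[of n k] by linarith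
  qed
  also have "\<dots> = (\<Sum>n\<in>(\<lambda>n. 2 * n) ` ?I. tk n (pr y) (pr x))"
    by (subst sum.reindex) (auto simp: inj_on_def)
  also have "\<dots> \<le> (\<Sum>n\<le>k. tk n (pr y) (pr x))" by (rule sum_mono2) auto
  finally show ?thesis .
qed

lemma hit_set_lower:
  assumes k: "k \<ge> 8" "k \<le> l" and s: "s \<ge> 1" "3 * real s \<le> c * real (rho (k div 4))"
    and z: "nrm \<delta> \<le> 1" "v \<in> Bx s (z + \<delta>)" "Z \<subseteq> Bx s z"
    and B: "0 < B" "\<And>y. y \<in> Z \<Longrightarrow> (\<Sum>n\<le>k. \<Sum>y'\<in>Z. tk n y y') \<le> B"
  shows "real (card Z) * (real k * b k / 16) / B \<le> hit l Z v"
proof -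
  obtain x where x: "v = pr (z + \<delta> + x)" "nrm x \<le> s" using z(2) by (auto simp: Bx_def cube_def)
  have Z: "Z \<subseteq> T" using z(3) Bx_subset by blast
  have v: "v \<in> T" using z(2) Bx_subset by blast
  have "real (card Z) * (real k * b k / 16) = (\<Sum>y\<in>Z. real k * b k / 16)" by simp
  also have "\<dots> \<le> (\<Sum>y\<in>Z. \<Sum>n\<le>k. tk n v y)"
  proof (rule sum_mono)
    fix y assume "y \<in> Z"
    then obtain w where w: "y = pr (z + w)" "nrm w \<le> s" using z(3) by (auto simp: Bx_def cube_def)
    have "nrm (z + w - (z + \<delta> + x)) \<le> nrm w + (nrm \<delta> + nrm x)"
      using nrm_triangle_diff[of w "\<delta> + x"] nrm_triangle[of \<delta> x] by (simp add: add.assoc)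
    then have "nrm (z + w - (z + \<delta> + x)) \<le> 3 * s" using x w z(1) s by linarith
    then show "real k * b k / 16 \<le> (\<Sum>n\<le>k. tk n v y)"
      unfolding x(1) w(1) by (rule green_near_lower[OF k(1) s(2)])
  qed
  also have "\<dots> = (\<Sum>n\<le>k. \<Sum>y\<in>Z. tk n v y)" by (rule sum.swap)
  also have "\<dots> \<le> hit k Z v * B" by (rule green_le_hit[OF Z v]) (use B in auto)
  also have "\<dots> \<le> hit l Z v * B" using B(1) hit_mono_time[OF k(2), of Z v] by (intro mult_right_mono) auto
  finally show ?thesis using B(1) by (simp add: field_simps)
qed

lemma expansion_lower:
  assumes k: "k \<ge> 8" "k \<le> l" and s: "s \<ge> 1" "3 * real s \<le> c * real (rho (k div 4))" "2 * s < L"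
    and z: "nrm \<delta> \<le> 1" "Z \<subseteq> Bx s z" "card Z = n" "n \<ge> 1" and m0: "m0 \<le> k + 1" "m0 \<ge> 1"
  shows "(2 * real s + 1) ^ CARD('d) * real n * (real k * b k / 16) / greenB k m0 n \<le> (\<Sum>v\<in>Bx s (z + \<delta>). hit l Z v)"
proof -
  have B: "greenB k m0 n > 0" unfolding greenB0_def using m0 b_pos err_nonneg[of k]
    by (intro add_pos_nonneg mult_nonneg_nonneg add_nonneg_nonneg sum_nonneg) (auto simp: less_imp_le)
  have Z: "Z \<subseteq> T" using z(2) Bx_subset by blast
  have "(2 * real s + 1) ^ CARD('d) * real n * (real k * b k / 16) / greenB k m0 n =
      (\<Sum>v\<in>Bx s (z + \<delta>). real (card Z) * (real k * b k / 16) / greenB k m0 n)"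
    using z(3) by (simp add: card_Bx[OF s(3)] add.commute)
  also have "\<dots> \<le> (\<Sum>v\<in>Bx s (z + \<delta>). hit l Z v)"
    by (intro sum_mono hit_set_lower[OF k s(1,2) z(1) _ z(2) B])
       (use green_set_upper[OF Z m0(1)] z(3) in auto)
  finally show ?thesis .
qed

text \<open>Summed over all starting points, the expected time at u is exactly l + 1, and every
  successful start accounts for at most the diagonal Green sum of it.\<close>

lemma sum_hit_lower:
  assumes "u \<in> T"
  shows "real (l + 1) / (G l + real (l + 1) * err l) \<le> (\<Sum>v\<in>T. hit l {u} v)"
proof -
  let ?B = "G l + real (l + 1) * err l"
  have B: "?B > 0" using G_ge_1[of l] err_nonneg[of l] by (simp add: add_pos_nonneg)
  have "real (l + 1) = (\<Sum>n\<le>l. \<Sum>v\<in>T. tk n v u)" by (simp add: sum_tk_left)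
  also have "\<dots> = (\<Sum>v\<in>T. \<Sum>n\<le>l. \<Sum>y\<in>{u}. tk n v y)" by (subst sum.swap) simp
  also have "\<dots> \<le> (\<Sum>v\<in>T. hit l {u} v * ?B)"
    by (intro sum_mono green_le_hit) (use assms B green_diag_upper[of u l] in auto)
  also have "\<dots> = (\<Sum>v\<in>T. hit l {u} v) * ?B" by (simp add: sum_distrib_right)
  finally show ?thesis using B by (simp add: field_simps)
qed

text \<open>The m additional steps let a walk that reaches u late still collect \<open>G m\<close>
  visits. Below criticality m is a small fraction of l; for the window below it equals l.\<close>

lemma sum_hit_part_upper:
  assumes "u \<in> T" "V \<subseteq> T"
  shows "(\<Sum>v\<in>V. hit l {u} v) * G m \<le> (\<Sum>n\<le>l + m. \<Sum>v\<in>V. tk n v u)"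
proof -
  have "(\<Sum>v\<in>V. hit l {u} v) * G m = (\<Sum>v\<in>V. hit l {u} v * G m)" by (simp add: sum_distrib_right)
  also have "\<dots> \<le> (\<Sum>v\<in>V. \<Sum>n\<le>l + m. \<Sum>y\<in>{u}. tk n v y)"
    by (intro sum_mono hit_le_green) (use assms G_ge_1[of m] green_diag_lower in auto)
  also have "\<dots> = (\<Sum>n\<le>l + m. \<Sum>v\<in>V. tk n v u)" by (subst sum.swap) simp
  finally show ?thesis .
qed

lemma sum_hit_upper:
  assumes "u \<in> T"
  shows "(\<Sum>v\<in>T. hit l {u} v) \<le> real (l + m + 1) / G m"
  using sum_hit_part_upper[OF assms order_refl, of l m] G_ge_1[of m] by (simp add: sum_tk_left field_simps)

text \<open>A start outside the window needs a displacement beyond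
  \<open>K \<delta> * rho (2 * l)\<close>, which has probability at most \<delta> at each time up to
  2 l. These starts are subtracted from the total of \<open>sum_hit_lower\<close>.\<close>

lemma sum_hit_window:
  assumes u: "u \<in> T" and l: "l \<ge> 1" and s: "s \<ge> 1" and \<delta>: "\<delta> > 0" and j: "K \<delta> * rho (2 * l) \<le> s * j"
  shows "real (l + 1) / (G l + real (l + 1) * err l) - \<delta> * real (2 * l + 1) / G l
    \<le> (\<Sum>v\<in>(\<Union>t\<in>(\<lambda>t. \<chi> i. int s * t $ i) ` cube j. Bx s (u + t)). hit l {u} v)"
proof -
  let ?W = "\<Union>t\<in>(\<lambda>t. \<chi> i. int s * t $ i) ` cube j. Bx s (u + t)"
  have W: "?W \<subseteq> T" using Bx_subset by blast
  have far: "K \<delta> * rho (2 * l) < nrm x" if v: "v \<in> T - ?W" and x: "pr (v + x) = pr u" for v x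
  proof (rule ccontr)
    assume "\<not> K \<delta> * rho (2 * l) < nrm x"
    then have "nrm (- x) \<le> s * j" using j by simp
    then have bd: "\<bar>(- x) $ i\<bar> \<le> int s * int j" for i unfolding nrm_le_iff by (metis of_nat_mult)
    \<comment> \<open>Division with remainder by s: every offset of norm at most s j is s t + w with
      t in \<open>cube j\<close> and w in \<open>cube s\<close>.\<close>
    define t where "t = (\<chi> i. (- x) $ i div int s)"
    define w where "w = (\<chi> i. (- x) $ i mod int s)"
    have dec: "- x = (\<chi> i. int s * t $ i) + w" by (simp add: vec_eq_iff t_def w_def)
    have t: "t \<in> cube j" unfolding cube_def mem_Collect_eq nrm_le_iff
    proof
      fix i
      have "(- x) $ i div int s \<le> (int s * int j) div int s"
        by (rule zdiv_mono1) (use bd[of i] s in auto)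
      moreover have "(- (int s * int j)) div int s \<le> (- x) $ i div int s"
        by (rule zdiv_mono1) (use bd[of i] s in auto)
      moreover have "(int s * int j) div int s = int j" "(- (int s * int j)) div int s = - int j"
        using s by (simp_all flip: mult_minus_right)
      ultimately show "\<bar>t $ i\<bar> \<le> int j" by (simp add: t_def)
    qed
    have w: "w \<in> cube s" unfolding cube_def mem_Collect_eq nrm_le_iff
    proof
      fix i
      have "0 \<le> (- x) $ i mod int s" "(- x) $ i mod int s < int s" using s by auto
      then show "\<bar>w $ i\<bar> \<le> int s" unfolding w_def by simp
    qed
    have "v = pr v" using v by (simp add: torus_proj_id)
    also have "\<dots> = pr ((v + x) - x)" by simp
    also have "\<dots> = pr (u - x)" by (rule torus_proj_diff_cong[OF x refl])
    also have "u - x = u + (\<chi> i. int s * t $ i) + w" using dec by (metis add.assoc diff_conv_add_uminus)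
    finally have "v \<in> Bx s (u + (\<chi> i. int s * t $ i))" unfolding Bx_def using w by blast
    then show False using v t by blast
  qed
  have "(\<Sum>v\<in>T - ?W. hit l {u} v) * G l \<le> (\<Sum>n\<le>l + l. \<Sum>v\<in>T - ?W. tk n v u)"
    by (rule sum_hit_part_upper[OF u]) auto
  also have "\<dots> \<le> (\<Sum>n\<le>l + l. \<delta>)"
  proof (rule sum_mono)
    fix n assume n: "n \<in> {..l + l}"
    have "(\<Sum>v\<in>T - ?W. tk n v u) \<le> measure (S n) {x. nrm x > K \<delta> * rho (2 * l)}"
      by (rule sum_tk_far) (use far in auto)
    also have "\<dots> \<le> \<delta>" by (rule nat_disp[OF \<delta>]) (use l n in auto)
    finally show "(\<Sum>v\<in>T - ?W. tk n v u) \<le> \<delta>" .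
  qed
  finally have "(\<Sum>v\<in>T - ?W. hit l {u} v) \<le> \<delta> * real (2 * l + 1) / G l"
    using G_ge_1[of l] by (simp add: field_simps mult_2)
  moreover have "(\<Sum>v\<in>T. hit l {u} v) = (\<Sum>v\<in>T - ?W. hit l {u} v) + (\<Sum>v\<in>?W. hit l {u} v)"
    by (rule sum.subset_diff[OF W]) simp
  ultimately show ?thesis using sum_hit_lower[OF u, of l] by linarith
qed

text \<open>The vertices outside the cube of radius \<open>D0\<close> are adjoined to the target.
  Then every block of k steps succeeds with the same lower bound wherever it starts, and blocks can
  be iterated; the probability of reaching the adjoined vertices is added back at the end. The 32 is
  16 from \<open>green_near_lower\<close> times 2 from k / (k + 1) at least 1 / 2.\<close>

lemma planted_miss:
  assumes k: "k \<ge> 8" "k \<le> l" and s: "s \<ge> 1" "3 * real s \<le> c * real (rho (k div 4))"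
    and D0: "D0 \<ge> 1" and U: "\<And>z. nrm z \<le> D0 \<Longrightarrow> n \<le> card (U \<inter> Bx s z)" and U: "U \<subseteq> T"
  shows "1 - hit l U 0 \<le> (1 - min 1 (real n * b k / 32)) ^ (l div k) + real (l + 1) * (A * real l * real D0 powr - \<kappa>)"
proof -
  let ?Far = "T - pr ` cube D0"
  let ?h = "min 1 (real n * b k / 32)"
  have av: "1 - hit k (U \<union> ?Far) w \<le> 1 - ?h" if w: "w \<in> T" for w
  proof (cases "w \<in> ?Far")
    case False
    then obtain x where x: "w = pr x" "nrm x \<le> D0" using w by (auto simp: cube_def)
    let ?Z = "U \<inter> Bx s x"
    have "w \<in> Bx s (x + 0)" unfolding Bx_def x(1) by (rule image_eqI[of _ _ 0]) (auto simp: cube_def)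
    then have "real (card ?Z) * (real k * b k / 16) / real (k + 1) \<le> hit k ?Z w"
    proof (rule hit_set_lower[OF k(1) order_refl s, rotated])
      fix y
      have "(\<Sum>n\<le>k. \<Sum>y'\<in>?Z. tk n y y') \<le> (\<Sum>n\<le>k. \<Sum>y'\<in>T. tk n y y')"
        by (intro sum_mono sum_mono2) (use U in auto)
      then show "(\<Sum>n\<le>k. \<Sum>y'\<in>?Z. tk n y y') \<le> real (k + 1)" by (simp add: sum_tk)
    qed auto
    moreover have "real n * b k / 32 \<le> real (card ?Z) * (real k * b k / 16) / real (k + 1)"
    proof -
      have "real n * b k / 32 \<le> real (card ?Z) * b k / 32"
        using assms(6)[OF x(2)] b_pos[of k] by (intro divide_right_mono mult_right_mono) auto
      also have "\<dots> = real (card ?Z) * b k / 16 * (1 / 2)" by simp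
      also have "\<dots> \<le> real (card ?Z) * b k / 16 * (real k / real (k + 1))"
        using k b_pos[of k] by (intro mult_left_mono) (auto simp: field_simps)
      finally show ?thesis by (simp add: field_simps)
    qed
    moreover have "hit k ?Z w \<le> hit k (U \<union> ?Far) w" by (rule hit_mono_set) auto
    ultimately have "real n * b k / 32 \<le> hit k (U \<union> ?Far) w" by linarith
    then show ?thesis by (simp add: min_le_iff_disj)
  qed (simp add: hit_in)
  have 0: "0 \<in> T" by (rule zero_in_torus[OF L])
  have "1 - hit l (U \<union> ?Far) 0 \<le> 1 - hit (l div k * k) (U \<union> ?Far) 0"
    using hit_mono_time[of "l div k * k" l "U \<union> ?Far" 0] by simp
  also have "\<dots> \<le> (1 - ?h) ^ (l div k)" by (rule avoid_mult_le[OF av _ 0]) auto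
  finally have 1: "1 - hit l (U \<union> ?Far) 0 \<le> (1 - ?h) ^ (l div k)" .
  have "hit l ?Far 0 \<le> (\<Sum>n\<le>l. \<Sum>y\<in>?Far. tk n 0 y)" by (rule hit_le_sum_tk) (use 0 in auto)
  also have "\<dots> \<le> (\<Sum>n\<le>l. A * real l * real D0 powr - \<kappa>)"
  proof (rule sum_mono)
    fix n assume n: "n \<in> {..l}"
    have "(\<Sum>y\<in>?Far. tk n 0 y) = (\<Sum>y\<in>?Far. tk n y 0)" by (rule sum.cong) (auto simp: tk_sym)
    also have "\<dots> \<le> measure (S n) {x. nrm x > D0}"
    proof (rule sum_tk_far)
      fix v x assume v: "v \<in> ?Far" and x: "pr (v + x) = pr 0"
      show "D0 < nrm x"
      proof (rule ccontr)
        assume "\<not> D0 < nrm x"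
        then have c: "- x \<in> cube D0" by (simp add: cube_def)
        have "v = pr ((v + x) - x)" using v by (simp add: torus_proj_id)
        also have "\<dots> = pr (0 - x)" by (rule torus_proj_diff_cong[OF x refl])
        finally have "v \<in> pr ` cube D0" using c by simp
        then show False using v by blast
      qed
    qed auto
    also have "\<dots> \<le> A * real n * real D0 powr - \<kappa>" by (rule poly_disp[OF D0])
    also have "\<dots> \<le> A * real l * real D0 powr - \<kappa>" using n A by (intro mult_right_mono mult_left_mono) auto
    finally show "(\<Sum>y\<in>?Far. tk n 0 y) \<le> A * real l * real D0 powr - \<kappa>" .
  qed
  finally have "hit l ?Far 0 \<le> real (l + 1) * (A * real l * real D0 powr - \<kappa>)" by simp
  then show ?thesis using 1 hit_Un_le[of l U ?Far 0] by linarith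
qed

end

section \<open>Probability bounds for activation, coverage and the planted particle\<close>

locale frog_estimates = torus_estimates q A p c \<kappa> rho K L + frog q L M Q lam N X
  for q :: "(int ^ 'd) pmf" and A p c \<kappa> :: real and rho :: "nat \<Rightarrow> nat" and K :: "real \<Rightarrow> nat" and L :: nat
    and M :: "'a measure" and Q :: "int ^ 'd \<Rightarrow> int ^ 'd \<Rightarrow> real" and lam :: real
    and N :: "int ^ 'd \<Rightarrow> 'a \<Rightarrow> nat" and X :: "(int ^ 'd) particle \<Rightarrow> 'a \<Rightarrow> nat \<Rightarrow> int ^ 'd"
begin

text \<open>Union bounds at two scales: boxes of radius \<open>s\<close> natural for the lifespan \<open>l\<close>, used all over the
  torus, and boxes of radius \<open>s'\<close> natural for the shorter time \<open>k\<close>, used only near the origin.\<close>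

lemma prob_not_all_activated_le:
  assumes k: "k \<ge> 8" "k \<le> l"
    and s: "s \<ge> 1" "3 * real s \<le> c * real (rho (l div 4))" "2 * s < L"
    and s': "s' \<ge> 1" "3 * real s' \<le> c * real (rho (k div 4))" "2 * s' < L"
    and y: "y \<ge> 1" and n': "n' \<ge> 1" and D0: "s \<le> D0"
    and \<delta>: "\<delta> > 0" and j: "K \<delta> * rho (2 * l) \<le> s * j"
    and \<mu>0: "\<mu>0 \<le> real (l + 1) / (G l + real (l + 1) * err l) - \<delta> * real (2 * l + 1) / G l"
    and \<mu>1: "\<mu>1 \<le> (2 * real s + 1) ^ CARD('d) * real y * (real l * b l / 16) / greenB l m0 y" "1 \<le> m0" "m0 \<le> l + 1"
    and \<mu>2: "\<mu>2 \<le> (2 * real s' + 1) ^ CARD('d) * (real k * b k / 16) / greenB k m1 n'" "1 \<le> m1" "m1 \<le> k + 1"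
    and x: "x = (1 - min 1 (real n' * b k / 32)) ^ (l div k) + real (l + 1) * (A * real l * real D0 powr - \<kappa>)"
    and \<tau>: "((2 * real s' + 1) ^ CARD('d) + 1) ^ 3 * exp (- lam * (\<mu>2 - 2)) \<le> \<tau>" "\<tau> \<le> 1 / 2"
  shows "\<exists>E\<in>events. {\<omega> \<in> space M. act l \<omega> \<noteq> T} \<subseteq> E \<and> prob E \<le>
    real L ^ CARD('d) * ((real ((2 * j + 1) ^ CARD('d)) * (2 * real s + 1) ^ CARD('d) + 1) ^ ((2 * j + 1) ^ CARD('d) * y)
        * exp (- lam * (\<mu>0 - real ((2 * j + 1) ^ CARD('d) * y))))
    + real L ^ CARD('d) * 3 ^ CARD('d) * ((2 * real s + 1) ^ CARD('d) + 1) ^ (y + y) * exp (- lam * (\<mu>1 - real y))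
    + (2 * real D0 + 1) ^ CARD('d) * 3 ^ CARD('d) * (2 * \<tau>)
    + (2 * real s' + 1) ^ CARD('d) * x / real n'"
proof -
  let ?J = "(\<lambda>t. \<chi> i. int s * t $ i) ` cube j :: (int ^ 'd) set"
  let ?cJ = "(2 * j + 1) ^ CARD('d)"
  define Z0 where "Z0 = (\<lambda>r. \<forall>u\<in>T. \<exists>z. y \<le> card (Back r u \<inter> Bx s z))"
  define Z1 where "Z1 = (\<lambda>r. \<forall>z\<in>T. expands r s y y z)"
  define Z2 where "Z2 = (\<lambda>r. \<forall>n\<in>{1..n'}. \<forall>z\<in>cube D0. expands r s' n (2 * n) z)"
  define GG where "GG = (\<lambda>r. Z0 r \<and> Z1 r \<and> Z2 r)"
  have D1: "D0 \<ge> 1" using D0 s by linarith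
  have l8: "l \<ge> 8" "l \<ge> 1" using k by auto
  have cardJ: "card ?J = ?cJ"
    by (subst card_image) (use s in \<open>auto simp: inj_on_def vec_eq_iff card_cube\<close>)
  have Jne: "?J \<noteq> {}" by (metis cardJ card.empty power_eq_0_iff zero_neq_one add_is_0 zero_less_one less_numeral_extra(3))
  let ?g0 = "real L ^ CARD('d) * ((real ?cJ * (2 * real s + 1) ^ CARD('d) + 1) ^ (?cJ * y) * exp (- lam * (\<mu>0 - real (?cJ * y))))"
  let ?g1 = "real L ^ CARD('d) * 3 ^ CARD('d) * ((2 * real s + 1) ^ CARD('d) + 1) ^ (y + y) * exp (- lam * (\<mu>1 - real y))"
  let ?g2 = "(2 * real D0 + 1) ^ CARD('d) * 3 ^ CARD('d) * (2 * \<tau>)"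
  have p0: "prob {\<omega> \<in> space M. \<not> Z0 (rel l \<omega>)} \<le> ?g0"
  proof -
    have "prob {\<omega> \<in> space M. \<not> Z0 (rel l \<omega>)} \<le> real (card T) *
        ((real ?cJ * (2 * real s + 1) ^ CARD('d) + 1) ^ (?cJ * y) * exp (- lam * (\<mu>0 - real (?cJ * y))))"
    proof (rule prob_finite_union_le[of T "\<lambda>u. {\<omega> \<in> space M. \<forall>z. card (Back (rel l \<omega>) u \<inter> Bx s z) < y}"])
      fix u assume u: "u \<in> T"
      have "\<mu>0 \<le> (\<Sum>v\<in>(\<Union>t\<in>?J. Bx s (u + t)). hit l {u} v)"
        by (rule order_trans[OF \<mu>0 sum_hit_window[OF u l8(2) s(1) \<delta> j]])
      from prob_no_rich_box[OF u _ Jne this, of y] cardJ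
      show "prob {\<omega> \<in> space M. \<forall>z. card (Back (rel l \<omega>) u \<inter> Bx s z) < y} \<le>
        (real ?cJ * (2 * real s + 1) ^ CARD('d) + 1) ^ (?cJ * y) * exp (- lam * (\<mu>0 - real (?cJ * y)))" by simp
      show "{\<omega> \<in> space M. \<forall>z. card (Back (rel l \<omega>) u \<inter> Bx s z) < y} \<in> events" by (rule rel_event)
    qed (auto simp: Z0_def not_le)
    then show ?thesis by (simp add: card_torus)
  qed
  have p1: "prob {\<omega> \<in> space M. \<not> Z1 (rel l \<omega>)} \<le> ?g1"
  proof -
    have "prob {\<omega> \<in> space M. \<exists>z\<in>T. \<not> expands (rel l \<omega>) s y y z} \<le>
      real (card T) * 3 ^ CARD('d) * ((2 * real s + 1) ^ CARD('d) + 1) ^ (y + y) * exp (- lam * (\<mu>1 - real y))"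
    proof (rule prob_not_expands)
      fix z \<delta> :: "int ^ 'd" and Z assume "nrm \<delta> \<le> 1" "Z \<subseteq> Bx s z" "card Z = y"
      then show "\<mu>1 \<le> (\<Sum>v\<in>Bx s (z + \<delta>). hit l Z v)"
        using expansion_lower[OF l8(1) order_refl s _ _ _ y \<mu>1(3,2)] \<mu>1(1) order_trans by blast
    qed simp
    then show ?thesis by (simp add: Z1_def card_torus)
  qed
  have p2: "prob {\<omega> \<in> space M. \<not> Z2 (rel l \<omega>)} \<le> ?g2"
  proof -
    let ?V = "(2 * real s' + 1) ^ CARD('d) + 1"
    let ?C = "(2 * real D0 + 1) ^ CARD('d) * 3 ^ CARD('d)"
    let ?E = "\<lambda>n. {\<omega> \<in> space M. \<exists>z\<in>cube D0. \<not> expands (rel l \<omega>) s' n (2 * n) z}"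
    have E: "prob (?E n) \<le> ?C * \<tau> ^ n" if n: "n \<in> {1..n'}" for n
    proof -
      have "prob (?E n) \<le> real (card (cube D0 :: (int ^ 'd) set)) * 3 ^ CARD('d) * ?V ^ (n + 2 * n) * exp (- lam * (real n * \<mu>2 - real (2 * n)))"
      proof (rule prob_not_expands)
        fix z \<delta> :: "int ^ 'd" and Z assume Z: "nrm \<delta> \<le> 1" "Z \<subseteq> Bx s' z" "card Z = n"
        have Bn: "greenB k m1 n > 0" "greenB k m1 n \<le> greenB k m1 n'"
        proof -
          show "greenB k m1 n > 0" unfolding greenB0_def using \<mu>2(2) b_pos err_nonneg[of k]
            by (intro add_pos_nonneg mult_nonneg_nonneg add_nonneg_nonneg sum_nonneg) (auto simp: less_imp_le)
          show "greenB k m1 n \<le> greenB k m1 n'" by (rule greenB_mono) (use n in simp)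
        qed
        have "real n * \<mu>2 \<le> real n * ((2 * real s' + 1) ^ CARD('d) * (real k * b k / 16) / greenB k m1 n')"
          by (rule mult_left_mono[OF \<mu>2(1)]) simp
        also have "\<dots> \<le> real n * ((2 * real s' + 1) ^ CARD('d) * (real k * b k / 16) / greenB k m1 n)"
          using Bn b_pos[of k] by (intro mult_left_mono divide_left_mono) auto
        also have "\<dots> = (2 * real s' + 1) ^ CARD('d) * real n * (real k * b k / 16) / greenB k m1 n" by simp
        also have "\<dots> \<le> (\<Sum>v\<in>Bx s' (z + \<delta>). hit l Z v)"
          by (rule expansion_lower[OF k s' Z _ \<mu>2(3,2)]) (use n in simp)
        finally show "real n * \<mu>2 \<le> (\<Sum>v\<in>Bx s' (z + \<delta>). hit l Z v)" .
      qed simp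
      \<comment> \<open>Per element of Z there is one factor \<open>?V\<close> for the choice of Z
        and two for an exceptional set of up to 2 n elements. The mean was bounded linearly in n by
        using the largest Green sum, the one at \<open>n'\<close>, so the whole bound is geometric
        in n.\<close>
      also have "?V ^ (n + 2 * n) = (?V ^ 3) ^ n" by (simp add: power_mult[symmetric])
      also have "exp (- lam * (real n * \<mu>2 - real (2 * n))) = exp (- lam * (\<mu>2 - 2)) ^ n"
        by (simp add: exp_of_nat_mult[symmetric] algebra_simps)
      also have "real (card (cube D0 :: (int ^ 'd) set)) = (2 * real D0 + 1) ^ CARD('d)" by (simp add: card_cube add.commute)
      also have "?C * (?V ^ 3) ^ n * exp (- lam * (\<mu>2 - 2)) ^ n = ?C * (?V ^ 3 * exp (- lam * (\<mu>2 - 2))) ^ n"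
        by (simp add: power_mult_distrib)
      also have "\<dots> \<le> ?C * \<tau> ^ n" by (intro mult_left_mono power_mono \<tau>) auto
      finally show ?thesis .
    qed
    have \<tau>0: "0 \<le> \<tau>" by (rule order_trans[OF _ \<tau>(1)]) auto
    have ev: "?E n \<in> events" for n by (rule rel_event)
    have "prob {\<omega> \<in> space M. \<not> Z2 (rel l \<omega>)} \<le> prob (\<Union>n\<in>{1..n'}. ?E n)"
      by (rule finite_measure_mono) (use ev in \<open>auto simp: Z2_def\<close>)
    also have "\<dots> \<le> (\<Sum>n\<in>{1..n'}. prob (?E n))"
      by (rule finite_measure_subadditive_finite) (auto intro: ev)
    also have "\<dots> \<le> (\<Sum>n\<in>{1..n'}. ?C * \<tau> ^ n)" by (rule sum_mono) (rule E)
    also have "\<dots> = ?C * (\<Sum>n\<in>{1..n'}. \<tau> ^ n)" by (simp add: sum_distrib_left)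
    also have "(\<Sum>n\<in>{1..n'}. \<tau> ^ n) \<le> 2 * \<tau>"
    proof -
      \<comment> \<open>The remainder is subtracted to make the induction close under
        \<open>\<tau> \<le> 1 / 2\<close>.\<close>
      have "(\<Sum>n\<in>{1..m}. \<tau> ^ n) \<le> 2 * \<tau> - 2 * (\<tau> ^ m * \<tau>)" if "m \<ge> 1" for m
        using that
      proof (induction m rule: dec_induct)
        case base
        show ?case using mult_left_mono[OF \<tau>(2) \<tau>0] by simp
      next
        case (step m)
        have "2 * (\<tau> ^ m * \<tau>) * \<tau> \<le> 2 * (\<tau> ^ m * \<tau>) * (1 / 2)"
          by (rule mult_left_mono[OF \<tau>(2)]) (use \<tau>0 in simp)
        moreover have "(\<Sum>n\<in>{1..Suc m}. \<tau> ^ n) = (\<Sum>n\<in>{1..m}. \<tau> ^ n) + \<tau> ^ m * \<tau>" by (simp add: mult.commute)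
        ultimately show ?case using step by (simp add: algebra_simps)
      qed
      from this[OF n'] show ?thesis using \<tau>0 by (smt (verit) mult_nonneg_nonneg zero_le_power)
    qed
    finally show ?thesis by (simp add: mult_left_mono)
  qed
  have pG: "prob {\<omega> \<in> space M. \<not> GG (rel l \<omega>)} \<le> ?g0 + ?g1 + ?g2"
  proof -
    have eq: "{\<omega> \<in> space M. \<not> GG (rel l \<omega>)} = {\<omega> \<in> space M. \<not> Z0 (rel l \<omega>)} \<union>
        ({\<omega> \<in> space M. \<not> Z1 (rel l \<omega>)} \<union> {\<omega> \<in> space M. \<not> Z2 (rel l \<omega>)})" by (auto simp: GG_def)
    have "prob {\<omega> \<in> space M. \<not> GG (rel l \<omega>)} \<le> prob {\<omega> \<in> space M. \<not> Z0 (rel l \<omega>)} +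
        (prob {\<omega> \<in> space M. \<not> Z1 (rel l \<omega>)} + prob {\<omega> \<in> space M. \<not> Z2 (rel l \<omega>)})"
      unfolding eq by (rule order_trans[OF measure_Un_le]) (auto intro!: rel_event sets.Un measure_Un_le)
    also have "\<dots> \<le> ?g0 + (?g1 + ?g2)" by (intro add_mono p0 p1 p2)
    finally show ?thesis by (simp only: add.assoc)
  qed
  \<comment> \<open>\<open>Z0\<close> gives y cluster vertices in some box, \<open>Z1\<close>
    carries them to the box at the origin, and any one of them there lies within \<open>D0\<close>
    and starts the growth given by \<open>Z2\<close>.\<close>
  have Gcard: "n' \<le> card (Back r u \<inter> Bx s' z)" if r: "GG r" and u: "u \<in> T" and z: "nrm z \<le> D0" for r u z
  proof -
    obtain z0 where "y \<le> card (Back r u \<inter> Bx s z0)" using r u by (auto simp: GG_def Z0_def)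
    then have "y \<le> card (Back r u \<inter> Bx s 0)"
      using Back_everywhere[of r s y u z0 0] r by (auto simp: GG_def Z1_def)
    then have "Back r u \<inter> Bx s 0 \<noteq> {}" using y by auto
    then obtain w where w: "nrm w \<le> s" "pr w \<in> Back r u" by (auto simp: Bx_def cube_def)
    show ?thesis
      by (rule Back_grows[of n' D0 r s' w]) (use r w D0 z n' in \<open>auto simp: GG_def Z2_def cube_def\<close>)
  qed
  have "\<exists>E\<in>events. {\<omega> \<in> space M. act l \<omega> \<noteq> T} \<subseteq> E \<and>
      prob E \<le> (?g0 + ?g1 + ?g2) + (2 * real s' + 1) ^ CARD('d) * x / real n'"
  proof (rule prob_not_all_activated[OF n' _ pG])
    show "0 \<le> x" unfolding x using A by (intro add_nonneg_nonneg zero_le_power mult_nonneg_nonneg) auto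
    show "n' \<le> card (Back r u \<inter> Bx s' 0)" if "GG r" "u \<in> T" for r u by (rule Gcard) (use that in auto)
    fix r u assume r: "r \<subseteq> T \<times> T" "GG r" "u \<in> T"
    have "Back r u \<subseteq> T"
    proof
      fix v assume "v \<in> Back r u"
      then have "(v, u) \<in> r\<^sup>*" by (simp add: Back_def)
      then show "v \<in> T" by (cases rule: converse_rtranclE) (use r in auto)
    qed
    then show "1 - hit l (Back r u) 0 \<le> x"
      unfolding x by (intro planted_miss[OF k s'(1,2) D1] Gcard r) auto
  qed
  then show ?thesis by (simp only: add.assoc)
qed

text \<open>Chebyshev's inequality for the number of unvisited vertices. The joint void probability
  of u and w exceeds the product by the factor exp (\<open>lam\<close> \<open>J u w\<close>), where
  \<open>J\<close> sums the probabilities of meeting both. For \<open>J\<close> at most \<eta> this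
  factor is harmless; for larger \<open>J\<close> the bound \<open>pp u\<close> suffices, and it is
  at most \<open>pp u\<close> \<open>J\<close> / \<eta>, whose sum over w is controlled by
  \<open>sum_hit_both_le\<close>.\<close>

lemma prob_all_visited:
  assumes \<eta>: "\<eta> > 0" and R: "\<And>u. u \<in> T \<Longrightarrow> (\<Sum>v\<in>T. hit l {u} v) \<le> R"
  shows "prob {\<omega> \<in> space M. T \<subseteq> Range (rel l \<omega>)} \<le>
    exp (lam * \<eta>) - 1 + (real l + 1)\<^sup>2 / (\<eta> * (real L ^ CARD('d) * exp (- lam * R)))"
proof -
  define U where "U = (\<lambda>u. {\<omega> \<in> space M. rel l \<omega> \<inter> T \<times> {u} = {}})"
  define R' where "R' = (\<lambda>u. \<Sum>v\<in>T. hit l {u} v)"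
  define pp where "pp = (\<lambda>u. exp (- lam * R' u))"
  define J where "J = (\<lambda>u w. \<Sum>v\<in>T. hit l {u} v + hit l {w} v - hit l {u, w} v)"
  have U_ev: "U u \<in> events" for u unfolding U_def by (rule rel_event)
  have pU: "prob (U u) = pp u" if "u \<in> T" for u
    unfolding U_def pp_def R'_def by (rule prob_void) (use that in auto)
  have pUU: "prob (U u \<inter> U w) \<le> exp (lam * \<eta>) * (pp u * pp w) + pp u * (J u w / \<eta>)" if uw: "u \<in> T" "w \<in> T" for u w
  proof -
    have Jn: "0 \<le> J u w" unfolding J_def
      using hit_Un_le[of l "{u}" "{w}"] by (intro sum_nonneg) (simp add: insert_commute)
    show ?thesis
    proof (cases "J u w \<le> \<eta>")
      case True
      have "U u \<inter> U w = {\<omega> \<in> space M. rel l \<omega> \<inter> T \<times> {u, w} = {}}" unfolding U_def by auto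
      then have "prob (U u \<inter> U w) = exp (- lam * (\<Sum>v\<in>T. hit l {u, w} v))"
        using prob_void(2)[of T "{u, w}" l] uw by simp
      also have "(\<Sum>v\<in>T. hit l {u, w} v) = R' u + R' w - J u w"
        by (simp add: R'_def J_def sum.distrib sum_subtractf)
      also have "exp (- lam * (R' u + R' w - J u w)) = exp (lam * J u w) * (pp u * pp w)"
        by (simp add: pp_def exp_add[symmetric] algebra_simps)
      also have "\<dots> \<le> exp (lam * \<eta>) * (pp u * pp w)"
        by (intro mult_right_mono) (use True lam in \<open>auto simp: pp_def\<close>)
      also have "\<dots> \<le> exp (lam * \<eta>) * (pp u * pp w) + pp u * (J u w / \<eta>)"
        using Jn \<eta> by (simp add: pp_def)
      finally show ?thesis .
    next
      case False
      have "prob (U u \<inter> U w) \<le> prob (U u)" by (rule finite_measure_mono) (use U_ev in auto)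
      also have "\<dots> = pp u * 1" using pU uw by simp
      also have "\<dots> \<le> pp u * (J u w / \<eta>)" by (rule mult_left_mono) (use False \<eta> in \<open>auto simp: pp_def\<close>)
      finally show ?thesis by (simp add: pp_def add_increasing)
    qed
  qed
  define E where "E = (\<Sum>u\<in>T. pp u)"
  have E_lower: "real L ^ CARD('d) * exp (- lam * R) \<le> E"
  proof -
    have "real L ^ CARD('d) * exp (- lam * R) = (\<Sum>u\<in>T. exp (- lam * R))" by (simp add: card_torus)
    also have "\<dots> \<le> E" unfolding E_def pp_def
      by (rule sum_mono) (use R lam in \<open>auto simp: R'_def\<close>)
    finally show ?thesis .
  qed
  have Lp: "0 < real L ^ CARD('d) * exp (- lam * R)" using L3 by simp
  then have E_pos: "E > 0" using E_lower by linarith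
  let ?W = "\<lambda>\<omega>. \<Sum>u\<in>T. indicator (U u) \<omega> :: real"
  have ind: "integrable M (indicator B :: 'a \<Rightarrow> real)" if "B \<in> events" for B
    using integrable_real_indicator[OF that] by (simp add: emeasure_eq_measure)
  have exp_ind: "expectation (indicator B) = prob B" if "B \<in> events" for B
    using that by (simp add: Int_absorb1 sets.sets_into_space)
  have W_int: "integrable M ?W" by (intro Bochner_Integration.integrable_sum ind U_ev)
  have W_exp: "expectation ?W = E"
  proof -
    have "expectation ?W = (\<Sum>u\<in>T. expectation (indicator (U u)))"
      by (rule Bochner_Integration.integral_sum) (intro ind U_ev)
    also have "\<dots> = E" unfolding E_def by (rule sum.cong[OF refl]) (simp only: exp_ind[OF U_ev] pU)
    finally show ?thesis .
  qed
  have sq: "(?W \<omega>)\<^sup>2 = (\<Sum>u\<in>T. \<Sum>w\<in>T. indicator (U u \<inter> U w) \<omega>)" for \<omega>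
    by (simp add: power2_eq_square sum_product indicator_inter_arith)
  have W2_int: "integrable M (\<lambda>\<omega>. (?W \<omega>)\<^sup>2)"
    unfolding sq by (intro Bochner_Integration.integrable_sum ind sets.Int U_ev)
  have "expectation (\<lambda>\<omega>. (?W \<omega>)\<^sup>2) = (\<Sum>u\<in>T. \<Sum>w\<in>T. prob (U u \<inter> U w))"
    unfolding sq
    by (subst Bochner_Integration.integral_sum;
        (intro Bochner_Integration.integrable_sum ind sets.Int U_ev)?;
        subst Bochner_Integration.integral_sum; (intro ind sets.Int U_ev)?;
        intro sum.cong refl exp_ind sets.Int U_ev)
  also have "\<dots> \<le> (\<Sum>u\<in>T. \<Sum>w\<in>T. exp (lam * \<eta>) * (pp u * pp w) + pp u * (J u w / \<eta>))"
    by (intro sum_mono pUU)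
  also have "\<dots> = exp (lam * \<eta>) * E\<^sup>2 + (\<Sum>u\<in>T. pp u * ((\<Sum>w\<in>T. J u w) / \<eta>))"
  proof -
    have "(\<Sum>u\<in>T. \<Sum>w\<in>T. exp (lam * \<eta>) * (pp u * pp w)) = exp (lam * \<eta>) * E\<^sup>2"
      by (simp only: E_def power2_eq_square sum_product) (simp only: sum_distrib_left)
    moreover have "(\<Sum>u\<in>T. \<Sum>w\<in>T. pp u * (J u w / \<eta>)) = (\<Sum>u\<in>T. pp u * ((\<Sum>w\<in>T. J u w) / \<eta>))"
      unfolding sum_divide_distrib sum_distrib_left ..
    ultimately show ?thesis by (simp only: sum.distrib)
  qed
  also have "(\<Sum>u\<in>T. pp u * ((\<Sum>w\<in>T. J u w) / \<eta>)) \<le> (\<Sum>u\<in>T. pp u * ((real l + 1)\<^sup>2 / \<eta>))"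
  proof (intro sum_mono mult_left_mono divide_right_mono)
    fix u assume u: "u \<in> T"
    have "(\<Sum>w\<in>T. J u w) = (\<Sum>v\<in>T. \<Sum>w\<in>T. hit l {u} v + hit l {w} v - hit l {u, w} v)"
      unfolding J_def by (rule sum.swap)
    also have "\<dots> \<le> (\<Sum>v\<in>T. (real l + 1) * hit l {u} v)" by (intro sum_mono sum_hit_both_le u)
    also have "\<dots> = (real l + 1) * (\<Sum>v\<in>T. hit l {u} v)" by (simp add: sum_distrib_left)
    also have "\<dots> \<le> (real l + 1) * (real l + 1)"
    proof (rule mult_left_mono)
      have "(\<Sum>v\<in>T. hit l {u} v) \<le> (\<Sum>v\<in>T. \<Sum>n\<le>l. \<Sum>y\<in>{u}. tk n v y)"
        by (intro sum_mono hit_le_sum_tk) (use u in auto)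
      also have "\<dots> = real l + 1" by (subst sum.swap) (simp add: sum_tk_left)
      finally show "(\<Sum>v\<in>T. hit l {u} v) \<le> real l + 1" .
    qed simp
    finally show "(\<Sum>w\<in>T. J u w) \<le> (real l + 1)\<^sup>2" by (simp add: power2_eq_square)
  qed (use \<eta> in \<open>auto simp: pp_def\<close>)
  also have "(\<Sum>u\<in>T. pp u * ((real l + 1)\<^sup>2 / \<eta>)) = E * ((real l + 1)\<^sup>2 / \<eta>)"
    unfolding E_def sum_distrib_right ..
  finally have m2: "expectation (\<lambda>\<omega>. (?W \<omega>)\<^sup>2) \<le> exp (lam * \<eta>) * E\<^sup>2 + E * ((real l + 1)\<^sup>2 / \<eta>)" by simp
  have "prob {\<omega> \<in> space M. T \<subseteq> Range (rel l \<omega>)} \<le> prob {\<omega> \<in> space M. E \<le> \<bar>?W \<omega> - expectation ?W\<bar>}"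
  proof (rule finite_measure_mono)
    show "{\<omega> \<in> space M. T \<subseteq> Range (rel l \<omega>)} \<subseteq> {\<omega> \<in> space M. E \<le> \<bar>?W \<omega> - expectation ?W\<bar>}"
    proof (rule subsetI)
      fix \<omega> assume "\<omega> \<in> {\<omega> \<in> space M. T \<subseteq> Range (rel l \<omega>)}"
      then have w: "\<omega> \<in> space M" "T \<subseteq> Range (rel l \<omega>)" by auto
      have "\<omega> \<notin> U u" if "u \<in> T" for u using w that rel_subset[of l \<omega>] by (auto simp: U_def)
      then have "?W \<omega> = 0" by (intro sum.neutral) auto
      then show "\<omega> \<in> {\<omega> \<in> space M. E \<le> \<bar>?W \<omega> - expectation ?W\<bar>}" using w W_exp E_pos by simp
    qed
    show "{\<omega> \<in> space M. E \<le> \<bar>?W \<omega> - expectation ?W\<bar>} \<in> events"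
      using borel_measurable_integrable[OF W_int] by measurable
  qed
  also have "\<dots> \<le> variance ?W / E\<^sup>2"
    by (rule Chebyshev_inequality[OF borel_measurable_integrable[OF W_int] W2_int E_pos])
  also have "variance ?W = expectation (\<lambda>\<omega>. (?W \<omega>)\<^sup>2) - E\<^sup>2"
    using variance_eq[OF W_int W2_int] W_exp by simp
  also have "(expectation (\<lambda>\<omega>. (?W \<omega>)\<^sup>2) - E\<^sup>2) / E\<^sup>2 \<le>
      (exp (lam * \<eta>) * E\<^sup>2 + E * ((real l + 1)\<^sup>2 / \<eta>) - E\<^sup>2) / E\<^sup>2"
    using m2 by (intro divide_right_mono) auto
  also have "\<dots> = exp (lam * \<eta>) - 1 + (real l + 1)\<^sup>2 / (\<eta> * E)"
    using E_pos \<eta> by (simp add: field_simps power2_eq_square)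
  also have "\<dots> \<le> exp (lam * \<eta>) - 1 + (real l + 1)\<^sup>2 / (\<eta> * (real L ^ CARD('d) * exp (- lam * R)))"
    using E_lower Lp \<eta> E_pos L3 by (intro add_left_mono divide_left_mono mult_left_mono mult_pos_pos) auto
  finally show ?thesis .
qed

text \<open>The planted particle is independent of the ordinary ones and meets at most l' + 1
  vertices on average. The origin is added separately, because it is active without being visited by
  anyone; this gives l' + 2.\<close>

lemma prob_planted_needed:
  assumes R: "\<And>u. u \<in> T \<Longrightarrow> R \<le> (\<Sum>v\<in>T. hit l {u} v)"
  shows "\<exists>E\<in>events. {\<omega> \<in> space M. \<exists>u\<in>T. u \<notin> Range (rel l \<omega>) \<and> (u = 0 \<or> (\<exists>k\<le>l'. X Planted \<omega> k = u))} \<subseteq> E \<and>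
    prob E \<le> (real l' + 2) * exp (- lam * R)"
proof -
  define B where "B = (\<lambda>u. space PM - av l' {u})"
  define F where "F = (\<lambda>u. {\<omega> \<in> space M. rel l \<omega> \<inter> T \<times> {u} = {} \<and> X Planted \<omega> \<in> B u})"
  let ?F0 = "{\<omega> \<in> space M. rel l \<omega> \<inter> T \<times> {0} = {}}"
  have B: "B u \<in> sets PM" for u using av_sets by (auto simp: B_def)
  have F: "F u \<in> events" "prob (F u) \<le> hit l' {u} 0 * exp (- lam * R)" if u: "u \<in> T" for u
  proof -
    have sub: "T \<times> {u} \<subseteq> T \<times> T" using u by auto
    show "F u \<in> events" unfolding F_def by (rule rel_void(1)[OF B sub])
    have "X Planted -` B u \<inter> space M = space M - (X Planted -` av l' {u} \<inter> space M)"
      using space_PM_Planted by (auto simp: B_def)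
    then have pB: "prob (X Planted -` B u \<inter> space M) = hit l' {u} 0"
      using prob_compl[OF measurable_sets[OF X_meas[OF Planted_particles] av_sets], of l' "{u}"]
        prob_avoid[OF Planted_particles, of l' "{u}"] by simp
    have "prob (F u) = hit l' {u} 0 * exp (- lam * (\<Sum>v\<in>T. hit l ((T \<times> {u}) `` {v}) v))"
      unfolding F_def rel_void(2)[OF B sub] pB ..
    also have "(\<Sum>v\<in>T. hit l ((T \<times> {u}) `` {v}) v) = (\<Sum>v\<in>T. hit l {u} v)"
      by (rule sum.cong) (auto simp: Image_def)
    also have "hit l' {u} 0 * exp (- lam * (\<Sum>v\<in>T. hit l {u} v)) \<le> hit l' {u} 0 * exp (- lam * R)"
      using R[OF u] lam by (intro mult_left_mono) auto
    finally show "prob (F u) \<le> hit l' {u} 0 * exp (- lam * R)" .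
  qed
  have 0: "0 \<in> T" by (rule zero_in_torus[OF L])
  have F0: "?F0 \<in> events" by (rule rel_event)
  have "prob ?F0 = exp (- lam * (\<Sum>v\<in>T. hit l {0} v))" by (rule prob_void) (use 0 in auto)
  also have "\<dots> \<le> exp (- lam * R)" using R[OF 0] lam by simp
  finally have pF0: "prob ?F0 \<le> exp (- lam * R)" .
  let ?E = "?F0 \<union> (\<Union>u\<in>T. F u)"
  have E_ev: "(\<Union>u\<in>T. F u) \<in> events" using F by (intro sets.finite_UN) auto
  have "prob (\<Union>u\<in>T. F u) \<le> (\<Sum>u\<in>T. prob (F u))"
    by (rule finite_measure_subadditive_finite) (use F in auto)
  also have "\<dots> \<le> (\<Sum>u\<in>T. hit l' {u} 0 * exp (- lam * R))" by (rule sum_mono) (rule F)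
  also have "\<dots> = (\<Sum>u\<in>T. hit l' {u} 0) * exp (- lam * R)" by (simp add: sum_distrib_right)
  also have "\<dots> \<le> (real l' + 1) * exp (- lam * R)" by (intro mult_right_mono sum_hit_le 0) auto
  finally have "prob ?E \<le> (real l' + 2) * exp (- lam * R)"
    using measure_Un_le[OF F0 E_ev] pF0 by (simp add: algebra_simps)
  moreover have "{\<omega> \<in> space M. \<exists>u\<in>T. u \<notin> Range (rel l \<omega>) \<and> (u = 0 \<or> (\<exists>k\<le>l'. X Planted \<omega> k = u))} \<subseteq> ?E"
  proof (rule subsetI, rule UnCI)
    fix \<omega> assume "\<omega> \<in> {\<omega> \<in> space M. \<exists>u\<in>T. u \<notin> Range (rel l \<omega>) \<and> (u = 0 \<or> (\<exists>k\<le>l'. X Planted \<omega> k = u))}"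
      and n: "\<omega> \<notin> (\<Union>u\<in>T. F u)"
    then obtain u where w: "\<omega> \<in> space M" "u \<in> T" "u \<notin> Range (rel l \<omega>)" "u = 0 \<or> (\<exists>k\<le>l'. X Planted \<omega> k = u)" by blast
    have e: "rel l \<omega> \<inter> T \<times> {u} = {}" using w(3) by auto
    have "X Planted \<omega> \<in> space PM" using space_PM_Planted w(1) by auto
    then have "X Planted \<omega> \<notin> B u \<Longrightarrow> \<not> (\<exists>k\<le>l'. X Planted \<omega> k = u)" by (auto simp: B_def av_def)
    moreover have "X Planted \<omega> \<notin> B u" using n w(1,2) e by (auto simp: F_def)
    ultimately have "u = 0" using w(4) by blast
    then show "\<omega> \<in> ?F0" using w(1) e by simp
  qed
  moreover have "?E \<in> events" using F0 E_ev by (intro sets.Un)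
  ultimately show ?thesis by blast
qed

end

section \<open>Choice of the scales\<close>

lemma power_le_cancel: "x ^ n \<le> y ^ n \<Longrightarrow> 0 < n \<Longrightarrow> 0 \<le> y \<Longrightarrow> x \<le> (y :: real)"
  by (cases n) (simp, blast intro: power_le_imp_le_base)

lemma sum_inverse_le:
  assumes "1 \<le> m" "m \<le> k"
  shows "(\<Sum>n=m..k. 1 / real n) \<le> 1 / real m + ln (real k / real m)"
  using assms(2)
proof (induction k rule: dec_induct)
  case base
  show ?case using assms by simp
next
  case (step k)
  have k: "real k > 0" using step assms by simp
  have "1 / real (Suc k) \<le> ln (real (Suc k) / real k)"
  proof -
    have "ln (real k / real (Suc k)) \<le> real k / real (Suc k) - 1" by (rule ln_le_minus_one) (use k in simp)
    also have "\<dots> = - 1 / real (Suc k)" by (simp add: field_simps)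
    finally show ?thesis using k by (simp add: ln_div)
  qed
  moreover have "ln (real (Suc k) / real m) = ln (real (Suc k) / real k) + ln (real k / real m)"
    using k assms by (simp add: ln_div)
  ultimately show ?case using step by simp
qed

lemma sum_inverse_ge: "ln (real k) \<le> (\<Sum>n=1..k. 1 / real n)"
proof (cases "k = 0")
  case False
  have "ln (real k) \<le> ln (real k + 1)" using False by simp
  also have "\<dots> \<le> harm k" by (rule ln_le_harm)
  finally show ?thesis by (simp add: harm_def inverse_eq_divide)
qed simp

section \<open>Slow variation of the Green function and box sizes\<close>

context walk_estimates
begin

lemma A_pos: "A > 0"
  using A by simp

lemma b_le_1: "b n \<le> 1"
  by (simp add: b_def pmf_le_1)

lemma b_le_inverse: "n \<ge> 1 \<Longrightarrow> b n \<le> A / real n"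
proof -
  assume n: "n \<ge> 1"
  have "real n * b n \<le> A * (real 1 * b 1)" by (rule nb_decr) (use n in auto)
  also have "\<dots> \<le> A * 1" using b_le_1[of 1] A by (intro mult_left_mono) auto
  finally show ?thesis using n by (simp add: field_simps)
qed

lemma div2_ge: "m \<ge> 2 \<Longrightarrow> real m / 3 \<le> real (m div 2)"
proof -
  assume "m \<ge> 2"
  then have "m \<le> 3 * (m div 2)" by presburger
  then show ?thesis by linarith
qed

text \<open>Return probabilities are at most of order 1 / n, so the Green function grows at most
  logarithmically; hence l / G l still tends to infinity.\<close>

lemma G_upper:
  assumes "l \<ge> 1"
  shows "G l \<le> 5 * A * (1 + ln (real l))"
proof -
  have "G l \<le> 2 + 3 * A * ln (real l)" using assms
  proof (induction l rule: dec_induct)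
    case base
    have "G 1 = pmf (S 0) 0 + pmf (S 1) 0" by (simp add: G_def)
    also have "\<dots> \<le> 1 + 1" by (intro add_mono pmf_le_1)
    finally show ?case by simp
  next
    case (step l)
    have l: "real l > 0" using step by simp
    have "pmf (S (Suc l)) 0 \<le> b (Suc l div 2)" by (rule pmf_S_le_b_half)
    also have "\<dots> \<le> A / real (Suc l div 2)" by (rule b_le_inverse) (use step in simp)
    also have "\<dots> \<le> A / (real (Suc l) / 3)"
      using div2_ge[of "Suc l"] step A by (intro divide_left_mono) auto
    also have "\<dots> = 3 * A * (1 / real (Suc l))" by simp
    also have "1 / real (Suc l) \<le> ln (real (Suc l)) - ln (real l)"
    proof -
      have "ln (real l / real (Suc l)) \<le> real l / real (Suc l) - 1" by (rule ln_le_minus_one) (use l in simp)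
      also have "\<dots> = - 1 / real (Suc l)" by (simp add: field_simps)
      finally show ?thesis using l by (simp add: ln_div)
    qed
    finally have "pmf (S (Suc l)) 0 \<le> 3 * A * (ln (real (Suc l)) - ln (real l))" using A by simp
    then show ?case using step.IH by (simp add: G_def algebra_simps)
  qed
  also have "\<dots> \<le> 5 * A * (1 + ln (real l))"
  proof -
    have "0 \<le> A * ln (real l)" using A assms by simp
    then show ?thesis using A by (simp add: algebra_simps)
  qed
  finally show ?thesis .
qed

text \<open>Slow variation of the Green function: \<open>n * b n\<close> is almost decreasing, so a logarithmically
  short range of times contributes little compared to all earlier times.\<close>

lemma sum_b_le:
  assumes "4 \<le> m" "m \<le> k"
  shows "(\<Sum>n=m..k. b (n div 2)) * ln (real m / 3) \<le> 3 * A\<^sup>2 * (1 + ln (real k / real m)) * G m"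
proof -
  let ?i = "m div 2"
  \<comment> \<open>The pivot value of n \<open>b n\<close>: up to the factor \<open>A\<close>,
    later values lie below it and earlier ones above it. The first fact bounds the sum over the
    range, the second gives a lower bound for \<open>G m\<close>.\<close>
  let ?X = "real ?i * b ?i"
  have i: "?i \<ge> 2" using assms by linarith
  have X0: "0 \<le> ?X" using b_pos[of ?i] by simp
  have l0: "0 \<le> ln (real m / 3)" using assms by simp
  have "(\<Sum>n=m..k. b (n div 2)) \<le> (\<Sum>n=m..k. 3 * A * ?X * (1 / real n))"
  proof (rule sum_mono)
    fix n assume n: "n \<in> {m..k}"
    have n2: "n div 2 \<ge> ?i" "n \<ge> 2" using n assms by (auto intro: div_le_mono)
    have "real (n div 2) * b (n div 2) \<le> A * ?X" by (rule nb_decr) (use i n2 in auto)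
    moreover have "real n / 3 * b (n div 2) \<le> real (n div 2) * b (n div 2)"
      using div2_ge[OF n2(2)] b_pos[of "n div 2"] by (intro mult_right_mono) auto
    ultimately have "real n / 3 * b (n div 2) \<le> A * ?X" by linarith
    then show "b (n div 2) \<le> 3 * A * ?X * (1 / real n)" using n2 by (simp add: field_simps)
  qed
  also have "\<dots> = 3 * A * ?X * (\<Sum>n=m..k. 1 / real n)" by (simp add: sum_distrib_left)
  also have "\<dots> \<le> 3 * A * ?X * (1 + ln (real k / real m))"
  proof (rule mult_left_mono)
    have "1 / real m \<le> 1" using assms by simp
    moreover have "(\<Sum>n=m..k. 1 / real n) \<le> 1 / real m + ln (real k / real m)"
      by (rule sum_inverse_le) (use assms in auto)
    ultimately show "(\<Sum>n=m..k. 1 / real n) \<le> 1 + ln (real k / real m)" by linarith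
  qed (use A X0 in simp)
  finally have 1: "(\<Sum>n=m..k. b (n div 2)) \<le> 3 * A * ?X * (1 + ln (real k / real m))" .
  have 2: "?X * ln (real m / 3) \<le> A * G m"
  proof -
    have "?X * ln (real m / 3) \<le> ?X * (\<Sum>n=1..?i. 1 / real n)"
    proof (rule mult_left_mono[OF _ X0])
      have "ln (real m / 3) \<le> ln (real ?i)" using div2_ge[of m] assms by simp
      then show "ln (real m / 3) \<le> (\<Sum>n=1..?i. 1 / real n)" using sum_inverse_ge[of ?i] by linarith
    qed
    also have "\<dots> = (\<Sum>n=1..?i. ?X / real n)" by (simp add: sum_distrib_left)
    also have "\<dots> \<le> (\<Sum>n=1..?i. A * b n)"
    proof (rule sum_mono)
      fix n assume "n \<in> {1..?i}"
      then have "?X \<le> A * (real n * b n)" "real n > 0" by (auto intro: nb_decr)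
      then show "?X / real n \<le> A * b n" by (simp add: field_simps)
    qed
    also have "\<dots> = A * (\<Sum>n=1..?i. pmf (S (2 * n)) 0)" by (simp add: sum_distrib_left b_def)
    also have "(\<Sum>n=1..?i. pmf (S (2 * n)) 0) = (\<Sum>n\<in>(\<lambda>n. 2 * n) ` {1..?i}. pmf (S n) 0)"
      by (subst sum.reindex) (auto simp: inj_on_def)
    also have "\<dots> \<le> G m" unfolding G_def by (rule sum_mono2) auto
    finally show ?thesis using A by (simp add: mult_left_mono)
  qed
  have lk: "0 \<le> 1 + ln (real k / real m)" using assms by (simp add: add_nonneg_nonneg)
  have "(\<Sum>n=m..k. b (n div 2)) * ln (real m / 3) \<le> 3 * A * ?X * (1 + ln (real k / real m)) * ln (real m / 3)"
    by (rule mult_right_mono[OF 1 l0])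
  also have "\<dots> = 3 * A * (1 + ln (real k / real m)) * (?X * ln (real m / 3))" by simp
  also have "\<dots> \<le> 3 * A * (1 + ln (real k / real m)) * (A * G m)"
    by (rule mult_left_mono[OF 2]) (use A lk in simp)
  finally show ?thesis by (simp add: power2_eq_square mult_ac)
qed

text \<open>Between l and B l the logarithmic length is the constant ln B, so
  \<open>sum_b_le\<close> bounds the increment by a constant over ln l times
  \<open>G l\<close>.\<close>

lemma G_ratio:
  assumes "B \<ge> 1" "\<epsilon> > 0"
  shows "\<forall>\<^sub>F l in sequentially. \<forall>l'. real l' \<le> B * real l \<longrightarrow> G l' \<le> (1 + \<epsilon>) * G l"
proof -
  have "\<forall>\<^sub>F l :: nat in sequentially. 3 * A\<^sup>2 * (1 + ln B) / \<epsilon> \<le> ln (real l / 3)"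
    by real_asymp
  then show ?thesis
  proof (rule eventually_elim2[OF eventually_ge_at_top[of 4]], intro allI impI)
    fix l l' :: nat
    assume l: "4 \<le> l" and big: "3 * A\<^sup>2 * (1 + ln B) / \<epsilon> \<le> ln (real l / 3)" and l': "real l' \<le> B * real l"
    have G1: "0 \<le> G l" using G_ge_1[of l] by simp
    show "G l' \<le> (1 + \<epsilon>) * G l"
    proof (cases "l' \<le> l")
      case True
      then have "G l' \<le> 1 * G l" using G_mono by simp
      also have "\<dots> \<le> (1 + \<epsilon>) * G l" by (rule mult_right_mono) (use assms G1 in auto)
      finally show ?thesis .
    next
      case False
      let ?s = "\<Sum>n=l..l'. b (n div 2)"
      have "G l' = G l + (\<Sum>n\<in>{Suc l..l'}. pmf (S n) 0)"
      proof -
        have "{..l'} = {..l} \<union> {Suc l..l'}" using False by auto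
        then show ?thesis unfolding G_def by (simp only:) (subst sum.union_disjoint; auto)
      qed
      also have "(\<Sum>n\<in>{Suc l..l'}. pmf (S n) 0) \<le> (\<Sum>n\<in>{Suc l..l'}. b (n div 2))"
        by (rule sum_mono) (rule pmf_S_le_b_half)
      also have "\<dots> \<le> ?s" by (rule sum_mono2) (use b_pos in \<open>auto simp: less_imp_le\<close>)
      finally have 1: "G l' \<le> G l + ?s" by simp
      have lp: "0 < ln (real l / 3)" using l by simp
      have "?s * ln (real l / 3) \<le> 3 * A\<^sup>2 * (1 + ln (real l' / real l)) * G l"
        by (rule sum_b_le) (use l False in auto)
      also have "\<dots> \<le> 3 * A\<^sup>2 * (1 + ln B) * G l"
      proof (intro mult_right_mono mult_left_mono add_left_mono G1)
        have "real l' / real l \<le> B" using l' l by (simp add: field_simps)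
        then show "ln (real l' / real l) \<le> ln B"
          using l False assms(1) by (subst ln_le_cancel_iff) auto
      qed simp
      also have "\<dots> \<le> (\<epsilon> * ln (real l / 3)) * G l"
        using big assms(2) by (intro mult_right_mono G1) (simp add: field_simps)
      finally have "ln (real l / 3) * ?s \<le> ln (real l / 3) * (\<epsilon> * G l)" by (simp add: mult_ac)
      then have "?s \<le> \<epsilon> * G l" using lp by (simp add: mult_le_cancel_left_pos)
      then show ?thesis using 1 by (simp add: algebra_simps)
    qed
  qed
qed

lemma b_lower: "k \<ge> 1 \<Longrightarrow> 1 / b k \<le> A / b 1 * real k powr p"
proof -
  assume k: "k \<ge> 1"
  have "b 1 \<le> A * (real k / real 1) powr p * b k" by (rule b_scaling) (use k in auto)
  then show ?thesis using b_pos[of k] b_pos[of 1] by (simp add: field_simps)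
qed

text \<open>The largest s with 3 s at most \<open>c * rho (k div 4)\<close>, the radius allowed in
  \<open>green_near_lower\<close>.\<close>

definition bs :: "nat \<Rightarrow> nat" where
  "bs k = nat \<lfloor>c * real (rho (k div 4)) / 3\<rfloor>"

lemma rho_le_rho:
  assumes "1 \<le> m" "m \<le> n" "real n \<le> B * real m" "B \<ge> 1"
  shows "real (rho n) \<le> A\<^sup>2 * B powr p * real (rho m)"
proof -
  have d: "CARD('d) \<ge> 1" by simp
  have C: "1 \<le> A\<^sup>2 * B powr p"
  proof -
    have "1 * 1 \<le> A\<^sup>2 * B powr p"
      using A assms p by (intro mult_mono) (auto simp: one_le_power ge_one_powr_ge_zero)
    then show ?thesis by simp
  qed
  have "real (rho n) ^ CARD('d) \<le> A / b n" by (rule rho_pow)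
  also have "1 / b n \<le> A * B powr p / b m"
  proof -
    have "b m \<le> A * (real n / real m) powr p * b n" by (rule b_scaling[OF assms(1,2)])
    also have "\<dots> \<le> A * B powr p * b n"
    proof (intro mult_right_mono mult_left_mono powr_mono2)
      show "real n / real m \<le> B" using assms by (simp add: field_simps)
    qed (use A p b_pos[of n] in auto)
    finally show ?thesis using b_pos[of m] b_pos[of n] by (simp add: field_simps)
  qed
  then have "A * (1 / b n) \<le> A * (A * B powr p / b m)" by (rule mult_left_mono) (use A in simp)
  then have "A / b n \<le> A * (A * B powr p / b m)" by simp
  also have "A * (A * B powr p / b m) = A\<^sup>2 * B powr p * (1 / b m)" by (simp add: power2_eq_square)
  also have "\<dots> \<le> A\<^sup>2 * B powr p * real (rho m) ^ CARD('d)"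
    by (rule mult_left_mono[OF rho_pow(1)]) simp
  also have "\<dots> \<le> (A\<^sup>2 * B powr p) ^ CARD('d) * real (rho m) ^ CARD('d)"
    using C self_le_power[OF C, of "CARD('d)"] by (intro mult_right_mono) auto
  also have "\<dots> = (A\<^sup>2 * B powr p * real (rho m)) ^ CARD('d)" by (simp add: power_mult_distrib)
  finally have "real (rho n) ^ CARD('d) \<le> (A\<^sup>2 * B powr p * real (rho m)) ^ CARD('d)"
    by (simp add: order_trans)
  then show ?thesis by (rule power_le_cancel) (use C in auto)
qed

lemma eventually_bs_arg: "\<forall>\<^sub>F k in sequentially. 1 \<le> c * real (rho (k div 4)) / 3"
proof -
  have "\<forall>\<^sub>F k :: nat in sequentially. A * (3 / c) ^ CARD('d) \<le> real k / 8"
    by real_asymp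
  then show ?thesis
  proof (rule eventually_elim2[OF eventually_ge_at_top[of 8]])
    fix k :: nat assume k: "8 \<le> k" and big: "A * (3 / c) ^ CARD('d) \<le> real k / 8"
    have "real k / 8 \<le> real (k div 4)" using k by linarith
    then have "A * (3 / c) ^ CARD('d) \<le> real (k div 4)" using big by linarith
    also have "\<dots> \<le> A / b (k div 4)"
      using b_le_inverse[of "k div 4"] b_pos[of "k div 4"] k by (simp add: field_simps)
    finally have "A * (3 / c) ^ CARD('d) \<le> A * (1 / b (k div 4))" by simp
    then have "(3 / c) ^ CARD('d) \<le> 1 / b (k div 4)" by (simp only: mult_le_cancel_left_pos[OF A_pos])
    also have "\<dots> \<le> real (rho (k div 4)) ^ CARD('d)" by (rule rho_pow)
    finally have "3 / c \<le> real (rho (k div 4))"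
      by (rule power_le_cancel) auto
    then show "1 \<le> c * real (rho (k div 4)) / 3" using c by (simp add: field_simps)
  qed
qed

text \<open>A lower bound for the box volume at scale k times \<open>b k\<close>. The 8 bounds k /
  (\<open>k div 4\<close>) for k at least 8.\<close>

definition c1 :: real where "c1 = (c / 3) ^ CARD('d) / (A * 8 powr p)"

lemma c1_pos: "c1 > 0"
  using c A by (simp add: c1_def)

lemma bs_facts:
  assumes z: "1 \<le> c * real (rho (k div 4)) / 3" and k: "k \<ge> 8"
  shows "bs k \<ge> 1" "3 * real (bs k) \<le> c * real (rho (k div 4))"
    "c1 \<le> (2 * real (bs k) + 1) ^ CARD('d) * b k"
    "(2 * real (bs k) + 1) ^ CARD('d) \<le> A / b k"
    "real (rho (k div 4)) \<le> 6 / c * real (bs k)"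
proof -
  let ?z = "c * real (rho (k div 4)) / 3"
  have s: "real (bs k) \<le> ?z" "?z < real (bs k) + 1" "bs k \<ge> 1" using z unfolding bs_def by linarith+
  show "bs k \<ge> 1" "3 * real (bs k) \<le> c * real (rho (k div 4))" using s by auto
  show "real (rho (k div 4)) \<le> 6 / c * real (bs k)"
  proof -
    have "?z \<le> 2 * real (bs k)" using s by linarith
    then show ?thesis using c by (simp add: field_simps)
  qed
  have b4: "b (k div 4) \<le> A * 8 powr p * b k"
  proof -
    have "b (k div 4) \<le> A * (real k / real (k div 4)) powr p * b k" by (rule b_scaling) (use k in auto)
    also have "\<dots> \<le> A * 8 powr p * b k"
    proof (intro mult_right_mono mult_left_mono powr_mono2)
      have "real k \<le> 8 * real (k div 4)" using k by linarith
      then show "real k / real (k div 4) \<le> 8" using k by (simp add: field_simps)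
    qed (use A p b_pos[of k] in auto)
    finally show ?thesis .
  qed
  have "c1 = (c / 3) ^ CARD('d) * (1 / (A * 8 powr p))" by (simp add: c1_def)
  also have "\<dots> \<le> (c / 3) ^ CARD('d) * (1 / b (k div 4) * b k)"
  proof (rule mult_left_mono)
    show "1 / (A * 8 powr p) \<le> 1 / b (k div 4) * b k"
      using b4 b_pos[of "k div 4"] A by (simp add: field_simps)
  qed (use c in simp)
  also have "\<dots> \<le> (c / 3) ^ CARD('d) * (real (rho (k div 4)) ^ CARD('d) * b k)"
    using b_pos[of k] c by (intro mult_left_mono mult_right_mono rho_pow) auto
  also have "\<dots> = ?z ^ CARD('d) * b k" by (simp add: power_mult_distrib power_divide)
  also have "\<dots> \<le> (2 * real (bs k) + 1) ^ CARD('d) * b k"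
    using s z b_pos[of k] by (intro mult_right_mono power_mono) auto
  finally show "c1 \<le> (2 * real (bs k) + 1) ^ CARD('d) * b k" .
  have "(2 * real (bs k) + 1) ^ CARD('d) \<le> real (rho k) ^ CARD('d)"
  proof (rule power_mono)
    have "2 * real (bs k) + 1 \<le> 3 * real (bs k)" using s by simp
    also have "\<dots> \<le> c * real (rho (k div 4))" using s by simp
    also have "\<dots> \<le> 1 * real (rho (k div 4))" by (rule mult_right_mono) (use c in auto)
    also have "\<dots> \<le> real (rho k)" using rho_mono[of "k div 4" k] by simp
    finally show "2 * real (bs k) + 1 \<le> real (rho k)" .
  qed simp
  also have "\<dots> \<le> A / b k" by (rule rho_pow)
  finally show "(2 * real (bs k) + 1) ^ CARD('d) \<le> A / b k" .
qed

end

lemma real_nat_floor: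
  assumes "1 \<le> (z :: real)"
  shows "real (nat \<lfloor>z\<rfloor>) \<le> z" "z / 2 \<le> real (nat \<lfloor>z\<rfloor>)" "1 \<le> nat \<lfloor>z\<rfloor>"
proof -
  have "1 \<le> \<lfloor>z\<rfloor>" using assms by (simp add: le_floor_iff)
  then show "real (nat \<lfloor>z\<rfloor>) \<le> z" "z / 2 \<le> real (nat \<lfloor>z\<rfloor>)" "1 \<le> nat \<lfloor>z\<rfloor>" by linarith+
qed

lemma pow_le_exp:
  assumes "0 < x" "x \<le> (C :: real)"
  shows "x ^ n \<le> exp (real n * ln C)"
proof -
  have "x ^ n \<le> C ^ n" using assms by (intro power_mono) auto
  also have "C ^ n = exp (real n * ln C)" using assms by (simp add: exp_of_nat_mult)
  finally show ?thesis .
qed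

section \<open>Parameters of the large and the small scale\<close>

context walk_estimates
begin

definition Cb :: real where "Cb = A * (A / b 1)"

lemma Cb_pos: "Cb > 0"
  using A b_pos[of 1] by (simp add: Cb_def)

lemma bs_volume:
  assumes "1 \<le> c * real (rho (k div 4)) / 3" "k \<ge> 8"
  shows "(2 * real (bs k) + 1) ^ CARD('d) \<le> Cb * real k powr p" "real (2 * bs k + 1) \<le> Cb * real k powr p"
proof -
  have "(2 * real (bs k) + 1) ^ CARD('d) \<le> A * (1 / b k)" using bs_facts(4)[OF assms] by simp
  also have "\<dots> \<le> A * (A / b 1 * real k powr p)" by (intro mult_left_mono b_lower) (use assms A in auto)
  finally show 1: "(2 * real (bs k) + 1) ^ CARD('d) \<le> Cb * real k powr p" by (simp add: Cb_def)
  have "2 * real (bs k) + 1 \<le> (2 * real (bs k) + 1) ^ CARD('d)" by (rule self_le_power) auto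
  then show "real (2 * bs k + 1) \<le> Cb * real k powr p" using 1 by simp
qed

lemma err0_nonneg: "0 \<le> err0 L k"
  using A by (simp add: err0_def)

text \<open>A bound for the wrap-around error that no longer involves L: at the relevant times L is
  at least an exponential of order l / ln l, so any power of 1 / L is superpolynomially small in
  l.\<close>

definition errB :: "real \<Rightarrow> nat \<Rightarrow> real" where
  "errB c0 l = A * 4 powr \<kappa> * real l * exp (- (\<kappa> * c0 / CARD('d)) * (real l / ln (real l)))"

lemma err0_le:
  assumes "L \<ge> 3" "c0 * (real l / ln (real l)) \<le> CARD('d) * ln (real L)" "k \<le> l"
  shows "err0 L k \<le> errB c0 l"
proof -
  have "L \<le> 4 * ((L - 1) div 2)" using assms(1) by presburger
  then have "real L / 4 \<le> real ((L - 1) div 2)" by linarith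
  then have "real ((L - 1) div 2) powr - \<kappa> \<le> (real L / 4) powr - \<kappa>"
    by (intro powr_mono2') (use assms kap in auto)
  also have "\<dots> = 4 powr \<kappa> * exp (- \<kappa> * ln (real L))"
    using assms(1) by (simp add: powr_def ln_div algebra_simps flip: exp_add)
  also have "\<dots> \<le> 4 powr \<kappa> * exp (- (\<kappa> * c0 / CARD('d)) * (real l / ln (real l)))"
  proof (intro mult_left_mono, subst exp_le_cancel_iff)
    have "\<kappa> / CARD('d) * (c0 * (real l / ln (real l))) \<le> \<kappa> / CARD('d) * (CARD('d) * ln (real L))"
      by (rule mult_left_mono[OF assms(2)]) (use kap in simp)
    then show "- \<kappa> * ln (real L) \<le> - (\<kappa> * c0 / CARD('d)) * (real l / ln (real l))" by simp
  qed simp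
  finally have "A * real k * real ((L - 1) div 2) powr - \<kappa> \<le>
      A * real l * (4 powr \<kappa> * exp (- (\<kappa> * c0 / CARD('d)) * (real l / ln (real l))))"
    using assms(3) A by (intro mult_mono) auto
  then show ?thesis by (simp add: err0_def errB_def mult_ac)
qed

lemma errB_small:
  assumes "c0 > 0" "x > 0"
  shows "\<forall>\<^sub>F l in sequentially. C * real l powr r * (real l + 1) * errB c0 l \<le> x"
proof -
  define w where "w = \<kappa> * c0 / CARD('d)"
  have w: "w > 0" using assms kap by (simp add: w_def)
  define B where "B = C * (A * 4 powr \<kappa>)"
  have "(\<lambda>l :: nat. B * real l powr r * (real l + 1) * real l * exp (- w * (real l / ln (real l)))) \<longlonglongrightarrow> 0"
    using w by real_asymp
  then have "\<forall>\<^sub>F l :: nat in sequentially. B * real l powr r * (real l + 1) * real l * exp (- w * (real l / ln (real l))) < x"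
    by (rule order_tendstoD) (rule assms(2))
  then show ?thesis
    by eventually_elim (simp add: errB_def w_def B_def mult_ac)
qed

text \<open>\<open>yy\<close> and \<open>nn\<close> are the sizes to which backward clusters are grown in a box of the larger and of
  the smaller scale, \<open>mm\<close> and \<open>mk\<close> the cut-offs \<open>m0\<close> in the corresponding Green sums.\<close>

definition yy :: "nat \<Rightarrow> nat" where "yy l = nat \<lfloor>real l / ln (real l) ^ 3\<rfloor>"

definition mm :: "nat \<Rightarrow> nat" where "mm l = nat \<lfloor>real l / ln (real l) ^ 4\<rfloor>"

text \<open>The power 3 in \<open>yy\<close> keeps the entropy \<open>yy\<close> ln l below l / ln
  l. The power 4 in \<open>mm\<close> makes the trivial part of the Green sum small against
  \<open>yy\<close>. The remaining times from \<open>mm\<close> to l have logarithmic length of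
  order ln (ln l), so \<open>sum_b_le\<close> makes them negligible against
  \<open>G l\<close>.\<close>

lemma critical_green:
  assumes "c0 > 0" "e > 0"
  shows "\<forall>\<^sub>F l in sequentially. \<forall>L. L \<ge> 3 \<longrightarrow> c0 * (real l / ln (real l)) \<le> CARD('d) * ln (real L) \<longrightarrow>
    1 \<le> yy l \<and> real (yy l) \<le> real l / ln (real l) ^ 3 \<and> 1 \<le> mm l \<and> mm l \<le> l + 1 \<and>
    greenB0 L l (mm l) (yy l) \<le> real (yy l) * (e * G l)"
proof -
  have e3: "e / 3 > 0" using assms by simp
  have "\<forall>\<^sub>F l :: nat in sequentially. 1 \<le> real l / ln (real l) ^ 3" by real_asymp
  moreover have "\<forall>\<^sub>F l :: nat in sequentially. 8 \<le> real l / ln (real l) ^ 4" by real_asymp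
  moreover have "\<forall>\<^sub>F l :: nat in sequentially. 2 / ln (real l) < e / 3"
    by (rule order_tendstoD[OF _ e3]) real_asymp
  moreover have "\<forall>\<^sub>F l :: nat in sequentially. 3 * A\<^sup>2 * (1 + ln (2 * ln (real l) ^ 4)) \<le> e / 3 * ln (real l / (6 * ln (real l) ^ 4))"
    using e3 by real_asymp
  moreover have "\<forall>\<^sub>F l :: nat in sequentially. 1 * real l powr 0 * (real l + 1) * errB c0 l \<le> e / 3"
    by (rule errB_small) (use assms in auto)
  moreover have "\<forall>\<^sub>F l :: nat in sequentially. 1 < ln (real l)" by real_asymp
  ultimately show ?thesis
  proof (eventually_elim, intro allI impI)
    fix l L :: nat
    assume y1: "1 \<le> real l / ln (real l) ^ 3" and m8: "8 \<le> real l / ln (real l) ^ 4"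
      and ln2: "2 / ln (real l) < e / 3"
      and sv: "3 * A\<^sup>2 * (1 + ln (2 * ln (real l) ^ 4)) \<le> e / 3 * ln (real l / (6 * ln (real l) ^ 4))"
      and er: "1 * real l powr 0 * (real l + 1) * errB c0 l \<le> e / 3" and ln1: "1 < ln (real l)"
      and L: "3 \<le> L" "c0 * (real l / ln (real l)) \<le> CARD('d) * ln (real L)"
    have l0: "real l > 0" using y1 by (cases "l = 0") auto
    have l1: "l > 1" using ln1 l0 by (cases "l = 1") auto
    have m1: "1 \<le> real l / ln (real l) ^ 4" using m8 by linarith
    note y = real_nat_floor[OF y1, folded yy_def]
    note m = real_nat_floor[OF m1, folded mm_def]
    have m4: "4 \<le> mm l" using m8 unfolding mm_def by linarith
    have ml: "mm l \<le> l"
    proof -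
      have "real l / ln (real l) ^ 4 \<le> real l / 1"
        using ln1 l0 by (intro divide_left_mono) (auto simp: one_le_power)
      then show ?thesis using m(1) by simp
    qed
    have G1: "1 \<le> G l" "G (mm l) \<le> G l" using G_ge_1 G_mono[OF ml] by auto
    have 1: "real (mm l) \<le> real (yy l) * (e / 3)"
    proof -
      have "real (mm l) \<le> real l / ln (real l) ^ 4" by (rule m)
      also have "\<dots> = (real l / ln (real l) ^ 3) / 2 * (2 / ln (real l))"
        using ln1 by (simp add: eval_nat_numeral)
      also have "\<dots> \<le> real (yy l) * (e / 3)" by (rule mult_mono) (use y ln2 ln1 in auto)
      finally show ?thesis .
    qed
    have 2: "(\<Sum>n=mm l..l. b (n div 2)) \<le> e / 3 * G l"
    proof -
      let ?s = "\<Sum>n=mm l..l. b (n div 2)"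
      have a: "ln (real l / (6 * ln (real l) ^ 4)) \<le> ln (real (mm l) / 3)"
      proof (subst ln_le_cancel_iff)
        show "real l / (6 * ln (real l) ^ 4) \<le> real (mm l) / 3" using m(2) by simp
        show "0 < real l / (6 * ln (real l) ^ 4)"
          by (intro divide_pos_pos mult_pos_pos zero_less_power) (use l0 l1 in auto)
      qed (use m4 in auto)
      have q: "ln (real l / real (mm l)) \<le> ln (2 * ln (real l) ^ 4)"
      proof (subst ln_le_cancel_iff)
        show "real l / real (mm l) \<le> 2 * ln (real l) ^ 4" using m m4 ln1 by (simp add: field_simps)
      qed (use l0 ln1 m4 in auto)
      have pos: "0 < ln (real (mm l) / 3)" using m4 by simp
      have "?s * ln (real (mm l) / 3) \<le> 3 * A\<^sup>2 * (1 + ln (real l / real (mm l))) * G (mm l)"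
        by (rule sum_b_le[OF m4 ml])
      also have "\<dots> \<le> 3 * A\<^sup>2 * (1 + ln (2 * ln (real l) ^ 4)) * G l"
      proof (rule mult_mono)
        show "3 * A\<^sup>2 * (1 + ln (real l / real (mm l))) \<le> 3 * A\<^sup>2 * (1 + ln (2 * ln (real l) ^ 4))"
          by (rule mult_left_mono) (use q in auto)
        have "0 \<le> ln (2 * ln (real l) ^ 4)" using ln1 one_le_power[of "ln (real l)" 4] by (intro ln_ge_zero) linarith
        then show "0 \<le> 3 * A\<^sup>2 * (1 + ln (2 * ln (real l) ^ 4))" by simp
      qed (use G1 G_ge_1[of "mm l"] in auto)
      also have "\<dots> \<le> e / 3 * ln (real (mm l) / 3) * G l"
        using sv a assms G1 by (intro mult_right_mono) (auto intro: order_trans mult_left_mono)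
      finally have "ln (real (mm l) / 3) * ?s \<le> ln (real (mm l) / 3) * (e / 3 * G l)" by (simp add: mult_ac)
      then show ?thesis using pos by (simp only: mult_le_cancel_left_pos)
    qed
    have 3: "real (l + 1) * err0 L l \<le> e / 3"
    proof -
      have "real (l + 1) * err0 L l \<le> real (l + 1) * errB c0 l"
        by (intro mult_left_mono err0_le L) auto
      also have "\<dots> \<le> e / 3" using er l0 by (simp add: add.commute)
      finally show ?thesis .
    qed
    have "greenB0 L l (mm l) (yy l) \<le> real (yy l) * (e / 3) + real (yy l) * (e / 3 * G l + e / 3)"
      unfolding greenB0_def by (intro add_mono mult_left_mono 1 2 3) auto
    also have "\<dots> \<le> real (yy l) * (e * G l)"
    proof -
      have "e / 3 + (e / 3 * G l + e / 3) \<le> e / 3 * G l + (e / 3 * G l + e / 3 * G l)"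
        using G1(1) assms by (intro add_mono) auto
      then have "real (yy l) * (e / 3 + (e / 3 * G l + e / 3)) \<le> real (yy l) * (e * G l)"
        by (intro mult_left_mono) auto
      then show ?thesis by (simp add: algebra_simps)
    qed
    finally show "1 \<le> yy l \<and> real (yy l) \<le> real l / ln (real l) ^ 3 \<and> 1 \<le> mm l \<and> mm l \<le> l + 1 \<and>
      greenB0 L l (mm l) (yy l) \<le> real (yy l) * (e * G l)" using y m ml by simp
  qed
qed

definition nn :: "nat \<Rightarrow> nat" where "nn k = nat \<lfloor>1 / (b k * real k powr (1/4))\<rfloor>"

definition mk :: "nat \<Rightarrow> nat" where "mk k = nat \<lfloor>real k powr (1 - 1 / (8 * p))\<rfloor>"

definition c5 :: real where "c5 = c1 / (16 * (2 + 2 * A * 6 powr p))"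

lemma c5_pos: "c5 > 0"
  using c1_pos A by (simp add: c5_def add_pos_nonneg)

text \<open>The target \<open>nn\<close> has density of order \<open>k powr (-1/4)\<close> in its
  box. The cut-off \<open>mk\<close> is chosen so that \<open>b\<close> varies over the later times
  by a factor of order (k / \<open>mk\<close>)^p, that is \<open>k powr (1/8)\<close>. These times
  contribute at most order \<open>k powr (1 + 1/8 - 1/4)\<close>, which is below
  \<open>k powr (1 - 1 / (8 * p))\<close>, the bound for the earlier times. The mean is thus at
  least a multiple of \<open>k powr (1 / (8 * p))\<close>. The 6 in \<open>c5\<close> comes from
  rounding down in \<open>mk\<close> (2) and in its half (3).\<close>

lemma local_scale:
  "\<forall>\<^sub>F k in sequentially. k \<ge> 8 \<and> 1 \<le> c * real (rho (k div 4)) / 3 \<and> 1 \<le> nn k \<and> 1 \<le> mk k \<and> mk k \<le> k + 1 \<and>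
    real (nn k) \<le> Cb * real k powr p \<and>
    (2 * real (bs k) + 1) ^ CARD('d) / real (nn k) \<le> 2 * A * real k powr (1/4) \<and>
    real k powr (- (1/4)) / 64 \<le> min 1 (real (nn k) * b k / 32) \<and>
    (\<forall>L. real (nn k) * (real (k + 1) * err0 L k) \<le> 1 \<longrightarrow>
       c5 * real k powr (1 / (8 * p)) \<le> (2 * real (bs k) + 1) ^ CARD('d) * (real k * b k / 16) / greenB0 L k (mk k) (nn k))"
proof -
  have p8: "0 < 1 / (8 * p)" "1 / (8 * p) \<le> 1 / 8" using p by (auto simp: field_simps)
  have "\<forall>\<^sub>F k :: nat in sequentially. A \<le> real k powr (3/4)" by real_asymp
  moreover have "\<forall>\<^sub>F k :: nat in sequentially. 2 \<le> real k powr (1 - 1/8)" by real_asymp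
  ultimately show ?thesis
    using eventually_bs_arg eventually_ge_at_top[of 8]
  proof eventually_elim
    fix k :: nat
    assume kA: "A \<le> real k powr (3/4)" and k2: "2 \<le> real k powr (1 - 1/8)"
      and bsa: "1 \<le> c * real (rho (k div 4)) / 3" and k8: "8 \<le> k"
    have k0: "real k > 0" "real k \<ge> 1" using k8 by auto
    have bk: "b k > 0" by (rule b_pos)
    let ?z = "1 / (b k * real k powr (1/4))"
    have z1: "1 \<le> ?z"
    proof -
      have "b k * real k powr (1/4) \<le> A / real k * real k powr (1/4)"
        by (intro mult_right_mono b_le_inverse) (use k8 in auto)
      also have "\<dots> = A / real k powr (3/4)"
      proof -
        have "real k powr (3/4) * real k powr (1/4) = real k" using k0 by (simp add: powr_add[symmetric])
        then show ?thesis using k0 by (simp add: field_simps)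
      qed
      also have "\<dots> \<le> 1" using kA k0 by (simp add: field_simps)
      finally show ?thesis using bk k0 by (simp add: field_simps)
    qed
    note n = real_nat_floor[OF z1, folded nn_def]
    have w2: "2 \<le> real k powr (1 - 1 / (8 * p))"
      by (rule order_trans[OF k2], rule powr_mono) (use p8 k0 in auto)
    have w1: "1 \<le> real k powr (1 - 1 / (8 * p))" using w2 by linarith
    note m = real_nat_floor[OF w1, folded mk_def]
    have mk2: "mk k \<ge> 2" using w2 unfolding mk_def by linarith
    have wk: "real k powr (1 - 1 / (8 * p)) \<le> real k"
      using powr_mono[of "1 - 1 / (8 * p)" 1 "real k"] p8 k0 by simp
    have mkk: "mk k \<le> k" using m(1) wk by linarith
    have nC: "real (nn k) \<le> Cb * real k powr p"
    proof -
      have "real (nn k) \<le> ?z" by (rule n)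
      also have "\<dots> = 1 / b k * (1 / real k powr (1/4))" by simp
      also have "\<dots> \<le> (A / b 1 * real k powr p) * 1"
        using bk A b_pos[of 1] k0 by (intro mult_mono b_lower) (auto simp: ge_one_powr_ge_zero k8 intro: order_trans[OF _ k8])
      also have "\<dots> \<le> Cb * real k powr p" unfolding Cb_def mult_1_right
        using A b_pos[of 1] by (intro mult_right_mono) (auto simp: field_simps)
      finally show ?thesis .
    qed
    have Vn: "(2 * real (bs k) + 1) ^ CARD('d) / real (nn k) \<le> 2 * A * real k powr (1/4)"
    proof -
      have "(2 * real (bs k) + 1) ^ CARD('d) \<le> A / b k" by (rule bs_facts(4)[OF bsa k8])
      also have "\<dots> = 2 * A * real k powr (1/4) * (?z / 2)" using k0 by simp
      also have "\<dots> \<le> 2 * A * real k powr (1/4) * real (nn k)"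
        by (rule mult_left_mono[OF n(2)]) (use A in simp)
      finally show ?thesis using n(3) by (simp add: field_simps)
    qed
    have h: "real k powr (- (1/4)) / 64 \<le> min 1 (real (nn k) * b k / 32)"
    proof -
      have "?z / 2 * b k / 32 \<le> real (nn k) * b k / 32"
        using n(2) bk by (intro divide_right_mono mult_right_mono) auto
      moreover have "?z / 2 * b k / 32 = real k powr (- (1/4)) / 64"
        using bk k0 by (simp add: powr_minus field_simps)
      moreover have "real k powr (- (1/4)) \<le> 1" using powr_mono[of "- (1/4)" 0 "real k"] k0 by simp
      ultimately show ?thesis by simp
    qed
    have g: "c5 * real k powr (1 / (8 * p)) \<le> (2 * real (bs k) + 1) ^ CARD('d) * (real k * b k / 16) / greenB0 L k (mk k) (nn k)"
      if er: "real (nn k) * (real (k + 1) * err0 L k) \<le> 1" for L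
    proof -
      let ?w = "real k powr (1 - 1 / (8 * p))"
      have sum: "(\<Sum>m=mk k..k. b (m div 2)) \<le> 2 * real k * (A * (6 powr p * real k powr (1/8)) * b k)"
      proof -
        have "b (m div 2) \<le> A * (6 powr p * real k powr (1/8)) * b k" if "m \<in> {mk k..k}" for m
        proof -
          have m2: "mk k div 2 \<ge> 1" using mk2 by linarith
          have "b (m div 2) \<le> b (mk k div 2)" by (rule b_antimono) (use that in \<open>auto intro: div_le_mono\<close>)
          also have "\<dots> \<le> A * (real k / real (mk k div 2)) powr p * b k"
            by (rule b_scaling[OF m2]) (use mkk in linarith)
          also have "\<dots> \<le> A * (6 * real k powr (1 / (8 * p))) powr p * b k"
          proof (intro mult_right_mono mult_left_mono powr_mono2)
            have "?w / 6 \<le> real (mk k div 2)" using div2_ge[OF mk2] m(2) by linarith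
            then have "real k / real (mk k div 2) \<le> real k / (?w / 6)"
              using k0 m2 w1 by (intro divide_left_mono) auto
            also have "\<dots> = 6 * real k powr (1 / (8 * p))"
              using k0 by (simp add: powr_diff)
            finally show "real k / real (mk k div 2) \<le> 6 * real k powr (1 / (8 * p))" .
          qed (use A p bk in auto)
          also have "(6 * real k powr (1 / (8 * p))) powr p = 6 powr p * real k powr (1/8)"
            using p by (simp add: powr_mult powr_powr)
          finally show ?thesis .
        qed
        then have "(\<Sum>m=mk k..k. b (m div 2)) \<le> (\<Sum>m=mk k..k. A * (6 powr p * real k powr (1/8)) * b k)"
          by (rule sum_mono)
        also have "\<dots> = real (k + 1 - mk k) * (A * (6 powr p * real k powr (1/8)) * b k)" by simp
        also have "\<dots> \<le> 2 * real k * (A * (6 powr p * real k powr (1/8)) * b k)"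
          using k8 A bk by (intro mult_right_mono mult_nonneg_nonneg) auto
        finally show ?thesis .
      qed
      have "real (nn k) * (\<Sum>m=mk k..k. b (m div 2)) \<le> ?z * (2 * real k * (A * (6 powr p * real k powr (1/8)) * b k))"
        by (rule mult_mono[OF n(1) sum]) (use bk k0 in \<open>auto intro!: sum_nonneg simp: b_pos less_imp_le\<close>)
      also have "\<dots> = 2 * A * 6 powr p * (real k * real k powr (1/8) / real k powr (1/4))"
        using bk k0 by (simp add: field_simps)
      also have "real k * real k powr (1/8) / real k powr (1/4) = real k powr (7/8)"
      proof -
        have "real k * real k powr (1/8) / real k powr (1/4) = real k powr (1 + 1/8 - 1/4)"
          unfolding powr_diff powr_add using k0 by simp
        then show ?thesis by simp
      qed
      also have "real k powr (7/8) \<le> ?w" by (rule powr_mono) (use p8 k0 in auto)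
      finally have ns: "real (nn k) * (\<Sum>m=mk k..k. b (m div 2)) \<le> 2 * A * 6 powr p * ?w"
        using A by (simp add: mult_left_mono)
      have gB: "greenB0 L k (mk k) (nn k) \<le> (2 + 2 * A * 6 powr p) * ?w"
      proof -
        have "greenB0 L k (mk k) (nn k) = real (mk k) + real (nn k) * (\<Sum>m=mk k..k. b (m div 2)) + real (nn k) * (real (k + 1) * err0 L k)"
          by (simp add: greenB0_def algebra_simps)
        also have "\<dots> \<le> ?w + 2 * A * 6 powr p * ?w + 1" by (intro add_mono m ns er)
        also have "\<dots> \<le> (2 + 2 * A * 6 powr p) * ?w" using w1 by (simp add: algebra_simps)
        finally show ?thesis .
      qed
      have gp: "0 < greenB0 L k (mk k) (nn k)"
      proof -
        have "0 \<le> real (nn k) * ((\<Sum>m=mk k..k. b (m div 2)) + real (k + 1) * err0 L k)"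
          using b_pos err0_nonneg[of L k] by (intro mult_nonneg_nonneg add_nonneg_nonneg sum_nonneg) (auto simp: less_imp_le)
        then show ?thesis unfolding greenB0_def using mk2 by simp
      qed
      have "c5 * real k powr (1 / (8 * p)) = c1 * (real k / 16) / ((2 + 2 * A * 6 powr p) * ?w)"
      proof -
        define a where "a = 2 + 2 * A * 6 powr p"
        have "a > 0" using A by (simp add: a_def add_pos_nonneg)
        then show ?thesis
          using k0 unfolding c5_def a_def[symmetric] powr_diff by (simp add: field_simps)
      qed
      also have "\<dots> \<le> c1 * (real k / 16) / greenB0 L k (mk k) (nn k)"
        using gB gp c1_pos by (intro divide_left_mono) (auto intro: order.strict_trans2)
      also have "\<dots> \<le> ((2 * real (bs k) + 1) ^ CARD('d) * b k) * (real k / 16) / greenB0 L k (mk k) (nn k)"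
        using bs_facts(3)[OF bsa k8] gp by (intro divide_right_mono mult_right_mono) auto
      finally show ?thesis by (simp add: mult_ac)
    qed
    show "8 \<le> k \<and> 1 \<le> c * real (rho (k div 4)) / 3 \<and> 1 \<le> nn k \<and> 1 \<le> mk k \<and> mk k \<le> k + 1 \<and>
    real (nn k) \<le> Cb * real k powr p \<and>
    (2 * real (bs k) + 1) ^ CARD('d) / real (nn k) \<le> 2 * A * real k powr (1/4) \<and>
    real k powr (- (1/4)) / 64 \<le> min 1 (real (nn k) * b k / 32) \<and>
    (\<forall>L. real (nn k) * (real (k + 1) * err0 L k) \<le> 1 \<longrightarrow>
       c5 * real k powr (1 / (8 * p)) \<le> (2 * real (bs k) + 1) ^ CARD('d) * (real k * b k / 16) / greenB0 L k (mk k) (nn k))"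
      using k8 bsa n(3) m(3) mkk nC Vn h g by simp
  qed
qed

end

section \<open>The terms of the activation bound\<close>

context walk_estimates
begin

definition logvol :: "nat \<Rightarrow> real" where "logvol L = real CARD('d) * ln (real L)"

lemma exp_logvol: "L \<ge> 1 \<Longrightarrow> exp (logvol L) = real L ^ CARD('d)"
  by (simp add: logvol_def exp_of_nat_mult)

text \<open>What is used of a lifespan l slightly above the critical one. The third clause gives
  every vertex a mean number of visiting particles above \<open>logvol\<close>, with a margin e / 2
  to be spent on entropy and on the window. The last two clauses convert between l / G l and
  \<open>logvol\<close>.\<close>

definition supercritical :: "real \<Rightarrow> real \<Rightarrow> real \<Rightarrow> nat \<Rightarrow> nat \<Rightarrow> bool" where
  "supercritical lam e c0 L l \<longleftrightarrow> L \<ge> 3 \<and> c0 * (real l / ln (real l)) \<le> logvol L \<and>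
     (1 + e / 2) * logvol L \<le> lam * (real (l + 1) / (G l + real (l + 1) * err0 L l)) \<and>
     lam * (real (2 * l + 1) / G l) \<le> 6 * logvol L \<and> logvol L / 2 \<le> lam * (real l / G l)"

lemma supercritical_scale: "supercritical lam e c0 L l \<Longrightarrow> L \<ge> 3"
    "supercritical lam e c0 L l \<Longrightarrow> c0 * (real l / ln (real l)) \<le> real CARD('d) * ln (real L)"
  by (auto simp: supercritical_def logvol_def)

text \<open>For n of order l / (ln l)^3 the left side is of order l / (ln l)^2.\<close>

lemma entropy_small:
  assumes "c0 > 0" "e > 0" "B > 0" "C \<ge> 1" "lam > 0"
  shows "\<forall>\<^sub>F l in sequentially. \<forall>n. real n \<le> B * (real l / ln (real l) ^ 3) \<longrightarrow>
    real n * (ln (C * real l powr p) + lam) \<le> e * (c0 * (real l / ln (real l)))"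
proof -
  have p0: "p > 0" using p by simp
  have "\<forall>\<^sub>F l :: nat in sequentially. B * (real l / ln (real l) ^ 3) * (ln C + p * ln (real l) + lam) \<le> e * (c0 * (real l / ln (real l)))"
    using assms p0 by real_asymp
  then show ?thesis
  proof (rule eventually_elim2[OF eventually_ge_at_top[of 1]], intro allI impI)
    fix l n :: nat
    assume l: "1 \<le> l" and n: "real n \<le> B * (real l / ln (real l) ^ 3)"
      and le: "B * (real l / ln (real l) ^ 3) * (ln C + p * ln (real l) + lam) \<le> e * (c0 * (real l / ln (real l)))"
    have "ln (C * real l powr p) = ln C + p * ln (real l)" using l assms by (simp add: ln_mult ln_powr)
    moreover have "0 \<le> ln C + p * ln (real l) + lam" using l assms p by (intro add_nonneg_nonneg mult_nonneg_nonneg) auto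
    ultimately have "real n * (ln (C * real l powr p) + lam) \<le> B * (real l / ln (real l) ^ 3) * (ln C + p * ln (real l) + lam)"
      using mult_right_mono[OF n, of "ln C + p * ln (real l) + lam"] by simp
    then show "real n * (ln (C * real l powr p) + lam) \<le> e * (c0 * (real l / ln (real l)))" using le by simp
  qed
qed

lemma logvol_exp_small:
  assumes "c0 > 0" "e > 0" "\<eta> > 0" "C \<ge> 0"
  shows "\<forall>\<^sub>F l in sequentially. \<forall>L. c0 * (real l / ln (real l)) \<le> logvol L \<longrightarrow> C * exp (- (e * logvol L)) \<le> \<eta>"
proof -
  have "(\<lambda>l :: nat. C * exp (- (e * (c0 * (real l / ln (real l)))))) \<longlonglongrightarrow> 0"
    using assms by real_asymp
  then have "\<forall>\<^sub>F l :: nat in sequentially. C * exp (- (e * (c0 * (real l / ln (real l))))) < \<eta>"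
    by (rule order_tendstoD) (rule assms(3))
  then show ?thesis
  proof (eventually_elim, intro allI impI)
    fix l L :: nat
    assume 1: "C * exp (- (e * (c0 * (real l / ln (real l))))) < \<eta>" and 2: "c0 * (real l / ln (real l)) \<le> logvol L"
    have "C * exp (- (e * logvol L)) \<le> C * exp (- (e * (c0 * (real l / ln (real l)))))"
      using mult_left_mono[OF 2, of e] assms by (intro mult_left_mono) auto
    then show "C * exp (- (e * logvol L)) \<le> \<eta>" using 1 by simp
  qed
qed

lemma power_le_scale:
  assumes "l \<ge> 1" "0 \<le> V" "V \<le> Cb * real l powr p" "a \<ge> 0"
  shows "(a * V + 1) ^ n \<le> exp (real n * ln ((a * Cb + 1) * real l powr p))"
proof (rule pow_le_exp)
  have "a * V \<le> a * (Cb * real l powr p)" using assms by (intro mult_left_mono) auto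
  moreover have "1 \<le> real l powr p" using assms p by (simp add: ge_one_powr_ge_zero)
  ultimately show "a * V + 1 \<le> (a * Cb + 1) * real l powr p" by (simp add: algebra_simps)
  show "0 < a * V + 1" using assms by (simp add: add_nonneg_pos)
qed

text \<open>In the exponent, in units of \<open>logvol\<close>: 1 for the choice of u, e / 8 for
  entropy and removed particles, and e / 8 = 6 e / 48 for the window, against 1 + e / 2. This leaves
  -e / 4.\<close>

lemma rich_box_term:
  assumes "lam > 0" "e > 0" "c0 > 0" "\<eta> > 0" "\<kappa>0 \<ge> 1"
  shows "\<forall>\<^sub>F l in sequentially. \<forall>L V. supercritical lam e c0 L l \<longrightarrow> 0 \<le> V \<longrightarrow> V \<le> Cb * real l powr p \<longrightarrow>
    real (yy l) \<le> real l / ln (real l) ^ 3 \<longrightarrow>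
    real L ^ CARD('d) * ((real \<kappa>0 * V + 1) ^ (\<kappa>0 * yy l) *
      exp (- lam * (real (l + 1) / (G l + real (l + 1) * err0 L l) - e / 48 * real (2 * l + 1) / G l - real (\<kappa>0 * yy l)))) \<le> \<eta>"
proof -
  have C: "real \<kappa>0 * Cb + 1 \<ge> 1" "real \<kappa>0 > 0" "e / 8 > 0" "e / 4 > 0"
    using Cb_pos assms by auto
  have "\<forall>\<^sub>F l in sequentially. \<forall>n. real n \<le> real \<kappa>0 * (real l / ln (real l) ^ 3) \<longrightarrow>
    real n * (ln ((real \<kappa>0 * Cb + 1) * real l powr p) + lam) \<le> e / 8 * (c0 * (real l / ln (real l)))"
    by (rule entropy_small) (use C assms in auto)
  moreover have "\<forall>\<^sub>F l in sequentially. \<forall>L. c0 * (real l / ln (real l)) \<le> logvol L \<longrightarrow> 1 * exp (- (e / 4 * logvol L)) \<le> \<eta>"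
    by (rule logvol_exp_small) (use C assms in auto)
  ultimately show ?thesis
    using eventually_ge_at_top[of 1]
  proof (eventually_elim, intro allI impI)
    fix l L :: nat and V :: real
    assume ent: "\<forall>n. real n \<le> real \<kappa>0 * (real l / ln (real l) ^ 3) \<longrightarrow>
        real n * (ln ((real \<kappa>0 * Cb + 1) * real l powr p) + lam) \<le> e / 8 * (c0 * (real l / ln (real l)))"
      and sm: "\<forall>L. c0 * (real l / ln (real l)) \<le> logvol L \<longrightarrow> 1 * exp (- (e / 4 * logvol L)) \<le> \<eta>"
      and l: "1 \<le> l" and sup: "supercritical lam e c0 L l" and V: "0 \<le> V" "V \<le> Cb * real l powr p"
      and y: "real (yy l) \<le> real l / ln (real l) ^ 3"
    let ?n = "\<kappa>0 * yy l" and ?R = "real (l + 1) / (G l + real (l + 1) * err0 L l)"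
    let ?h = "ln ((real \<kappa>0 * Cb + 1) * real l powr p)"
    have n: "real ?n * (?h + lam) \<le> e / 8 * logvol L"
    proof -
      have "real ?n \<le> real \<kappa>0 * (real l / ln (real l) ^ 3)" using mult_left_mono[OF y, of "real \<kappa>0"] by simp
      then have "real ?n * (?h + lam) \<le> e / 8 * (c0 * (real l / ln (real l)))" using ent by blast
      also have "\<dots> \<le> e / 8 * logvol L" by (rule mult_left_mono) (use sup assms in \<open>auto simp: supercritical_def\<close>)
      finally show ?thesis .
    qed
    have d: "lam * (e / 48 * real (2 * l + 1) / G l) \<le> e / 8 * logvol L"
    proof -
      have "e / 48 * (lam * (real (2 * l + 1) / G l)) \<le> e / 48 * (6 * logvol L)"
        by (rule mult_left_mono) (use sup assms in \<open>auto simp: supercritical_def\<close>)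
      then show ?thesis by (simp add: mult_ac)
    qed
    have R: "(1 + e / 2) * logvol L \<le> lam * ?R" using sup by (simp add: supercritical_def)
    have "real L ^ CARD('d) * ((real \<kappa>0 * V + 1) ^ ?n * exp (- lam * (?R - e / 48 * real (2 * l + 1) / G l - real ?n)))
       \<le> exp (logvol L) * (exp (real ?n * ?h) * exp (- lam * (?R - e / 48 * real (2 * l + 1) / G l - real ?n)))"
      using sup l by (intro mult_mono power_le_scale V) (auto simp: exp_logvol supercritical_def V)
    also have "\<dots> = exp (logvol L + real ?n * (?h + lam) + lam * (e / 48 * real (2 * l + 1) / G l) - lam * ?R)"
    proof -
      have "exp a * (exp (n * h) * exp (- lam * (R - D - n))) = exp (a + n * (h + lam) + lam * D - lam * R)"
        for a n h R D :: real by (simp add: algebra_simps flip: exp_add)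
      then show ?thesis .
    qed
    also have "\<dots> \<le> 1 * exp (- (e / 4 * logvol L))"
    proof -
      have "exp (v + a + D - R) \<le> 1 * exp (- (e / 4 * v))"
        if "a \<le> e / 8 * v" "D \<le> e / 8 * v" "(1 + e / 2) * v \<le> R" for v a D R
      proof -
        have "v + e / 2 * v \<le> R" using that(3) by (simp add: distrib_right)
        then have "v + a + D - R \<le> - (e / 4 * v)" using that(1,2) by linarith
        then show ?thesis by simp
      qed
      from this[OF n d R] show ?thesis .
    qed
    also have "\<dots> \<le> \<eta>" using sm sup by (simp add: supercritical_def)
    finally show "real L ^ CARD('d) * ((real \<kappa>0 * V + 1) ^ ?n * exp (- lam * (?R - e / 48 * real (2 * l + 1) / G l - real ?n))) \<le> \<eta>" .
  qed
qed

text \<open>\<open>critical_green\<close> with c1 / 128 makes the mean at least 8 l / G l, since 16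
  / 128 = 1 / 8. Times \<open>lam\<close> this is at least 4 \<open>logvol\<close>, against
  \<open>logvol\<close> for the centres and at most \<open>logvol\<close> for the entropy.\<close>

lemma neighbour_term:
  assumes "lam > 0" "e > 0" "c0 > 0" "\<eta> > 0"
  shows "\<forall>\<^sub>F l in sequentially. \<forall>L V. supercritical lam e c0 L l \<longrightarrow> c1 \<le> V * b l \<longrightarrow> 0 \<le> V \<longrightarrow> V \<le> Cb * real l powr p \<longrightarrow>
    real L ^ CARD('d) * 3 ^ CARD('d) * (V + 1) ^ (yy l + yy l) *
      exp (- lam * (V * real (yy l) * (real l * b l / 16) / greenB0 L l (mm l) (yy l) - real (yy l))) \<le> \<eta>"
proof -
  have e1: "c1 / 128 > 0" using c1_pos by simp
  have "\<forall>\<^sub>F l in sequentially. \<forall>n. real n \<le> 2 * (real l / ln (real l) ^ 3) \<longrightarrow>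
    real n * (ln ((1 * Cb + 1) * real l powr p) + lam) \<le> 1 * (c0 * (real l / ln (real l)))"
    by (rule entropy_small) (use Cb_pos assms in auto)
  moreover have "\<forall>\<^sub>F l in sequentially. \<forall>L. c0 * (real l / ln (real l)) \<le> logvol L \<longrightarrow> 3 ^ CARD('d) * exp (- (2 * logvol L)) \<le> \<eta>"
    by (rule logvol_exp_small) (use assms in auto)
  ultimately show ?thesis
    using eventually_ge_at_top[of 1] critical_green[OF assms(3) e1]
  proof (eventually_elim, intro allI impI)
    fix l L :: nat and V :: real
    assume ent: "\<forall>n. real n \<le> 2 * (real l / ln (real l) ^ 3) \<longrightarrow>
        real n * (ln ((1 * Cb + 1) * real l powr p) + lam) \<le> 1 * (c0 * (real l / ln (real l)))"
      and sm: "\<forall>L. c0 * (real l / ln (real l)) \<le> logvol L \<longrightarrow> 3 ^ CARD('d) * exp (- (2 * logvol L)) \<le> \<eta>"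
      and l: "1 \<le> l" and sup: "supercritical lam e c0 L l" and V: "0 \<le> V" "V \<le> Cb * real l powr p" and c1: "c1 \<le> V * b l"
      and crit: "\<forall>L. L \<ge> 3 \<longrightarrow> c0 * (real l / ln (real l)) \<le> CARD('d) * ln (real L) \<longrightarrow>
        1 \<le> yy l \<and> real (yy l) \<le> real l / ln (real l) ^ 3 \<and> 1 \<le> mm l \<and> mm l \<le> l + 1 \<and>
        greenB0 L l (mm l) (yy l) \<le> real (yy l) * (c1 / 128 * G l)"
    have y: "1 \<le> yy l" "real (yy l) \<le> real l / ln (real l) ^ 3" "1 \<le> mm l"
        "greenB0 L l (mm l) (yy l) \<le> real (yy l) * (c1 / 128 * G l)"
      using crit supercritical_scale[OF sup] by auto
    let ?y = "real (yy l)" and ?g = "greenB0 L l (mm l) (yy l)" and ?h = "ln ((1 * Cb + 1) * real l powr p)"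
    let ?\<mu> = "V * ?y * (real l * b l / 16) / ?g"
    have g: "0 < ?g"
    proof -
      have "0 \<le> real (yy l) * ((\<Sum>m=mm l..l. b (m div 2)) + real (l + 1) * err0 L l)"
        using b_pos err0_nonneg[of L l] by (intro mult_nonneg_nonneg add_nonneg_nonneg sum_nonneg) (auto simp: less_imp_le)
      then show ?thesis unfolding greenB0_def using y by simp
    qed
    have G1: "0 < G l" using G_ge_1[of l] by simp
    have mu: "4 * logvol L \<le> lam * ?\<mu>"
    proof -
      have "8 * (real l / G l) = c1 * (?y * (real l / 16)) / (?y * (c1 / 128 * G l))"
        using y c1_pos G1 by (simp add: field_simps)
      also have "\<dots> \<le> c1 * (?y * (real l / 16)) / ?g"
        using y g c1_pos G1 by (intro divide_left_mono) auto
      also have "\<dots> \<le> (V * b l) * (?y * (real l / 16)) / ?g"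
        using c1 g by (intro divide_right_mono mult_right_mono) auto
      finally have "8 * (real l / G l) \<le> ?\<mu>" by (simp add: mult_ac)
      then have "lam * (8 * (real l / G l)) \<le> lam * ?\<mu>" using assms(1) by (intro mult_left_mono) auto
      moreover have "logvol L / 2 \<le> lam * (real l / G l)" using sup by (simp add: supercritical_def)
      ultimately show ?thesis by simp
    qed
    have n: "real (yy l + yy l) * (?h + lam) \<le> logvol L"
    proof -
      have "real (yy l + yy l) \<le> 2 * (real l / ln (real l) ^ 3)" using y by simp
      then have "real (yy l + yy l) * (?h + lam) \<le> 1 * (c0 * (real l / ln (real l)))" using ent by blast
      also have "\<dots> \<le> logvol L" using sup by (auto simp: supercritical_def)
      finally show ?thesis .
    qed
    have "real L ^ CARD('d) * 3 ^ CARD('d) * (V + 1) ^ (yy l + yy l) * exp (- lam * (?\<mu> - ?y))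
       \<le> exp (logvol L) * 3 ^ CARD('d) * exp (real (yy l + yy l) * ?h) * exp (- lam * (?\<mu> - ?y))"
      using sup l power_le_scale[OF l V, of 1 "yy l + yy l"]
      by (intro mult_mono) (auto simp: exp_logvol supercritical_def V)
    also have "\<dots> = 3 ^ CARD('d) * exp (logvol L + real (yy l + yy l) * ?h + lam * ?y - lam * ?\<mu>)"
      by (simp add: algebra_simps flip: exp_add)
    also have "\<dots> \<le> 3 ^ CARD('d) * exp (- (2 * logvol L))"
    proof -
      have "lam * ?y \<ge> 0" using assms by simp
      then have "logvol L + real (yy l + yy l) * ?h + lam * ?y - lam * ?\<mu> \<le> - (2 * logvol L)"
        using n mu by (simp add: algebra_simps)
      then show ?thesis by simp
    qed
    also have "\<dots> \<le> \<eta>" using sm sup by (simp add: supercritical_def)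
    finally show "real L ^ CARD('d) * 3 ^ CARD('d) * (V + 1) ^ (yy l + yy l) * exp (- lam * (?\<mu> - ?y)) \<le> \<eta>" .
  qed
qed

definition tau_bound :: "real \<Rightarrow> nat \<Rightarrow> real" where
  "tau_bound lam k = (Cb * real k powr p + 1) ^ 3 * exp (- lam * (c5 * real k powr (1 / (8 * p)) - 2))"

lemma tau_bound_small:
  assumes "lam > 0" "\<eta> > 0"
  shows "\<forall>\<^sub>F k in sequentially. C * real k powr r * tau_bound lam k \<le> \<eta>"
proof -
  define r' where "r' = 1 / (8 * p)"
  have r': "r' > 0" using p by (simp add: r'_def)
  have p0: "p > 0" using p by simp
  note c5 = c5_pos Cb_pos
  have "(\<lambda>k :: nat. C * real k powr r * ((Cb * real k powr p + 1) ^ 3 * exp (- lam * (c5 * real k powr r' - 2)))) \<longlonglongrightarrow> 0"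
    using r' p0 c5 assms by real_asymp
  then have "\<forall>\<^sub>F k in sequentially. C * real k powr r * ((Cb * real k powr p + 1) ^ 3 * exp (- lam * (c5 * real k powr r' - 2))) < \<eta>"
    by (rule order_tendstoD) (rule assms(2))
  then show ?thesis by eventually_elim (simp add: tau_bound_def r'_def)
qed

text \<open>The number of boxes in the cube of radius l^a is polynomial in k, while
  \<open>tau_bound\<close> decays like a stretched exponential of k.\<close>

lemma growth_term:
  assumes "lam > 0" "\<eta> > 0"
  shows "\<forall>\<^sub>F k in sequentially. \<forall>l. l \<le> (k + 1)\<^sup>2 \<longrightarrow>
    (2 * real (l ^ a) + 1) ^ CARD('d) * 3 ^ CARD('d) * (2 * tau_bound lam k) \<le> \<eta>"
proof -
  let ?C = "((3 * 4 ^ a) ^ CARD('d) * 3 ^ CARD('d) * 2 :: real)"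
  have "\<forall>\<^sub>F k in sequentially. ?C * real k powr real (2 * a * CARD('d)) * tau_bound lam k \<le> \<eta>"
    by (rule tau_bound_small[OF assms])
  then show ?thesis
  proof (rule eventually_elim2[OF eventually_ge_at_top[of 1]], intro allI impI)
    fix k l :: nat
    assume k: "1 \<le> k" and sm: "?C * real k powr real (2 * a * CARD('d)) * tau_bound lam k \<le> \<eta>" and l: "l \<le> (k + 1)\<^sup>2"
    have tb: "0 \<le> tau_bound lam k" using Cb_pos by (simp add: tau_bound_def)
    have "(k + 1)\<^sup>2 \<le> (2 * k)\<^sup>2" using k by (intro power_mono) auto
    then have "l \<le> 4 * k\<^sup>2" using l by (simp add: power_mult_distrib)
    then have "l ^ a \<le> (4 * k\<^sup>2) ^ a" by (intro power_mono) auto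
    also have "\<dots> = 4 ^ a * k ^ (2 * a)" by (simp add: power_mult_distrib power_mult)
    finally have "real (l ^ a) \<le> real (4 ^ a * k ^ (2 * a))" by (rule of_nat_mono)
    then have 1: "real (l ^ a) \<le> 4 ^ a * real k ^ (2 * a)" by simp
    have "1 * 1 \<le> 4 ^ a * real k ^ (2 * a)" using k by (intro mult_mono) (auto simp: one_le_power)
    then have "2 * real (l ^ a) + 1 \<le> 3 * 4 ^ a * real k ^ (2 * a)" using 1 by simp
    then have "(2 * real (l ^ a) + 1) ^ CARD('d) \<le> (3 * 4 ^ a * real k ^ (2 * a)) ^ CARD('d)" by (intro power_mono) auto
    also have "\<dots> = (3 * 4 ^ a) ^ CARD('d) * real k powr real (2 * a * CARD('d))"
    proof -
      have "real k powr real (2 * a * CARD('d)) = (real k ^ (2 * a)) ^ CARD('d)"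
        by (subst powr_realpow) (use k in \<open>auto simp: power_mult\<close>)
      then show ?thesis by (simp only: power_mult_distrib)
    qed
    finally have "(2 * real (l ^ a) + 1) ^ CARD('d) * (3 ^ CARD('d) * (2 * tau_bound lam k)) \<le>
        (3 * 4 ^ a) ^ CARD('d) * real k powr real (2 * a * CARD('d)) * (3 ^ CARD('d) * (2 * tau_bound lam k))"
      using tb by (intro mult_right_mono) auto
    also have "\<dots> = ?C * real k powr real (2 * a * CARD('d)) * tau_bound lam k" by (simp only: mult_ac)
    also have "\<dots> \<le> \<eta>" by (rule sm)
    finally show "(2 * real (l ^ a) + 1) ^ CARD('d) * 3 ^ CARD('d) * (2 * tau_bound lam k) \<le> \<eta>"
      by (simp only: mult.assoc)
  qed
qed

text \<open>At least k blocks, each successful with probability at least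
  \<open>k powr (-1/4)\<close> / 64, fail with probability at most exp (-
  \<open>k powr (3/4)\<close> / 64). The condition on a makes the displacement term at most 2 A / k.
  Both beat the prefactor of order \<open>k powr (1/4)\<close>.\<close>

lemma planted_term:
  assumes "\<eta> > 0" and a: "real a * \<kappa> \<ge> 3"
  shows "\<forall>\<^sub>F k in sequentially. \<forall>l W h n. k * k \<le> l \<longrightarrow> 0 \<le> W \<longrightarrow> W / n \<le> 2 * A * real k powr (1/4) \<longrightarrow>
    real k powr (- (1/4)) / 64 \<le> h \<longrightarrow> h \<le> 1 \<longrightarrow> 0 < n \<longrightarrow>
    W * ((1 - h) ^ (l div k) + real (l + 1) * (A * real l * real (l ^ a) powr - \<kappa>)) / n \<le> \<eta>"
proof -
  have A0: "A > 0" using A by simp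
  have "(\<lambda>k :: nat. 2 * A * real k powr (1/4) * (exp (- (real k powr (- (1/4)) / 64 * real k)) + 2 * A / real k)) \<longlonglongrightarrow> 0"
    using A0 by real_asymp
  then have "\<forall>\<^sub>F k :: nat in sequentially. 2 * A * real k powr (1/4) * (exp (- (real k powr (- (1/4)) / 64 * real k)) + 2 * A / real k) < \<eta>"
    by (rule order_tendstoD) (rule assms(1))
  then show ?thesis
  proof (rule eventually_elim2[OF eventually_ge_at_top[of 1]], intro allI impI)
    fix k l :: nat and W h n :: real
    assume k: "1 \<le> k" and sm: "2 * A * real k powr (1/4) * (exp (- (real k powr (- (1/4)) / 64 * real k)) + 2 * A / real k) < \<eta>"
      and l: "k * k \<le> l" and W: "0 \<le> W" "W / n \<le> 2 * A * real k powr (1/4)" and h: "real k powr (- (1/4)) / 64 \<le> h" "h \<le> 1" and n: "0 < n"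
    have kl: "k \<le> l div k" using l k by (simp add: less_eq_div_iff_mult_less_eq)
    have kl': "k \<le> l" using l k by (metis le_trans le_square)
    have l1: "1 \<le> l" using kl' k by simp
    have h0: "0 \<le> h" using h(1) by (rule order_trans[rotated]) simp
    have 1: "(1 - h) ^ (l div k) \<le> exp (- (real k powr (- (1/4)) / 64 * real k))"
    proof -
      have "(1 - h) ^ (l div k) \<le> exp (- h) ^ (l div k)"
        using h exp_ge_add_one_self[of "- h"] by (intro power_mono) auto
      also have "\<dots> = exp (- (h * real (l div k)))" by (simp add: mult.commute flip: exp_of_nat_mult)
      also have "\<dots> \<le> exp (- (real k powr (- (1/4)) / 64 * real k))"
      proof -
        have "real k powr (- (1/4)) / 64 * real k \<le> h * real (l div k)"
          using h kl h0 by (intro mult_mono) auto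
        then show ?thesis by simp
      qed
      finally show ?thesis .
    qed
    have 2: "real (l + 1) * (A * real l * real (l ^ a) powr - \<kappa>) \<le> 2 * A / real k"
    proof -
      have "real (l ^ a) powr - \<kappa> = real l powr - (real a * \<kappa>)"
        using l1 by (simp add: powr_powr flip: powr_realpow)
      also have "\<dots> \<le> real l powr - 3" by (rule powr_mono) (use a l1 in auto)
      also have "\<dots> = 1 / real l ^ 3" using l1 by (simp add: powr_minus powr_numeral divide_inverse)
      finally have "real (l + 1) * (A * real l * real (l ^ a) powr - \<kappa>) \<le> (2 * real l) * (A * real l * (1 / real l ^ 3))"
        using A l1 by (intro mult_mono mult_left_mono) auto
      also have "\<dots> = 2 * A / real l" using l1 by (simp add: eval_nat_numeral)
      also have "\<dots> \<le> 2 * A / real k" using kl' k A by (intro divide_left_mono) auto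
      finally show ?thesis .
    qed
    have "W * ((1 - h) ^ (l div k) + real (l + 1) * (A * real l * real (l ^ a) powr - \<kappa>)) / n =
        W / n * ((1 - h) ^ (l div k) + real (l + 1) * (A * real l * real (l ^ a) powr - \<kappa>))" by simp
    also have "\<dots> \<le> 2 * A * real k powr (1/4) * (exp (- (real k powr (- (1/4)) / 64 * real k)) + 2 * A / real k)"
      using 1 2 W n h A by (intro mult_mono add_mono) auto
    finally show "W * ((1 - h) ^ (l div k) + real (l + 1) * (A * real l * real (l ^ a) powr - \<kappa>)) / n \<le> \<eta>" using sm by simp
  qed
qed

text \<open>The lower bound k k for l provides at least k blocks of length k; the upper bound keeps
  quantities polynomial in l polynomial in k.\<close>

lemma root_scale:
  fixes l :: nat
  defines "k \<equiv> nat \<lfloor>sqrt (real l)\<rfloor>"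
  shows "k * k \<le> l" "l \<le> (k + 1)\<^sup>2" "k \<le> l"
proof -
  have k: "real k \<le> sqrt (real l)" "sqrt (real l) \<le> real k + 1"
    unfolding k_def using real_sqrt_ge_zero[of "real l"] by linarith+
  have "real (k * k) \<le> sqrt (real l) * sqrt (real l)" using k unfolding of_nat_mult by (intro mult_mono) auto
  then have "real (k * k) \<le> real l" by simp
  then show kk: "k * k \<le> l" by (simp only: of_nat_le_iff)
  show "k \<le> l" using kk by (meson le_square le_trans)
  have "(sqrt (real l))\<^sup>2 \<le> (real k + 1)\<^sup>2" by (rule power_mono[OF k(2)]) simp
  then have "real l \<le> real ((k + 1)\<^sup>2)" by (simp add: add.commute)
  then show "l \<le> (k + 1)\<^sup>2" by (simp only: of_nat_le_iff)
qed

lemma eventually_root: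
  assumes "\<forall>\<^sub>F k in sequentially. P k"
  shows "\<forall>\<^sub>F l in sequentially. P (nat \<lfloor>sqrt (real l)\<rfloor>)"
proof -
  have "filterlim (\<lambda>l. nat \<lfloor>sqrt (real l)\<rfloor>) sequentially sequentially"
    unfolding filterlim_at_top
  proof
    fix Z :: nat
    show "\<forall>\<^sub>F l in sequentially. Z \<le> nat \<lfloor>sqrt (real l)\<rfloor>"
      using eventually_ge_at_top[of "Z\<^sup>2"]
    proof eventually_elim
      fix l assume "Z\<^sup>2 \<le> l"
      then have "(real Z)\<^sup>2 \<le> real l" by (metis of_nat_le_iff of_nat_power)
      then have "real Z \<le> sqrt (real l)" by (rule real_le_rsqrt)
      then show "Z \<le> nat \<lfloor>sqrt (real l)\<rfloor>" by (simp add: le_nat_floor)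
    qed
  qed
  then show ?thesis using assms by (rule eventually_compose_filterlim[rotated])
qed

lemma activation_eventually:
  assumes "lam > 0" "e > 0" "c0 > 0" "\<eta> > 0"
  shows "\<forall>\<^sub>F l in sequentially. \<forall>L (M :: 'a measure) Q N X. supercritical lam e c0 L l \<longrightarrow>
    frog_estimates q A p c \<kappa> rho K L M Q lam N X \<longrightarrow>
    (\<exists>E\<in>sets M. {\<omega> \<in> space M. activated L (\<lambda>v. N v \<omega>) (\<lambda>p. X p \<omega>) l \<noteq> torus L} \<subseteq> E \<and> measure M E \<le> \<eta>)"
proof -
  \<comment> \<open>The bound p + 1 puts the large box at the origin inside the cube of radius l^a,
    and 3 / \<kappa> serves \<open>planted_term\<close>.\<close>
  define a where "a = nat \<lceil>max (p + 1) (3 / \<kappa>)\<rceil>"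
  have a0: "max (p + 1) (3 / \<kappa>) \<le> real a" unfolding a_def by linarith
  then have a1: "p + 1 \<le> real a" by simp
  have a2: "real a * \<kappa> \<ge> 3" using a0 kap by (simp add: field_simps)
  \<comment> \<open>Six times \<delta> is e / 8, the share of the margin reserved for the window in
    \<open>rich_box_term\<close>.\<close>
  define \<delta> where "\<delta> = e / 48"
  \<comment> \<open>Since 2 l is at most 16 (\<open>l div 4\<close>), \<open>rho_le_rho\<close> and
    the choice of \<open>bs\<close> bound \<open>rho (2 * l)\<close> by a constant times
    \<open>bs l\<close>. So the number of boxes needed to cover the window does not depend on
    l.\<close>
  define j where "j = nat \<lceil>K \<delta> * (A\<^sup>2 * 16 powr p * (6 / c))\<rceil>"
  define \<kappa>0 where "\<kappa>0 = (2 * j + 1) ^ CARD('d)"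
  have k01: "\<kappa>0 \<ge> 1" unfolding \<kappa>0_def by simp
  have \<delta>0: "\<delta> > 0" using assms by (simp add: \<delta>_def)
  have \<eta>4: "\<eta> / 4 > 0" using assms by simp
  \<comment> \<open>This keeps the sides of the boxes below L, which is at least the exponential on
    the right.\<close>
  have growth: "\<forall>\<^sub>F l :: nat in sequentially. Cb * real l powr p \<le> exp (c0 / CARD('d) * (real l / ln (real l)))"
  proof -
    define w where "w = c0 / CARD('d)"
    have "w > 0" "p > 0" using assms p by (auto simp: w_def)
    then have "(\<lambda>l :: nat. Cb * real l powr p / exp (w * (real l / ln (real l)))) \<longlonglongrightarrow> 0"
      using Cb_pos by real_asymp
    then have "\<forall>\<^sub>F l :: nat in sequentially. Cb * real l powr p / exp (w * (real l / ln (real l))) < 1"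
      by (rule order_tendstoD) simp
    then show ?thesis by eventually_elim (simp add: w_def field_simps)
  qed
  have far: "\<forall>\<^sub>F l :: nat in sequentially. Cb \<le> real l" by real_asymp
  have half: "\<forall>\<^sub>F k in sequentially. 1 * real k powr 0 * tau_bound lam k \<le> 1 / 2"
    by (rule tau_bound_small) (use assms in auto)
  have errs: "\<forall>\<^sub>F l in sequentially. Cb * real l powr p * (real l + 1) * errB c0 l \<le> 1"
    by (rule errB_small) (use assms in auto)
  show ?thesis
    using growth far errs eventually_root[OF half] eventually_root[OF local_scale]
      eventually_root[OF growth_term[OF assms(1) \<eta>4, of a]] eventually_root[OF planted_term[OF \<eta>4 a2]]
      eventually_bs_arg eventually_ge_at_top[of 8]
      rich_box_term[OF assms(1,2,3) \<eta>4 k01] neighbour_term[OF assms(1,2,3) \<eta>4] critical_green[OF assms(3) zero_less_one]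
  proof (eventually_elim, intro allI impI)
    fix l L :: nat and M :: "'a measure" and Q N X
    let ?k = "nat \<lfloor>sqrt (real l)\<rfloor>"
    let ?V = "(2 * real (bs l) + 1) ^ CARD('d)" and ?W = "(2 * real (bs ?k) + 1) ^ CARD('d)"
    let ?h = "min 1 (real (nn ?k) * b ?k / 32)"
    assume gr: "Cb * real l powr p \<le> exp (c0 / CARD('d) * (real l / ln (real l)))" and far: "Cb \<le> real l"
      and er: "Cb * real l powr p * (real l + 1) * errB c0 l \<le> 1"
      and half: "1 * real ?k powr 0 * tau_bound lam ?k \<le> 1 / 2"
      and loc: "?k \<ge> 8 \<and> 1 \<le> c * real (rho (?k div 4)) / 3 \<and> 1 \<le> nn ?k \<and> 1 \<le> mk ?k \<and> mk ?k \<le> ?k + 1 \<and>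
        real (nn ?k) \<le> Cb * real ?k powr p \<and> ?W / real (nn ?k) \<le> 2 * A * real ?k powr (1/4) \<and>
        real ?k powr (- (1/4)) / 64 \<le> ?h \<and>
        (\<forall>L. real (nn ?k) * (real (?k + 1) * err0 L ?k) \<le> 1 \<longrightarrow>
           c5 * real ?k powr (1 / (8 * p)) \<le> ?W * (real ?k * b ?k / 16) / greenB0 L ?k (mk ?k) (nn ?k))"
      and gt: "\<forall>l. l \<le> (?k + 1)\<^sup>2 \<longrightarrow> (2 * real (l ^ a) + 1) ^ CARD('d) * 3 ^ CARD('d) * (2 * tau_bound lam ?k) \<le> \<eta> / 4"
      and pt: "\<forall>l W h n. ?k * ?k \<le> l \<longrightarrow> 0 \<le> W \<longrightarrow> W / n \<le> 2 * A * real ?k powr (1/4) \<longrightarrow>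
        real ?k powr (- (1/4)) / 64 \<le> h \<longrightarrow> h \<le> 1 \<longrightarrow> 0 < n \<longrightarrow>
        W * ((1 - h) ^ (l div ?k) + real (l + 1) * (A * real l * real (l ^ a) powr - \<kappa>)) / n \<le> \<eta> / 4"
      and bsl: "1 \<le> c * real (rho (l div 4)) / 3" and l8: "8 \<le> l"
      and rich: "\<forall>L V. supercritical lam e c0 L l \<longrightarrow> 0 \<le> V \<longrightarrow> V \<le> Cb * real l powr p \<longrightarrow>
        real (yy l) \<le> real l / ln (real l) ^ 3 \<longrightarrow>
        real L ^ CARD('d) * ((real \<kappa>0 * V + 1) ^ (\<kappa>0 * yy l) *
          exp (- lam * (real (l + 1) / (G l + real (l + 1) * err0 L l) - e / 48 * real (2 * l + 1) / G l - real (\<kappa>0 * yy l)))) \<le> \<eta> / 4"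
      and nei: "\<forall>L V. supercritical lam e c0 L l \<longrightarrow> c1 \<le> V * b l \<longrightarrow> 0 \<le> V \<longrightarrow> V \<le> Cb * real l powr p \<longrightarrow>
        real L ^ CARD('d) * 3 ^ CARD('d) * (V + 1) ^ (yy l + yy l) *
          exp (- lam * (V * real (yy l) * (real l * b l / 16) / greenB0 L l (mm l) (yy l) - real (yy l))) \<le> \<eta> / 4"
      and crit: "\<forall>L. L \<ge> 3 \<longrightarrow> c0 * (real l / ln (real l)) \<le> CARD('d) * ln (real L) \<longrightarrow>
        1 \<le> yy l \<and> real (yy l) \<le> real l / ln (real l) ^ 3 \<and> 1 \<le> mm l \<and> mm l \<le> l + 1 \<and>
        greenB0 L l (mm l) (yy l) \<le> real (yy l) * (1 * G l)"
      and sup: "supercritical lam e c0 L l" and fe: "frog_estimates q A p c \<kappa> rho K L M Q lam N X"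
    interpret frog_estimates q A p c \<kappa> rho K L M Q lam N X by (rule fe)
    have Lc: "L \<ge> 3" "c0 * (real l / ln (real l)) \<le> CARD('d) * ln (real L)"
      using supercritical_scale[OF sup] by auto
    have y: "1 \<le> yy l" "real (yy l) \<le> real l / ln (real l) ^ 3" "1 \<le> mm l" "mm l \<le> l + 1" using crit Lc by auto
    have k: "?k \<ge> 8" "?k * ?k \<le> l" "l \<le> (?k + 1)\<^sup>2" "?k \<le> l" using loc root_scale[of l] by auto
    have V: "?V \<le> Cb * real l powr p" "real (2 * bs l + 1) \<le> Cb * real l powr p"
      using bs_volume[OF bsl l8] by auto
    have bsk: "1 \<le> c * real (rho (?k div 4)) / 3" using loc by blast
    have kp: "Cb * real ?k powr p \<le> Cb * real l powr p"
      using Cb_pos p k by (intro mult_left_mono powr_mono2) auto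
    have W: "?W \<le> Cb * real ?k powr p" "real (2 * bs ?k + 1) \<le> Cb * real l powr p"
      by (rule bs_volume[OF bsk k(1)], rule order_trans[OF bs_volume(2)[OF bsk k(1)] kp])
    have big: "Cb * real l powr p \<le> real L"
    proof -
      have "c0 / CARD('d) * (real l / ln (real l)) \<le> ln (real L)"
      proof -
        have "c0 * (real l / ln (real l)) / CARD('d) \<le> CARD('d) * ln (real L) / CARD('d)"
          by (rule divide_right_mono[OF Lc(2)]) simp
        then show ?thesis by (simp add: mult.commute)
      qed
      then have "exp (c0 / CARD('d) * (real l / ln (real l))) \<le> exp (ln (real L))" by (simp only: exp_le_cancel_iff)
      then show ?thesis using gr Lc(1) by simp
    qed
    have sL: "2 * bs l < L" "2 * bs ?k < L" using V(2) W(2) big by linarith+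
    have D0: "bs l \<le> l ^ a"
    proof -
      have "real (bs l) \<le> Cb * real l powr p" using V(2) by simp
      also have "\<dots> \<le> real l * real l powr p" using far by (intro mult_right_mono) auto
      also have "\<dots> = real l powr (p + 1)" using l8 by (simp add: powr_add)
      also have "\<dots> \<le> real l powr real a" by (rule powr_mono) (use a1 l8 in auto)
      also have "\<dots> = real (l ^ a)" using l8 by (simp add: powr_realpow)
      finally show ?thesis by (simp only: of_nat_le_iff)
    qed
    have j: "K \<delta> * rho (2 * l) \<le> bs l * j"
    proof -
      have "2 * l \<le> 16 * (l div 4)" using l8 by linarith
      then have "real (2 * l) \<le> 16 * real (l div 4)" by linarith
      then have "real (rho (2 * l)) \<le> A\<^sup>2 * 16 powr p * real (rho (l div 4))"
        by (intro rho_le_rho) (use l8 in auto)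
      also have "\<dots> \<le> A\<^sup>2 * 16 powr p * (6 / c * real (bs l))"
        by (intro mult_left_mono bs_facts(5)[OF bsl l8]) auto
      finally have "real (K \<delta>) * real (rho (2 * l)) \<le> real (K \<delta>) * (A\<^sup>2 * 16 powr p * (6 / c * real (bs l)))"
        by (rule mult_left_mono) simp
      also have "\<dots> = K \<delta> * (A\<^sup>2 * 16 powr p * (6 / c)) * real (bs l)" by simp
      also have "\<dots> \<le> real j * real (bs l)" unfolding j_def by (intro mult_right_mono) (linarith, simp)
      finally have "real (K \<delta> * rho (2 * l)) \<le> real (bs l * j)" by (simp add: mult.commute)
      then show ?thesis by (simp only: of_nat_le_iff)
    qed
    have mu2: "c5 * real ?k powr (1 / (8 * p)) \<le> ?W * (real ?k * b ?k / 16) / greenB0 L ?k (mk ?k) (nn ?k)"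
    proof -
      have "real (nn ?k) * (real (?k + 1) * err0 L ?k) \<le> (Cb * real l powr p) * ((real l + 1) * errB c0 l)"
      proof (intro mult_mono)
        show "real (nn ?k) \<le> Cb * real l powr p" using loc kp by linarith
        show "err0 L ?k \<le> errB c0 l" by (rule err0_le[OF Lc k(4)])
      qed (use k err0_nonneg[of L ?k] Cb_pos in \<open>auto intro: order_trans[OF _ err0_le[OF Lc k(4)]]\<close>)
      also have "\<dots> \<le> 1" using er by (simp only: mult.assoc)
      finally show ?thesis using loc by blast
    qed
    have tau: "(?W + 1) ^ 3 * exp (- lam * (c5 * real ?k powr (1 / (8 * p)) - 2)) \<le> tau_bound lam ?k"
      unfolding tau_bound_def by (intro mult_right_mono power_mono) (use W in auto)
    have "real ?k \<noteq> 0" using k(1) by linarith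
    then have "tau_bound lam ?k \<le> 1 / 2" using half by (simp only: powr_zero_eq_one if_False mult_1_left)
    note main = prob_not_all_activated_le[OF k(1,4) bs_facts(1,2)[OF bsl l8] sL(1) bs_facts(1,2)[OF bsk k(1)] sL(2)
        y(1) _ D0 \<delta>0 j order_refl order_refl y(3,4) mu2 _ _ refl tau this]
    have "\<exists>E\<in>events. {\<omega> \<in> space M. act l \<omega> \<noteq> T} \<subseteq> E \<and> prob E \<le> \<eta> / 4 + \<eta> / 4 + \<eta> / 4 + \<eta> / 4"
    proof -
      have n: "1 \<le> nn ?k" "1 \<le> mk ?k" "mk ?k \<le> ?k + 1" using loc by auto
      have "real L ^ CARD('d) * ((real \<kappa>0 * ?V + 1) ^ (\<kappa>0 * yy l) *
          exp (- lam * (real (l + 1) / (G l + real (l + 1) * err0 L l) - \<delta> * real (2 * l + 1) / G l - real (\<kappa>0 * yy l)))) \<le> \<eta> / 4"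
        unfolding \<delta>_def using rich sup V(1) y(2) by simp
      moreover have "real L ^ CARD('d) * 3 ^ CARD('d) * (?V + 1) ^ (yy l + yy l) *
          exp (- lam * (?V * real (yy l) * (real l * b l / 16) / greenB0 L l (mm l) (yy l) - real (yy l))) \<le> \<eta> / 4"
        using nei sup V(1) bs_facts(3)[OF bsl l8] by simp
      moreover have "(2 * real (l ^ a) + 1) ^ CARD('d) * 3 ^ CARD('d) * (2 * tau_bound lam ?k) \<le> \<eta> / 4"
        using gt k(3) by blast
      moreover have "?W * ((1 - ?h) ^ (l div ?k) + real (l + 1) * (A * real l * real (l ^ a) powr - \<kappa>)) / real (nn ?k) \<le> \<eta> / 4"
      proof -
        have "0 \<le> ?W" "?W / real (nn ?k) \<le> 2 * A * real ?k powr (1/4)" "real ?k powr (- (1/4)) / 64 \<le> ?h" "?h \<le> 1" "0 < real (nn ?k)"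
          using loc by auto
        then show ?thesis using pt k(2) by blast
      qed
      ultimately show ?thesis using main[OF n] unfolding \<kappa>0_def
        by (meson add_mono order_trans)
    qed
    then show "\<exists>E\<in>sets M. {\<omega> \<in> space M. activated L (\<lambda>v. N v \<omega>) (\<lambda>p. X p \<omega>) l \<noteq> torus L} \<subseteq> E \<and> measure M E \<le> \<eta>"
      by simp
  qed
qed

end

section \<open>The critical lifespan\<close>

context walk_estimates
begin

text \<open>The two inequalities that minimality of the critical time provides, at x and at x - 1.
  They allow statements for all large x that are uniform in L.\<close>

definition near_critical :: "real \<Rightarrow> nat \<Rightarrow> nat \<Rightarrow> bool" where
  "near_critical lam L x \<longleftrightarrow> L \<ge> 3 \<and> 0 < x \<and> logvol L \<le> lam * (real x / G x) \<and>
     lam * (real (x - 1) / G (x - 1)) < logvol L"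

definition critical :: "real \<Rightarrow> nat \<Rightarrow> nat" where
  "critical lam L = (LEAST l. 0 < l \<and> lam * real l / G l \<ge> real CARD('d) * ln (real L))"

lemma near_critical_critical:
  assumes "lam > 0" "L \<ge> 3"
  shows "near_critical lam L (critical lam L)"
proof -
  let ?P = "\<lambda>l. 0 < l \<and> lam * real l / G l \<ge> real CARD('d) * ln (real L)"
  have pos: "0 < logvol L" using assms by (simp add: logvol_def)
  have A0: "A > 0" using A by simp
  \<comment> \<open>The logarithmic bound \<open>G_upper\<close> shows that the set of admissible
    times is nonempty.\<close>
  have "\<forall>\<^sub>F l :: nat in sequentially. logvol L \<le> lam * real l / (5 * A * (1 + ln (real l)))"
    using assms A0 by real_asymp
  then have "\<forall>\<^sub>F l :: nat in sequentially. l \<ge> 1 \<and> logvol L \<le> lam * real l / (5 * A * (1 + ln (real l)))"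
    using eventually_ge_at_top[of 1] by eventually_elim auto
  then obtain l :: nat where l: "l \<ge> 1" "logvol L \<le> lam * real l / (5 * A * (1 + ln (real l)))"
    by (metis (no_types, lifting) eventually_sequentially order_refl)
  have "lam * real l / (5 * A * (1 + ln (real l))) \<le> lam * real l / G l"
    using G_upper[OF l(1)] G_ge_1[of l] assms l(1) A0 by (intro divide_left_mono mult_pos_pos add_pos_nonneg) auto
  then have "?P l" using l by (simp add: logvol_def)
  then have P: "?P (critical lam L)" unfolding critical_def by (rule LeastI)
  have "lam * (real (critical lam L - 1) / G (critical lam L - 1)) < logvol L"
  proof (cases "critical lam L = 1")
    case True
    then show ?thesis using pos by simp
  next
    case False
    then have "\<not> ?P (critical lam L - 1)" unfolding critical_def
      using P by (intro not_less_Least) (simp add: critical_def[symmetric])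
    then show ?thesis using False P by (simp add: logvol_def)
  qed
  then show ?thesis using P assms by (simp add: near_critical_def logvol_def)
qed

lemma critical_at_top:
  assumes "lam > 0"
  shows "filterlim (critical lam) sequentially sequentially"
  unfolding filterlim_at_top
proof
  fix Z :: nat
  have "\<forall>\<^sub>F L :: nat in sequentially. lam * real Z \<le> real CARD('d) * ln (real L)" by real_asymp
  then show "\<forall>\<^sub>F L in sequentially. Z \<le> critical lam L"
    using eventually_ge_at_top[of 3]
  proof eventually_elim
    fix L :: nat assume Z: "lam * real Z \<le> real CARD('d) * ln (real L)" and L: "3 \<le> L"
    let ?x = "critical lam L"
    have "logvol L \<le> lam * (real ?x / G ?x)"
      using near_critical_critical[OF assms L] by (simp add: near_critical_def)
    also have "\<dots> \<le> lam * (real ?x / 1)"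
      using G_ge_1[of ?x] assms by (intro mult_left_mono divide_left_mono) auto
    finally have "lam * real Z \<le> lam * real ?x" using Z by (simp add: logvol_def)
    then show "Z \<le> ?x" using assms by simp
  qed
qed

text \<open>Failure of the threshold at x - 1 bounds \<open>logvol\<close> from below, and
  \<open>G_upper\<close> bounds the Green function there. The 20 is 10 from \<open>G_upper\<close>
  times 2 from x - 1 at least x / 2.\<close>

lemma logvol_lower:
  assumes "lam > 0"
  shows "\<forall>\<^sub>F x in sequentially. \<forall>L. near_critical lam L x \<longrightarrow> lam / (20 * A) * (real x / ln (real x)) \<le> logvol L"
proof -
  have "\<forall>\<^sub>F x :: nat in sequentially. 1 \<le> ln (real x)" by real_asymp
  then show ?thesis
    using eventually_ge_at_top[of 3]
  proof (eventually_elim, intro allI impI)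
    fix x L :: nat
    assume ln: "1 \<le> ln (real x)" and x: "3 \<le> x" and nc: "near_critical lam L x"
    have 1: "G (x - 1) \<le> 10 * A * ln (real x)"
    proof -
      have "G (x - 1) \<le> G x" by (rule G_mono) simp
      also have "\<dots> \<le> 5 * A * (1 + ln (real x))" by (rule G_upper) (use x in simp)
      also have "\<dots> \<le> 5 * A * (2 * ln (real x))" using ln A by (intro mult_left_mono) auto
      finally show ?thesis by simp
    qed
    have "lam / (20 * A) * (real x / ln (real x)) = lam * (real x / 2 / (10 * A * ln (real x)))" by simp
    also have "\<dots> \<le> lam * (real (x - 1) / G (x - 1))"
    proof (intro mult_left_mono frac_le)
      show "real x / 2 \<le> real (x - 1)" using x by (simp add: of_nat_diff)
    qed (use assms 1 G_ge_1[of "x - 1"] in auto)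
    also have "\<dots> \<le> logvol L" using nc unfolding near_critical_def by linarith
    finally show "lam / (20 * A) * (real x / ln (real x)) \<le> logvol L" .
  qed
qed

text \<open>Passing from x to l multiplies the time by at least 1 + e once the extra step is
  counted. Slow variation raises the Green function by at most a factor 1 + e / 6, and the
  wrap-around error adds at most e / 6 of \<open>G x\<close>. Since e is at most 1, (1 + e) / (1 + e
  / 3) is at least 1 + e / 2. The constant of \<open>logvol_lower\<close> is halved because l may be
  as large as 2 x.\<close>

lemma supercritical_eventually:
  assumes "lam > 0" "0 < e" "e \<le> 1"
  shows "\<forall>\<^sub>F x in sequentially. \<forall>L. near_critical lam L x \<longrightarrow>
    supercritical lam e (lam / (40 * A)) L (nat \<lfloor>(1 + e) * real x\<rfloor>)"
proof -
  define c0 where "c0 = lam / (40 * A)"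
  have c0: "c0 > 0" using assms A by (simp add: c0_def)
  have e6: "e / 6 > 0" using assms by simp
  have "\<forall>\<^sub>F l in sequentially. 1 * real l powr 0 * (real l + 1) * errB c0 l \<le> e / 6"
    by (rule errB_small) (use c0 e6 in auto)
  then have "\<forall>\<^sub>F l in sequentially. (real l + 1) * errB c0 l \<le> e / 6"
    using eventually_ge_at_top[of 1] by eventually_elim simp
  then obtain l0 where l0: "\<And>l. l \<ge> l0 \<Longrightarrow> (real l + 1) * errB c0 l \<le> e / 6"
    by (auto simp: eventually_sequentially)
  have "\<forall>\<^sub>F x :: nat in sequentially. 1 \<le> ln (real x)" by real_asymp
  moreover have "\<forall>\<^sub>F x in sequentially. \<forall>l'. real l' \<le> 2 * real x \<longrightarrow> G l' \<le> (1 + e / 6) * G x"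
    by (rule G_ratio) (use e6 in auto)
  ultimately show ?thesis
    using logvol_lower[OF assms(1)] eventually_ge_at_top[of 6] eventually_ge_at_top[of l0]
  proof (eventually_elim, intro allI impI)
    fix x L :: nat
    assume ln: "1 \<le> ln (real x)" and ratio: "\<forall>l'. real l' \<le> 2 * real x \<longrightarrow> G l' \<le> (1 + e / 6) * G x"
      and low: "\<forall>L. near_critical lam L x \<longrightarrow> lam / (20 * A) * (real x / ln (real x)) \<le> logvol L"
      and x: "6 \<le> x" "l0 \<le> x" and nc: "near_critical lam L x"
    define l where "l = nat \<lfloor>(1 + e) * real x\<rfloor>"
    have ex: "0 \<le> e * real x" "e * real x \<le> 1 * real x"
      using assms mult_right_mono[OF assms(3), of "real x"] by auto
    have fl: "real l \<le> (1 + e) * real x" "(1 + e) * real x \<le> real (l + 1)"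
    proof -
      have "0 \<le> (1 + e) * real x" using assms by simp
      then show "real l \<le> (1 + e) * real x" "(1 + e) * real x \<le> real (l + 1)" unfolding l_def by linarith+
    qed
    have "real x \<le> (1 + e) * real x" using ex by (simp add: distrib_right)
    then have xl: "x \<le> l" unfolding l_def by (rule le_nat_floor)
    have l2: "real l \<le> 2 * real x" using fl(1) ex by (simp add: distrib_right)
    have nc': "L \<ge> 3" "0 < x" "logvol L \<le> lam * (real x / G x)" "lam * (real (x - 1) / G (x - 1)) < logvol L"
      using nc unfolding near_critical_def by blast+
    have Lv: "0 \<le> logvol L" using nc' by (simp add: logvol_def)
    have G: "1 \<le> G l" "1 \<le> G x" "1 \<le> G (x - 1)" "G x \<le> G l" "G (x - 1) \<le> G x" "G l \<le> (1 + e / 6) * G x"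
      using G_ge_1 G_mono[OF xl] G_mono[of "x - 1" x] ratio l2 by auto
    have s1: "c0 * (real l / ln (real l)) \<le> logvol L"
    proof -
      have "real l / ln (real l) \<le> 2 * real x / ln (real x)"
        using l2 xl x ln by (intro frac_le) auto
      then have "c0 * (real l / ln (real l)) \<le> c0 * (2 * real x / ln (real x))" using c0 by (intro mult_left_mono) auto
      also have "\<dots> = lam / (20 * A) * (real x / ln (real x))" by (simp add: c0_def)
      also have "\<dots> \<le> logvol L" using low nc by blast
      finally show ?thesis .
    qed
    have den: "G l + real (l + 1) * err0 L l \<le> (1 + e / 3) * G x"
    proof -
      have "err0 L l \<le> errB c0 l" by (rule err0_le) (use nc' s1 in \<open>auto simp: logvol_def\<close>)
      then have "real (l + 1) * err0 L l \<le> (real l + 1) * errB c0 l" by (simp add: add.commute mult_left_mono)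
      also have "\<dots> \<le> e / 6 * 1" using l0[of l] x xl by simp
      also have "\<dots> \<le> e / 6 * G x" using G e6 by (intro mult_left_mono) auto
      finally have "real (l + 1) * err0 L l \<le> e / 6 * G x" .
      then show ?thesis using G(6) by (simp add: algebra_simps)
    qed
    have s2: "(1 + e / 2) * logvol L \<le> lam * (real (l + 1) / (G l + real (l + 1) * err0 L l))"
    proof -
      have "(1 + e / 2) * (1 + e / 3) \<le> 1 + e"
      proof -
        have "e * e \<le> e" using assms mult_left_mono[OF assms(3), of e] by simp
        moreover have "(1 + e / 2) * (1 + e / 3) = 1 + e * (5 / 6) + e * e / 6" by (simp add: field_simps)
        ultimately show ?thesis by linarith
      qed
      then have f: "1 + e / 2 \<le> (1 + e) / (1 + e / 3)" using assms by (simp add: pos_le_divide_eq)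
      have "(1 + e / 2) * logvol L \<le> (1 + e) / (1 + e / 3) * (lam * (real x / G x))"
        using f nc' Lv assms by (intro mult_mono) auto
      also have "\<dots> = lam * ((1 + e) * real x / ((1 + e / 3) * G x))" by simp
      also have "\<dots> \<le> lam * (real (l + 1) / (G l + real (l + 1) * err0 L l))"
        using fl(2) den assms G(1) err0_nonneg[of L l]
        by (intro mult_left_mono frac_le) (auto intro: add_pos_nonneg)
      finally show ?thesis .
    qed
    have s3: "lam * (real (2 * l + 1) / G l) \<le> 6 * logvol L"
    proof -
      have "lam * (real (2 * l + 1) / G l) \<le> lam * (5 * real (x - 1) / G (x - 1))"
        using l2 x G assms by (intro mult_left_mono frac_le) (auto simp: of_nat_diff)
      also have "\<dots> = 5 * (lam * (real (x - 1) / G (x - 1)))" by simp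
      also have "\<dots> \<le> 5 * logvol L" using nc'(4) by linarith
      also have "\<dots> \<le> 6 * logvol L" using Lv by simp
      finally show ?thesis .
    qed
    have s4: "logvol L / 2 \<le> lam * (real l / G l)"
    proof -
      have "lam * (real x / G x) / 2 = lam * (real x / (2 * G x))" by simp
      also have "\<dots> \<le> lam * (real l / G l)"
      proof (intro mult_left_mono frac_le)
        have "(1 + e / 6) * G x \<le> 2 * G x" using assms G by (intro mult_right_mono) auto
        then show "G l \<le> 2 * G x" using G(6) by linarith
      qed (use xl G assms in auto)
      finally show ?thesis by (rule order_trans[OF divide_right_mono[OF nc'(3)], rotated]) simp
    qed
    show "supercritical lam e (lam / (40 * A)) L (nat \<lfloor>(1 + e) * real x\<rfloor>)"
      unfolding supercritical_def l_def[symmetric] c0_def[symmetric] using nc' s1 s2 s3 s4 by simp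
  qed
qed

text \<open>The first clause bounds the mean number of particles visiting a vertex through
  \<open>sum_hit_upper\<close> with m extra steps. The second is a crude lower bound for that mean,
  sufficient for the few vertices met by the planted particle.\<close>

definition subcritical :: "real \<Rightarrow> real \<Rightarrow> nat \<Rightarrow> nat \<Rightarrow> nat \<Rightarrow> bool" where
  "subcritical lam e L l m \<longleftrightarrow> lam * (real (l + m + 1) / G m) \<le> (1 - e / 4) * logvol L \<and>
     logvol L / 4 \<le> lam * (real (l + 1) / (G l + real (l + 1) * err0 L l))"

text \<open>The extra time m is a fixed fraction of x, so that \<open>G m\<close> is comparable to
  \<open>G (x - 1)\<close> up to 1 + e / 4, yet small enough for l + m + 1 to stay below (1 - e / 2)
  (x - 1); and (1 - e / 2) (1 + e / 4) is at most 1 - e / 4. The \<open>- 1\<close> makes l the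
  largest integer below (1 - e) x, so not covering by time l forces a cover time of at least the
  ceiling.\<close>

lemma subcritical_eventually:
  assumes "lam > 0" "0 < e" "e \<le> 1 / 2"
  shows "\<forall>\<^sub>F x in sequentially. \<forall>L. near_critical lam L x \<longrightarrow>
    subcritical lam e L (nat \<lceil>(1 - e) * real x\<rceil> - 1) (nat \<lfloor>e / 4 * real x\<rfloor>)"
proof -
  define c0 where "c0 = lam / (20 * A)"
  have c0: "c0 > 0" using assms A by (simp add: c0_def)
  have er: "\<forall>\<^sub>F x in sequentially. 1 * real x powr 0 * (real x + 1) * errB c0 x \<le> 1"
    by (rule errB_small) (use c0 in auto)
  have m_top: "filterlim (\<lambda>x. nat \<lfloor>e / 4 * real x\<rfloor>) sequentially sequentially"
    unfolding filterlim_at_top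
  proof
    fix Z :: nat
    have "\<forall>\<^sub>F x :: nat in sequentially. real Z \<le> e / 4 * real x" using assms by real_asymp
    then show "\<forall>\<^sub>F x in sequentially. Z \<le> nat \<lfloor>e / 4 * real x\<rfloor>"
      by eventually_elim (simp add: le_nat_floor)
  qed
  have "\<forall>\<^sub>F m in sequentially. \<forall>l'. real l' \<le> 8 / e * real m \<longrightarrow> G l' \<le> (1 + e / 4) * G m"
    by (rule G_ratio) (use assms in \<open>auto simp: field_simps\<close>)
  from eventually_compose_filterlim[OF this m_top]
  have ratio: "\<forall>\<^sub>F x in sequentially. \<forall>l'. real l' \<le> 8 / e * real (nat \<lfloor>e / 4 * real x\<rfloor>) \<longrightarrow>
      G l' \<le> (1 + e / 4) * G (nat \<lfloor>e / 4 * real x\<rfloor>)" .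
  have "\<forall>\<^sub>F x :: nat in sequentially. 2 \<le> e / 4 * real x" using assms by real_asymp
  then show ?thesis
    using er ratio logvol_lower[OF assms(1)] eventually_ge_at_top[of 6]
  proof (eventually_elim, intro allI impI)
    fix x L :: nat
    assume ex: "2 \<le> e / 4 * real x" and er: "1 * real x powr 0 * (real x + 1) * errB c0 x \<le> 1"
      and ratio: "\<forall>l'. real l' \<le> 8 / e * real (nat \<lfloor>e / 4 * real x\<rfloor>) \<longrightarrow> G l' \<le> (1 + e / 4) * G (nat \<lfloor>e / 4 * real x\<rfloor>)"
      and low: "\<forall>L. near_critical lam L x \<longrightarrow> lam / (20 * A) * (real x / ln (real x)) \<le> logvol L"
      and x: "6 \<le> x" and nc: "near_critical lam L x"
    define m where "m = nat \<lfloor>e / 4 * real x\<rfloor>"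
    define l where "l = nat \<lceil>(1 - e) * real x\<rceil> - 1"
    have nc': "L \<ge> 3" "0 < x" "logvol L \<le> lam * (real x / G x)" "lam * (real (x - 1) / G (x - 1)) < logvol L"
      using nc unfolding near_critical_def by blast+
    have Lv: "0 \<le> logvol L" using nc' by (simp add: logvol_def)
    have e2: "e * real x \<le> 1 / 2 * real x" using assms by (intro mult_right_mono) auto
    have m: "real m \<le> e / 4 * real x" "e / 8 * real x \<le> real m"
      using real_nat_floor[of "e / 4 * real x"] ex by (auto simp: m_def)
    have pos: "1 \<le> (1 - e) * real x" using e2 x unfolding left_diff_distrib by linarith
    have l1: "real l + 1 = real (nat \<lceil>(1 - e) * real x\<rceil>)" using pos unfolding l_def by linarith
    have l: "real l \<le> (1 - e) * real x" "(1 - e) * real x \<le> real (l + 1)"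
      using l1 pos by linarith+
    have lx: "l \<le> x" using l(1) ex by (simp add: left_diff_distrib)
    have G: "1 \<le> G m" "1 \<le> G (x - 1)" "1 \<le> G l" "G l \<le> G x" using G_ge_1 G_mono[OF lx] by auto
    have r: "G (x - 1) \<le> (1 + e / 4) * G m"
    proof -
      have "real (x - 1) \<le> real x" by simp
      also have "\<dots> = 8 / e * (e / 8 * real x)" using assms by simp
      also have "\<dots> \<le> 8 / e * real m" using m(2) assms by (intro mult_left_mono) auto
      finally show ?thesis using ratio unfolding m_def by blast
    qed
    have 1: "lam * (real (l + m + 1) / G m) \<le> (1 - e / 4) * logvol L"
    proof -
      have le: "real (l + m + 1) \<le> (1 - e / 2) * real (x - 1)"
      proof -
        have "real (l + m + 1) \<le> (1 - e) * real x + e / 4 * real x + 1" using l m by simp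
        also have "\<dots> \<le> (1 - e / 2) * (real x - 1)"
        proof -
          define t where "t = e * real x"
          have eq: "(1 - e / 2) * (real x - 1) = real x - 1 - t / 2 + e / 2" "(1 - e) * real x = real x - t"
              "e / 4 * real x = t / 4" and t8: "8 \<le> t"
            using ex by (simp_all add: t_def field_simps)
          show ?thesis unfolding eq using t8 assms(2) by linarith
        qed
        also have "\<dots> = (1 - e / 2) * real (x - 1)" using x by (simp add: of_nat_diff)
        finally show ?thesis .
      qed
      have "lam * (real (l + m + 1) / G m) \<le> lam * ((1 - e / 2) * real (x - 1) / (G (x - 1) / (1 + e / 4)))"
      proof (intro mult_left_mono frac_le)
        show "real (l + m + 1) \<le> (1 - e / 2) * real (x - 1)" by (rule le)
        show "0 \<le> (1 - e / 2) * real (x - 1)" using assms by simp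
        show "0 < G (x - 1) / (1 + e / 4)" using assms G by simp
        show "G (x - 1) / (1 + e / 4) \<le> G m" using r assms by (simp add: field_simps)
      qed (use assms in auto)
      also have "\<dots> = ((1 - e / 2) * (1 + e / 4)) * (lam * (real (x - 1) / G (x - 1)))" by simp
      also have "\<dots> \<le> (1 - e / 4) * logvol L"
      proof (rule mult_mono)
        show "(1 - e / 2) * (1 + e / 4) \<le> 1 - e / 4" using assms by (simp add: algebra_simps)
      qed (use nc' assms G in auto)
      finally show ?thesis .
    qed
    have er0: "real (l + 1) * err0 L l \<le> G x"
    proof -
      have "err0 L l \<le> errB c0 x"
        by (rule err0_le[OF _ _ lx]) (use nc nc' low in \<open>auto simp: logvol_def c0_def\<close>)
      then have "real (l + 1) * err0 L l \<le> (real x + 1) * errB c0 x"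
        using lx err0_nonneg[of L l] by (intro mult_mono) auto
      also have "\<dots> \<le> 1" using er x by simp
      finally show ?thesis using G by simp
    qed
    have 2: "logvol L / 4 \<le> lam * (real (l + 1) / (G l + real (l + 1) * err0 L l))"
    proof -
      have "lam * (real x / G x) / 4 = lam * ((real x / 2) / (2 * G x))" by simp
      also have "\<dots> \<le> lam * (real (l + 1) / (G l + real (l + 1) * err0 L l))"
      proof (intro mult_left_mono frac_le)
        show "real x / 2 \<le> real (l + 1)" using l(2) e2 unfolding left_diff_distrib by linarith
        show "G l + real (l + 1) * err0 L l \<le> 2 * G x" using G(4) er0 by simp
      qed (use G assms err0_nonneg[of L l] in \<open>auto intro: add_pos_nonneg\<close>)
      finally show ?thesis by (rule order_trans[OF divide_right_mono[OF nc'(3)], rotated]) simp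
    qed
    show "subcritical lam e L (nat \<lceil>(1 - e) * real x\<rceil> - 1) (nat \<lfloor>e / 4 * real x\<rfloor>)"
      unfolding subcritical_def l_def[symmetric] m_def[symmetric] using 1 2 by simp
  qed
qed

end

section \<open>Cover time and cover lifespan\<close>

lemma Inf_enat_attained:
  assumes "P k"
  shows "\<exists>k'\<le>k. P k' \<and> Inf (enat ` {k. P k}) = enat k'"
proof (intro exI conjI)
  show "(LEAST k. P k) \<le> k" using assms by (rule Least_le)
  show "P (LEAST k. P k)" using assms by (rule LeastI)
  then show "Inf (enat ` {k. P k}) = enat (LEAST k. P k)"
    by (intro antisym Inf_lower Inf_greatest) (auto intro: Least_le)
qed

lemma sets_Inf_enat:
  assumes "\<And>k. {\<omega> \<in> space M. P k \<omega>} \<in> sets M"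
  shows "{\<omega> \<in> space M. Inf (enat ` {k. P k \<omega>}) = s} \<in> sets M"
proof (cases s)
  case (enat n)
  have eq: "Inf (enat ` {k. P k \<omega>}) = enat n \<longleftrightarrow> P n \<omega> \<and> (\<forall>k\<in>{..<n}. \<not> P k \<omega>)" for \<omega>
  proof
    assume I: "Inf (enat ` {k. P k \<omega>}) = enat n"
    have "\<exists>k. P k \<omega>"
    proof (rule ccontr)
      assume "\<not> (\<exists>k. P k \<omega>)"
      then show False using I by (simp add: top_enat_def)
    qed
    then obtain k where k: "P k \<omega>" by blast
    then have "P n \<omega>" using Inf_enat_attained[of "\<lambda>k. P k \<omega>", OF k] I by auto
    moreover have "\<not> P k \<omega>" if "k < n" for k
    proof
      assume "P k \<omega>"
      then have "Inf (enat ` {k. P k \<omega>}) \<le> enat k" by (intro Inf_lower) auto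
      then show False using I that by simp
    qed
    ultimately show "P n \<omega> \<and> (\<forall>k\<in>{..<n}. \<not> P k \<omega>)" by auto
  next
    assume P: "P n \<omega> \<and> (\<forall>k\<in>{..<n}. \<not> P k \<omega>)"
    then obtain k where "k \<le> n" "P k \<omega>" "Inf (enat ` {k. P k \<omega>}) = enat k"
      using Inf_enat_attained[of "\<lambda>k. P k \<omega>" n] by blast
    then show "Inf (enat ` {k. P k \<omega>}) = enat n" using P by (cases "k = n") auto
  qed
  show ?thesis unfolding enat eq
    by (intro sets.sets_Collect_conj sets.sets_Collect_finite_All sets.sets_Collect_neg assms) auto
next
  case infinity
  have eq: "Inf (enat ` {k. P k \<omega>}) = \<infinity> \<longleftrightarrow> (\<forall>k. \<not> P k \<omega>)" for \<omega>
  proof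
    assume I: "Inf (enat ` {k. P k \<omega>}) = \<infinity>"
    show "\<forall>k. \<not> P k \<omega>"
    proof (intro allI notI)
      fix k assume "P k \<omega>"
      then have "Inf (enat ` {k. P k \<omega>}) \<le> enat k" by (intro Inf_lower) auto
      then show False using I by simp
    qed
  qed (simp add: top_enat_def)
  show ?thesis unfolding infinity eq
    by (intro sets.sets_Collect_countable_All sets.sets_Collect_neg assms)
qed

section \<open>The deterministic comparison and measurability\<close>

context frog
begin

lemma rel_mono: "k \<le> l \<Longrightarrow> rel k \<omega> \<subseteq> rel l \<omega>"
  unfolding rel_def using order_trans by blast

lemma all_visited_iff:
  "(\<forall>u\<in>T. \<exists>v\<in>T. \<exists>j<N v \<omega>. \<exists>i\<le>k. X (Ordinary v j) \<omega> i = u) \<longleftrightarrow> T \<subseteq> Range (rel k \<omega>)"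
  by (force simp: rel_def)

lemma reaches_iff:
  assumes "\<omega> \<in> space M"
  shows "reaches L (\<lambda>v. N v \<omega>) (\<lambda>p. X p \<omega>) l v u \<longleftrightarrow> (v, u) \<in> rel l \<omega> \<or> v = 0 \<and> (\<exists>k\<le>l. X Planted \<omega> k = u)"
proof
  assume "reaches L (\<lambda>v. N v \<omega>) (\<lambda>p. X p \<omega>) l v u"
  then obtain p where p: "p \<in> particles L" "present (\<lambda>v. N v \<omega>) p" "start p = v" "\<exists>k\<le>l. X p \<omega> k = u"
    by (auto simp: reaches_def)
  show "(v, u) \<in> rel l \<omega> \<or> v = 0 \<and> (\<exists>k\<le>l. X Planted \<omega> k = u)"
  proof (cases p)
    case Planted
    then show ?thesis using p by auto
  next
    case (Ordinary v' j)
    have "v \<in> T" "u \<in> T" using p X_in_T[OF p(1) assms] by (auto simp: particles_def)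
    then show ?thesis using p Ordinary by (auto simp: rel_def present_def)
  qed
qed (auto intro: reaches_rel reaches_planted)

lemma act_cases:
  assumes "\<omega> \<in> space M" "u \<in> act l \<omega>"
  shows "u = 0 \<or> u \<in> Range (rel l \<omega>) \<or> (\<exists>k\<le>l. X Planted \<omega> k = u)"
proof -
  have "(reaches L (\<lambda>v. N v \<omega>) (\<lambda>p. X p \<omega>) l)\<^sup>*\<^sup>* 0 u" using assms(2) by (simp add: activated_def)
  then show ?thesis by (cases rule: rtranclp.cases) (auto simp: reaches_iff[OF assms(1)])
qed

text \<open>Let l1 be the cover lifespan. Every vertex is the origin, or met by an ordinary particle
  within l1 steps, or met by the planted one; by p the first and last kinds are met by ordinary
  particles already within l0 steps. If l1 were below l0, everything would be met within l0 steps,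
  contrary to n. So l1 steps of the ordinary particles cover the torus.\<close>

lemma cover_sandwich:
  assumes w: "\<omega> \<in> space M" and n: "\<not> T \<subseteq> Range (rel l0 \<omega>)" and a: "act l \<omega> = T"
    and p: "\<not> (\<exists>u\<in>T. u \<notin> Range (rel l0 \<omega>) \<and> (u = 0 \<or> (\<exists>k\<le>l. X Planted \<omega> k = u)))"
  shows "enat (Suc l0) \<le> cover_time L (\<lambda>v. N v \<omega>) (\<lambda>p. X p \<omega>)"
    and "cover_time L (\<lambda>v. N v \<omega>) (\<lambda>p. X p \<omega>) \<le> cover_lifespan L (\<lambda>v. N v \<omega>) (\<lambda>p. X p \<omega>)"
    and "cover_lifespan L (\<lambda>v. N v \<omega>) (\<lambda>p. X p \<omega>) \<le> enat l"
proof -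
  let ?\<tau> = "cover_time L (\<lambda>v. N v \<omega>) (\<lambda>p. X p \<omega>)"
  have \<tau>: "?\<tau> = Inf (enat ` {k. T \<subseteq> Range (rel k \<omega>)})"
    unfolding cover_time_def all_visited_iff ..
  show "enat (Suc l0) \<le> ?\<tau>" unfolding \<tau>
  proof (rule Inf_greatest)
    fix t assume "t \<in> enat ` {k. T \<subseteq> Range (rel k \<omega>)}"
    then obtain k where k: "t = enat k" "T \<subseteq> Range (rel k \<omega>)" by auto
    have "l0 < k"
    proof (rule ccontr)
      assume "\<not> l0 < k"
      then have "Range (rel k \<omega>) \<subseteq> Range (rel l0 \<omega>)" using rel_mono[of k l0 \<omega>] by auto
      then show False using k n by blast
    qed
    then show "enat (Suc l0) \<le> t" using k by simp
  qed
  obtain l1 where l1: "l1 \<le> l" "act l1 \<omega> = T" "cover_lifespan L (\<lambda>v. N v \<omega>) (\<lambda>p. X p \<omega>) = enat l1"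
    using Inf_enat_attained[of "\<lambda>l. act l \<omega> = T", OF a] unfolding cover_lifespan_def by blast
  then show "cover_lifespan L (\<lambda>v. N v \<omega>) (\<lambda>p. X p \<omega>) \<le> enat l" by simp
  have visited: "u \<in> Range (rel l0 \<omega>) \<or> u \<in> Range (rel l1 \<omega>)" if u: "u \<in> T" for u
    using act_cases[OF w, of u l1] l1 p u order_trans by blast
  have "T \<subseteq> Range (rel l1 \<omega>)"
  proof (cases "l0 \<le> l1")
    case True
    then show ?thesis using visited rel_mono[OF True, of \<omega>] by blast
  next
    case False
    then show ?thesis using visited rel_mono[of l1 l0 \<omega>] n by auto
  qed
  then show "?\<tau> \<le> cover_lifespan L (\<lambda>v. N v \<omega>) (\<lambda>p. X p \<omega>)"
    unfolding \<tau> l1(3) by (intro Inf_lower) auto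
qed

text \<open>The activated set is a function of \<open>rel l\<close> and of the set of vertices met
  by the planted particle, both of which take finitely many values.\<close>

lemma act_event: "{\<omega> \<in> space M. act l \<omega> = T} \<in> events"
proof -
  define F where "F = (\<lambda>(r :: ((int ^ 'd) \<times> (int ^ 'd)) set) B. {u. (\<lambda>v u. (v, u) \<in> r \<or> v = 0 \<and> u \<in> B)\<^sup>*\<^sup>* 0 u})"
  define V where "V = (\<lambda>B. {\<omega> \<in> space M. \<forall>u\<in>T. (\<exists>k\<in>{..l}. X Planted \<omega> k = u) \<longleftrightarrow> u \<in> B})"
  have act: "act l \<omega> = F (rel l \<omega>) {u. \<exists>k\<le>l. X Planted \<omega> k = u}" if "\<omega> \<in> space M" for \<omega>
    unfolding activated_def F_def by (intro Collect_cong arg_cong3[where f = rtranclp]) (auto simp: reaches_iff[OF that] fun_eq_iff)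
  have visit: "{\<omega> \<in> space M. X Planted \<omega> k = u} \<in> events" if "u \<in> T" for k u
  proof -
    have "{\<omega> \<in> space M. X Planted \<omega> k = u} = (\<lambda>\<omega>. X Planted \<omega> k) -` {u} \<inter> space M" by auto
    also have "\<dots> \<in> events" by (rule measurable_sets[OF coord_meas[OF Planted_particles]]) (use that in simp)
    finally show ?thesis .
  qed
  have V: "V B \<in> events" for B
  proof -
    have "V B = {\<omega> \<in> space M. \<forall>u\<in>T. if u \<in> B then \<exists>k\<in>{..l}. X Planted \<omega> k = u else \<not> (\<exists>k\<in>{..l}. X Planted \<omega> k = u)}"
      by (auto simp: V_def)
    also have "\<dots> \<in> events"
    proof (rule sets.sets_Collect_finite_All)
      fix u assume u: "u \<in> T"
      have "{\<omega> \<in> space M. \<exists>k\<in>{..l}. X Planted \<omega> k = u} \<in> events"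
        by (intro sets.sets_Collect_finite_Ex visit u) auto
      then show "{\<omega> \<in> space M. if u \<in> B then \<exists>k\<in>{..l}. X Planted \<omega> k = u else \<not> (\<exists>k\<in>{..l}. X Planted \<omega> k = u)} \<in> events"
        by (cases "u \<in> B") (auto dest: sets.sets_Collect_neg)
    qed simp
    finally show ?thesis .
  qed
  have "{\<omega> \<in> space M. act l \<omega> = T} = (\<Union>B\<in>Pow T. V B \<inter> {\<omega> \<in> space M. F (rel l \<omega>) B = T})"
  proof (intro equalityI subsetI)
    fix \<omega> assume w: "\<omega> \<in> {\<omega> \<in> space M. act l \<omega> = T}"
    let ?B = "{u. \<exists>k\<le>l. X Planted \<omega> k = u}"
    have "?B \<subseteq> T" using w X_in_T[OF Planted_particles] by auto
    moreover have "\<omega> \<in> V ?B" using w by (auto simp: V_def)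
    ultimately show "\<omega> \<in> (\<Union>B\<in>Pow T. V B \<inter> {\<omega> \<in> space M. F (rel l \<omega>) B = T})"
      using w act by auto
  next
    fix \<omega> assume "\<omega> \<in> (\<Union>B\<in>Pow T. V B \<inter> {\<omega> \<in> space M. F (rel l \<omega>) B = T})"
    then obtain B where B: "B \<subseteq> T" "\<omega> \<in> V B" "\<omega> \<in> space M" "F (rel l \<omega>) B = T" by auto
    have "u \<in> B \<longleftrightarrow> (\<exists>k\<le>l. X Planted \<omega> k = u)" for u
      using B(1,2) X_in_T[OF Planted_particles B(3)] by (auto simp: V_def)
    then have "B = {u. \<exists>k\<le>l. X Planted \<omega> k = u}" by auto
    then show "\<omega> \<in> {\<omega> \<in> space M. act l \<omega> = T}" using B act by auto
  qed
  also have "\<dots> \<in> events" by (intro sets.finite_UN sets.Int V rel_event) auto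
  finally show ?thesis .
qed

lemma cover_times_event:
  "{\<omega> \<in> space M. P (cover_time L (\<lambda>v. N v \<omega>) (\<lambda>p. X p \<omega>)) (cover_lifespan L (\<lambda>v. N v \<omega>) (\<lambda>p. X p \<omega>))} \<in> events"
proof -
  let ?\<tau> = "\<lambda>\<omega>. cover_time L (\<lambda>v. N v \<omega>) (\<lambda>p. X p \<omega>)" and ?\<L> = "\<lambda>\<omega>. cover_lifespan L (\<lambda>v. N v \<omega>) (\<lambda>p. X p \<omega>)"
  have 1: "{\<omega> \<in> space M. ?\<tau> \<omega> = s} \<in> events" for s
    unfolding cover_time_def all_visited_iff by (rule sets_Inf_enat) (rule rel_event)
  have 2: "{\<omega> \<in> space M. ?\<L> \<omega> = s} \<in> events" for s
    unfolding cover_lifespan_def by (rule sets_Inf_enat) (rule act_event)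
  have "{\<omega> \<in> space M. P (?\<tau> \<omega>) (?\<L> \<omega>)} =
      (\<Union>(s, t)\<in>{(s, t). P s t}. {\<omega> \<in> space M. ?\<tau> \<omega> = s} \<inter> {\<omega> \<in> space M. ?\<L> \<omega> = t})" by auto
  also have "\<dots> \<in> events"
  proof (rule sets.countable_UN')
    show "countable {(s, t). P s t}" by (rule countableI_type)
  qed (use 1 2 in auto)
  finally show ?thesis .
qed

end

section \<open>Assembly of the three error events\<close>

context walk_estimates
begin

lemma poly_exp_small:
  assumes "w > 0" "\<eta> > 0"
  shows "\<forall>\<^sub>F x :: nat in sequentially. C * (real x + 1)\<^sup>2 * exp (- (w * (real x / ln (real x)))) \<le> \<eta>"
proof -
  have "(\<lambda>x :: nat. C * (real x + 1)\<^sup>2 * exp (- (w * (real x / ln (real x))))) \<longlonglongrightarrow> 0"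
    using assms by real_asymp
  then have "\<forall>\<^sub>F x :: nat in sequentially. C * (real x + 1)\<^sup>2 * exp (- (w * (real x / ln (real x)))) < \<eta>"
    by (rule order_tendstoD) (rule assms(2))
  then show ?thesis by eventually_elim simp
qed

lemma cover_sandwich_eventually:
  assumes lam: "lam > 0" and e: "0 < e" "e \<le> 1 / 2" and \<eta>: "\<eta> > 0"
  shows "\<forall>\<^sub>F x in sequentially. \<forall>L (M :: 'a measure) Q N X. near_critical lam L x \<longrightarrow>
    frog_estimates q A p c \<kappa> rho K L M Q lam N X \<longrightarrow>
    1 - \<eta> \<le> measure M {\<omega> \<in> space M.
      enat (Suc (nat \<lceil>(1 - e) * real x\<rceil> - 1)) \<le> cover_time L (\<lambda>v. N v \<omega>) (\<lambda>p. X p \<omega>) \<and>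
      cover_time L (\<lambda>v. N v \<omega>) (\<lambda>p. X p \<omega>) \<le> cover_lifespan L (\<lambda>v. N v \<omega>) (\<lambda>p. X p \<omega>) \<and>
      cover_lifespan L (\<lambda>v. N v \<omega>) (\<lambda>p. X p \<omega>) \<le> enat (nat \<lfloor>(1 + e) * real x\<rfloor>)}"
proof -
  \<comment> \<open>Chosen so that exp (\<open>lam\<close> \<eta>1) - 1 = \<eta> / 8, half of the
    share of the second moment bound.\<close>
  define \<eta>1 where "\<eta>1 = ln (1 + \<eta> / 8) / lam"
  have \<eta>1: "\<eta>1 > 0" "exp (lam * \<eta>1) = 1 + \<eta> / 8" using \<eta> lam by (auto simp: \<eta>1_def)
  define c2 where "c2 = lam / (20 * A)"
  have c2: "c2 > 0" using lam A by (simp add: c2_def)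
  have c3: "lam / (40 * A) > 0" "\<eta> / 4 > 0" using lam A \<eta> by auto
  have top: "filterlim (\<lambda>x. nat \<lfloor>(1 + e) * real x\<rfloor>) sequentially sequentially"
    unfolding filterlim_at_top
  proof
    fix Z :: nat
    have "\<forall>\<^sub>F x :: nat in sequentially. real Z \<le> (1 + e) * real x" using e by real_asymp
    then show "\<forall>\<^sub>F x in sequentially. Z \<le> nat \<lfloor>(1 + e) * real x\<rfloor>"
      by eventually_elim (simp add: le_nat_floor)
  qed
  have t1: "\<forall>\<^sub>F x :: nat in sequentially. 1 / \<eta>1 * (real x + 1)\<^sup>2 * exp (- (e / 4 * c2 * (real x / ln (real x)))) \<le> \<eta> / 8"
    by (rule poly_exp_small) (use c2 e \<eta> in auto)
  have t2: "\<forall>\<^sub>F x :: nat in sequentially. 2 * (real x + 1)\<^sup>2 * exp (- (c2 / 4 * (real x / ln (real x)))) \<le> \<eta> / 4"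
    by (rule poly_exp_small) (use c2 \<eta> in auto)
  have e1: "e \<le> 1" using e by simp
  show ?thesis
    using t1 t2 eventually_compose_filterlim[OF activation_eventually[OF lam e(1) c3] top]
      supercritical_eventually[OF lam e(1) e1] subcritical_eventually[OF lam e] logvol_lower[OF lam]
  proof (eventually_elim, intro allI impI)
    fix x L :: nat and M :: "'a measure" and Q N X
    let ?l = "nat \<lfloor>(1 + e) * real x\<rfloor>" and ?k = "nat \<lceil>(1 - e) * real x\<rceil> - 1" and ?m = "nat \<lfloor>e / 4 * real x\<rfloor>"
    assume t1: "1 / \<eta>1 * (real x + 1)\<^sup>2 * exp (- (e / 4 * c2 * (real x / ln (real x)))) \<le> \<eta> / 8"
      and t2: "2 * (real x + 1)\<^sup>2 * exp (- (c2 / 4 * (real x / ln (real x)))) \<le> \<eta> / 4"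
      and act: "\<forall>L (M :: 'a measure) Q N X. supercritical lam e (lam / (40 * A)) L ?l \<longrightarrow>
        frog_estimates q A p c \<kappa> rho K L M Q lam N X \<longrightarrow>
        (\<exists>E\<in>sets M. {\<omega> \<in> space M. activated L (\<lambda>v. N v \<omega>) (\<lambda>p. X p \<omega>) ?l \<noteq> torus L} \<subseteq> E \<and> measure M E \<le> \<eta> / 4)"
      and sup: "\<forall>L. near_critical lam L x \<longrightarrow> supercritical lam e (lam / (40 * A)) L ?l"
      and sub: "\<forall>L. near_critical lam L x \<longrightarrow> subcritical lam e L ?k ?m"
      and low: "\<forall>L. near_critical lam L x \<longrightarrow> lam / (20 * A) * (real x / ln (real x)) \<le> logvol L"
      and nc: "near_critical lam L x" and fe: "frog_estimates q A p c \<kappa> rho K L M Q lam N X"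
    interpret frog_estimates q A p c \<kappa> rho K L M Q lam N X by (rule fe)
    have low': "c2 * (real x / ln (real x)) \<le> logvol L" using low nc by (simp add: c2_def)
    have sub': "lam * (real (?k + ?m + 1) / G ?m) \<le> (1 - e / 4) * logvol L"
        "logvol L / 4 \<le> lam * (real (?k + 1) / (G ?k + real (?k + 1) * err ?k))"
      using sub nc by (auto simp: subcritical_def)
    have l0x: "real ?k \<le> real x"
    proof -
      have "(1 - e) * real x \<le> 1 * real x" using e by (intro mult_right_mono) auto
      then show ?thesis by linarith
    qed
    have lx: "real ?l \<le> 2 * real x"
    proof -
      have "(1 + e) * real x \<le> 2 * real x" "0 \<le> (1 + e) * real x" using e by (auto intro!: mult_right_mono)
      then show ?thesis by linarith
    qed
    let ?E1 = "{\<omega> \<in> space M. T \<subseteq> Range (rel ?k \<omega>)}"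
    have E1: "prob ?E1 \<le> \<eta> / 4"
    proof -
      let ?R = "real (?k + ?m + 1) / G ?m"
      have "prob ?E1 \<le> exp (lam * \<eta>1) - 1 + (real ?k + 1)\<^sup>2 / (\<eta>1 * (real L ^ CARD('d) * exp (- lam * ?R)))"
        by (rule prob_all_visited[OF \<eta>1(1)]) (rule sum_hit_upper)
      also have "(real ?k + 1)\<^sup>2 / (\<eta>1 * (real L ^ CARD('d) * exp (- lam * ?R))) =
          1 / \<eta>1 * (real ?k + 1)\<^sup>2 * exp (lam * ?R - logvol L)"
      proof -
        have "a / (h * (exp v * exp (- lam * R))) = 1 / h * a * exp (lam * R - v)" for a h v R :: real
          by (simp add: exp_diff exp_minus divide_inverse mult_ac)
        then show ?thesis using L3 exp_logvol[of L] by (metis One_nat_def Suc_leI L)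
      qed
      also have "\<dots> \<le> 1 / \<eta>1 * (real x + 1)\<^sup>2 * exp (- (e / 4 * c2 * (real x / ln (real x))))"
      proof (intro mult_mono power_mono)
        have "e / 4 * (c2 * (real x / ln (real x))) \<le> e / 4 * logvol L" using low' e by (intro mult_left_mono) auto
        moreover have "(1 - e / 4) * logvol L = logvol L - e / 4 * logvol L" by (simp add: left_diff_distrib)
        ultimately show "exp (lam * ?R - logvol L) \<le> exp (- (e / 4 * c2 * (real x / ln (real x))))"
          using sub'(1) by (simp only: exp_le_cancel_iff mult.assoc)
      qed (use \<eta>1 l0x in auto)
      also note t1
      finally show ?thesis using \<eta>1(2) by simp
    qed
    obtain E2 where E2: "E2 \<in> events" "prob E2 \<le> \<eta> / 4"
      "{\<omega> \<in> space M. \<exists>u\<in>T. u \<notin> Range (rel ?k \<omega>) \<and> (u = 0 \<or> (\<exists>k\<le>?l. X Planted \<omega> k = u))} \<subseteq> E2"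
    proof -
      let ?R = "real (?k + 1) / (G ?k + real (?k + 1) * err ?k)"
      obtain E where E: "E \<in> events" "prob E \<le> (real ?l + 2) * exp (- lam * ?R)"
        "{\<omega> \<in> space M. \<exists>u\<in>T. u \<notin> Range (rel ?k \<omega>) \<and> (u = 0 \<or> (\<exists>k\<le>?l. X Planted \<omega> k = u))} \<subseteq> E"
        using prob_planted_needed[of ?R ?k ?l] sum_hit_lower by blast
      have "(real ?l + 2) * exp (- lam * ?R) \<le> 2 * (real x + 1)\<^sup>2 * exp (- (c2 / 4 * (real x / ln (real x))))"
      proof (rule mult_mono)
        have "real ?l + 2 \<le> 2 * (real x + 1) * 1" using lx by simp
        also have "\<dots> \<le> 2 * (real x + 1) * (real x + 1)" by (intro mult_left_mono) auto
        finally show "real ?l + 2 \<le> 2 * (real x + 1)\<^sup>2" by (simp only: power2_eq_square mult.assoc)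
        have "c2 * (real x / ln (real x)) / 4 \<le> lam * ?R"
          by (rule order_trans[OF divide_right_mono[OF low'] sub'(2)]) simp
        then have "c2 / 4 * (real x / ln (real x)) \<le> lam * ?R" by (simp only: times_divide_eq_left)
        then show "exp (- lam * ?R) \<le> exp (- (c2 / 4 * (real x / ln (real x))))" by simp
      qed auto
      also note t2
      finally have "prob E \<le> \<eta> / 4" using E(2) by (rule order_trans[rotated])
      from that[OF E(1) this E(3)] show thesis .
    qed
    obtain E3 where E3: "E3 \<in> events" "prob E3 \<le> \<eta> / 4" "{\<omega> \<in> space M. act ?l \<omega> \<noteq> T} \<subseteq> E3"
      using act[rule_format, OF sup[rule_format, OF nc] fe] by blast
    let ?G = "{\<omega> \<in> space M. enat (Suc ?k) \<le> cover_time L (\<lambda>v. N v \<omega>) (\<lambda>p. X p \<omega>) \<and>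
      cover_time L (\<lambda>v. N v \<omega>) (\<lambda>p. X p \<omega>) \<le> cover_lifespan L (\<lambda>v. N v \<omega>) (\<lambda>p. X p \<omega>) \<and>
      cover_lifespan L (\<lambda>v. N v \<omega>) (\<lambda>p. X p \<omega>) \<le> enat ?l}"
    have "space M - (?E1 \<union> (E2 \<union> E3)) \<subseteq> ?G"
    proof
      fix \<omega> assume w: "\<omega> \<in> space M - (?E1 \<union> (E2 \<union> E3))"
      show "\<omega> \<in> ?G" using w E2(3) E3(3) by (auto intro!: cover_sandwich)
    qed
    then have "prob (space M - (?E1 \<union> (E2 \<union> E3))) \<le> prob ?G"
      by (rule finite_measure_mono) (rule cover_times_event)
    moreover have "prob (space M - (?E1 \<union> (E2 \<union> E3))) = 1 - prob (?E1 \<union> (E2 \<union> E3))"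
      by (rule prob_compl) (intro sets.Un rel_event E2 E3)
    moreover have "prob (?E1 \<union> (E2 \<union> E3)) \<le> prob ?E1 + (prob E2 + prob E3)"
      using measure_Un_le[OF E2(1) E3(1)] measure_Un_le[OF rel_event[of "\<lambda>r. T \<subseteq> Range r" ?k] sets.Un[OF E2(1) E3(1)]]
      by linarith
    ultimately show "1 - \<eta> \<le> prob ?G" using E1 E2(2) E3(2) \<eta> by linarith
  qed
qed

end

section \<open>From the kernel on the lattice to a group walk, and the limit\<close>

lemma kernel_power_eq:
  fixes Q :: "'v :: ab_group_add \<Rightarrow> 'v \<Rightarrow> real"
  assumes "\<And>x y. Q x y = pmf q (y - x)"
  shows "kernel_power Q n x y = pmf (conv_pow q n) (y - x)"
proof (induction n arbitrary: y)
  case 0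
  show ?case by (auto simp: pmf_return)
next
  case (Suc n)
  let ?f = "\<lambda>z. pmf (conv_pow q n) z * pmf q (y - x - z)"
  have bij: "bij_betw (\<lambda>z. z - x) UNIV UNIV" by (rule bij_betwI[where g = "\<lambda>z. z + x"]) auto
  have "Infinite_Set_Sum.abs_summable_on ?f UNIV"
    by (rule abs_summable_on_comparison_test[OF pmf_abs_summable[of "conv_pow q n"]])
       (auto simp: mult_left_le pmf_le_1)
  then have "(\<Sum>\<^sub>az. ?f z) = (\<Sum>\<^sub>\<infinity>z. ?f z)" by (rule infsetsum_infsum)
  also have "\<dots> = (\<Sum>\<^sub>\<infinity>z. ?f (z - x))" by (rule infsum_reindex_bij_betw[OF bij, symmetric])
  also have "\<dots> = kernel_power Q (Suc n) x y" by (simp add: Suc assms algebra_simps)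
  finally show ?case
    by (simp only: conv_pow_Suc_right pmf_bind pmf_map_plus pmf_expectation_eq_infsetsum)
qed

theorem theorem2p7:
  fixes Q :: "int ^ 'd \<Rightarrow> int ^ 'd \<Rightarrow> real"
    and \<alpha> lam \<epsilon> :: real
    and M :: "nat \<Rightarrow> 'a measure"
    and N :: "nat \<Rightarrow> int ^ 'd \<Rightarrow> 'a \<Rightarrow> nat"
    and X :: "nat \<Rightarrow> (int ^ 'd) particle \<Rightarrow> 'a \<Rightarrow> nat \<Rightarrow> int ^ 'd"
  assumes "CARD('d) \<ge> 2" and "\<alpha> > 0" and "lam > 0"
    and "transition_kernel Q" and "symmetric_kernel Q" and "translation_invariant Q"
    and "heavy_tailed \<alpha> Q"
    and "\<And>L. L \<ge> 1 \<Longrightarrow> frog_model Q lam L (M L) (N L) (X L)"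
    and "\<epsilon> > 0"
  shows "(\<lambda>L. measure (M L) {\<omega> \<in> space (M L).
            let \<tau> = cover_time L (\<lambda>v. N L v \<omega>) (\<lambda>p. X L p \<omega>);
                \<L> = cover_lifespan L (\<lambda>v. N L v \<omega>) (\<lambda>p. X L p \<omega>);
                l = real (ell_star Q lam L)
            in ereal ((1 - \<epsilon>) * l) \<le> ereal_of_enat \<tau> \<and> \<tau> \<le> \<L> \<and>
               ereal_of_enat \<L> \<le> ereal ((1 + \<epsilon>) * l)}) \<longlonglongrightarrow> 1"
proof -
  have nonneg: "0 \<le> Q x y" and sum: "(Q 0 has_sum 1) UNIV" for x y
    using assms(4) by (auto simp: transition_kernel_def)
  have inv: "Q x y = Q 0 (y - x)" for x y using assms(6) unfolding translation_invariant_def by blast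
  define q where "q = embed_pmf (Q 0)"
  have "(\<integral>\<^sup>+x. ennreal (Q 0 x) \<partial>count_space UNIV) = 1"
  proof -
    have "Infinite_Sum.abs_summable_on (Q 0) UNIV"
      by (rule summable_on_iff_abs_summable_on_real[THEN iffD1, OF has_sum_imp_summable[OF sum]])
    then have abs: "Infinite_Set_Sum.abs_summable_on (Q 0) UNIV" by (rule abs_summable_equivalent[THEN iffD1])
    have "(\<integral>\<^sup>+x. ennreal (Q 0 x) \<partial>count_space UNIV) = ennreal (infsetsum (Q 0) UNIV)"
      by (rule nn_integral_conv_infsetsum[OF abs]) (rule nonneg)
    also have "infsetsum (Q 0) UNIV = 1" using infsetsum_infsum[OF abs] infsumI[OF sum] by simp
    finally show ?thesis by simp
  qed
  then have pmf_q: "pmf q x = Q 0 x" for x unfolding q_def by (intro pmf_embed_pmf nonneg)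
  have Q_eq: "Q x y = pmf q (y - x)" for x y unfolding pmf_q by (rule inv)
  obtain K0 where K0: "K0 > 0" "\<And>x y. x \<noteq> y \<Longrightarrow>
        inverse K0 * real_of_int (linf_norm (x - y)) powr - (real CARD('d) + \<alpha>) \<le> Q x y \<and>
        Q x y \<le> K0 * real_of_int (linf_norm (x - y)) powr - (real CARD('d) + \<alpha>)"
    using assms(7) by (auto simp: heavy_tailed_def)
  have hw: "heavy_walk q \<alpha> (inverse K0) K0"
  proof
    show "map_pmf uminus q = q"
    proof (rule pmf_eqI)
      fix x
      have "pmf (map_pmf uminus q) x = pmf q (- x)" using pmf_map_inj'[of uminus q "- x"] by simp
      also have "\<dots> = Q (- x) 0" using assms(5) by (simp add: pmf_q symmetric_kernel_def)
      finally show "pmf (map_pmf uminus q) x = pmf q x" by (simp add: Q_eq)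
    qed
    show "inverse K0 * real (nrm x) powr - (real CARD('d) + \<alpha>) \<le> pmf q x"
      "pmf q x \<le> K0 * real (nrm x) powr - (real CARD('d) + \<alpha>)" if "x \<noteq> 0" for x
      using K0(2)[of 0 x] that by (auto simp: pmf_q linf_norm_eq_nrm)
  qed (use assms K0 in auto)
  interpret heavy_walk q \<alpha> "inverse K0" K0 by (rule hw)
  obtain A p c K where we: "walk_estimates q A p c \<kappa> rho K" using walk_estimates by blast
  interpret walk_estimates q A p c \<kappa> rho K by (rule we)
  have ell: "ell_star Q lam L = critical lam L" for L
    unfolding ell_star_def critical_def green_def G_def kernel_power_eq[OF Q_eq] by simp
  have fe: "frog_estimates q A p c \<kappa> rho K L (M L) Q lam (N L) (X L)" if "L \<ge> 3" for L
  proof -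
    have fm: "frog_model Q lam L (M L) (N L) (X L)" using assms(8) that by simp
    then interpret prob_space "M L" by (simp add: frog_model_def)
    show ?thesis by unfold_locales (use that fm assms(3) Q_eq in auto)
  qed
  \<comment> \<open>The subcritical estimate requires e at most 1 / 2. For larger \<epsilon> the
    event only grows.\<close>
  define e where "e = min \<epsilon> (1 / 2)"
  have e: "0 < e" "e \<le> 1 / 2" "e \<le> \<epsilon>" using assms(9) by (auto simp: e_def)
  let ?E = "\<lambda>L. {\<omega> \<in> space (M L).
            let \<tau> = cover_time L (\<lambda>v. N L v \<omega>) (\<lambda>p. X L p \<omega>);
                \<L> = cover_lifespan L (\<lambda>v. N L v \<omega>) (\<lambda>p. X L p \<omega>);
                l = real (ell_star Q lam L)
            in ereal ((1 - \<epsilon>) * l) \<le> ereal_of_enat \<tau> \<and> \<tau> \<le> \<L> \<and>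
               ereal_of_enat \<L> \<le> ereal ((1 + \<epsilon>) * l)}"
  show ?thesis
  proof (rule tendstoI)
    fix r :: real assume r: "r > 0"
    then have r2: "r / 2 > 0" by simp
    show "\<forall>\<^sub>F L in sequentially. dist (measure (M L) (?E L)) 1 < r"
      using eventually_compose_filterlim[OF cover_sandwich_eventually[OF assms(3) e(1,2) r2] critical_at_top[OF assms(3)]]
        eventually_ge_at_top[of 3]
    proof eventually_elim
      fix L :: nat
      let ?x = "critical lam L"
      let ?F = "{\<omega> \<in> space (M L).
        enat (Suc (nat \<lceil>(1 - e) * real ?x\<rceil> - 1)) \<le> cover_time L (\<lambda>v. N L v \<omega>) (\<lambda>p. X L p \<omega>) \<and>
        cover_time L (\<lambda>v. N L v \<omega>) (\<lambda>p. X L p \<omega>) \<le> cover_lifespan L (\<lambda>v. N L v \<omega>) (\<lambda>p. X L p \<omega>) \<and>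
        cover_lifespan L (\<lambda>v. N L v \<omega>) (\<lambda>p. X L p \<omega>) \<le> enat (nat \<lfloor>(1 + e) * real ?x\<rfloor>)}"
      assume sw: "\<forall>L' (M :: 'a measure) Q N X. near_critical lam L' ?x \<longrightarrow>
          frog_estimates q A p c \<kappa> rho K L' M Q lam N X \<longrightarrow>
          1 - r / 2 \<le> measure M {\<omega> \<in> space M.
            enat (Suc (nat \<lceil>(1 - e) * real ?x\<rceil> - 1)) \<le> cover_time L' (\<lambda>v. N v \<omega>) (\<lambda>p. X p \<omega>) \<and>
            cover_time L' (\<lambda>v. N v \<omega>) (\<lambda>p. X p \<omega>) \<le> cover_lifespan L' (\<lambda>v. N v \<omega>) (\<lambda>p. X p \<omega>) \<and>
            cover_lifespan L' (\<lambda>v. N v \<omega>) (\<lambda>p. X p \<omega>) \<le> enat (nat \<lfloor>(1 + e) * real ?x\<rfloor>)}"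
        and L: "3 \<le> L"
      interpret F: frog_estimates q A p c \<kappa> rho K L "M L" Q lam "N L" "X L" by (rule fe[OF L])
      have "1 - r / 2 \<le> F.prob ?F"
        by (rule sw[rule_format, OF near_critical_critical[OF assms(3) L] fe[OF L]])
      also have "\<dots> \<le> F.prob (?E L)"
      proof (rule F.finite_measure_mono)
        show "?E L \<in> F.events" unfolding Let_def by (rule F.cover_times_event)
        show "?F \<subseteq> ?E L"
        proof
          fix \<omega> assume w: "\<omega> \<in> ?F"
          let ?\<tau> = "cover_time L (\<lambda>v. N L v \<omega>) (\<lambda>p. X L p \<omega>)"
          let ?\<L> = "cover_lifespan L (\<lambda>v. N L v \<omega>) (\<lambda>p. X L p \<omega>)"
          have le: "(1 - \<epsilon>) * real ?x \<le> (1 - e) * real ?x" "(1 + e) * real ?x \<le> (1 + \<epsilon>) * real ?x"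
            using e by (auto intro: mult_right_mono)
          have pos: "0 \<le> (1 + e) * real ?x" using e by simp
          \<comment> \<open>The successor of a truncated predecessor never lies below the original
            number, so the bound by the ceiling survives even when it is 0.\<close>
          have "ereal ((1 - \<epsilon>) * real ?x) \<le> ereal (real (Suc (nat \<lceil>(1 - e) * real ?x\<rceil> - 1)))"
            using le(1) by (simp only: ereal_less_eq) linarith
          also have "\<dots> = ereal_of_enat (enat (Suc (nat \<lceil>(1 - e) * real ?x\<rceil> - 1)))" by simp
          also have "\<dots> \<le> ereal_of_enat ?\<tau>" using w by (simp only: ereal_of_enat_le_iff) blast
          finally have 1: "ereal ((1 - \<epsilon>) * real ?x) \<le> ereal_of_enat ?\<tau>" .
          have "ereal_of_enat ?\<L> \<le> ereal_of_enat (enat (nat \<lfloor>(1 + e) * real ?x\<rfloor>))"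
            using w by (simp only: ereal_of_enat_le_iff) blast
          also have "\<dots> = ereal (real (nat \<lfloor>(1 + e) * real ?x\<rfloor>))" by simp
          also have "\<dots> \<le> ereal ((1 + \<epsilon>) * real ?x)"
            using le(2) pos by (simp only: ereal_less_eq) linarith
          finally have 2: "ereal_of_enat ?\<L> \<le> ereal ((1 + \<epsilon>) * real ?x)" .
          show "\<omega> \<in> ?E L" unfolding Let_def ell using w 1 2 by blast
        qed
      qed
      finally have "1 - r / 2 \<le> F.prob (?E L)" .
      moreover have "F.prob (?E L) \<le> 1" by (rule F.prob_le_1)
      ultimately show "dist (F.prob (?E L)) 1 < r" using r unfolding dist_real_def by linarith
    qed
  qed
qed

end
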